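(* Let $(M,g)$ be a pseudo-Riemannian $n$-manifold ($n\ge 2$), $V$ a vector bundle over $M$ with a connection $D$, and $F$ the curvature of $D$. The sequence of differential operators $$\mathcal E^0(V)\xrightarrow{\ d^D\ }\mathcal E^1(V)\xrightarrow{\ M^D\ }\mathcal E_1(V)\xrightarrow{\ \delta^D\ }\mathcal E_0(V),\qquad M^D\phi=\delta^D d^D\phi-F\cdot\phi ,$$ is a complex (i.e. $M^D d^D=0$ and $\delta^D M^D=0$) if and only if $D$ satisfies the (pure) Yang-Mills equation $\delta^D F=0$. In addition: (i) If $D$ is an orthogonal or unitary connection (i.e. preserves an inner product or Hermitian form on $V$), then the sequence is formally self-adjoint. (ii) In Riemannian signature the sequence is elliptic. (iii) In dimension $n=4$ the sequence is conformally invariant.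
   Context: Metrics have arbitrary signature $(p,q)$; inner products and Hermitian forms on $V$ are nondegenerate but not necessarily definite. Densities: for a conformal class $[g]$, let $\mathcal Q\subset S^2T^*M$ be the ray bundle of metrics in the class, a principal $\mathbb R_+$-bundle; $E[w]$ is the line bundle on $M$ associated to the representation $\mathbb R_+\ni x\mapsto x^{-w/2}$. A choice of metric $g\in[g]$ trivialises $E[w]$. $\mathcal E^k(V)$ denotes the smooth sections of $\wedge^kT^*M\otimes V$, and $\mathcal E_k(V)$ the smooth sections of $\wedge^kT^*M\otimes E[2k-n]\otimes V$. When a metric is fixed these two spaces are identified. $d^D:\mathcal E^k(V)\to\mathcal E^{k+1}(V)$ is the connection-coupled exterior derivative (similarly on the dual bundle $V^*$ with the dual connection), and $\delta^D:\mathcal E_{k+1}(V)\to\mathcal E_k(V)$ is the formal adjoint of $d^D:\mathcal E^k(V^* )\to\mathcal E^{k+1}(V^* )$. The expression $\delta^D F$ uses the connection on $\operatorname{End}(V)$ induced from $D$ and regards $F$ as an $\operatorname{End}(V)$-valued 2-form. $F\cdot:\mathcal E^1(V)\to\mathcal E_1(V)$ is $(F\cdot\phi)_a=F_a{}^b\phi_b$, where form indices are shown, indices are raised using the metric, and the $\operatorname{End}(V)$-action of $F$ on the $V$-valued 1-form $\phi$ is implicit. $F_{ab}$ acts on sections of $V$ as $D_aD_b-D_bD_a$ ($D$ coupled with the Levi-Civita connection). "Formally self-adjoint" means that, identifying $V$ with $V^*$ (or its conjugate) using the preserved form, $M^D$ equals its formal adjoint and the last operator is the formal adjoint of the first. "Elliptic"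 means that the principal symbol sequence is exact for every nonzero covector. "Conformally invariant" means that the operators between the indicated spaces depend only on the conformal class of $g$ (and on $(V,D)$). *)

theory Defs
  imports "HOL-Analysis.Analysis"
begin

section \<open>Smooth functions and manifolds\<close>

text \<open>For open \<open>S\<close> in a Euclidean space this is \<open>C\<^sup>k\<close>: the iterated directional derivatives
  exist and are continuous.\<close>

primrec Ck_on :: "nat \<Rightarrow> 'a::real_normed_vector set \<Rightarrow> ('a \<Rightarrow> 'b::real_normed_vector) \<Rightarrow> bool" where
  "Ck_on 0 S f \<longleftrightarrow> continuous_on S f"
| "Ck_on (Suc k) S f \<longleftrightarrow> (\<forall>y\<in>S. f differentiable (at y)) \<and>
     (\<forall>v. Ck_on k S (\<lambda>y. frechet_derivative f (at y) v))"

definition smooth_on :: "'a::real_normed_vector set \<Rightarrow> ('a \<Rightarrow> 'b::real_normed_vector) \<Rightarrow> bool" where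
  "smooth_on S f \<longleftrightarrow> (\<forall>k. Ck_on k S f)"

text \<open>The manifold is the whole type \<open>'m\<close> (Hausdorff and second countable by its sort in the
  theorem), the dimension is \<open>CARD('n)\<close>, and the charts are indexed by the type \<open>'i\<close>.  A coordinate
  map \<open>crd M i\<close> is only meaningful on its domain \<open>cdom M i\<close>.\<close>

record ('i, 'm, 'n) atlas =
  cdom :: "'i \<Rightarrow> 'm set"
  crd :: "'i \<Rightarrow> 'm \<Rightarrow> real^'n"

definition in_chart :: "('i, 'm, 'n::finite) atlas \<Rightarrow> 'i \<Rightarrow> ('m \<Rightarrow> 'b) \<Rightarrow> real^'n \<Rightarrow> 'b" where
  "in_chart M i f = f \<circ> inv_into (cdom M i) (crd M i)"

definition smooth_in ::
  "('i, 'm, 'n::finite) atlas \<Rightarrow> 'i \<Rightarrow> 'm set \<Rightarrow> ('m \<Rightarrow> 'b::real_normed_vector) \<Rightarrow> bool" where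
  "smooth_in M i S f \<longleftrightarrow> smooth_on (crd M i ` S) (in_chart M i f)"

definition smooth_manifold :: "('i, 'm::topological_space, 'n::finite) atlas \<Rightarrow> bool" where
  "smooth_manifold M \<longleftrightarrow>
     (\<Union>i. cdom M i) = UNIV \<and>
     (\<forall>i. open (cdom M i) \<and> open (crd M i ` cdom M i) \<and>
          (\<exists>y. homeomorphism (cdom M i) (crd M i ` cdom M i) (crd M i) y)) \<and>
     (\<forall>i j. smooth_in M i (cdom M i \<inter> cdom M j) (crd M j))"

definition smooth_fun :: "('i, 'm, 'n::finite) atlas \<Rightarrow> ('m \<Rightarrow> real) \<Rightarrow> bool" where
  "smooth_fun M f \<longleftrightarrow> (\<forall>i. smooth_in M i (cdom M i) f)"

definition pd ::
  "('i, 'm, 'n::finite) atlas \<Rightarrow> 'i \<Rightarrow> 'n \<Rightarrow> ('m \<Rightarrow> 'b::real_normed_vector) \<Rightarrow> 'm \<Rightarrow> 'b" where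
  "pd M i a f x = frechet_derivative (in_chart M i f) (at (crd M i x)) (axis a 1)"

text \<open>\<open>jac M j i x a b\<close> is the partial derivative of the coordinate \<open>b\<close> of the chart \<open>i\<close> with respect
  to the coordinate \<open>a\<close> of the chart \<open>j\<close>.\<close>

definition jac :: "('i, 'm, 'n::finite) atlas \<Rightarrow> 'i \<Rightarrow> 'i \<Rightarrow> 'm \<Rightarrow> 'n \<Rightarrow> 'n \<Rightarrow> real" where
  "jac M j i x a b = pd M j a (\<lambda>y. crd M i y $ b) x"


section \<open>Vector bundles with connection\<close>

text \<open>A vector bundle is given by its transition functions over an atlas of trivialising charts,
  and a connection by its local connection forms: a section has fibre coordinates \<open>s i x\<close> with
  \<open>s i x = transition V i j x *v s j x\<close>, and its covariant derivative in the chart and frame \<open>i\<close> is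
  \<open>cov M V i a s x\<close>.  The scalars \<open>'k\<close> range over the finite-dimensional real normed fields, that is
  over the real and the complex numbers (Frobenius).\<close>

record ('i, 'm, 'n, 'k, 'r) vbundle =
  transition :: "'i \<Rightarrow> 'i \<Rightarrow> 'm \<Rightarrow> 'k^'r^'r"
  conn_form :: "'i \<Rightarrow> 'm \<Rightarrow> 'n \<Rightarrow> 'k^'r^'r"

definition vector_bundle ::
  "('i, 'm, 'n::finite) atlas \<Rightarrow> ('i, 'm, 'n, 'k::{real_normed_field,euclidean_space}, 'r::finite) vbundle \<Rightarrow> bool" where
  "vector_bundle M V \<longleftrightarrow>
     (\<forall>i. \<forall>x\<in>cdom M i. transition V i i x = mat 1) \<and>
     (\<forall>i j k. \<forall>x\<in>cdom M i \<inter> cdom M j \<inter> cdom M k.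
        transition V i j x ** transition V j k x = transition V i k x) \<and>
     (\<forall>i j. smooth_in M i (cdom M i \<inter> cdom M j) (transition V i j))"

definition cov ::
  "('i, 'm, 'n::finite) atlas \<Rightarrow> ('i, 'm, 'n, 'k::{real_normed_field,euclidean_space}, 'r::finite) vbundle \<Rightarrow>
   'i \<Rightarrow> 'n \<Rightarrow> ('m \<Rightarrow> 'k^'r) \<Rightarrow> 'm \<Rightarrow> 'k^'r" where
  "cov M V i a s x = pd M i a s x + conn_form V i x a *v s x"

text \<open>The transformation law says that \<open>cov\<close> of a section is a \<open>V\<close>-valued 1-form.\<close>

definition connection ::
  "('i, 'm, 'n::finite) atlas \<Rightarrow> ('i, 'm, 'n, 'k::{real_normed_field,euclidean_space}, 'r::finite) vbundle \<Rightarrow> bool" where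
  "connection M V \<longleftrightarrow>
     (\<forall>i a. smooth_in M i (cdom M i) (\<lambda>x. conn_form V i x a)) \<and>
     (\<forall>i j a. \<forall>x\<in>cdom M i \<inter> cdom M j.
        pd M j a (transition V j i) x + conn_form V j x a ** transition V j i x =
        (\<Sum>b\<in>UNIV. jac M j i x a b *\<^sub>R (transition V j i x ** conn_form V i x b)))"

definition dual_bundle ::
  "('i, 'm, 'n, 'k::{real_normed_field,euclidean_space}, 'r::finite) vbundle \<Rightarrow> ('i, 'm, 'n, 'k, 'r) vbundle" where
  "dual_bundle V = \<lparr>transition = (\<lambda>i j x. transpose (transition V j i x)),
                    conn_form = (\<lambda>i x a. - transpose (conn_form V i x a))\<rparr>"

text \<open>\<open>End(V)\<close> with the induced connection; the entry \<open>T $ (c, d)\<close> is the matrix entry in row \<open>c\<close> and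
  column \<open>d\<close>.  The transition functions are \<open>T \<mapsto> G T G\<^sup>-\<^sup>1\<close>, the connection forms \<open>T \<mapsto> A T - T A\<close>.\<close>

definition end_bundle ::
  "('i, 'm, 'n, 'k::{real_normed_field,euclidean_space}, 'r::finite) vbundle \<Rightarrow> ('i, 'm, 'n, 'k, 'r \<times> 'r) vbundle" where
  "end_bundle V =
     \<lparr>transition = (\<lambda>i j x. \<chi> cd c'd'. transition V i j x $ fst cd $ fst c'd' *
                                     transition V j i x $ snd c'd' $ snd cd),
      conn_form = (\<lambda>i x a. \<chi> cd c'd'.
         (if snd cd = snd c'd' then conn_form V i x a $ fst cd $ fst c'd' else 0) -
         (if fst cd = fst c'd' then conn_form V i x a $ snd c'd' $ snd cd else 0))\<rparr>"

text \<open>\<open>F\<^sub>a\<^sub>b = D\<^sub>a D\<^sub>b - D\<^sub>b D\<^sub>a\<close>, computed on the vectors of the local frame (it is tensorial).  The Christoffel symbols of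
  the Levi-Civita connection cancel since it is torsion-free.\<close>

definition curvature ::
  "('i, 'm, 'n::finite) atlas \<Rightarrow> ('i, 'm, 'n, 'k::{real_normed_field,euclidean_space}, 'r::finite) vbundle \<Rightarrow>
   'i \<Rightarrow> 'm \<Rightarrow> 'n \<Rightarrow> 'n \<Rightarrow> 'k^'r^'r" where
  "curvature M V i x a b =
     matrix (\<lambda>v. cov M V i a (cov M V i b (\<lambda>_. v)) x - cov M V i b (cov M V i a (\<lambda>_. v)) x)"


section \<open>Bundle-valued forms\<close>

text \<open>\<open>\<omega> i x [a\<^sub>1, \<dots>, a\<^sub>k]\<close> is the component of a \<open>k\<close>-form in the chart and frame \<open>i\<close>.  Off the chart domain
  and at index lists of the wrong length it is 0, so that equality of forms is equality of functions.\<close>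

type_synonym ('i, 'm, 'n, 'k, 'r) form = "'i \<Rightarrow> 'm \<Rightarrow> 'n list \<Rightarrow> 'k^'r"

definition alt_tensors :: "nat \<Rightarrow> ('n list \<Rightarrow> 'k::real_normed_field^'r) set" where
  "alt_tensors k = {w. (\<forall>I. length I \<noteq> k \<longrightarrow> w I = 0) \<and>
     (\<forall>I s t. s < t \<and> t < length I \<longrightarrow> w (I[s := I ! t, t := I ! s]) = - w I)}"

definition forms ::
  "('i, 'm, 'n::finite) atlas \<Rightarrow> ('i, 'm, 'n, 'k::{real_normed_field,euclidean_space}, 'r::finite) vbundle \<Rightarrow>
   nat \<Rightarrow> ('i, 'm, 'n, 'k, 'r) form set" where
  "forms M V k = {\<omega>.
     (\<forall>i x. \<omega> i x \<in> alt_tensors k) \<and>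
     (\<forall>i x I. x \<notin> cdom M i \<longrightarrow> \<omega> i x I = 0) \<and>
     (\<forall>i I. smooth_in M i (cdom M i) (\<lambda>x. \<omega> i x I)) \<and>
     (\<forall>i j I. \<forall>x\<in>cdom M i \<inter> cdom M j. length I = k \<longrightarrow>
        \<omega> j x I = (\<Sum>J | length J = k. (\<Prod>t<k. jac M j i x (I ! t) (J ! t)) *\<^sub>R
                                        (transition V j i x *v \<omega> i x J)))}"

definition fscale ::
  "('m \<Rightarrow> real) \<Rightarrow> ('i, 'm, 'n, 'k::real_normed_field, 'r::finite) form \<Rightarrow> ('i, 'm, 'n, 'k, 'r) form" where
  "fscale f \<omega> = (\<lambda>i x I. f x *\<^sub>R \<omega> i x I)"

definition compact_support ::
  "('i, 'm::topological_space, 'n, 'k::real_normed_field, 'r::finite) form \<Rightarrow> bool" where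
  "compact_support \<omega> \<longleftrightarrow> (\<exists>K. compact K \<and> (\<forall>i x I. x \<notin> K \<longrightarrow> \<omega> i x I = 0))"

definition ext_d ::
  "('i, 'm, 'n::finite) atlas \<Rightarrow> ('i, 'm, 'n, 'k::{real_normed_field,euclidean_space}, 'r::finite) vbundle \<Rightarrow>
   ('i, 'm, 'n, 'k, 'r) form \<Rightarrow> ('i, 'm, 'n, 'k, 'r) form" where
  "ext_d M V \<omega> = (\<lambda>i x I. if x \<in> cdom M i
     then \<Sum>t<length I. (-1)^t *\<^sub>R cov M V i (I ! t) (\<lambda>y. \<omega> i y (take t I @ drop (Suc t) I)) x
     else 0)"

definition curvature_form ::
  "('i, 'm, 'n::finite) atlas \<Rightarrow> ('i, 'm, 'n, 'k::{real_normed_field,euclidean_space}, 'r::finite) vbundle \<Rightarrow>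
   ('i, 'm, 'n, 'k, 'r \<times> 'r) form" where
  "curvature_form M V = (\<lambda>i x I. if x \<in> cdom M i \<and> length I = 2
     then \<chi> cd. curvature M V i x (I ! 0) (I ! 1) $ fst cd $ snd cd else 0)"


section \<open>Metrics and conformal classes\<close>

type_synonym ('i, 'm, 'n) metric = "'i \<Rightarrow> 'm \<Rightarrow> real^'n^'n"

definition has_signature :: "nat \<Rightarrow> nat \<Rightarrow> real^'n^'n::finite \<Rightarrow> bool" where
  "has_signature p q B \<longleftrightarrow> transpose B = B \<and>
     (\<exists>(P :: real^'n^'n) (\<epsilon> :: 'n \<Rightarrow> real). invertible P \<and> range \<epsilon> \<subseteq> {1, -1} \<and> card {a. \<epsilon> a = 1} = p \<and> card {a. \<epsilon> a = -1} = q \<and>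
        transpose P ** B ** P = (\<chi> a b. if a = b then \<epsilon> a else 0))"

definition pseudo_metric ::
  "('i, 'm, 'n::finite) atlas \<Rightarrow> nat \<Rightarrow> nat \<Rightarrow> ('i, 'm, 'n) metric \<Rightarrow> bool" where
  "pseudo_metric M p q g \<longleftrightarrow>
     (\<forall>i x. x \<notin> cdom M i \<longrightarrow> g i x = 0) \<and>
     (\<forall>i. smooth_in M i (cdom M i) (g i)) \<and>
     (\<forall>i. \<forall>x\<in>cdom M i. has_signature p q (g i x)) \<and>
     (\<forall>i j a b. \<forall>x\<in>cdom M i \<inter> cdom M j.
        g j x $ a $ b = (\<Sum>c\<in>UNIV. \<Sum>d\<in>UNIV. jac M j i x a c * jac M j i x b d * g i x $ c $ d))"

definition conf_scale :: "('i, 'm, 'n::finite) atlas \<Rightarrow> ('m \<Rightarrow> real) \<Rightarrow> bool" where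
  "conf_scale M \<Omega> \<longleftrightarrow> smooth_fun M \<Omega> \<and> (\<forall>x. \<Omega> x > 0)"

definition rescale :: "('m \<Rightarrow> real) \<Rightarrow> ('i, 'm, 'n::finite) metric \<Rightarrow> ('i, 'm, 'n) metric" where
  "rescale \<Omega> g = (\<lambda>i x. (\<Omega> x)\<^sup>2 *\<^sub>R g i x)"

definition conf_class ::
  "('i, 'm, 'n::finite) atlas \<Rightarrow> ('i, 'm, 'n) metric \<Rightarrow> ('i, 'm, 'n) metric set" where
  "conf_class M g = {rescale \<Omega> g | \<Omega>. conf_scale M \<Omega>}"


section \<open>Forms with density weights\<close>

text \<open>A section of \<open>E[w]\<close> is a function on the ray bundle of metrics that is equivariant for the
  representation \<open>x \<mapsto> x\<^sup>-\<^sup>w\<^sup>/\<^sup>2\<close>, hence multiplied by \<open>\<Omega>\<^sup>w\<close> when the metric is multiplied by \<open>\<Omega>\<^sup>2\<close>.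
  Evaluated on metrics in the class, a section of \<open>\<Lambda>\<^sup>kT\<^sup>*M \<otimes> E[2k-n] \<otimes> V\<close> is therefore a map \<open>\<psi>\<close> from
  metrics to forms with the homogeneity below; \<open>\<psi> h\<close> is its expression in the trivialisation given
  by \<open>h\<close>.  (It is set to 0 at metrics outside the class.)\<close>

type_synonym ('i, 'm, 'n, 'k, 'r) wform = "('i, 'm, 'n) metric \<Rightarrow> ('i, 'm, 'n, 'k, 'r) form"

definition weighted_forms ::
  "('i, 'm, 'n::finite) atlas \<Rightarrow> ('i, 'm, 'n) metric set \<Rightarrow>
   ('i, 'm, 'n, 'k::{real_normed_field,euclidean_space}, 'r::finite) vbundle \<Rightarrow> nat \<Rightarrow>
   ('i, 'm, 'n, 'k, 'r) wform set" where
  "weighted_forms M C V k = {\<psi>.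
     (\<forall>h. h \<notin> C \<longrightarrow> \<psi> h = (\<lambda>_ _ _. 0)) \<and>
     (\<forall>h\<in>C. \<psi> h \<in> forms M V k) \<and>
     (\<forall>h\<in>C. \<forall>\<Omega>. conf_scale M \<Omega> \<longrightarrow>
        \<psi> (rescale \<Omega> h) = fscale (\<lambda>x. \<Omega> x powr (2 * real k - real CARD('n))) (\<psi> h))}"

text \<open>The identification of forms with weighted forms provided by the metric \<open>g\<close>.\<close>

definition weighted ::
  "('i, 'm, 'n::finite) atlas \<Rightarrow> ('i, 'm, 'n, 'k::{real_normed_field,euclidean_space}, 'r::finite) vbundle \<Rightarrow>
   ('i, 'm, 'n) metric \<Rightarrow> nat \<Rightarrow> ('i, 'm, 'n, 'k, 'r) form \<Rightarrow> ('i, 'm, 'n, 'k, 'r) wform" where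
  "weighted M V g k \<omega> = (THE \<psi>. \<psi> \<in> weighted_forms M (conf_class M g) V k \<and> \<psi> g = \<omega>)"


section \<open>Integration and formal adjoints\<close>

definition volume :: "('i, 'm::topological_space, 'n::finite) atlas \<Rightarrow> ('i, 'm, 'n) metric \<Rightarrow> 'm measure" where
  "volume M g = (THE \<mu>. sets \<mu> = sets borel \<and>
     (\<forall>i. \<forall>B\<in>sets borel. B \<subseteq> cdom M i \<longrightarrow>
        emeasure \<mu> B = (\<integral>\<^sup>+ y. ennreal (sqrt \<bar>det (in_chart M i (g i) y)\<bar>) * indicator (crd M i ` B) y \<partial>lborel)))"

text \<open>The integral over \<open>M\<close> of the inner product of two \<open>k\<close>-forms, where \<open>b i x\<close> pairs the fibres of
  the coefficient bundles in the frame \<open>i\<close>.  With the factor \<open>1/k!\<close> the sum over all index lists is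
  the sum over increasing ones, so that the adjoint of the exterior derivative is minus the divergence
  in the first index.\<close>

definition form_pairing ::
  "('i, 'm::topological_space, 'n::finite) atlas \<Rightarrow> ('i, 'm, 'n) metric \<Rightarrow>
   ('i \<Rightarrow> 'm \<Rightarrow> 'k^'r \<Rightarrow> 'k^'r \<Rightarrow> 'k) \<Rightarrow> nat \<Rightarrow>
   ('i, 'm, 'n, 'k::{real_normed_field,euclidean_space}, 'r::finite) form \<Rightarrow> ('i, 'm, 'n, 'k, 'r) form \<Rightarrow> 'k" where
  "form_pairing M g b k \<alpha> \<beta> =
     (LINT x | volume M g. (let i = (SOME i. x \<in> cdom M i) in
        (1 / fact k) *\<^sub>R (\<Sum>I | length I = k. \<Sum>J | length J = k.
           (\<Prod>t<k. matrix_inv (g i x) $ (I ! t) $ (J ! t)) *\<^sub>R b i x (\<alpha> i x I) (\<beta> i x J))))"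

definition dual_pairing :: "'i \<Rightarrow> 'm \<Rightarrow> 'k^'r \<Rightarrow> 'k^'r \<Rightarrow> 'k::real_normed_field" where
  "dual_pairing i x \<alpha> v = (\<Sum>c\<in>UNIV. \<alpha> $ c * v $ c)"

text \<open>\<open>\<delta>\<^sup>D\<close> from weighted \<open>(k+1)\<close>-forms to weighted \<open>k\<close>-forms, as the formal adjoint of \<open>d\<^sup>D\<close> on \<open>V\<^sup>*\<close>-valued
  \<open>k\<close>-forms.  The pairing of a form with a weighted form is a density; it is integrated in the
  trivialisation given by \<open>g\<close>.\<close>

definition codiff ::
  "('i, 'm::topological_space, 'n::finite) atlas \<Rightarrow>
   ('i, 'm, 'n, 'k::{real_normed_field,euclidean_space}, 'r::finite) vbundle \<Rightarrow> ('i, 'm, 'n) metric \<Rightarrow> nat \<Rightarrow>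
   ('i, 'm, 'n, 'k, 'r) wform \<Rightarrow> ('i, 'm, 'n, 'k, 'r) wform" where
  "codiff M V g k \<psi> = (THE \<eta>. \<eta> \<in> weighted_forms M (conf_class M g) V k \<and>
     (\<forall>\<alpha>\<in>forms M (dual_bundle V) k. compact_support \<alpha> \<longrightarrow>
        form_pairing M g dual_pairing (Suc k) (ext_d M (dual_bundle V) \<alpha>) (\<psi> g) =
        form_pairing M g dual_pairing k \<alpha> (\<eta> g)))"


section \<open>The Yang-Mills sequence\<close>

definition F_dot ::
  "('i, 'm, 'n::finite) atlas \<Rightarrow> ('i, 'm, 'n, 'k::{real_normed_field,euclidean_space}, 'r::finite) vbundle \<Rightarrow>
   ('i, 'm, 'n) metric \<Rightarrow> ('i, 'm, 'n, 'k, 'r) form \<Rightarrow> ('i, 'm, 'n, 'k, 'r) form" where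
  "F_dot M V g \<phi> = (\<lambda>i x I. if length I = 1
     then \<Sum>b\<in>UNIV. \<Sum>c\<in>UNIV. matrix_inv (g i x) $ c $ b *\<^sub>R (curvature M V i x (I ! 0) c *v \<phi> i x [b])
     else 0)"

definition M_op ::
  "('i, 'm::topological_space, 'n::finite) atlas \<Rightarrow>
   ('i, 'm, 'n, 'k::{real_normed_field,euclidean_space}, 'r::finite) vbundle \<Rightarrow> ('i, 'm, 'n) metric \<Rightarrow>
   ('i, 'm, 'n, 'k, 'r) form \<Rightarrow> ('i, 'm, 'n, 'k, 'r) wform" where
  "M_op M V g \<phi> = (\<lambda>h i x I. codiff M V g 1 (weighted M V g 2 (ext_d M V \<phi>)) h i x I -
                              weighted M V g 1 (F_dot M V g \<phi>) h i x I)"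

definition well_defined_sequence ::
  "('i, 'm::topological_space, 'n::finite) atlas \<Rightarrow>
   ('i, 'm, 'n, 'k::{real_normed_field,euclidean_space}, 'r::finite) vbundle \<Rightarrow> ('i, 'm, 'n) metric \<Rightarrow> bool" where
  "well_defined_sequence M V g \<longleftrightarrow>
     (\<forall>s\<in>forms M V 0. ext_d M V s \<in> forms M V 1) \<and>
     (\<forall>\<phi>\<in>forms M V 1. M_op M V g \<phi> \<in> weighted_forms M (conf_class M g) V 1) \<and>
     (\<forall>\<psi>\<in>weighted_forms M (conf_class M g) V 1.
        codiff M V g 0 \<psi> \<in> weighted_forms M (conf_class M g) V 0)"

definition is_complex ::
  "('i, 'm::topological_space, 'n::finite) atlas \<Rightarrow>
   ('i, 'm, 'n, 'k::{real_normed_field,euclidean_space}, 'r::finite) vbundle \<Rightarrow> ('i, 'm, 'n) metric \<Rightarrow> bool" where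
  "is_complex M V g \<longleftrightarrow>
     (\<forall>s\<in>forms M V 0. M_op M V g (ext_d M V s) = (\<lambda>_ _ _ _. 0)) \<and>
     (\<forall>\<phi>\<in>forms M V 1. codiff M V g 0 (M_op M V g \<phi>) = (\<lambda>_ _ _ _. 0))"

definition yang_mills ::
  "('i, 'm::topological_space, 'n::finite) atlas \<Rightarrow>
   ('i, 'm, 'n, 'k::{real_normed_field,euclidean_space}, 'r::finite) vbundle \<Rightarrow> ('i, 'm, 'n) metric \<Rightarrow> bool" where
  "yang_mills M V g \<longleftrightarrow>
     codiff M (end_bundle V) g 1 (weighted M (end_bundle V) g 2 (curvature_form M V)) = (\<lambda>_ _ _ _. 0)"


section \<open>Orthogonal and unitary connections, formal self-adjointness\<close>

text \<open>Inner products and Hermitian forms are treated together: for \<open>\<sigma> = id\<close> a Hermitian form for \<open>\<sigma>\<close> is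
  an inner product (symmetric and bilinear), and for \<open>'k = complex\<close> and \<open>\<sigma> = cnj\<close> it is a Hermitian
  form in the usual sense (conjugate-linear in the second argument).  There are no further possibilities for \<open>\<sigma>\<close>.\<close>

definition scalar_involution :: "('k::{real_normed_field,euclidean_space} \<Rightarrow> 'k) \<Rightarrow> bool" where
  "scalar_involution \<sigma> \<longleftrightarrow> linear \<sigma> \<and> \<sigma> 1 = 1 \<and> (\<forall>a b. \<sigma> (a * b) = \<sigma> a * \<sigma> b) \<and> (\<forall>a. \<sigma> (\<sigma> a) = a)"

lemma scalar_involution_id: "scalar_involution id"
  by (simp add: scalar_involution_def linear_id)

lemma scalar_involution_cnj: "scalar_involution cnj"
  by (simp add: scalar_involution_def bounded_linear.linear[OF bounded_linear_cnj])

definition hform ::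
  "('k \<Rightarrow> 'k) \<Rightarrow> ('i \<Rightarrow> 'm \<Rightarrow> 'k^'r^'r) \<Rightarrow> 'i \<Rightarrow> 'm \<Rightarrow> 'k^'r \<Rightarrow> 'k^'r \<Rightarrow> 'k::real_normed_field" where
  "hform \<sigma> H i x u v = (\<Sum>c\<in>UNIV. \<Sum>d\<in>UNIV. H i x $ c $ d * u $ c * \<sigma> (v $ d))"

definition bundle_hform ::
  "('i, 'm, 'n::finite) atlas \<Rightarrow> ('i, 'm, 'n, 'k::{real_normed_field,euclidean_space}, 'r::finite) vbundle \<Rightarrow>
   ('k \<Rightarrow> 'k) \<Rightarrow> ('i \<Rightarrow> 'm \<Rightarrow> 'k^'r^'r) \<Rightarrow> bool" where
  "bundle_hform M V \<sigma> H \<longleftrightarrow>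
     (\<forall>i. smooth_in M i (cdom M i) (H i)) \<and>
     (\<forall>i. \<forall>x\<in>cdom M i. invertible (H i x) \<and> (\<forall>c d. H i x $ d $ c = \<sigma> (H i x $ c $ d))) \<and>
     (\<forall>i j u v. \<forall>x\<in>cdom M i \<inter> cdom M j.
        hform \<sigma> H i x (transition V i j x *v u) (transition V i j x *v v) = hform \<sigma> H j x u v)"

definition preserves_hform ::
  "('i, 'm, 'n::finite) atlas \<Rightarrow> ('i, 'm, 'n, 'k::{real_normed_field,euclidean_space}, 'r::finite) vbundle \<Rightarrow>
   ('k \<Rightarrow> 'k) \<Rightarrow> ('i \<Rightarrow> 'm \<Rightarrow> 'k^'r^'r) \<Rightarrow> bool" where
  "preserves_hform M V \<sigma> H \<longleftrightarrow>
     (\<forall>i a s t. smooth_in M i (cdom M i) s \<and> smooth_in M i (cdom M i) t \<longrightarrow>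
        (\<forall>x\<in>cdom M i. pd M i a (\<lambda>y. hform \<sigma> H i y (s y) (t y)) x =
           hform \<sigma> H i x (cov M V i a s x) (t x) + hform \<sigma> H i x (s x) (cov M V i a t x)))"

text \<open>Formal adjoints with \<open>V\<close> identified with its (conjugate) dual by \<open>H\<close>: the middle operator is its
  own adjoint, and the last operator is the adjoint of the first.\<close>

definition formally_self_adjoint ::
  "('i, 'm::topological_space, 'n::finite) atlas \<Rightarrow>
   ('i, 'm, 'n, 'k::{real_normed_field,euclidean_space}, 'r::finite) vbundle \<Rightarrow> ('i, 'm, 'n) metric \<Rightarrow>
   ('k \<Rightarrow> 'k) \<Rightarrow> ('i \<Rightarrow> 'm \<Rightarrow> 'k^'r^'r) \<Rightarrow> bool" where
  "formally_self_adjoint M V g \<sigma> H \<longleftrightarrow>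
     (\<forall>\<phi>\<in>forms M V 1. \<forall>\<phi>'\<in>forms M V 1. compact_support \<phi> \<longrightarrow>
        form_pairing M g (hform \<sigma> H) 1 (M_op M V g \<phi> g) \<phi>' =
        form_pairing M g (hform \<sigma> H) 1 \<phi> (M_op M V g \<phi>' g)) \<and>
     (\<forall>s\<in>forms M V 0. \<forall>\<psi>\<in>weighted_forms M (conf_class M g) V 1. compact_support s \<longrightarrow>
        form_pairing M g (hform \<sigma> H) 1 (ext_d M V s) (\<psi> g) =
        form_pairing M g (hform \<sigma> H) 0 s (codiff M V g 0 \<psi> g))"


section \<open>Principal symbols and ellipticity\<close>

text \<open>The principal symbol, at a point \<open>x\<close> of the chart \<open>i\<close> and a covector \<open>\<xi>\<close>, of an operator \<open>P\<close> of
  order \<open>m\<close> on \<open>V\<close>-valued \<open>k\<close>-forms: it maps \<open>\<omega> x\<close> to \<open>P (f\<^sup>m \<omega>) x / m!\<close> for any smooth function \<open>f\<close> with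
  \<open>f x = 0\<close> and \<open>df x = \<xi>\<close>.\<close>

definition symbol ::
  "('i, 'm, 'n::finite) atlas \<Rightarrow> ('i, 'm, 'n, 'k::{real_normed_field,euclidean_space}, 'r::finite) vbundle \<Rightarrow>
   nat \<Rightarrow> nat \<Rightarrow> (('i, 'm, 'n, 'k, 'r) form \<Rightarrow> ('i, 'm, 'n, 'k, 'r) form) \<Rightarrow>
   'i \<Rightarrow> 'm \<Rightarrow> real^'n \<Rightarrow> ('n list \<Rightarrow> 'k^'r) \<Rightarrow> ('n list \<Rightarrow> 'k^'r)" where
  "symbol M V k m P i x \<xi> w = (THE z. \<forall>f \<omega>.
     smooth_fun M f \<and> f x = 0 \<and> (\<forall>a. pd M i a f x = \<xi> $ a) \<and> \<omega> \<in> forms M V k \<and> \<omega> i x = w \<longrightarrow>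
     z = (\<lambda>I. (1 / fact m) *\<^sub>R P (fscale (\<lambda>y. f y ^ m) \<omega>) i x I))"

text \<open>Exactness includes injectivity of the first and surjectivity of the last symbol, as usual for
  elliptic complexes.  \<open>M\<^sup>D\<close> and \<open>\<delta>\<^sup>D\<close> are viewed as operators on forms using the trivialisation of the
  density bundles given by \<open>g\<close>.\<close>

definition elliptic_sequence ::
  "('i, 'm::topological_space, 'n::finite) atlas \<Rightarrow>
   ('i, 'm, 'n, 'k::{real_normed_field,euclidean_space}, 'r::finite) vbundle \<Rightarrow> ('i, 'm, 'n) metric \<Rightarrow> bool" where
  "elliptic_sequence M V g \<longleftrightarrow>
     (\<forall>i. \<forall>x\<in>cdom M i. \<forall>\<xi>. \<xi> \<noteq> 0 \<longrightarrow>
        (let s0 = symbol M V 0 1 (ext_d M V) i x \<xi>;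
             s1 = symbol M V 1 2 (\<lambda>\<phi>. M_op M V g \<phi> g) i x \<xi>;
             s2 = symbol M V 1 1 (\<lambda>\<phi>. codiff M V g 0 (weighted M V g 1 \<phi>) g) i x \<xi>
         in inj_on s0 (alt_tensors 0) \<and>
            s0 ` alt_tensors 0 = {w \<in> alt_tensors 1. s1 w = (\<lambda>_. 0)} \<and>
            s1 ` alt_tensors 1 = {w \<in> alt_tensors 1. s2 w = (\<lambda>_. 0)} \<and>
            s2 ` alt_tensors 1 = alt_tensors 0))"


section \<open>Conformal invariance\<close>

text \<open>\<open>d\<^sup>D\<close> and the spaces of unweighted forms do not involve a metric at all.\<close>

definition conformally_invariant ::
  "('i, 'm::topological_space, 'n::finite) atlas \<Rightarrow>
   ('i, 'm, 'n, 'k::{real_normed_field,euclidean_space}, 'r::finite) vbundle \<Rightarrow> ('i, 'm, 'n) metric \<Rightarrow> bool" where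
  "conformally_invariant M V g \<longleftrightarrow>
     (\<forall>h\<in>conf_class M g.
        (\<forall>k. weighted_forms M (conf_class M h) V k = weighted_forms M (conf_class M g) V k) \<and>
        (\<forall>\<phi>\<in>forms M V 1. M_op M V h \<phi> = M_op M V g \<phi>) \<and>
        (\<forall>\<psi>\<in>weighted_forms M (conf_class M g) V 1. codiff M V h 0 \<psi> = codiff M V g 0 \<psi>))"

end

theory Submission
  imports Defs
begin


text \<open>
  In a chart and frame, \<open>\<delta>\<^sup>D\<close> is minus a divergence. On alternating tensors the Christoffel symbols drop out of
  it, so that \<open>\<delta>\<^sup>D \<psi> = - |g|\<^bsup>-1/2\<^esup> D\<^sub>a (|g|\<^bsup>1/2\<^esup> \<psi>\<^sup>a)\<close> with the indices of the result lowered; this is \<open>cdiv\<close>.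
  Integration by parts in a chart (\<open>integral_pd_eq_0\<close>) and cutoff functions give Green's formula
  \<open>\<langle>d\<^sup>D \<alpha>, \<psi>\<rangle> = \<langle>\<alpha>, \<delta>\<^sup>D \<psi>\<rangle>\<close> (\<open>green\<close>).  Compactly supported forms separate points (\<open>pairing_nondegenerate\<close>).
  Hence an adjoint of \<open>d\<^sup>D\<close> is unique, and \<open>codiff\<close>, which is described as an adjoint, is given by the local
  formula.  The same fact shows that the local formulas agree on the overlap of two charts (\<open>div_form\<close>), because
  there both are adjoint to \<open>d\<^sup>D\<close>; the transformation law of a divergence is never computed.

  The equivalence with the Yang-Mills equation comes from the Leibniz rule.  Let \<open>\<alpha>\<close> be a compactly supported
  1-form with values in \<open>V\<^sup>*\<close> and \<open>s\<close> a section of \<open>V\<close>.  Then \<open>\<alpha> \<otimes> s\<close> is a test form for \<open>\<delta>\<^sup>D F\<close>, and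
  \<open>d\<^sup>D (\<alpha> \<otimes> s) = d\<^sup>D \<alpha> \<otimes> s - \<alpha> \<and> d\<^sup>D s\<close>.  Paired with \<open>F\<close>, the first term gives \<open>\<langle>d\<^sup>D \<alpha>, F s\<rangle> = \<langle>d\<^sup>D \<alpha>, d\<^sup>D d\<^sup>D s\<rangle>\<close>
  and the second \<open>\<langle>\<alpha>, F \<cdot> d\<^sup>D s\<rangle>\<close>, so that \<open>\<langle>\<alpha> \<otimes> s, \<delta>\<^sup>D F\<rangle> = \<langle>\<alpha>, M\<^sup>D d\<^sup>D s\<rangle>\<close> (\<open>Mop_ext_d_weak\<close>).  For a section
  \<open>\<alpha>\<close> of \<open>V\<^sup>*\<close> and a 1-form \<open>\<phi>\<close> one finds in the same way \<open>\<langle>\<alpha> \<otimes> \<phi>, \<delta>\<^sup>D F\<rangle> = - \<langle>\<alpha>, \<delta>\<^sup>D M\<^sup>D \<phi>\<rangle>\<close> (\<open>cdiv_Mop_weak\<close>).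
  So \<open>\<delta>\<^sup>D F = 0\<close> makes both compositions vanish, and \<open>M\<^sup>D d\<^sup>D = 0\<close> alone forces \<open>\<delta>\<^sup>D F = 0\<close> since the tensors
  \<open>\<alpha> \<otimes> s\<close> separate points.

  A preserved inner product or Hermitian form identifies \<open>V\<close> with \<open>V\<^sup>*\<close>, up to conjugation, in a way that commutes
  with \<open>d\<^sup>D\<close>.  Green's formula turns \<open>\<langle>M\<^sup>D \<phi>, \<phi>'\<rangle>\<close> into \<open>\<langle>d\<^sup>D \<phi>, d\<^sup>D \<phi>'\<rangle> - \<langle>F \<cdot> \<phi>, \<phi>'\<rangle>\<close>; the first term is visibly
  symmetric, the second because \<open>F\<close> is skew both in its form indices and for the inner product (\<open>self_adjoint\<close>).

  The symbols of the three operators at a covector \<open>\<xi>\<close> are \<open>w \<mapsto> w \<xi>\<close>, \<open>w \<mapsto> \<langle>\<xi>, w\<rangle> \<xi> - |\<xi>|\<^sup>2 w\<close> and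
  \<open>w \<mapsto> - \<langle>\<xi>, w\<rangle>\<close>.  In Riemannian signature \<open>|\<xi>|\<^sup>2 > 0\<close>, the middle one is a multiple of the projection to the
  orthogonal complement of \<open>\<xi>\<close>, and exactness is read off (\<open>elliptic\<close>).

  For \<open>h = \<Omega>\<^sup>2 g\<close> the powers of \<open>\<Omega>\<close> from the volume density, the inverse metric and the weight of \<open>\<psi>\<close> cancel
  inside the divergence, so \<open>\<delta>\<^sup>D\<close> on weighted 1-forms and 2-forms is conformally invariant in every dimension
  (\<open>codiff_conformal\<close>).  In dimension 4, and only there, 2-forms have weight 0 and the factor \<open>\<Omega>\<^bsup>-2\<^esup>\<close> by
  which \<open>F\<cdot>\<close> scales matches the weight of its target (\<open>conformal_invariance\<close>).
\<close>


section \<open>Smooth functions on open sets\<close>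

lemma Ck_on_cong_imp:
  assumes "open S" "\<And>y. y \<in> S \<Longrightarrow> f y = g y" "Ck_on k S f"
  shows "Ck_on k S g"
  using assms(2,3)
proof (induction k arbitrary: f g)
  case 0
  then show ?case by (auto cong: continuous_on_cong)
next
  case (Suc k)
  have D: "f differentiable (at y)" if "y \<in> S" for y using Suc.prems that by auto
  have "frechet_derivative f (at y) = frechet_derivative g (at y)" if "y \<in> S" for y
    using frechet_derivative_transform_within_open[OF D[OF that] assms(1) that] Suc.prems(1) by auto
  then have "Ck_on k S (\<lambda>y. frechet_derivative g (at y) v)" for v
    using Suc.IH[of "\<lambda>y. frechet_derivative f (at y) v" "\<lambda>y. frechet_derivative g (at y) v"] Suc.prems(2)
    by auto
  moreover have "g differentiable (at y)" if "y \<in> S" for y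
    using D[OF that] Suc.prems(1) assms(1) that unfolding differentiable_def
    by (blast intro: has_derivative_transform_within_open)
  ultimately show ?case by simp
qed

lemma Ck_on_SucI:
  assumes "open S" "\<And>y. y \<in> S \<Longrightarrow> (f has_derivative f' y) (at y)"
    and "\<And>v. Ck_on k S (\<lambda>y. f' y v)"
  shows "Ck_on (Suc k) S f"
proof -
  have e: "f' y v = frechet_derivative f (at y) v" if "y \<in> S" for y v
    using frechet_derivative_at[OF assms(2)[OF that]] by simp
  have "Ck_on k S (\<lambda>y. frechet_derivative f (at y) v)" for v
    by (rule Ck_on_cong_imp[OF assms(1) _ assms(3)[of v]]) (rule e)
  moreover have "f differentiable (at y)" if "y \<in> S" for y
    using assms(2)[OF that] differentiable_def by blast
  ultimately show ?thesis by simp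
qed

lemma Ck_on_SucD:
  assumes "Ck_on (Suc k) S f"
  shows "y \<in> S \<Longrightarrow> (f has_derivative frechet_derivative f (at y)) (at y)"
    and "Ck_on k S (\<lambda>y. frechet_derivative f (at y) v)"
  using assms by (auto simp: frechet_derivative_works)

lemma Ck_on_Suc_imp: "Ck_on (Suc k) S f \<Longrightarrow> Ck_on k S f"
proof (induction k arbitrary: f)
  case 0
  then show ?case
    by (auto intro!: continuous_at_imp_continuous_on differentiable_imp_continuous_within)
next
  case (Suc k)
  have "Ck_on k S (\<lambda>y. frechet_derivative f (at y) v)" for v
    using Suc.IH[of "\<lambda>y. frechet_derivative f (at y) v"] Suc.prems by (metis Ck_on_SucD(2))
  then show ?case using Suc.prems by simp
qed

lemma Ck_on_const: "Ck_on k S (\<lambda>_. c)"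
  by (induction k arbitrary: c) (auto simp: frechet_derivative_const)

lemma Ck_on_bounded_linear:
  assumes "bounded_linear h" "open S" "Ck_on k S f"
  shows "Ck_on k S (\<lambda>y. h (f y))"
  using assms(3)
proof (induction k arbitrary: f)
  case 0
  then show ?case using bounded_linear.continuous_on[OF assms(1)] by auto
next
  case (Suc k)
  show ?case
    by (rule Ck_on_SucI[OF assms(2)])
      (auto intro!: bounded_linear.has_derivative[OF assms(1)] Ck_on_SucD(1)[OF Suc.prems] Suc.IH Ck_on_SucD(2)[OF Suc.prems]
        simp del: Ck_on.simps)
qed

lemma Ck_on_add:
  assumes "open S" "Ck_on k S f" "Ck_on k S g"
  shows "Ck_on k S (\<lambda>y. f y + g y)"
  using assms(2,3)
proof (induction k arbitrary: f g)
  case 0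
  then show ?case by (auto intro: continuous_on_add)
next
  case (Suc k)
  show ?case
    by (rule Ck_on_SucI[OF assms(1)])
      (auto intro!: has_derivative_add Ck_on_SucD(1)[OF Suc.prems(1)] Ck_on_SucD(1)[OF Suc.prems(2)]
          Suc.IH Ck_on_SucD(2)[OF Suc.prems(1)] Ck_on_SucD(2)[OF Suc.prems(2)]
        simp del: Ck_on.simps)
qed

lemma Ck_on_bilinear:
  assumes "bounded_bilinear h" "open S" "Ck_on k S f" "Ck_on k S g"
  shows "Ck_on k S (\<lambda>y. h (f y) (g y))"
  using assms(3,4)
proof (induction k arbitrary: f g)
  case 0
  then show ?case by (auto intro: bounded_bilinear.continuous_on[OF assms(1)])
next
  case (Suc k)
  show ?case
    by (rule Ck_on_SucI[OF assms(2)])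
      (auto intro!: bounded_bilinear.FDERIV[OF assms(1)] Ck_on_SucD(1)[OF Suc.prems(1)] Ck_on_SucD(1)[OF Suc.prems(2)]
          Suc.IH Ck_on_SucD(2)[OF Suc.prems(1)] Ck_on_SucD(2)[OF Suc.prems(2)]
          Ck_on_add[OF assms(2)] Ck_on_Suc_imp[OF Suc.prems(1)] Ck_on_Suc_imp[OF Suc.prems(2)]
        simp del: Ck_on.simps)
qed

lemma Ck_on_sum:
  assumes "open S" "\<And>a. a \<in> A \<Longrightarrow> Ck_on k S (f a)"
  shows "Ck_on k S (\<lambda>y. \<Sum>a\<in>A. f a y)"
  using assms(2)
  by (induction A rule: infinite_finite_induct) (auto intro: Ck_on_const Ck_on_add[OF assms(1)])

lemma Ck_on_linear:
  assumes "bounded_linear h" "open S"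
  shows "Ck_on k S h"
proof (cases k)
  case 0
  then show ?thesis using bounded_linear.continuous_on[OF assms(1) continuous_on_id] by simp
next
  case (Suc m)
  show ?thesis unfolding Suc
    by (rule Ck_on_SucI[OF assms(2), where f'="\<lambda>_. h"])
      (auto intro: bounded_linear_imp_has_derivative[OF assms(1)] Ck_on_const)
qed

text \<open>The chain rule expands the derivative of the outer function in the standard basis, so that
  the induction hypothesis applies to its partial derivatives.\<close>

lemma Ck_on_compose:
  fixes g :: "'a::real_normed_vector \<Rightarrow> 'b::euclidean_space"
  assumes "open S" "open T" "g ` S \<subseteq> T" "Ck_on k S g" "Ck_on k T f"
  shows "Ck_on k S (\<lambda>y. f (g y))"
  using assms(4,5)
proof (induction k arbitrary: f)
  case 0
  then show ?case using assms(3) by (auto intro: continuous_on_compose2)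
next
  case (Suc k)
  let ?Df = "\<lambda>z. frechet_derivative f (at z)" and ?Dg = "\<lambda>z. frechet_derivative g (at z)"
  have f: "(f has_derivative ?Df (g y)) (at (g y))" if "y \<in> S" for y
    using Ck_on_SucD(1)[OF Suc.prems(2)] assms(3) that by auto
  have g: "(g has_derivative ?Dg y) (at y)" if "y \<in> S" for y
    using Ck_on_SucD(1)[OF Suc.prems(1)] that by auto
  have *: "?Df (g y) (?Dg y v) = (\<Sum>e\<in>Basis. (?Dg y v \<bullet> e) *\<^sub>R ?Df (g y) e)" if "y \<in> S" for y v
  proof -
    interpret linear "?Df (g y)" using f[OF that] has_derivative_linear by blast
    have "?Df (g y) (?Dg y v) = ?Df (g y) (\<Sum>e\<in>Basis. (?Dg y v \<bullet> e) *\<^sub>R e)"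
      by (simp add: euclidean_representation)
    then show ?thesis by (simp add: sum scale)
  qed
  have "Ck_on k S (\<lambda>y. \<Sum>e\<in>Basis. (?Dg y v \<bullet> e) *\<^sub>R ?Df (g y) e)" for v
  proof (intro Ck_on_sum assms(1) Ck_on_bilinear[OF bounded_bilinear_scaleR])
    show "Ck_on k S (\<lambda>y. ?Dg y v \<bullet> e)" for e
      by (rule Ck_on_bounded_linear[OF bounded_linear_inner_left assms(1) Ck_on_SucD(2)[OF Suc.prems(1)]])
    show "Ck_on k S (\<lambda>y. ?Df (g y) e)" for e
      by (rule Suc.IH[OF Ck_on_Suc_imp[OF Suc.prems(1)] Ck_on_SucD(2)[OF Suc.prems(2)]])
  qed
  then have "Ck_on k S (\<lambda>y. ?Df (g y) (?Dg y v))" for v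
    by (rule Ck_on_cong_imp[OF assms(1), rotated]) (simp add: *)
  then show ?case
    by (intro Ck_on_SucI[OF assms(1), where f'="\<lambda>y v. ?Df (g y) (?Dg y v)"])
      (auto intro: has_derivative_compose[OF g f])
qed

lemma smooth_on_Ck: "smooth_on S f \<Longrightarrow> Ck_on k S f"
  by (simp add: smooth_on_def)

lemma smooth_on_cong:
  assumes "open S" "\<And>y. y \<in> S \<Longrightarrow> f y = g y" "smooth_on S f"
  shows "smooth_on S g"
  using assms Ck_on_cong_imp unfolding smooth_on_def by blast

lemma smooth_on_continuous: "smooth_on S f \<Longrightarrow> continuous_on S f"
  using smooth_on_Ck[of S f 0] by simp

lemma smooth_on_has_derivative:
  "smooth_on S f \<Longrightarrow> y \<in> S \<Longrightarrow> (f has_derivative frechet_derivative f (at y)) (at y)"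
  using smooth_on_Ck[of S f "Suc 0"] Ck_on_SucD(1) by blast

lemma smooth_on_frechet_derivative:
  "smooth_on S f \<Longrightarrow> smooth_on S (\<lambda>y. frechet_derivative f (at y) v)"
  unfolding smooth_on_def using Ck_on_SucD(2) by blast

lemma smooth_on_const: "smooth_on S (\<lambda>_. c)"
  by (simp add: smooth_on_def Ck_on_const)

lemma smooth_on_linear: "bounded_linear h \<Longrightarrow> open S \<Longrightarrow> smooth_on S h"
  by (simp add: smooth_on_def Ck_on_linear)

lemma smooth_on_bounded_linear:
  "bounded_linear h \<Longrightarrow> open S \<Longrightarrow> smooth_on S f \<Longrightarrow> smooth_on S (\<lambda>y. h (f y))"
  by (simp add: smooth_on_def Ck_on_bounded_linear)

lemma smooth_on_add:
  "open S \<Longrightarrow> smooth_on S f \<Longrightarrow> smooth_on S g \<Longrightarrow> smooth_on S (\<lambda>y. f y + g y)"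
  by (simp add: smooth_on_def Ck_on_add)

lemma smooth_on_bilinear:
  "bounded_bilinear h \<Longrightarrow> open S \<Longrightarrow> smooth_on S f \<Longrightarrow> smooth_on S g \<Longrightarrow> smooth_on S (\<lambda>y. h (f y) (g y))"
  by (simp add: smooth_on_def Ck_on_bilinear)

lemma smooth_on_sum:
  "open S \<Longrightarrow> (\<And>a. a \<in> A \<Longrightarrow> smooth_on S (f a)) \<Longrightarrow> smooth_on S (\<lambda>y. \<Sum>a\<in>A. f a y)"
  by (simp add: smooth_on_def Ck_on_sum)

lemma smooth_on_compose:
  fixes g :: "'a::real_normed_vector \<Rightarrow> 'b::euclidean_space"
  assumes "open S" "open T" "g ` S \<subseteq> T" "smooth_on S g" "smooth_on T f"
  shows "smooth_on S (\<lambda>y. f (g y))"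
  using assms Ck_on_compose unfolding smooth_on_def by blast

lemma smooth_on_minus:
  "open S \<Longrightarrow> smooth_on S f \<Longrightarrow> smooth_on S (\<lambda>y. - f y)"
  by (rule smooth_on_bounded_linear[OF bounded_linear_minus[OF bounded_linear_ident]])

lemma smooth_on_diff:
  "open S \<Longrightarrow> smooth_on S f \<Longrightarrow> smooth_on S g \<Longrightarrow> smooth_on S (\<lambda>y. f y - g y)"
  using smooth_on_add[of S f "\<lambda>y. - g y"] smooth_on_minus by auto

lemma smooth_on_mult:
  fixes f :: "'a::real_normed_vector \<Rightarrow> 'b::real_normed_algebra"
  shows "open S \<Longrightarrow> smooth_on S f \<Longrightarrow> smooth_on S g \<Longrightarrow> smooth_on S (\<lambda>y. f y * g y)"
  by (rule smooth_on_bilinear[OF bounded_bilinear_mult])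

lemma Ck_on_subset: "Ck_on k S f \<Longrightarrow> T \<subseteq> S \<Longrightarrow> Ck_on k T f"
  by (induction k arbitrary: f) (auto intro: continuous_on_subset)

lemma smooth_on_subset: "smooth_on S f \<Longrightarrow> T \<subseteq> S \<Longrightarrow> smooth_on T f"
  unfolding smooth_on_def using Ck_on_subset by blast

lemma Ck_on_local:
  assumes "\<And>x. x \<in> S \<Longrightarrow> \<exists>T. open T \<and> x \<in> T \<and> Ck_on k T f"
  shows "Ck_on k S f"
  using assms
proof (induction k arbitrary: f)
  case 0
  have "isCont f x" if "x \<in> S" for x
    using 0[OF that] by (auto simp: continuous_on_eq_continuous_at)
  then show ?case by (simp add: continuous_at_imp_continuous_on)
next
  case (Suc k)
  have "f differentiable (at y)" if "y \<in> S" for y using Suc.prems[OF that] by auto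
  moreover have "Ck_on k S (\<lambda>y. frechet_derivative f (at y) v)" for v
    by (rule Suc.IH) (use Suc.prems in fastforce)
  ultimately show ?case by simp
qed

lemma smooth_on_local:
  assumes "\<And>x. x \<in> S \<Longrightarrow> \<exists>T. open T \<and> x \<in> T \<and> smooth_on T f"
  shows "smooth_on S f"
  unfolding smooth_on_def
proof
  show "Ck_on k S f" for k
    by (rule Ck_on_local) (meson assms smooth_on_Ck)
qed

lemma bounded_linear_vec_axis:
  "bounded_linear (\<lambda>x::'b::real_normed_vector. axis c x :: 'b^'c::finite)"
proof
  show "axis c (a + b) = axis c a + axis c b" for a b :: 'b by (simp add: vec_eq_iff axis_def)
  show "axis c (r *\<^sub>R b) = r *\<^sub>R axis c b" for r and b :: 'b by (simp add: vec_eq_iff axis_def)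
  have "norm (axis c x :: 'b^'c) \<le> norm x * 1" for x :: 'b
    unfolding norm_vec_def by (rule order_trans[OF L2_set_le_sum])
      (simp_all add: axis_def if_distrib cong: if_cong)
  then show "\<exists>K. \<forall>x. norm (axis c x :: 'b^'c) \<le> norm x * K" by blast
qed

lemma smooth_on_vec_lambda:
  fixes f :: "'a::real_normed_vector \<Rightarrow> 'c::finite \<Rightarrow> 'b::real_normed_vector"
  assumes "open S" "\<And>c. smooth_on S (\<lambda>y. f y c)"
  shows "smooth_on S (\<lambda>y. \<chi> c. f y c)"
proof -
  have "(\<chi> c. f y c) = (\<Sum>c\<in>UNIV. axis c (f y c))" for y
    by (simp add: vec_eq_iff axis_def if_distrib cong: if_cong)
  then show ?thesis
    by (auto intro!: smooth_on_sum assms smooth_on_bounded_linear[OF bounded_linear_vec_axis])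
qed


section \<open>Elementary smooth functions and bump functions\<close>

lemma Ck_on_real_deriv:
  fixes f :: "real \<Rightarrow> real"
  assumes "open S" "\<And>y. y \<in> S \<Longrightarrow> (f has_real_derivative f' y) (at y)" "Ck_on k S f'"
  shows "Ck_on (Suc k) S f"
proof (rule Ck_on_SucI[OF assms(1)])
  show "(f has_derivative (*) (f' y)) (at y)" if "y \<in> S" for y
    using assms(2)[OF that] by (simp add: has_field_derivative_def)
  show "Ck_on k S (\<lambda>y. f' y * v)" for v
    by (rule Ck_on_bounded_linear[OF bounded_linear_mult_left assms(1,3)])
qed

lemma smooth_on_inverse: "smooth_on (UNIV - {0::real}) inverse"
  unfolding smooth_on_def
proof
  fix k show "Ck_on k (UNIV - {0::real}) inverse"
  proof (induction k)
    case 0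
    then show ?case by (auto intro: continuous_intros)
  next
    case (Suc k)
    show ?case
    proof (rule Ck_on_real_deriv)
      show "open (UNIV - {0::real})" by auto
      show "(inverse has_real_derivative - (inverse y * inverse y)) (at y)" if "y \<in> UNIV - {0}" for y :: real
        using that by (auto intro!: derivative_eq_intros)
      show "Ck_on k (UNIV - {0}) (\<lambda>y. - (inverse y * inverse y :: real))"
        by (intro Ck_on_bounded_linear[OF bounded_linear_minus[OF bounded_linear_ident]]
            Ck_on_bilinear[OF bounded_bilinear_mult] Suc) auto
    qed
  qed
qed

lemma smooth_on_powr: "smooth_on {0::real<..} (\<lambda>x. x powr r)"
  unfolding smooth_on_def
proof
  fix k show "Ck_on k {0::real<..} (\<lambda>x. x powr r)"
  proof (induction k arbitrary: r)
    case 0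
    then show ?case by (auto intro!: continuous_intros)
  next
    case (Suc k)
    show ?case
    proof (rule Ck_on_real_deriv)
      show "((\<lambda>x. x powr r) has_real_derivative r * y powr (r - 1)) (at y)" if "y \<in> {0<..}" for y :: real
        using that by (auto intro!: derivative_eq_intros simp: powr_diff field_simps)
      show "Ck_on k {0<..} (\<lambda>y. r * y powr (r - 1))"
        by (rule Ck_on_bounded_linear[OF bounded_linear_mult_right _ Suc]) auto
    qed auto
  qed
qed

lemma smooth_on_divide_real:
  fixes f g :: "'a::real_normed_vector \<Rightarrow> real"
  assumes "open S" "smooth_on S f" "smooth_on S g" "\<And>x. x \<in> S \<Longrightarrow> g x \<noteq> 0"
  shows "smooth_on S (\<lambda>x. f x / g x)"
proof -
  have "smooth_on S (\<lambda>x. inverse (g x))"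
    by (rule smooth_on_compose[OF assms(1) _ _ assms(3) smooth_on_inverse]) (use assms(4) in auto)
  then show ?thesis
    unfolding divide_inverse by (rule smooth_on_mult[OF assms(1,2)])
qed

lemma smooth_on_powr_compose:
  assumes "open S" "smooth_on S g" "\<And>x. x \<in> S \<Longrightarrow> g x > 0"
  shows "smooth_on S (\<lambda>x. (g x :: real) powr r)"
  by (rule smooth_on_compose[OF assms(1) _ _ assms(2) smooth_on_powr]) (use assms(3) in auto)

text \<open>The standard smooth function that vanishes for negative arguments is the case \<open>n = 0\<close>; the factors \<open>t\<^sup>-\<^sup>n\<close> make the
  family closed under differentiation, up to linear combinations.\<close>

definition flat :: "nat \<Rightarrow> real \<Rightarrow> real" where
  "flat n t = (if t > 0 then exp (- inverse t) * inverse t ^ n else 0)"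

text \<open>Exponential decay beats every power, so \<open>flat\<close> vanishes to second order at the origin; its
  derivative is again a combination of functions of this family.\<close>

lemma flat_bound: "\<bar>flat n t\<bar> \<le> fact (n + 2) * t\<^sup>2"
proof (cases "t > 0")
  case True
  define u where "u = inverse t"
  have u: "u > 0" using True by (simp add: u_def)
  have "u ^ (n + 2) / fact (n + 2) \<le> exp u"
    using sum_le_suminf[OF summable_exp_generic[of u], of "{n+2}"] u
    by (simp add: exp_def divide_inverse mult.commute)
  then have "exp (- u) * u ^ (n + 2) \<le> fact (n + 2)"
    by (simp add: exp_minus field_simps del: fact_Suc power_Suc add_2_eq_Suc')
  moreover have "exp (- u) * u ^ n = (exp (- u) * u ^ (n + 2)) * t\<^sup>2"
    using True by (simp add: u_def power_add field_simps power2_eq_square)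
  ultimately have "exp (- u) * u ^ n \<le> fact (n + 2) * t\<^sup>2"
    by (metis mult_right_mono zero_le_power2)
  then show ?thesis using True u by (simp add: flat_def u_def)
qed (simp add: flat_def)

lemma flat_deriv: "(flat n has_real_derivative flat (n + 2) t - n * flat (n + 1) t) (at t)"
proof -
  consider "t > 0" | "t < 0" | "t = 0" by linarith
  then show ?thesis
  proof cases
    case 1
    have "((\<lambda>t. exp (- inverse t) * inverse t ^ n) has_real_derivative flat (n + 2) t - n * flat (n + 1) t) (at t)"
    proof -
      have i: "(inverse has_real_derivative - (inverse t * inverse t)) (at t)"
        using 1 by (auto intro!: derivative_eq_intros)
      have "((\<lambda>t. exp (- inverse t)) has_real_derivative exp (- inverse t) * (inverse t * inverse t)) (at t)"
        using DERIV_fun_exp[OF DERIV_minus[OF i]] by simp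
      moreover have "((\<lambda>t. inverse t ^ n) has_real_derivative - (n * inverse t ^ (n + 1))) (at t)"
        using DERIV_power[OF i, of n] by (cases n) (simp_all add: mult_ac)
      ultimately show ?thesis
      proof -
        assume "((\<lambda>t. exp (- inverse t)) has_real_derivative exp (- inverse t) * (inverse t * inverse t)) (at t)"
          "((\<lambda>t. inverse t ^ n) has_real_derivative - (n * inverse t ^ (n + 1))) (at t)"
        from DERIV_mult[OF this] show ?thesis
          by (rule DERIV_cong) (use 1 in \<open>simp add: flat_def algebra_simps\<close>)
      qed
    qed
    then show ?thesis
      by (rule has_field_derivative_transform_within[where d=t]) (use 1 in \<open>auto simp: flat_def dist_real_def\<close>)
  next
    case 2
    have "((\<lambda>t. 0) has_real_derivative 0) (at t)" by simp
    then have "(flat n has_real_derivative 0) (at t)"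
      by (rule has_field_derivative_transform_within[where d="-t"]) (use 2 in \<open>auto simp: flat_def dist_real_def\<close>)
    then show ?thesis using 2 by (simp add: flat_def)
  next
    case 3
    have "((\<lambda>h. flat n h / h) \<longlongrightarrow> 0) (at 0)"
    proof (rule Lim_null_comparison)
      show "\<forall>\<^sub>F h in at 0. norm (flat n h / h) \<le> fact (n + 2) * \<bar>h\<bar>"
      proof (rule eventuallyI)
        fix h :: real
        show "norm (flat n h / h) \<le> fact (n + 2) * \<bar>h\<bar>"
          using flat_bound[of n h] by (cases "h = 0")
            (auto simp: field_simps power2_eq_square abs_mult[symmetric] simp del: fact_Suc)
      qed
      show "((\<lambda>h. fact (n + 2) * \<bar>h\<bar>) \<longlongrightarrow> (0::real)) (at 0)"
        by (rule tendsto_eq_intros refl | simp)+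
    qed
    then show ?thesis using 3 by (simp add: DERIV_def flat_def)
  qed
qed

lemma smooth_on_flat: "smooth_on UNIV (flat n)"
  unfolding smooth_on_def
proof
  fix k show "Ck_on k UNIV (flat n)"
  proof (induction k arbitrary: n)
    case 0
    show ?case using DERIV_isCont[OF flat_deriv] by (simp add: continuous_on_eq_continuous_at)
  next
    case (Suc k)
    have "Ck_on k UNIV (\<lambda>t. flat (n + 2) t + (- real n) * flat (n + 1) t)"
      by (intro Ck_on_add Ck_on_bounded_linear[OF bounded_linear_mult_right] Suc) auto
    then show ?case
      by (intro Ck_on_real_deriv[where f'="\<lambda>t. flat (n + 2) t + (- real n) * flat (n + 1) t"])
        (use flat_deriv in auto)
  qed
qed

text \<open>With \<open>u\<close> positive exactly inside the large ball and \<open>v\<close> positive exactly outside the closed small ball, \<open>u / (u + v)\<close>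
  is a bump function.\<close>

lemma smooth_bump:
  fixes c :: "'a::euclidean_space"
  assumes "r > 0"
  obtains b :: "'a \<Rightarrow> real" where "smooth_on UNIV b" "\<And>y. 0 \<le> b y" "\<And>y. b y \<le> 1"
    "\<And>y. y \<in> ball c (r/2) \<Longrightarrow> b y = 1" "\<And>y. y \<notin> ball c r \<Longrightarrow> b y = 0"
proof -
  define q where "q y = (y - c) \<bullet> (y - c)" for y
  define u where "u y = flat 0 (r\<^sup>2 - q y)" for y
  define v where "v y = flat 0 (q y - (r/2)\<^sup>2)" for y
  have q: "q y = (dist c y)\<^sup>2" for y by (simp add: q_def dist_norm norm_minus_commute power2_norm_eq_inner[symmetric])
  have sq: "smooth_on UNIV q"
    unfolding q_def by (intro smooth_on_bilinear[OF bounded_bilinear_inner] smooth_on_diff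
        smooth_on_const smooth_on_linear bounded_linear_ident) auto
  have su: "smooth_on UNIV u" unfolding u_def
    by (rule smooth_on_compose[OF _ _ _ _ smooth_on_flat[of 0]])
      (auto intro: smooth_on_diff smooth_on_const sq)
  have sv: "smooth_on UNIV v" unfolding v_def
    by (rule smooth_on_compose[OF _ _ _ _ smooth_on_flat[of 0]])
      (auto intro: smooth_on_diff smooth_on_const sq)
  have nn: "0 \<le> u y" "0 \<le> v y" for y by (auto simp: u_def v_def flat_def)
  have pos: "u y + v y > 0" for y
  proof (cases "q y < r\<^sup>2")
    case True
    then have "u y > 0" by (simp add: u_def flat_def)
    then show ?thesis using nn(2)[of y] by simp
  next
    case False
    then have "q y > (r/2)\<^sup>2" using assms by (simp add: power_divide) (smt (verit) zero_less_power)
    then have "v y > 0" by (simp add: v_def flat_def)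
    then show ?thesis using nn(1)[of y] by simp
  qed
  show thesis
  proof
    show "smooth_on UNIV (\<lambda>y. u y / (u y + v y))"
      by (intro smooth_on_divide_real smooth_on_add su sv) (use pos in \<open>auto simp: less_le\<close>)
    show "0 \<le> u y / (u y + v y)" "u y / (u y + v y) \<le> 1" for y
      using nn[of y] pos[of y] by auto
    show "u y / (u y + v y) = 1" if "y \<in> ball c (r/2)" for y
    proof -
      have "q y < (r/2)\<^sup>2" unfolding q using that by (auto intro!: power_strict_mono)
      then have "v y = 0" by (simp add: v_def flat_def)
      then show ?thesis using pos[of y] by simp
    qed
    show "u y / (u y + v y) = 0" if "y \<notin> ball c r" for y
    proof -
      have "q y \<ge> r\<^sup>2" unfolding q using that assms by (auto intro!: power_mono)
      then show ?thesis by (simp add: u_def flat_def)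
    qed
  qed
qed


section \<open>Symmetry of second derivatives\<close>

text \<open>Two applications of the mean value theorem, first in the direction \<open>u\<close> to the difference of \<open>f\<close> along \<open>v\<close>, then in
  the direction \<open>v\<close>.\<close>

lemma second_difference_mean_value:
  fixes f :: "'a::real_normed_vector \<Rightarrow> real"
  assumes S: "open S" "Ck_on 2 S f" and t: "t > 0"
    and inS: "\<And>r s. 0 \<le> r \<Longrightarrow> r \<le> t \<Longrightarrow> 0 \<le> s \<Longrightarrow> s \<le> t \<Longrightarrow> x + r *\<^sub>R u + s *\<^sub>R v \<in> S"
  shows "\<exists>r s. 0 < r \<and> r < t \<and> 0 < s \<and> s < t \<and>
    f (x + t *\<^sub>R u + t *\<^sub>R v) - f (x + t *\<^sub>R u) - f (x + t *\<^sub>R v) + f x =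
    t * t * frechet_derivative (\<lambda>y. frechet_derivative f (at y) u) (at (x + r *\<^sub>R u + s *\<^sub>R v)) v"
proof -
  let ?D = "\<lambda>f y. frechet_derivative f (at y)"
  let ?f' = "\<lambda>y. ?D f y u"
  have S2: "Ck_on (Suc (Suc 0)) S f" using S(2) by (simp add: numeral_2_eq_2)
  have D: "(f has_derivative ?D f y) (at y)" if "y \<in> S" for y
    using Ck_on_SucD(1)[OF S2 that] .
  have D': "(?f' has_derivative ?D ?f' y) (at y)" if "y \<in> S" for y
    using Ck_on_SucD(1)[OF Ck_on_SucD(2)[OF S2] that] .
  have scale: "?D h y (c *\<^sub>R w) = c * ?D h y w" if "(h has_derivative ?D h y) (at y)" for h :: "'a \<Rightarrow> real" and y c w
    using linear_scale[OF has_derivative_linear[OF that]] by simp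
  have line: "((\<lambda>r. h (z + r *\<^sub>R w)) has_real_derivative ?D h (z + r *\<^sub>R w) w) (at r)"
    if "(h has_derivative ?D h (z + r *\<^sub>R w)) (at (z + r *\<^sub>R w))" for h :: "'a \<Rightarrow> real" and z w r
  proof -
    have "((\<lambda>r. z + r *\<^sub>R w) has_derivative (\<lambda>r. r *\<^sub>R w)) (at r)"
      by (auto intro!: derivative_eq_intros)
    from has_derivative_compose[OF this that] show ?thesis
      by (simp add: has_field_derivative_def scale[OF that] mult_commute_abs)
  qed
  define p where "p r = f ((x + t *\<^sub>R v) + r *\<^sub>R u) - f (x + r *\<^sub>R u)" for r
  have p: "(p has_real_derivative ?f' ((x + t *\<^sub>R v) + r *\<^sub>R u) - ?f' (x + r *\<^sub>R u)) (at r)"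
    if "0 \<le> r" "r \<le> t" for r
    unfolding p_def using inS[OF that, of t] inS[OF that, of 0] t
    by (intro DERIV_diff line D) (auto simp: algebra_simps)
  obtain r where r: "0 < r" "r < t" "p t - p 0 = t * (?f' ((x + t *\<^sub>R v) + r *\<^sub>R u) - ?f' (x + r *\<^sub>R u))"
    using MVT2[OF t p] by auto
  have "((\<lambda>s. ?f' ((x + r *\<^sub>R u) + s *\<^sub>R v)) has_real_derivative ?D ?f' ((x + r *\<^sub>R u) + s *\<^sub>R v) v) (at s)"
    if "0 \<le> s" "s \<le> t" for s
    using inS[of r s] r that by (intro line D') auto
  from MVT2[OF t this] obtain s where s: "0 < s" "s < t"
    "?f' ((x + r *\<^sub>R u) + t *\<^sub>R v) - ?f' (x + r *\<^sub>R u) = t * ?D ?f' ((x + r *\<^sub>R u) + s *\<^sub>R v) v"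
    by auto
  have "p t - p 0 = t * t * ?D ?f' (x + r *\<^sub>R u + s *\<^sub>R v) v"
    using r(3) s(3) by (simp add: algebra_simps)
  then show ?thesis using r(1,2) s(1,2)
    by (intro exI[of _ r] exI[of _ s]) (simp add: p_def algebra_simps)
qed

text \<open>The second difference is symmetric in \<open>u\<close> and \<open>v\<close> and, on small parallelograms, close to either mixed
  derivative times \<open>t\<^sup>2\<close>.\<close>

lemma symmetric_second_derivative_le:
  fixes f :: "'a::real_normed_vector \<Rightarrow> real"
  assumes S: "open S" "Ck_on 2 S f" and x: "x \<in> S"
  shows "frechet_derivative (\<lambda>y. frechet_derivative f (at y) u) (at x) v
       \<le> frechet_derivative (\<lambda>y. frechet_derivative f (at y) v) (at x) u"
proof (rule ccontr)
  define A where "A y = frechet_derivative (\<lambda>y. frechet_derivative f (at y) u) (at y) v" for y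
  define B where "B y = frechet_derivative (\<lambda>y. frechet_derivative f (at y) v) (at y) u" for y
  assume "\<not> ?thesis"
  then have lt: "B x < A x" by (simp add: A_def B_def)
  define m where "m = (A x + B x) / 2"
  have S2: "Ck_on (Suc (Suc 0)) S f" using S(2) by (simp add: numeral_2_eq_2)
  have cA: "continuous_on S A" and cB: "continuous_on S B"
    using Ck_on_SucD(2)[OF Ck_on_SucD(2)[OF S2]] by (auto simp: A_def B_def)
  have "open (S \<inter> A -` {m<..})" "open (S \<inter> B -` {..<m})"
    by (auto intro: continuous_open_preimage cA cB S)
  then have "open (S \<inter> A -` {m<..} \<inter> (S \<inter> B -` {..<m}))" by blast
  moreover have "x \<in> S \<inter> A -` {m<..} \<inter> (S \<inter> B -` {..<m})"
    using x lt by (auto simp: m_def)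
  ultimately obtain e where e: "e > 0" "ball x e \<subseteq> S \<inter> A -` {m<..} \<inter> (S \<inter> B -` {..<m})"
    by (meson open_contains_ball)
  \<comment> \<open>The parallelogram with sides \<open>t u\<close> and \<open>t v\<close> lies in the ball of radius \<open>e\<close>.\<close>
  define t where "t = e / (2 * (norm u + norm v + 1))"
  have t: "t > 0" using e by (auto simp: t_def intro!: divide_pos_pos add_nonneg_pos)
  have near: "x + r *\<^sub>R u + s *\<^sub>R v \<in> ball x e" if "0 \<le> r" "r \<le> t" "0 \<le> s" "s \<le> t" for r s
  proof -
    have "dist x (x + r *\<^sub>R u + s *\<^sub>R v) = norm (r *\<^sub>R u + s *\<^sub>R v)"
      by (metis add.assoc add_diff_cancel_left' dist_commute dist_norm)
    also have "\<dots> \<le> r * norm u + s * norm v"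
      using norm_triangle_ineq[of "r *\<^sub>R u" "s *\<^sub>R v"] that by simp
    also have "\<dots> \<le> t * norm u + t * norm v"
      using that by (intro add_mono mult_right_mono) auto
    also have "\<dots> \<le> t * (norm u + norm v + 1)" using t by (simp add: algebra_simps)
    also have "\<dots> = e / 2" unfolding t_def
      by (simp add: field_simps add_nonneg_eq_0_iff)
    also have "\<dots> < e" using e by simp
    finally show ?thesis by simp
  qed
  have inS: "x + r *\<^sub>R u + s *\<^sub>R v \<in> S" if "0 \<le> r" "r \<le> t" "0 \<le> s" "s \<le> t" for r s
    using near[OF that] e by auto
  have inS': "x + r *\<^sub>R v + s *\<^sub>R u \<in> S" if "0 \<le> r" "r \<le> t" "0 \<le> s" "s \<le> t" for r s
    using inS[of s r] that by (simp add: algebra_simps)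
  obtain r s where 1: "0 < r" "r < t" "0 < s" "s < t"
    "f (x + t *\<^sub>R u + t *\<^sub>R v) - f (x + t *\<^sub>R u) - f (x + t *\<^sub>R v) + f x = t * t * A (x + r *\<^sub>R u + s *\<^sub>R v)"
    using second_difference_mean_value[OF S t inS] unfolding A_def by blast
  obtain r' s' where 2: "0 < r'" "r' < t" "0 < s'" "s' < t"
    "f (x + t *\<^sub>R v + t *\<^sub>R u) - f (x + t *\<^sub>R v) - f (x + t *\<^sub>R u) + f x = t * t * B (x + r' *\<^sub>R v + s' *\<^sub>R u)"
    using second_difference_mean_value[OF S t inS'] unfolding B_def by blast
  have "t * t * A (x + r *\<^sub>R u + s *\<^sub>R v) = t * t * B (x + r' *\<^sub>R v + s' *\<^sub>R u)"
    using 1(5) 2(5) by (simp add: algebra_simps)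
  then have "A (x + r *\<^sub>R u + s *\<^sub>R v) = B (x + r' *\<^sub>R v + s' *\<^sub>R u)" using t by simp
  moreover have "A (x + r *\<^sub>R u + s *\<^sub>R v) > m" using near[of r s] 1 e by auto
  moreover have "x + r' *\<^sub>R v + s' *\<^sub>R u \<in> ball x e"
    using near[of s' r'] 2 by (simp add: algebra_simps)
  then have "B (x + r' *\<^sub>R v + s' *\<^sub>R u) < m" using e by auto
  ultimately show False by simp
qed

lemma symmetric_second_derivative:
  fixes f :: "'a::real_normed_vector \<Rightarrow> 'b::euclidean_space"
  assumes S: "open S" "Ck_on 2 S f" and x: "x \<in> S"
  shows "frechet_derivative (\<lambda>y. frechet_derivative f (at y) u) (at x) v
       = frechet_derivative (\<lambda>y. frechet_derivative f (at y) v) (at x) u"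
proof (rule euclidean_eqI)
  fix e :: 'b assume "e \<in> Basis"
  let ?D = "\<lambda>f y. frechet_derivative f (at y)"
  have S2: "Ck_on (Suc (Suc 0)) S f" using S(2) by (simp add: numeral_2_eq_2)
  have inner: "?D (\<lambda>y. h y \<bullet> e) y w = ?D h y w \<bullet> e"
    if "(h has_derivative ?D h y) (at y)" for h :: "'a \<Rightarrow> 'b" and y w
    using frechet_derivative_at[OF bounded_linear.has_derivative[OF bounded_linear_inner_left that, of e]]
    by metis
  have 1: "?D (\<lambda>y. f y \<bullet> e) y w = ?D f y w \<bullet> e" if "y \<in> S" for y w
    by (rule inner[OF Ck_on_SucD(1)[OF S2 that]])
  have C: "Ck_on 2 S (\<lambda>y. f y \<bullet> e)"
    by (rule Ck_on_bounded_linear[OF bounded_linear_inner_left S])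
  have 2: "?D (\<lambda>y. ?D (\<lambda>y. f y \<bullet> e) y w) x z = ?D (\<lambda>y. ?D f y w) x z \<bullet> e" for w z
  proof -
    have "?D (\<lambda>y. ?D (\<lambda>y. f y \<bullet> e) y w) x = ?D (\<lambda>y. ?D f y w \<bullet> e) x"
      by (rule frechet_derivative_transform_within_open[OF _ S(1) x 1])
        (use C x in \<open>auto simp: numeral_2_eq_2\<close>)
    then show ?thesis
      using inner[OF Ck_on_SucD(1)[OF Ck_on_SucD(2)[OF S2] x]] by simp
  qed
  show "?D (\<lambda>y. ?D f y u) x v \<bullet> e = ?D (\<lambda>y. ?D f y v) x u \<bullet> e"
    using symmetric_second_derivative_le[OF S(1) C x, of u v]
      symmetric_second_derivative_le[OF S(1) C x, of v u] unfolding 2 by simp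
qed

section \<open>Calculus in the charts of a manifold\<close>

locale smooth_mfd =
  fixes M :: "('i, 'm::{t2_space,second_countable_topology}, 'n::finite) atlas"
  assumes smooth_manifold: "smooth_manifold M"
begin

abbreviation chart_inv :: "'i \<Rightarrow> real^'n \<Rightarrow> 'm" where
  "chart_inv i \<equiv> inv_into (cdom M i) (crd M i)"

definition chart_open :: "'i \<Rightarrow> 'm set \<Rightarrow> bool" where
  "chart_open i W \<longleftrightarrow> open W \<and> W \<subseteq> cdom M i"

lemma ex_chart: "\<exists>i. x \<in> cdom M i"
  using smooth_manifold unfolding smooth_manifold_def by blast

lemma open_cdom: "open (cdom M i)"
  using smooth_manifold unfolding smooth_manifold_def by blast

lemma chart_open_cdom: "chart_open i (cdom M i)"
  by (simp add: chart_open_def open_cdom)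

lemma chart_open_Int: "chart_open i (cdom M i \<inter> cdom M j)" "chart_open j (cdom M i \<inter> cdom M j)"
  by (auto simp: chart_open_def open_cdom)

lemma chart_homeomorphism:
  "homeomorphism (cdom M i) (crd M i ` cdom M i) (crd M i) (chart_inv i)"
proof -
  obtain y where y: "homeomorphism (cdom M i) (crd M i ` cdom M i) (crd M i) y"
    using smooth_manifold unfolding smooth_manifold_def by blast
  then have inj: "inj_on (crd M i) (cdom M i)" unfolding homeomorphism_def by (metis inj_onI)
  then have "y z = chart_inv i z" if "z \<in> crd M i ` cdom M i" for z
    using y that unfolding homeomorphism_def by (auto simp: inv_into_f_f)
  then show ?thesis using y by (auto intro: homeomorphism_cong)
qed

lemma inj_crd: "inj_on (crd M i) (cdom M i)"
  using chart_homeomorphism[of i] unfolding homeomorphism_def by (metis inj_onI)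

lemma chart_inv_crd [simp]: "x \<in> cdom M i \<Longrightarrow> chart_inv i (crd M i x) = x"
  by (simp add: inj_crd)

lemma continuous_crd: "continuous_on (cdom M i) (crd M i)"
  and continuous_chart_inv: "continuous_on (crd M i ` cdom M i) (chart_inv i)"
  using chart_homeomorphism[of i] by (auto simp: homeomorphism_def)

lemma open_crd_image: "chart_open i W \<Longrightarrow> open (crd M i ` W)"
proof -
  assume W: "chart_open i W"
  have "openin (top_of_set (crd M i ` cdom M i)) (crd M i ` W)"
    by (rule homeomorphism_imp_open_map[OF chart_homeomorphism])
      (use W in \<open>auto simp: chart_open_def openin_open_eq open_cdom\<close>)
  moreover have "open (crd M i ` cdom M i)"
    using smooth_manifold unfolding smooth_manifold_def by blast
  ultimately show ?thesis by (simp add: openin_open_eq)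
qed

lemma in_chart_crd [simp]: "x \<in> cdom M i \<Longrightarrow> in_chart M i f (crd M i x) = f x"
  by (simp add: in_chart_def)

lemma in_chart_eq: "in_chart M i f = (\<lambda>y. f (chart_inv i y))"
  by (simp add: in_chart_def comp_def)

lemma smooth_in_iff: "smooth_in M i W f \<longleftrightarrow> smooth_on (crd M i ` W) (\<lambda>y. f (chart_inv i y))"
  by (simp add: smooth_in_def in_chart_eq)

lemma smooth_in_continuous:
  assumes "chart_open i W" "smooth_in M i W f"
  shows "continuous_on W f"
proof -
  have "continuous_on W (in_chart M i f \<circ> crd M i)"
    using assms smooth_on_continuous continuous_on_subset[OF continuous_crd[of i]]
    by (intro continuous_on_compose) (auto simp: smooth_in_def chart_open_def)
  then show ?thesis
    by (rule continuous_on_eq) (use assms in \<open>auto simp: chart_open_def\<close>)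
qed

lemma smooth_in_cong:
  assumes "chart_open i W" "\<And>x. x \<in> W \<Longrightarrow> f x = g x" "smooth_in M i W f"
  shows "smooth_in M i W g"
  using assms(3) unfolding smooth_in_def
  by (rule smooth_on_cong[OF open_crd_image[OF assms(1)], rotated])
    (use assms(1,2) in \<open>auto simp: chart_open_def in_chart_def subset_iff\<close>)

lemma smooth_in_subset: "smooth_in M i W f \<Longrightarrow> W' \<subseteq> W \<Longrightarrow> smooth_in M i W' f"
  unfolding smooth_in_def by (erule smooth_on_subset) auto

lemma smooth_in_local:
  assumes "\<And>x. x \<in> W \<Longrightarrow> \<exists>T. chart_open i T \<and> x \<in> T \<and> smooth_in M i T f"
  shows "smooth_in M i W f"
  unfolding smooth_in_def
proof (rule smooth_on_local)
  fix y assume "y \<in> crd M i ` W"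
  then obtain x where "x \<in> W" "y = crd M i x" by auto
  with assms[of x] show "\<exists>T. open T \<and> y \<in> T \<and> smooth_on T (in_chart M i f)"
    unfolding smooth_in_def using open_crd_image by blast
qed

lemma smooth_in_const: "smooth_in M i W (\<lambda>_. c)"
  by (simp add: smooth_in_iff smooth_on_const)

lemma smooth_in_linear:
  assumes "chart_open i W" "bounded_linear h" "smooth_in M i W f"
  shows "smooth_in M i W (\<lambda>x. h (f x))"
  using smooth_on_bounded_linear[OF assms(2) open_crd_image[OF assms(1)] assms(3)[unfolded smooth_in_iff]] by (simp add: smooth_in_iff)

lemma smooth_in_bilinear:
  assumes "chart_open i W" "bounded_bilinear h" "smooth_in M i W f" "smooth_in M i W g"
  shows "smooth_in M i W (\<lambda>x. h (f x) (g x))"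
  using smooth_on_bilinear[OF assms(2) open_crd_image[OF assms(1)] assms(3)[unfolded smooth_in_iff] assms(4)[unfolded smooth_in_iff]] by (simp add: smooth_in_iff)

lemma smooth_in_add:
  assumes "chart_open i W" "smooth_in M i W f" "smooth_in M i W g"
  shows "smooth_in M i W (\<lambda>x. f x + g x)"
  using smooth_on_add[OF open_crd_image[OF assms(1)] assms(2)[unfolded smooth_in_iff] assms(3)[unfolded smooth_in_iff]] by (simp add: smooth_in_iff)

lemma smooth_in_diff:
  assumes "chart_open i W" "smooth_in M i W f" "smooth_in M i W g"
  shows "smooth_in M i W (\<lambda>x. f x - g x)"
  using smooth_on_diff[OF open_crd_image[OF assms(1)] assms(2)[unfolded smooth_in_iff] assms(3)[unfolded smooth_in_iff]] by (simp add: smooth_in_iff)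

lemma smooth_in_minus:
  assumes "chart_open i W" "smooth_in M i W f"
  shows "smooth_in M i W (\<lambda>x. - f x)"
  using smooth_on_minus[OF open_crd_image[OF assms(1)] assms(2)[unfolded smooth_in_iff]] by (simp add: smooth_in_iff)

lemma smooth_in_sum:
  assumes "chart_open i W" "\<And>a. a \<in> A \<Longrightarrow> smooth_in M i W (f a)"
  shows "smooth_in M i W (\<lambda>x. \<Sum>a\<in>A. f a x)"
  using assms(2) by (induction A rule: infinite_finite_induct)
    (auto intro: smooth_in_const smooth_in_add[OF assms(1)])

lemma smooth_in_prod:
  fixes f :: "_ \<Rightarrow> 'm \<Rightarrow> real"
  assumes "chart_open i W" "\<And>a. a \<in> A \<Longrightarrow> smooth_in M i W (f a)"
  shows "smooth_in M i W (\<lambda>x. \<Prod>a\<in>A. f a x)"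
  using assms(2) by (induction A rule: infinite_finite_induct)
    (auto intro: smooth_in_const smooth_in_bilinear[OF assms(1) bounded_bilinear_mult])

lemma smooth_in_vec_nth:
  assumes "chart_open i W" "smooth_in M i W f"
  shows "smooth_in M i W (\<lambda>x. f x $ c)"
  by (rule smooth_in_linear[OF assms(1) bounded_linear_vec_nth assms(2)])

lemma smooth_in_vec_lambda:
  assumes "chart_open i W" "\<And>c. smooth_in M i W (\<lambda>x. f x c)"
  shows "smooth_in M i W (\<lambda>x. \<chi> c. f x c)"
  using assms(2) unfolding smooth_in_iff
  by (intro smooth_on_vec_lambda open_crd_image[OF assms(1)])

lemma smooth_in_divide:
  assumes "chart_open i W" "smooth_in M i W f" "smooth_in M i W g" "\<And>x. x \<in> W \<Longrightarrow> g x \<noteq> (0::real)"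
  shows "smooth_in M i W (\<lambda>x. f x / g x)"
  unfolding smooth_in_iff
  by (rule smooth_on_divide_real[OF open_crd_image[OF assms(1)] assms(2,3)[unfolded smooth_in_iff]])
    (use assms(1,4) in \<open>auto simp: chart_open_def subset_iff\<close>)

lemma smooth_in_powr:
  assumes "chart_open i W" "smooth_in M i W g" "\<And>x. x \<in> W \<Longrightarrow> g x > (0::real)"
  shows "smooth_in M i W (\<lambda>x. g x powr r)"
  unfolding smooth_in_iff
  by (rule smooth_on_powr_compose[OF open_crd_image[OF assms(1)] assms(2)[unfolded smooth_in_iff]])
    (use assms(1,3) in \<open>auto simp: chart_open_def subset_iff\<close>)

lemmas smooth_in_scaleR = smooth_in_bilinear[OF _ bounded_bilinear_scaleR]
lemmas smooth_in_mult = smooth_in_bilinear[OF _ bounded_bilinear_mult]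

lemma has_derivative_in_chart:
  assumes "smooth_in M i W f" "x \<in> W"
  shows "(in_chart M i f has_derivative frechet_derivative (in_chart M i f) (at (crd M i x))) (at (crd M i x))"
  using assms unfolding smooth_in_def by (intro smooth_on_has_derivative) auto

lemma pd_eqI:
  "(in_chart M i f has_derivative D) (at (crd M i x)) \<Longrightarrow> pd M i a f x = D (axis a 1)"
  unfolding pd_def by (simp add: frechet_derivative_at[symmetric])

lemma pd_eqI':
  "((\<lambda>y. f (chart_inv i y)) has_derivative D) (at (crd M i x)) \<Longrightarrow> pd M i a f x = D (axis a 1)"
  using pd_eqI[of i f D x a] by (simp add: in_chart_eq)

lemma has_derivative_chart_inv:
  assumes "smooth_in M i W f" "x \<in> W"
  shows "((\<lambda>y. f (chart_inv i y)) has_derivative frechet_derivative (in_chart M i f) (at (crd M i x))) (at (crd M i x))"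
  using has_derivative_in_chart[OF assms] by (simp add: in_chart_eq)

lemma pd_const [simp]: "pd M i a (\<lambda>_. c) x = 0"
  by (rule pd_eqI'[of "\<lambda>_. c" i "\<lambda>_. 0"]) simp

lemma pd_linear:
  assumes "bounded_linear h" "smooth_in M i W f" "x \<in> W"
  shows "pd M i a (\<lambda>x. h (f x)) x = h (pd M i a f x)"
  unfolding pd_def[of M i a f]
  by (rule pd_eqI'[of "\<lambda>x. h (f x)", OF bounded_linear.has_derivative[OF assms(1) has_derivative_chart_inv[OF assms(2,3)]]])

lemma pd_bilinear:
  assumes "bounded_bilinear h" "smooth_in M i W f" "smooth_in M i W g" "x \<in> W" "x \<in> cdom M i"
  shows "pd M i a (\<lambda>x. h (f x) (g x)) x = h (f x) (pd M i a g x) + h (pd M i a f x) (g x)"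
  using pd_eqI'[of "\<lambda>x. h (f x) (g x)" i _ x a, OF bounded_bilinear.FDERIV[OF assms(1)
        has_derivative_chart_inv[OF assms(2,4)] has_derivative_chart_inv[OF assms(3,4)]]] assms(5)
  by (simp add: pd_def)

lemma pd_add:
  assumes "smooth_in M i W f" "smooth_in M i W g" "x \<in> W"
  shows "pd M i a (\<lambda>x. f x + g x) x = pd M i a f x + pd M i a g x"
  using pd_eqI'[of "\<lambda>x. f x + g x" i _ x a, OF has_derivative_add[OF
        has_derivative_chart_inv[OF assms(1,3)] has_derivative_chart_inv[OF assms(2,3)]]]
  by (simp add: pd_def)

lemma pd_diff:
  assumes "smooth_in M i W f" "smooth_in M i W g" "x \<in> W"
  shows "pd M i a (\<lambda>x. f x - g x) x = pd M i a f x - pd M i a g x"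
  using pd_eqI'[of "\<lambda>x. f x - g x" i _ x a, OF has_derivative_diff[OF
        has_derivative_chart_inv[OF assms(1,3)] has_derivative_chart_inv[OF assms(2,3)]]]
  by (simp add: pd_def)

lemma pd_sum:
  assumes "chart_open i W" "\<And>k. k \<in> A \<Longrightarrow> smooth_in M i W (f k)" "x \<in> W"
  shows "pd M i a (\<lambda>x. \<Sum>k\<in>A. f k x) x = (\<Sum>k\<in>A. pd M i a (f k) x)"
  using assms(2)
proof (induction A rule: infinite_finite_induct)
  case (insert k A)
  have "pd M i a (\<lambda>x. f k x + (\<Sum>k\<in>A. f k x)) x = pd M i a (f k) x + pd M i a (\<lambda>x. \<Sum>k\<in>A. f k x) x"
    by (rule pd_add[OF _ _ assms(3)]) (auto intro: smooth_in_sum[OF assms(1)] insert.prems)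
  then show ?case using insert by simp
qed auto

lemmas pd_vec_nth = pd_linear[OF bounded_linear_vec_nth]
lemmas pd_scaleR = pd_bilinear[OF bounded_bilinear_scaleR]

lemma pd_cong:
  assumes "chart_open i W" "x \<in> W" "\<And>y. y \<in> W \<Longrightarrow> f y = g y"
  shows "pd M i a f x = pd M i a g x"
proof -
  have e: "in_chart M i f y = in_chart M i g y" if "y \<in> crd M i ` W" for y
    using that assms(1,3) by (auto simp: chart_open_def subset_iff)
  have "(in_chart M i f has_derivative D) (at (crd M i x)) \<longleftrightarrow> (in_chart M i g has_derivative D) (at (crd M i x))" for D
  proof
    have x: "crd M i x \<in> crd M i ` W" using assms(2) by blast
    note o = open_crd_image[OF assms(1)]
    show "(in_chart M i g has_derivative D) (at (crd M i x))" if "(in_chart M i f has_derivative D) (at (crd M i x))"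
      by (rule has_derivative_transform_within_open[OF that o x]) (rule e)
    show "(in_chart M i f has_derivative D) (at (crd M i x))" if "(in_chart M i g has_derivative D) (at (crd M i x))"
      by (rule has_derivative_transform_within_open[OF that o x]) (rule e[symmetric])
  qed
  then show ?thesis unfolding pd_def frechet_derivative_def by simp
qed

lemma smooth_in_pd:
  assumes "chart_open i W" "smooth_in M i W f"
  shows "smooth_in M i W (pd M i a f)"
  unfolding smooth_in_def
proof (rule smooth_on_cong[OF open_crd_image[OF assms(1)]])
  show "smooth_on (crd M i ` W) (\<lambda>y. frechet_derivative (in_chart M i f) (at y) (axis a 1))"
    using assms(2) unfolding smooth_in_def by (rule smooth_on_frechet_derivative)
  show "frechet_derivative (in_chart M i f) (at y) (axis a 1) = in_chart M i (pd M i a f) y"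
    if "y \<in> crd M i ` W" for y
    using that assms(1) by (auto simp: chart_open_def subset_iff pd_def)
qed

lemma pd_commute:
  fixes f :: "'m \<Rightarrow> 'b::euclidean_space"
  assumes "chart_open i W" "smooth_in M i W f" "x \<in> W"
  shows "pd M i a (pd M i b f) x = pd M i b (pd M i a f) x"
proof -
  let ?D = "\<lambda>c y. frechet_derivative (in_chart M i f) (at y) (axis c 1)"
  let ?X = "crd M i ` W"
  have o: "open ?X" by (rule open_crd_image[OF assms(1)])
  have s: "smooth_on ?X (in_chart M i f)" using assms(2) by (simp add: smooth_in_def)
  have e: "?D c y = in_chart M i (pd M i c f) y" if "y \<in> ?X" for y c
    using that assms(1) by (auto simp: chart_open_def subset_iff pd_def)
  have "frechet_derivative (?D c) (at (crd M i x)) = frechet_derivative (in_chart M i (pd M i c f)) (at (crd M i x))" for c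
    by (rule frechet_derivative_transform_within_open[OF _ o _ e])
      (use assms(3) smooth_on_has_derivative[OF smooth_on_frechet_derivative[OF s]] in \<open>auto simp: differentiable_def\<close>)
  moreover have "frechet_derivative (?D b) (at (crd M i x)) (axis a 1) = frechet_derivative (?D a) (at (crd M i x)) (axis b 1)"
    by (rule symmetric_second_derivative[OF o smooth_on_Ck[OF s]]) (use assms(3) in auto)
  ultimately show ?thesis by (simp add: pd_def[of M i a "pd M i b f"] pd_def[of M i b "pd M i a f"])
qed


section \<open>Change of chart\<close>

lemma smooth_in_crd: "smooth_in M i (cdom M i \<inter> cdom M j) (crd M j)"
  using smooth_manifold unfolding smooth_manifold_def by blast

lemma smooth_in_change:
  assumes W: "chart_open i W" "W \<subseteq> cdom M j" and f: "smooth_in M i W f"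
  shows "smooth_in M j W f"
proof -
  have Wj: "chart_open j W" using W by (simp add: chart_open_def)
  have "smooth_on (crd M j ` W) (\<lambda>y. in_chart M i f (in_chart M j (crd M i) y))"
  proof (rule smooth_on_compose[OF open_crd_image[OF Wj] open_crd_image[OF W(1)]])
    show "in_chart M j (crd M i) ` crd M j ` W \<subseteq> crd M i ` W"
      using W by (auto simp: chart_open_def subset_iff)
    show "smooth_on (crd M j ` W) (in_chart M j (crd M i))"
      using smooth_in_crd[of j i] W unfolding smooth_in_def chart_open_def
      by (auto intro: smooth_on_subset)
    show "smooth_on (crd M i ` W) (in_chart M i f)" using f by (simp add: smooth_in_def)
  qed
  then show ?thesis unfolding smooth_in_def
    by (rule smooth_on_cong[OF open_crd_image[OF Wj], rotated])
      (use W in \<open>auto simp: chart_open_def subset_iff\<close>)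
qed

lemma pd_change:
  assumes W: "chart_open i W" "W \<subseteq> cdom M j" and f: "smooth_in M i W f" and x: "x \<in> W"
  shows "pd M j a f x = (\<Sum>b\<in>UNIV. jac M j i x a b *\<^sub>R pd M i b f x)"
proof -
  have Wj: "chart_open j W" using W by (simp add: chart_open_def)
  have xi: "x \<in> cdom M i" "x \<in> cdom M j" using W x by (auto simp: chart_open_def)
  let ?\<phi> = "in_chart M j (crd M i)"
  let ?D\<phi> = "frechet_derivative ?\<phi> (at (crd M j x))"
  let ?Df = "frechet_derivative (in_chart M i f) (at (crd M i x))"
  have d\<phi>: "(?\<phi> has_derivative ?D\<phi>) (at (crd M j x))"
    by (rule has_derivative_in_chart[OF smooth_in_crd[of j i]]) (use xi in auto)
  have df: "(in_chart M i f has_derivative ?Df) (at (?\<phi> (crd M j x)))"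
    using has_derivative_in_chart[OF f x] xi by simp
  have "((\<lambda>y. in_chart M i f (?\<phi> y)) has_derivative (\<lambda>v. ?Df (?D\<phi> v))) (at (crd M j x))"
    by (rule has_derivative_compose[OF d\<phi> df])
  then have "(in_chart M j f has_derivative (\<lambda>v. ?Df (?D\<phi> v))) (at (crd M j x))"
    by (rule has_derivative_transform_within_open[OF _ open_crd_image[OF Wj]])
      (use W x in \<open>auto simp: chart_open_def subset_iff\<close>)
  then have 1: "pd M j a f x = ?Df (?D\<phi> (axis a 1))" by (rule pd_eqI)
  have 2: "jac M j i x a b = ?D\<phi> (axis a 1) $ b" for b
    unfolding jac_def
    by (rule pd_eqI'[of "\<lambda>y. crd M i y $ b" j, OF bounded_linear.has_derivative[OF bounded_linear_vec_nth d\<phi>[unfolded in_chart_eq], folded in_chart_eq]])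
  interpret linear ?Df using df has_derivative_linear by blast
  have "?D\<phi> (axis a 1) = (\<Sum>b\<in>UNIV. (?D\<phi> (axis a 1) $ b) *\<^sub>R axis b 1)"
    using basis_expansion[of "?D\<phi> (axis a 1)"] by (simp add: scalar_mult_eq_scaleR)
  then have "?Df (?D\<phi> (axis a 1)) = (\<Sum>b\<in>UNIV. (?D\<phi> (axis a 1) $ b) *\<^sub>R ?Df (axis b 1))"
    by (metis (mono_tags, lifting) sum scale sum.cong)
  then show ?thesis unfolding 1 2 by (simp add: pd_def)
qed

lemma smooth_in_jac:
  "smooth_in M j (cdom M i \<inter> cdom M j) (\<lambda>x. jac M j i x a b)"
  unfolding jac_def
  by (intro smooth_in_pd smooth_in_vec_nth chart_open_Int)
    (metis Int_commute smooth_in_crd)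

lemma jac_compose:
  assumes "x \<in> cdom M i" "x \<in> cdom M j" "x \<in> cdom M k"
  shows "jac M j k x a c = (\<Sum>b\<in>UNIV. jac M j i x a b * jac M i k x b c)"
proof -
  have "chart_open i (cdom M i \<inter> cdom M j \<inter> cdom M k)"
    by (auto simp: chart_open_def open_cdom intro!: open_Int)
  moreover have "smooth_in M i (cdom M i \<inter> cdom M j \<inter> cdom M k) (\<lambda>y. crd M k y $ c)"
    using smooth_in_crd[of i k] by (intro smooth_in_vec_nth calculation) (auto elim: smooth_in_subset)
  ultimately show ?thesis
    using pd_change[of i "cdom M i \<inter> cdom M j \<inter> cdom M k" j "\<lambda>y. crd M k y $ c" x a] assms
    by (simp add: jac_def[of M j k] jac_def[of M i k] le_infI1)
qed

lemma jac_self: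
  assumes "x \<in> cdom M i"
  shows "jac M i i x a b = (if a = b then 1 else 0)"
proof -
  have "((\<lambda>y. y $ b) has_derivative (\<lambda>y. y $ b)) (at (crd M i x))"
    by (rule bounded_linear_imp_has_derivative[OF bounded_linear_vec_nth])
  then have "(in_chart M i (\<lambda>y. crd M i y $ b) has_derivative (\<lambda>y. y $ b)) (at (crd M i x))"
    by (rule has_derivative_transform_within_open[OF _ open_crd_image[OF chart_open_cdom[of i]]])
      (use assms in auto)
  then have "pd M i a (\<lambda>y. crd M i y $ b) x = axis a 1 $ b" by (rule pd_eqI)
  then show ?thesis unfolding jac_def by (auto simp: axis_def)
qed

lemma jac_inverse:
  assumes "x \<in> cdom M i" "x \<in> cdom M j"
  shows "(\<Sum>b\<in>UNIV. jac M j i x a b * jac M i j x b c) = (if a = c then 1 else 0)"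
  using jac_compose[of x i j j a c] jac_self[of x j a c] assms by simp


section \<open>Extension by zero and cutoff functions on a manifold\<close>

lemma smooth_zero_extension:
  assumes W: "chart_open i W" and f: "smooth_in M i W f"
    and K: "compact K" "K \<subseteq> W" "\<And>x. x \<notin> K \<Longrightarrow> f x = 0"
  shows "smooth_in M j (cdom M j) f"
proof (rule smooth_in_local)
  fix x assume x: "x \<in> cdom M j"
  show "\<exists>T. chart_open j T \<and> x \<in> T \<and> smooth_in M j T f"
  proof (cases "x \<in> K")
    case True
    have "chart_open i (W \<inter> cdom M j)" "chart_open j (W \<inter> cdom M j)"
      using W open_cdom by (auto simp: chart_open_def)
    moreover have "smooth_in M j (W \<inter> cdom M j) f"
      by (rule smooth_in_change[OF calculation(1)]) (auto intro: smooth_in_subset[OF f])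
    ultimately show ?thesis using True x K(2) by blast
  next
    case False
    have o: "chart_open j (cdom M j - K)"
      using open_cdom compact_imp_closed[OF K(1)] by (auto simp: chart_open_def)
    moreover have "smooth_in M j (cdom M j - K) f"
      by (rule smooth_in_cong[OF o _ smooth_in_const[of j _ 0]]) (use K(3) in auto)
    ultimately show ?thesis using False x by blast
  qed
qed

lemma manifold_bump:
  assumes W: "chart_open i W" and x: "x \<in> W"
  obtains \<eta> U K where "smooth_fun M \<eta>" "\<And>y. 0 \<le> \<eta> y" "\<And>y. \<eta> y \<le> 1"
    "open U" "x \<in> U" "U \<subseteq> K" "compact K" "K \<subseteq> W"
    "\<And>y. y \<in> U \<Longrightarrow> \<eta> y = 1" "\<And>y. y \<notin> K \<Longrightarrow> \<eta> y = 0"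
proof -
  have Wi: "W \<subseteq> cdom M i" using W by (simp add: chart_open_def)
  obtain r where r: "r > 0" "cball (crd M i x) r \<subseteq> crd M i ` W"
    using open_crd_image[OF W] x by (meson imageI open_contains_cball)
  obtain b :: "real^'n \<Rightarrow> real" where b: "smooth_on UNIV b" "\<And>y. 0 \<le> b y" "\<And>y. b y \<le> 1"
    "\<And>y. y \<in> ball (crd M i x) (r/2) \<Longrightarrow> b y = 1" "\<And>y. y \<notin> ball (crd M i x) r \<Longrightarrow> b y = 0"
    using smooth_bump[OF r(1)] by blast
  define K where "K = chart_inv i ` cball (crd M i x) r"
  define U where "U = cdom M i \<inter> crd M i -` ball (crd M i x) (r/2)"
  define \<eta> where "\<eta> y = (if y \<in> cdom M i then b (crd M i y) else 0)" for y
  have "compact K" unfolding K_def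
    by (rule compact_continuous_image[OF continuous_on_subset[OF continuous_chart_inv]])
      (use r Wi in \<open>auto\<close>)
  moreover have KW: "K \<subseteq> W"
  proof
    fix z assume "z \<in> K"
    then obtain y where y: "y \<in> cball (crd M i x) r" "z = chart_inv i y" unfolding K_def by blast
    then obtain w where "w \<in> W" "y = crd M i w" using r(2) by blast
    then show "z \<in> W" using y(2) Wi by auto
  qed
  moreover have inK: "y \<in> K" if "y \<in> cdom M i" "crd M i y \<in> cball (crd M i x) r" for y
    unfolding K_def using that by (metis chart_inv_crd imageI)
  have zero: "\<eta> y = 0" if "y \<notin> K" for y
  proof (cases "y \<in> cdom M i")
    case True
    then have "crd M i y \<notin> cball (crd M i x) r" using inK that by blast
    then show ?thesis using b(5)[of "crd M i y"] True by (simp add: \<eta>_def)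
  qed (simp add: \<eta>_def)
  moreover have "open U" unfolding U_def
    by (rule continuous_open_preimage[OF continuous_crd open_cdom]) auto
  moreover have "x \<in> U" using x Wi r(1) by (auto simp: U_def)
  moreover have "U \<subseteq> K" using inK r(1) by (fastforce simp: U_def)
  moreover have "\<eta> y = 1" if "y \<in> U" for y using that b(4) by (auto simp: U_def \<eta>_def)
  moreover have "0 \<le> \<eta> y" "\<eta> y \<le> 1" for y using b by (auto simp: \<eta>_def)
  moreover have "smooth_fun M \<eta>" unfolding smooth_fun_def
  proof
    fix j
    have "smooth_in M i W \<eta>" unfolding smooth_in_def
      by (rule smooth_on_cong[OF open_crd_image[OF W] _ smooth_on_subset[OF b(1)]])
        (use Wi in \<open>auto simp: \<eta>_def\<close>)
    from smooth_zero_extension[OF W this \<open>compact K\<close> KW zero] show "smooth_in M j (cdom M j) \<eta>" .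
  qed
  ultimately show thesis using that by metis
qed

lemma smooth_fun_const: "smooth_fun M (\<lambda>_. c)"
  by (simp add: smooth_fun_def smooth_in_const)

lemma smooth_fun_diff: "smooth_fun M f \<Longrightarrow> smooth_fun M h \<Longrightarrow> smooth_fun M (\<lambda>x. f x - h x)"
  by (simp add: smooth_fun_def smooth_in_diff chart_open_cdom)

lemma smooth_fun_mult: "smooth_fun M f \<Longrightarrow> smooth_fun M h \<Longrightarrow> smooth_fun M (\<lambda>x. f x * h x)"
  by (simp add: smooth_fun_def smooth_in_mult chart_open_cdom)

text \<open>A linear function of the coordinates, cut off outside the chart.\<close>

lemma ex_function_with_differential:
  assumes x: "x \<in> cdom M i"
  obtains f where "smooth_fun M f" "f x = 0" "\<And>a. pd M i a f x = \<xi> $ a"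
proof -
  obtain \<eta> U K where b: "smooth_fun M \<eta>" "open U" "x \<in> U" "U \<subseteq> K" "compact K" "K \<subseteq> cdom M i"
    "\<And>y. y \<in> U \<Longrightarrow> \<eta> y = 1" "\<And>y. y \<notin> K \<Longrightarrow> \<eta> y = 0"
    using manifold_bump[OF chart_open_cdom x] by metis
  define l where "l y = (\<Sum>a\<in>UNIV. \<xi> $ a * (crd M i y $ a - crd M i x $ a))" for y
  define f where "f y = \<eta> y * l y" for y
  have c: "smooth_in M i (cdom M i) (\<lambda>y. crd M i y $ a)" for a
    using smooth_in_crd[of i i] by (auto intro: smooth_in_vec_nth[OF chart_open_cdom])
  have l: "smooth_in M i (cdom M i) l" unfolding l_def
    by (intro smooth_in_sum smooth_in_mult smooth_in_diff smooth_in_const c chart_open_cdom)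
  have "smooth_in M i (cdom M i) f" unfolding f_def
    using b(1) by (intro smooth_in_mult l chart_open_cdom) (simp add: smooth_fun_def)
  from smooth_zero_extension[OF chart_open_cdom this b(5,6)] have "smooth_fun M f"
    by (simp add: smooth_fun_def f_def b(8))
  moreover have "f x = 0" by (simp add: f_def l_def)
  moreover have "pd M i a f x = \<xi> $ a" for a
  proof -
    have U: "chart_open i U" using b by (auto simp: chart_open_def)
    have "pd M i a f x = pd M i a l x"
      by (rule pd_cong[OF U b(3)]) (simp add: f_def b(7))
    also have "\<dots> = (\<Sum>k\<in>UNIV. pd M i a (\<lambda>y. \<xi> $ k * (crd M i y $ k - crd M i x $ k)) x)"
      unfolding l_def by (rule pd_sum[OF chart_open_cdom _ x])
        (intro smooth_in_mult smooth_in_diff smooth_in_const c chart_open_cdom)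
    also have "\<dots> = (\<Sum>k\<in>UNIV. \<xi> $ k * jac M i i x a k)"
    proof (rule sum.cong[OF refl])
      fix k
      have "pd M i a (\<lambda>y. \<xi> $ k * (crd M i y $ k - crd M i x $ k)) x
        = \<xi> $ k * pd M i a (\<lambda>y. crd M i y $ k - crd M i x $ k) x"
        by (rule pd_linear[OF bounded_linear_mult_right _ x]) (intro smooth_in_diff smooth_in_const c chart_open_cdom)
      also have "pd M i a (\<lambda>y. crd M i y $ k - crd M i x $ k) x = jac M i i x a k"
        using pd_diff[OF c smooth_in_const x] by (simp add: jac_def)
      finally show "pd M i a (\<lambda>y. \<xi> $ k * (crd M i y $ k - crd M i x $ k)) x = \<xi> $ k * jac M i i x a k" .
    qed
    also have "\<dots> = \<xi> $ a" by (simp add: jac_self[OF x] if_distrib cong: if_cong)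
    finally show ?thesis .
  qed
  ultimately show thesis using that by blast
qed

lemma smooth_fun_continuous: "smooth_fun M f \<Longrightarrow> continuous_on UNIV f"
proof -
  assume f: "smooth_fun M f"
  have "isCont f x" for x
  proof -
    obtain i where "x \<in> cdom M i" using ex_chart by blast
    moreover have "continuous_on (cdom M i) f"
      using f by (auto intro: smooth_in_continuous[OF chart_open_cdom] simp: smooth_fun_def)
    ultimately show ?thesis using open_cdom by (simp add: continuous_on_eq_continuous_at)
  qed
  then show ?thesis by (simp add: continuous_at_imp_continuous_on)
qed

text \<open>One minus the product of the functions \<open>1 - \<eta>\<^sub>m\<close>, over a finite cover of \<open>K\<close> by sets where a bump function
  \<open>\<eta>\<^sub>m\<close> is 1, is a cutoff function; the product is formed by induction on the cover.\<close>

lemma compact_cutoff: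
  assumes "compact K"
  obtains \<eta> U L where "smooth_fun M \<eta>" "open U" "K \<subseteq> U" "compact L"
    "\<And>y. y \<in> U \<Longrightarrow> \<eta> y = 1" "\<And>y. y \<notin> L \<Longrightarrow> \<eta> y = 0"
proof -
  define Q where "Q U \<longleftrightarrow> (\<exists>\<eta> L. smooth_fun M \<eta> \<and> open U \<and> compact L \<and>
    (\<forall>y\<in>U. \<eta> y = 1) \<and> (\<forall>y. y \<notin> L \<longrightarrow> \<eta> y = 0))" for U
  have "\<exists>U. x \<in> U \<and> Q U" for x
  proof -
    obtain i where "x \<in> cdom M i" using ex_chart by blast
    from manifold_bump[OF chart_open_cdom this] show ?thesis unfolding Q_def by metis
  qed
  then obtain N where N: "\<And>x. x \<in> N x" "\<And>x. Q (N x)" by metis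
  have "K \<subseteq> (\<Union>x\<in>K. N x)" "\<And>x. x \<in> K \<Longrightarrow> open (N x)" using N by (auto simp: Q_def)
  then obtain C where C: "C \<subseteq> K" "finite C" "K \<subseteq> (\<Union>x\<in>C. N x)"
    using compactE_image[OF assms] by metis
  have "Q (\<Union>x\<in>C. N x)" using C(2)
  proof induction
    case empty
    show ?case unfolding Q_def
      by (intro exI[of _ "\<lambda>_. 0"] exI[of _ "{}"]) (auto simp: smooth_fun_const)
  next
    case (insert x C)
    obtain \<eta> L where 1: "smooth_fun M \<eta>" "compact L" "\<And>y. y \<in> N x \<Longrightarrow> \<eta> y = 1" "\<And>y. y \<notin> L \<Longrightarrow> \<eta> y = 0" "open (N x)"
      using N(2)[of x] unfolding Q_def by blast
    obtain \<eta>' L' where 2: "smooth_fun M \<eta>'" "compact L'" "\<And>y. y \<in> (\<Union>x\<in>C. N x) \<Longrightarrow> \<eta>' y = 1"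
      "\<And>y. y \<notin> L' \<Longrightarrow> \<eta>' y = 0" "open (\<Union>x\<in>C. N x)"
      using insert.IH unfolding Q_def by blast
    show ?case unfolding Q_def
    proof (intro exI conjI)
      show "smooth_fun M (\<lambda>y. 1 - (1 - \<eta> y) * (1 - \<eta>' y))"
        by (intro smooth_fun_diff smooth_fun_mult smooth_fun_const 1 2)
      show "compact (L \<union> L')" using 1 2 by (simp add: compact_Un)
    qed (use 1 2 in auto)
  qed
  then show thesis using C(3) that unfolding Q_def by blast
qed

end

section \<open>Change of variables over an arbitrary finite index type\<close>

text \<open>A copy of a finite type that carries a well-order, the sort on which \<open>has_absolute_integral_change_of_variables\<close>
  depends.  Reindexing the coordinates along a bijection preserves Lebesgue measure and determinants, so the
  formula carries over to every finite index type.\<close>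

typedef ('n::finite) idx = "{..<CARD('n)}"
  by (rule exI[of _ 0]) (simp add: card_gt_0_iff)

instance idx :: (finite) finite
proof
  have "UNIV = (Abs_idx :: nat \<Rightarrow> 'a idx) ` {..<CARD('a)}"
    by (metis type_definition.Abs_image type_definition_idx)
  then show "finite (UNIV :: 'a idx set)" by (metis finite_imageI finite_lessThan)
qed

instantiation idx :: (finite) wellorder
begin

definition less_eq_idx :: "'a idx \<Rightarrow> 'a idx \<Rightarrow> bool" where
  "less_eq_idx x y \<longleftrightarrow> Rep_idx x \<le> Rep_idx y"

definition less_idx :: "'a idx \<Rightarrow> 'a idx \<Rightarrow> bool" where
  "less_idx x y \<longleftrightarrow> Rep_idx x < Rep_idx y"

instance
proof
  fix P :: "'a idx \<Rightarrow> bool" and a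
  assume step: "\<And>x. (\<And>y. y < x \<Longrightarrow> P y) \<Longrightarrow> P x"
  show "P a"
  proof (induction a rule: measure_induct_rule[of Rep_idx])
    case (less x)
    show ?case by (rule step, rule less) (simp add: less_idx_def)
  qed
qed (auto simp: less_eq_idx_def less_idx_def Rep_idx_inject)

end

lemma ex_bij_idx: "\<exists>e :: 'n::finite idx \<Rightarrow> 'n. bij e"
proof -
  have "card (UNIV :: 'n idx set) = CARD('n)"
    using type_definition.card[OF type_definition_idx] by simp
  then show ?thesis
    using finite_same_card_bij[of "UNIV :: 'n idx set" "UNIV :: 'n set"] by auto
qed

definition reindex :: "('k::finite \<Rightarrow> 'n::finite) \<Rightarrow> real^'n \<Rightarrow> real^'k" where
  "reindex e x = (\<chi> k. x $ e k)"

lemma reindex_inverse: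
  assumes "bij e"
  shows "reindex (inv e) (reindex e x) = x" "reindex e (reindex (inv e) y) = y"
  using assms by (auto simp: reindex_def vec_eq_iff bij_is_surj surj_f_inv_f bij_is_inj)

lemma bounded_linear_reindex: "bounded_linear (reindex e)"
  by (rule linear_conv_bounded_linear[THEN iffD1]) (auto intro!: linearI simp: reindex_def vec_eq_iff)

lemma measurable_reindex [measurable]: "reindex e \<in> borel_measurable borel"
  by (intro borel_measurable_continuous_onI bounded_linear.continuous_on[OF bounded_linear_reindex] continuous_on_id)

lemma prod_Basis_cart:
  fixes f :: "real^'n::finite \<Rightarrow> 'a::comm_monoid_mult"
  shows "(\<Prod>b\<in>Basis. f b) = (\<Prod>i\<in>UNIV. f (axis i 1))"
proof -
  have "bij_betw (\<lambda>i. axis i 1 :: real^'n) UNIV Basis"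
    by (auto simp: bij_betw_def inj_def axis_eq_axis Basis_vec_def)
  from prod.reindex_bij_betw[OF this, of f] show ?thesis by simp
qed

lemma distr_lborel_reindex:
  fixes e :: "'k::finite \<Rightarrow> 'n::finite"
  assumes e: "bij e"
  shows "distr lborel borel (reindex e) = lborel"
proof (rule lborel_eqI[symmetric])
  fix l u :: "real^'k" assume lu: "\<And>b. b \<in> Basis \<Longrightarrow> l \<bullet> b \<le> u \<bullet> b"
  have le: "l $ i \<le> u $ i" for i
    using lu[of "axis i 1"] by (simp add: axis_in_Basis_iff inner_axis)
  have ii: "e (inv e i) = i" for i using e by (simp add: bij_is_surj surj_f_inv_f)
  have jj: "inv e (e i) = i" for i using e by (simp add: bij_is_inj)
  have "reindex e -` box l u = box (reindex (inv e) l) (reindex (inv e) u)"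
  proof (rule set_eqI)
    fix x
    have "(\<forall>k. l $ k < x $ e k \<and> x $ e k < u $ k) \<longleftrightarrow> (\<forall>i. l $ inv e i < x $ i \<and> x $ i < u $ inv e i)"
    proof (intro iffI allI)
      fix i assume "\<forall>k. l $ k < x $ e k \<and> x $ e k < u $ k"
      from this[rule_format, of "inv e i"] show "l $ inv e i < x $ i \<and> x $ i < u $ inv e i"
        by (simp add: ii)
    next
      fix k assume "\<forall>i. l $ inv e i < x $ i \<and> x $ i < u $ inv e i"
      from this[rule_format, of "e k"] show "l $ k < x $ e k \<and> x $ e k < u $ k"
        by (simp add: jj)
    qed
    then show "x \<in> reindex e -` box l u \<longleftrightarrow> x \<in> box (reindex (inv e) l) (reindex (inv e) u)"
      by (simp add: mem_box_cart reindex_def)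
  qed
  then have "emeasure (distr lborel borel (reindex e)) (box l u) = emeasure lborel (box (reindex (inv e) l) (reindex (inv e) u))"
    by (subst emeasure_distr) auto
  also have "\<dots> = (\<Prod>b\<in>Basis. (reindex (inv e) u - reindex (inv e) l) \<bullet> b)"
    by (rule emeasure_lborel_box) (auto simp: Basis_vec_def inner_axis reindex_def le)
  also have "\<dots> = (\<Prod>i\<in>UNIV. u $ inv e i - l $ inv e i)"
    by (simp add: prod_Basis_cart inner_axis reindex_def)
  also have "\<dots> = (\<Prod>i\<in>UNIV. u $ i - l $ i)"
    using prod.reindex_bij_betw[of "inv e" UNIV UNIV "\<lambda>i. u $ i - l $ i"] e bij_imp_bij_inv by fastforce
  also have "\<dots> = (\<Prod>b\<in>Basis. (u - l) \<bullet> b)"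
    by (simp add: prod_Basis_cart inner_axis)
  finally show "emeasure (distr lborel borel (reindex e)) (box l u) = (\<Prod>b\<in>Basis. (u - l) \<bullet> b)" .
qed simp

lemma nn_integral_reindex:
  fixes e :: "'k::finite \<Rightarrow> 'n::finite"
  assumes "bij e" "f \<in> borel_measurable borel"
  shows "(\<integral>\<^sup>+ x. f x \<partial>lborel) = (\<integral>\<^sup>+ x. f (reindex e x) \<partial>lborel)"
  using nn_integral_distr[of "reindex e" lborel borel f] assms distr_lborel_reindex[OF assms(1)] by simp

lemma det_reindex:
  fixes e :: "'k::finite \<Rightarrow> 'n::finite" and A :: "'a::comm_ring_1^'n^'n"
  assumes e: "bij e"
  shows "det (\<chi> i j. A $ e i $ e j) = det A"
proof -
  have "(\<Sum>q | q permutes UNIV. of_int (sign q) * (\<Prod>i\<in>UNIV. A $ i $ q i)) =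
    (\<Sum>p | p permutes UNIV. of_int (sign (map_permutation UNIV e p)) * (\<Prod>i\<in>UNIV. A $ i $ map_permutation UNIV e p i))"
  proof (rule sum.reindex_bij_betw[symmetric])
    have "map_permutation UNIV e = (\<lambda>p x. if x \<in> UNIV then e (p (inv_into UNIV e x)) else x)"
      using e by (auto simp: fun_eq_iff map_permutation_def restrict_id_def bij_is_surj)
    then show "bij_betw (map_permutation UNIV e) {p. p permutes UNIV} {p. p permutes UNIV}"
      using bij_betw_permutations[of e UNIV UNIV] e by simp
  qed
  also have "\<dots> = (\<Sum>p | p permutes UNIV. of_int (sign p) * (\<Prod>i\<in>UNIV. A $ e i $ e (p i)))"
  proof (rule sum.cong[OF refl])
    fix p :: "'k \<Rightarrow> 'k" assume "p \<in> {p. p permutes UNIV}"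
    then have "sign (map_permutation UNIV e p) = sign p"
      using e by (intro sign_map_permutation) (auto simp: bij_is_inj)
    moreover have "(\<Prod>i\<in>UNIV. A $ i $ map_permutation UNIV e p i) = (\<Prod>i\<in>UNIV. A $ e i $ map_permutation UNIV e p (e i))"
      by (rule prod.reindex_bij_betw[symmetric]) (use e in simp)
    moreover have "map_permutation UNIV e p (e i) = e (p i)" for i
      using e by (intro map_permutation_apply) (auto simp: bij_is_inj)
    ultimately show "of_int (sign (map_permutation UNIV e p)) * (\<Prod>i\<in>UNIV. A $ i $ map_permutation UNIV e p i)
      = of_int (sign p) * (\<Prod>i\<in>UNIV. A $ e i $ e (p i))" by simp
  qed
  finally show ?thesis by (simp add: det_def)
qed

text \<open>On a compact set the integrands are bounded, hence absolutely integrable, and the formula for vector-valued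
  absolute integrals applies with values in \<open>real^1\<close>.\<close>

lemma change_of_variables_compact:
  fixes \<phi> :: "real^'n::{finite,wellorder} \<Rightarrow> real^'n::_"
  assumes S: "open S" and der: "\<And>y. y \<in> S \<Longrightarrow> (\<phi> has_derivative \<phi>' y) (at y)" and inj: "inj_on \<phi> S"
    and w: "\<And>z. w z \<ge> (0::real)" "continuous_on (\<phi> ` S) w"
    and d: "continuous_on S (\<lambda>y. det (matrix (\<phi>' y)))"
    and B: "B \<in> sets borel" "B \<subseteq> C" "compact C" "C \<subseteq> S"
  shows "(\<integral>\<^sup>+ y. ennreal (w (\<phi> y) * \<bar>det (matrix (\<phi>' y))\<bar>) * indicator B y \<partial>lborel)
       = (\<integral>\<^sup>+ z. ennreal (w z) * indicator (\<phi> ` B) z \<partial>lborel)"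
proof -
  let ?h = "\<lambda>y. w (\<phi> y) * \<bar>det (matrix (\<phi>' y))\<bar>"
  have cont: "continuous_on S \<phi>"
    using der has_derivative_continuous by (blast intro: continuous_at_imp_continuous_on)
  have ch: "continuous_on C ?h"
    by (intro continuous_on_mult continuous_on_rabs continuous_on_compose2[OF w(2) cont]
        continuous_on_subset[OF d] continuous_on_subset[OF _ B(4)]) (use B(4) in auto)
  have Bl: "B \<in> sets lebesgue" using B(1) by (simp add: sets_completionI_sets)
  have ai: "?h absolutely_integrable_on C"
    unfolding set_integrable_def
    using borel_integrable_compact[OF B(3) ch] by (intro integrable_completion[THEN iffD2]) auto
  have aB: "?h absolutely_integrable_on B"
    by (rule set_integrable_subset[OF ai Bl B(2)])
  let ?f = "\<lambda>z. vec (w z) :: real^1"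
  have "(\<lambda>y. \<bar>det (matrix (\<phi>' y))\<bar> *\<^sub>R ?f (\<phi> y)) = (\<lambda>y. vec (?h y))"
    by (auto simp: vec_eq_iff)
  then have 1: "(\<lambda>y. \<bar>det (matrix (\<phi>' y))\<bar> *\<^sub>R ?f (\<phi> y)) absolutely_integrable_on B"
    "integral B (\<lambda>y. \<bar>det (matrix (\<phi>' y))\<bar> *\<^sub>R ?f (\<phi> y)) = vec (integral B ?h)"
    using aB by (simp_all add: absolutely_integrable_on_1_iff integral_on_1_eq)
  have "?f absolutely_integrable_on (\<phi> ` B) \<and> integral (\<phi> ` B) ?f = vec (integral B ?h)"
    by (rule has_absolute_integral_change_of_variables[OF Bl, THEN iffD1])
      (use 1 B der inj in \<open>auto intro: has_derivative_at_withinI inj_on_subset\<close>)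
  then have "w absolutely_integrable_on (\<phi> ` B)" "integral (\<phi> ` B) w = integral B ?h"
    by (auto simp: absolutely_integrable_on_1_iff integral_on_1_eq vec_eq_iff)
  then have 2: "(w has_integral integral B ?h) (\<phi> ` B)" "(?h has_integral integral B ?h) B"
    using aB by (simp_all add: has_integral_iff set_lebesgue_integral_eq_integral(1))
  show ?thesis
    using nn_integral_has_integral_lebesgue'[OF _ 2(1)] nn_integral_has_integral_lebesgue'[OF _ 2(2)] w(1)
    by simp
qed


lemma measurable_continuous_on_indicator:
  fixes h :: "'a::topological_space \<Rightarrow> real"
  assumes "A \<in> sets borel" "continuous_on A h"
  shows "(\<lambda>y. ennreal (h y) * indicator A y) \<in> borel_measurable borel"
proof -
  have "(\<lambda>y. ennreal (h y) * indicator A y) = (\<lambda>y. ennreal (indicator A y *\<^sub>R h y))"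
    by (auto simp: indicator_def)
  then show ?thesis
    using borel_measurable_continuous_on_indicator[OF assms] by simp
qed

lemma nn_integral_indicator_UN:
  assumes f: "f \<in> borel_measurable M" and A: "range A \<subseteq> sets M" "incseq A"
  shows "(\<integral>\<^sup>+ y. f y * indicator (\<Union>n. A n) y \<partial>M) = (SUP n. \<integral>\<^sup>+ y. f y * indicator (A n) y \<partial>M)"
proof -
  have "emeasure (density M f) (\<Union>n. A n) = (SUP n. emeasure (density M f) (A n))"
    by (rule SUP_emeasure_incseq[symmetric]) (use A in auto)
  then show ?thesis
    using f A by (simp add: emeasure_density range_subsetD sets.countable_UN)
qed

lemma homeomorphism_image_borel:
  assumes "homeomorphism S T \<phi> \<psi>" "open T" "A \<in> sets borel" "A \<subseteq> S"
  shows "\<phi> ` A \<in> sets borel"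
proof -
  have "\<phi> ` A = \<psi> -` A \<inter> T"
    using assms(1,4) unfolding homeomorphism_def by (auto simp: subset_iff image_iff)
  moreover have "\<psi> \<in> borel_measurable (restrict_space borel T)"
    using assms(1) by (intro borel_measurable_continuous_on_restrict) (simp add: homeomorphism_def)
  then have "\<psi> -` A \<inter> T \<in> sets (restrict_space borel T)"
    using measurable_sets[of \<psi> "restrict_space borel T" borel A] assms(3) by (simp add: space_restrict_space)
  ultimately show ?thesis
    using assms(2) by (auto simp: sets_restrict_space)
qed

text \<open>Monotone convergence along a compact exhaustion of \<open>S\<close>.\<close>

lemma change_of_variables_wellorder:
  fixes \<phi> :: "real^'n::{finite,wellorder} \<Rightarrow> real^'n::_"
  assumes S: "open S" "open (\<phi> ` S)" and der: "\<And>y. y \<in> S \<Longrightarrow> (\<phi> has_derivative \<phi>' y) (at y)"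
    and hom: "homeomorphism S (\<phi> ` S) \<phi> \<psi>"
    and w: "\<And>z. w z \<ge> (0::real)" "continuous_on (\<phi> ` S) w"
    and d: "continuous_on S (\<lambda>y. det (matrix (\<phi>' y)))"
    and B: "B \<in> sets borel" "B \<subseteq> S"
  shows "(\<integral>\<^sup>+ y. ennreal (w (\<phi> y) * \<bar>det (matrix (\<phi>' y))\<bar>) * indicator B y \<partial>lborel)
       = (\<integral>\<^sup>+ z. ennreal (w z) * indicator (\<phi> ` B) z \<partial>lborel)"
proof -
  obtain C where C: "\<And>n::nat. compact (C n)" "\<And>n. C n \<subseteq> S" "\<And>n. C n \<subseteq> interior (C (Suc n))" "\<Union>(range C) = S"
    using open_Union_compact_subsets[OF S(1)] by metis
  have inj: "inj_on \<phi> S" using hom unfolding homeomorphism_def by (metis inj_onI)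
  define A where "A n = B \<inter> C n" for n
  have A: "range A \<subseteq> sets borel" "incseq A" "(\<Union>n. A n) = B" "\<And>n. A n \<subseteq> S" "\<And>n. A n \<subseteq> C n"
  proof -
    have "C n \<subseteq> C (Suc n)" for n using C(3)[of n] interior_subset by blast
    then show "incseq A" by (auto simp: A_def incseq_Suc_iff)
  qed (use B C(1,2,4) in \<open>auto simp: A_def borel_compact\<close>)
  have A': "range (\<lambda>n. \<phi> ` A n) \<subseteq> sets borel" "incseq (\<lambda>n. \<phi> ` A n)" "(\<Union>n. \<phi> ` A n) = \<phi> ` B"
    using A homeomorphism_image_borel[OF hom S(2)] by (auto simp: incseq_Suc_iff image_mono)
  let ?h = "\<lambda>y. w (\<phi> y) * \<bar>det (matrix (\<phi>' y))\<bar>"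
  have cont: "continuous_on S \<phi>" using hom by (simp add: homeomorphism_def)
  have ch: "continuous_on S ?h"
    by (intro continuous_on_mult continuous_on_rabs d continuous_on_compose2[OF w(2) cont]) auto
  have e1: "ennreal (?h y) * indicator S y * indicator D y = ennreal (?h y) * indicator D y" if "D \<subseteq> S" for D y
    using that by (auto simp: indicator_def)
  have e2: "ennreal (w y) * indicator (\<phi> ` S) y * indicator (\<phi> ` D) y = ennreal (w y) * indicator (\<phi> ` D) y" if "D \<subseteq> S" for D y
    using that by (auto simp: indicator_def)
  have "(\<integral>\<^sup>+ y. ennreal (?h y) * indicator B y \<partial>lborel) = (SUP n. \<integral>\<^sup>+ y. ennreal (?h y) * indicator (A n) y \<partial>lborel)"
    using nn_integral_indicator_UN[of "\<lambda>y. ennreal (?h y) * indicator S y" lborel A]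
      measurable_continuous_on_indicator[OF _ ch] A S B
    by (simp add: e1)
  also have "\<dots> = (SUP n. \<integral>\<^sup>+ z. ennreal (w z) * indicator (\<phi> ` A n) z \<partial>lborel)"
    using change_of_variables_compact[OF S(1) der inj w d _ A(5) C(1,2)] A(1) by (simp add: range_subsetD)
  also have "\<dots> = (\<integral>\<^sup>+ z. ennreal (w z) * indicator (\<phi> ` B) z \<partial>lborel)"
    using nn_integral_indicator_UN[of "\<lambda>y. ennreal (w y) * indicator (\<phi> ` S) y" lborel "\<lambda>n. \<phi> ` A n"]
      measurable_continuous_on_indicator[OF _ w(2)] A A' S B
    by (simp add: e2)
  finally show ?thesis .
qed

theorem change_of_variables_nonneg:
  fixes \<phi> :: "real^'n::finite \<Rightarrow> real^'n"
  assumes S: "open S" "open (\<phi> ` S)" and der: "\<And>y. y \<in> S \<Longrightarrow> (\<phi> has_derivative \<phi>' y) (at y)"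
    and hom: "homeomorphism S (\<phi> ` S) \<phi> \<psi>"
    and w: "\<And>z. w z \<ge> (0::real)" "continuous_on (\<phi> ` S) w"
    and d: "continuous_on S (\<lambda>y. det (matrix (\<phi>' y)))"
    and B: "B \<in> sets borel" "B \<subseteq> S"
  shows "(\<integral>\<^sup>+ y. ennreal (w (\<phi> y) * \<bar>det (matrix (\<phi>' y))\<bar>) * indicator B y \<partial>lborel)
       = (\<integral>\<^sup>+ z. ennreal (w z) * indicator (\<phi> ` B) z \<partial>lborel)"
proof -
  obtain e :: "'n idx \<Rightarrow> 'n" where e: "bij e" using ex_bij_idx by blast
  let ?T = "reindex e :: real^'n \<Rightarrow> real^'n idx" and ?R = "reindex (inv e) :: real^'n idx \<Rightarrow> real^'n"
  have RT: "?R (?T x) = x" and TR: "?T (?R y) = y" for x y using reindex_inverse[OF e] by auto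
  have cR: "continuous_on UNIV ?R" and cT: "continuous_on UNIV ?T"
    by (intro bounded_linear.continuous_on[OF bounded_linear_reindex] continuous_on_id)+
  have im: "?T ` D = ?R -` D" for D using RT TR by (auto simp: image_iff) metis
  have open_im: "open (?T ` D)" if "open D" for D
    unfolding im by (rule open_vimage[OF that cR])
  let ?\<Phi> = "\<lambda>y. ?T (\<phi> (?R y))" and ?\<Phi>' = "\<lambda>y v. ?T (\<phi>' (?R y) (?R v))"
  have im2: "?\<Phi> ` ?T ` D = ?T ` \<phi> ` D" for D by (auto simp: RT image_iff)
  have axis: "?R (axis j 1) = axis (e j) 1" for j
    using e by (auto simp: reindex_def axis_def vec_eq_iff) (metis bij_inv_eq_iff)+
  have det: "det (matrix (?\<Phi>' y)) = det (matrix (\<phi>' (?R y)))" for y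
  proof -
    have "matrix (?\<Phi>' y) = (\<chi> i j. matrix (\<phi>' (?R y)) $ e i $ e j)"
      by (simp add: matrix_def vec_eq_iff axis) (simp add: reindex_def)
    then show ?thesis by (simp add: det_reindex[OF e])
  qed
  have ind: "indicator (?T ` D) y = (indicator D (?R y) :: ennreal)" for D y
    unfolding im by (simp add: indicator_def)
  have cont: "continuous_on S \<phi>" using hom by (simp add: homeomorphism_def)
  have ch: "continuous_on S (\<lambda>y. w (\<phi> y) * \<bar>det (matrix (\<phi>' y))\<bar>)"
    by (intro continuous_on_mult continuous_on_rabs d continuous_on_compose2[OF w(2) cont]) auto
  have bi: "bij (inv e)" using e by (rule bij_imp_bij_inv)
  have "(\<integral>\<^sup>+ y. ennreal (w (\<phi> y) * \<bar>det (matrix (\<phi>' y))\<bar>) * indicator B y \<partial>lborel)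
    = (\<integral>\<^sup>+ y. ennreal (w (\<phi> (?R y)) * \<bar>det (matrix (\<phi>' (?R y)))\<bar>) * indicator B (?R y) \<partial>lborel)"
    by (rule nn_integral_reindex[OF bi]) (rule measurable_continuous_on_indicator[OF B(1) continuous_on_subset[OF ch B(2)]])
  also have "\<dots> = (\<integral>\<^sup>+ y. ennreal (w (?R (?\<Phi> y)) * \<bar>det (matrix (?\<Phi>' y))\<bar>) * indicator (?T ` B) y \<partial>lborel)"
    by (simp add: RT det ind)
  also have "\<dots> = (\<integral>\<^sup>+ z. ennreal (w (?R z)) * indicator (?\<Phi> ` ?T ` B) z \<partial>lborel)"
  proof (rule change_of_variables_wellorder[where S="?T ` S" and w="\<lambda>z. w (?R z)" and \<psi>="\<lambda>y. ?T (\<psi> (?R y))"])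
    show "open (?T ` S)" "open (?\<Phi> ` ?T ` S)"
      unfolding im2 by (intro open_im S)+
    show "(?\<Phi> has_derivative ?\<Phi>' y) (at y)" if "y \<in> ?T ` S" for y
    proof -
      have "?R y \<in> S" using that RT by auto
      from der[OF this] have "((\<lambda>y. \<phi> (?R y)) has_derivative (\<lambda>v. \<phi>' (?R y) (?R v))) (at y)"
        by (rule has_derivative_compose[OF bounded_linear_imp_has_derivative[OF bounded_linear_reindex]])
      then show ?thesis
        by (rule bounded_linear.has_derivative[OF bounded_linear_reindex])
    qed
    show "homeomorphism (?T ` S) (?\<Phi> ` ?T ` S) ?\<Phi> (\<lambda>y. ?T (\<psi> (?R y)))"
    proof (rule homeomorphismI)
      show "continuous_on (?T ` S) ?\<Phi>"
        by (rule continuous_on_compose2[OF cT], rule continuous_on_compose2[OF cont], rule continuous_on_subset[OF cR])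
          (auto simp: RT)
      have \<psi>: "continuous_on (\<phi> ` S) \<psi>" using hom by (simp add: homeomorphism_def)
      show "continuous_on (?\<Phi> ` ?T ` S) (\<lambda>y. ?T (\<psi> (?R y)))"
        unfolding im2
        by (rule continuous_on_compose2[OF cT], rule continuous_on_compose2[OF \<psi>], rule continuous_on_subset[OF cR])
          (auto simp: RT)
      have inv: "\<psi> (\<phi> x) = x" "\<phi> x \<in> \<phi> ` S" if "x \<in> S" for x
        using hom that by (auto simp: homeomorphism_def)
      show "?T (\<psi> (?R (?\<Phi> y))) = y" if "y \<in> ?T ` S" for y
        using that inv by (auto simp: RT)
      show "?\<Phi> (?T (\<psi> (?R y))) = y" if "y \<in> ?\<Phi> ` ?T ` S" for y
        using that inv unfolding im2 by (auto simp: RT)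
      show "(\<lambda>y. ?T (\<psi> (?R y))) ` ?\<Phi> ` ?T ` S \<subseteq> ?T ` S"
        using inv unfolding im2 by (auto simp: RT)
    qed auto
    show "0 \<le> w (?R z)" for z by (rule w)
    show "continuous_on (?\<Phi> ` ?T ` S) (\<lambda>z. w (?R z))"
      unfolding im2 by (intro continuous_on_compose2[OF w(2)] continuous_on_subset[OF cR]) (auto simp: RT)
    show "continuous_on (?T ` S) (\<lambda>y. det (matrix (?\<Phi>' y)))"
      unfolding det by (intro continuous_on_compose2[OF d] continuous_on_subset[OF cR]) (auto simp: RT)
    show "?T ` B \<in> sets borel"
      unfolding im using measurable_sets[OF measurable_reindex B(1), of "inv e"] by simp
    show "?T ` B \<subseteq> ?T ` S" using B(2) by blast
  qed
  also have "\<dots> = (\<integral>\<^sup>+ z. ennreal (w (?R z)) * indicator (\<phi> ` B) (?R z) \<partial>lborel)"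
    unfolding im2 ind ..
  also have "\<dots> = (\<integral>\<^sup>+ z. ennreal (w z) * indicator (\<phi> ` B) z \<partial>lborel)"
    by (rule nn_integral_reindex[OF bi, symmetric])
      (rule measurable_continuous_on_indicator[OF homeomorphism_image_borel[OF hom S(2) B] continuous_on_subset[OF w(2)]],
       use B in blast)
  finally show ?thesis .
qed

section \<open>The metric in charts\<close>

lemma matrix_inv_inverse:
  fixes A :: "'a::semiring_1^'n^'n"
  assumes "invertible A"
  shows "A ** matrix_inv A = mat 1" "matrix_inv A ** A = mat 1"
proof -
  have "\<exists>B. A ** B = mat 1 \<and> B ** A = mat 1" using assms by (simp add: invertible_def)
  from someI_ex[OF this] show "A ** matrix_inv A = mat 1" "matrix_inv A ** A = mat 1"
    by (simp_all add: matrix_inv_def)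
qed

lemma matrix_inv_eqI:
  fixes A B :: "'a::semiring_1^'n^'n"
  assumes "invertible A" "B ** A = mat 1"
  shows "matrix_inv A = B"
  by (metis assms matrix_inv_inverse(1) matrix_mul_assoc matrix_mul_lid matrix_mul_rid)

lemma matrix_inv_cramer:
  fixes A :: "'a::field^'n^'n"
  assumes "det A \<noteq> 0"
  shows "matrix_inv A $ k $ b = det (\<chi> i j. if j = k then axis b 1 $ i else A $ i $ j) / det A"
proof -
  have inv: "invertible A" using assms by (simp add: invertible_det_nz)
  have "A *v column b (matrix_inv A) = axis b 1"
    using matrix_inv_inverse(1)[OF inv]
    by (simp add: vec_eq_iff matrix_matrix_mult_def matrix_vector_mult_def column_def mat_def axis_def)
  then have "column b (matrix_inv A) = (\<chi> k. det (\<chi> i j. if j = k then axis b 1 $ i else A $ i $ j) / det A)"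
    using cramer[OF assms] by blast
  then show ?thesis by (simp add: column_def vec_eq_iff)
qed

context smooth_mfd
begin

lemma smooth_in_det:
  fixes A :: "'m \<Rightarrow> real^'l^'l"
  assumes "chart_open i W" "\<And>a b. smooth_in M i W (\<lambda>x. A x $ a $ b)"
  shows "smooth_in M i W (\<lambda>x. det (A x))"
  unfolding det_def
  by (intro smooth_in_sum smooth_in_mult smooth_in_prod smooth_in_const assms)

end

locale pseudo_riem = smooth_mfd M
  for M :: "('i, 'm::{t2_space,second_countable_topology}, 'n::finite) atlas" +
  fixes g :: "('i, 'm, 'n) metric" and p q :: nat
  assumes metric: "pseudo_metric M p q g"
begin

definition gi :: "'i \<Rightarrow> 'm \<Rightarrow> 'n \<Rightarrow> 'n \<Rightarrow> real" where
  "gi i x a b = matrix_inv (g i x) $ a $ b"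

definition dens :: "'i \<Rightarrow> 'm \<Rightarrow> real" where
  "dens i x = sqrt \<bar>det (g i x)\<bar>"

lemma metric_smooth: "smooth_in M i (cdom M i) (\<lambda>x. g i x $ a $ b)"
  using metric unfolding pseudo_metric_def by (intro smooth_in_vec_nth chart_open_cdom) blast

lemma metric_signature: "x \<in> cdom M i \<Longrightarrow> has_signature p q (g i x)"
  using metric unfolding pseudo_metric_def by blast

lemma metric_sym:
  assumes "x \<in> cdom M i"
  shows "g i x $ a $ b = g i x $ b $ a"
proof -
  have "transpose (g i x) = g i x" using metric_signature[OF assms] by (simp add: has_signature_def)
  from arg_cong[OF this, of "\<lambda>B. B $ b $ a"] show ?thesis by (simp add: transpose_def)
qed

text \<open>The diagonal matrix in the definition of the signature has entries \<open>\<plusminus>1\<close>.\<close>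

lemma metric_det:
  assumes "x \<in> cdom M i"
  shows "det (g i x) \<noteq> 0"
proof
  assume "det (g i x) = 0"
  obtain P :: "real^'n^'n" and \<epsilon> :: "'n \<Rightarrow> real" where P: "range \<epsilon> \<subseteq> {1, -1}"
    "transpose P ** g i x ** P = (\<chi> a b. if a = b then \<epsilon> a else 0)"
    using metric_signature[OF assms] unfolding has_signature_def by blast
  have "det (transpose P ** g i x ** P) = (\<Prod>a\<in>UNIV. \<epsilon> a)"
    unfolding P(2) by (subst det_diagonal) auto
  moreover have "\<epsilon> a \<noteq> 0" for a using P(1) by (metis insert_iff neg_equal_0_iff_equal range_subsetD singletonD zero_neq_one)
  ultimately show False using \<open>det (g i x) = 0\<close> by (simp add: det_mul)
qed

lemma metric_invertible: "x \<in> cdom M i \<Longrightarrow> invertible (g i x)"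
  using metric_det by (simp add: invertible_det_nz)

lemma gi_inverse:
  assumes "x \<in> cdom M i"
  shows "(\<Sum>b\<in>UNIV. gi i x a b * g i x $ b $ c) = (if a = c then 1 else 0)"
    "(\<Sum>b\<in>UNIV. g i x $ a $ b * gi i x b c) = (if a = c then 1 else 0)"
  using matrix_inv_inverse[OF metric_invertible[OF assms]]
  by (auto simp: matrix_matrix_mult_def mat_def vec_eq_iff gi_def)

lemma gi_sym:
  assumes "x \<in> cdom M i"
  shows "gi i x a b = gi i x b a"
proof -
  have t: "transpose (g i x) = g i x" using metric_sym[OF assms] by (simp add: transpose_def vec_eq_iff)
  have "matrix_inv (g i x) = transpose (matrix_inv (g i x))"
    by (rule matrix_inv_eqI[OF metric_invertible[OF assms]])
      (metis t matrix_inv_inverse(1)[OF metric_invertible[OF assms]] matrix_transpose_mul transpose_mat)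
  from arg_cong[OF this, of "\<lambda>B. B $ a $ b"] show ?thesis by (simp add: transpose_def gi_def)
qed

text \<open>By Cramer's rule the entries of the inverse are rational functions of the entries of the metric.\<close>

lemma gi_smooth: "smooth_in M i (cdom M i) (\<lambda>x. gi i x a b)"
proof (rule smooth_in_cong[OF chart_open_cdom])
  have "smooth_in M i (cdom M i) (\<lambda>x. (\<chi> k j. if j = a then axis b 1 $ k else g i x $ k $ j) $ u $ v)" for u v
    by (cases "v = a") (simp_all add: metric_smooth smooth_in_const)
  then show "smooth_in M i (cdom M i) (\<lambda>x. det (\<chi> k j. if j = a then axis b 1 $ k else g i x $ k $ j) / det (g i x))"
    by (intro smooth_in_divide smooth_in_det chart_open_cdom metric_smooth metric_det)
qed (simp add: gi_def matrix_inv_cramer[OF metric_det])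

lemma dens_pos: "x \<in> cdom M i \<Longrightarrow> dens i x > 0"
  by (simp add: dens_def metric_det)

lemma dens_nonneg: "dens i x \<ge> 0"
  by (simp add: dens_def)

text \<open>The square root of \<open>|d|\<close> is written as \<open>(d\<^sup>2)\<^bsup>1/4\<^esup>\<close>, which avoids the absolute value.\<close>

lemma dens_smooth: "smooth_in M i (cdom M i) (dens i)"
proof (rule smooth_in_cong[OF chart_open_cdom])
  show "smooth_in M i (cdom M i) (\<lambda>x. (det (g i x) * det (g i x)) powr (1/4))"
    by (intro smooth_in_powr smooth_in_mult smooth_in_det chart_open_cdom metric_smooth)
      (use metric_det in \<open>auto simp: zero_less_mult_iff linorder_neq_iff\<close>)
  show "(det (g i x) * det (g i x)) powr (1/4) = dens i x" if "x \<in> cdom M i" for x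
  proof -
    let ?d = "\<bar>det (g i x)\<bar>"
    have "det (g i x) * det (g i x) = ?d powr 2" using metric_det[OF that] by (simp add: power2_eq_square)
    then have "(det (g i x) * det (g i x)) powr (1/4) = ?d powr (2 * (1/4))" by (simp only: powr_powr)
    then show ?thesis by (simp add: dens_def powr_half_sqrt)
  qed
qed

lemma metric_change:
  assumes "x \<in> cdom M i" "x \<in> cdom M j"
  shows "g j x $ a $ b = (\<Sum>c\<in>UNIV. \<Sum>d\<in>UNIV. jac M j i x a c * jac M j i x b d * g i x $ c $ d)"
  using metric assms unfolding pseudo_metric_def by blast

definition Jac :: "'i \<Rightarrow> 'i \<Rightarrow> 'm \<Rightarrow> real^'n^'n" where
  "Jac j i x = (\<chi> a b. jac M j i x a b)"

lemma metric_change_matrix: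
  assumes "x \<in> cdom M i" "x \<in> cdom M j"
  shows "g j x = Jac j i x ** g i x ** transpose (Jac j i x)"
proof -
  have "g j x $ a $ b = (\<Sum>d\<in>UNIV. (\<Sum>c\<in>UNIV. jac M j i x a c * g i x $ c $ d) * jac M j i x b d)" for a b
    unfolding metric_change[OF assms] sum_distrib_right by (subst sum.swap) (simp add: mult_ac)
  then show ?thesis by (simp add: vec_eq_iff matrix_matrix_mult_def transpose_def Jac_def)
qed

lemma Jac_inverse:
  assumes "x \<in> cdom M i" "x \<in> cdom M j"
  shows "Jac j i x ** Jac i j x = mat 1"
  using jac_inverse[OF assms] by (simp add: vec_eq_iff matrix_matrix_mult_def Jac_def mat_def)

lemma gi_change:
  assumes "x \<in> cdom M i" "x \<in> cdom M j"
  shows "gi i x c d = (\<Sum>a\<in>UNIV. \<Sum>b\<in>UNIV. jac M j i x a c * jac M j i x b d * gi j x a b)"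
proof -
  let ?J = "Jac j i x" and ?K = "Jac i j x"
  have JK: "?J ** ?K = mat 1" and KJ: "?K ** ?J = mat 1" using Jac_inverse assms by auto
  have "(transpose ?J ** matrix_inv (g j x) ** ?J) ** g i x
      = transpose ?J ** matrix_inv (g j x) ** (?J ** g i x ** (transpose ?J ** transpose ?K))"
    using KJ by (simp add: matrix_mul_assoc[symmetric] matrix_transpose_mul[symmetric] transpose_mat)
  also have "\<dots> = transpose ?J ** (matrix_inv (g j x) ** (?J ** g i x ** transpose ?J)) ** transpose ?K"
    by (simp add: matrix_mul_assoc)
  also have "\<dots> = mat 1"
    using KJ unfolding metric_change_matrix[OF assms, symmetric]
    by (simp add: matrix_inv_inverse[OF metric_invertible[OF assms(2)]] matrix_transpose_mul[symmetric] transpose_mat)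
  finally have "matrix_inv (g i x) = transpose ?J ** matrix_inv (g j x) ** ?J"
    by (rule matrix_inv_eqI[OF metric_invertible[OF assms(1)]])
  then have "gi i x c d = (\<Sum>b\<in>UNIV. (\<Sum>a\<in>UNIV. jac M j i x a c * gi j x a b) * jac M j i x b d)"
    by (simp add: gi_def matrix_matrix_mult_def transpose_def Jac_def)
  then show ?thesis
    unfolding sum_distrib_right by (subst sum.swap) (simp add: mult_ac)
qed

lemma dens_change:
  assumes "x \<in> cdom M i" "x \<in> cdom M j"
  shows "dens j x = \<bar>det (Jac j i x)\<bar> * dens i x"
  unfolding dens_def metric_change_matrix[OF assms] det_mul det_transpose
  by (simp add: abs_mult real_sqrt_mult mult_ac)


section \<open>The Riemannian volume\<close>

text \<open>The density vanishes off the image of the chart, so the value \<open>undefined\<close> of the inverse coordinate map there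
  does not affect the measure.\<close>

definition chart_measure :: "'i \<Rightarrow> 'm measure" where
  "chart_measure i = distr
     (density lborel (\<lambda>y. ennreal (sqrt \<bar>det (in_chart M i (g i) y)\<bar>) * indicator (crd M i ` cdom M i) y))
     borel (\<lambda>y. if y \<in> crd M i ` cdom M i then chart_inv i y else undefined)"

lemma dens_in_chart: "sqrt \<bar>det (in_chart M i (g i) y)\<bar> = in_chart M i (dens i) y"
  by (simp add: in_chart_eq dens_def)

lemma open_crd_cdom: "open (crd M i ` cdom M i)"
  by (rule open_crd_image[OF chart_open_cdom])

lemma measurable_chart_inv [measurable]:
  "(\<lambda>y. if y \<in> crd M i ` cdom M i then chart_inv i y else undefined) \<in> borel_measurable borel"
proof (rule measurable_If_restrict_space_iff[THEN iffD2])
  show "{x \<in> space borel. x \<in> crd M i ` cdom M i} \<in> sets borel" using open_crd_cdom by auto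
  have "chart_inv i \<in> borel_measurable (restrict_space borel (crd M i ` cdom M i))"
    by (rule borel_measurable_continuous_on_restrict[OF continuous_chart_inv])
  then show "chart_inv i \<in> borel_measurable (restrict_space borel {y. y \<in> crd M i ` cdom M i}) \<and>
      (\<lambda>_. undefined) \<in> borel_measurable (restrict_space borel {y. y \<notin> crd M i ` cdom M i})"
    by simp
qed

lemma continuous_dens_chart: "continuous_on (crd M i ` cdom M i) (in_chart M i (dens i))"
  using dens_smooth[of i] smooth_on_continuous unfolding smooth_in_def by blast

lemma measurable_dens_chart [measurable]:
  "(\<lambda>y. ennreal (sqrt \<bar>det (in_chart M i (g i) y)\<bar>) * indicator (crd M i ` cdom M i) y) \<in> borel_measurable borel"
  unfolding dens_in_chart
  by (rule measurable_continuous_on_indicator[OF _ continuous_dens_chart]) (use open_crd_cdom in auto)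

lemma sets_chart_measure [simp, measurable_cong]: "sets (chart_measure i) = sets borel"
  and space_chart_measure [simp]: "space (chart_measure i) = UNIV"
  by (simp_all add: chart_measure_def)

lemma emeasure_chart_measure:
  assumes B: "B \<in> sets borel"
  shows "emeasure (chart_measure i) B =
    (\<integral>\<^sup>+ y. ennreal (sqrt \<bar>det (in_chart M i (g i) y)\<bar>) * indicator (crd M i ` (B \<inter> cdom M i)) y \<partial>lborel)"
proof -
  let ?r = "\<lambda>y. if y \<in> crd M i ` cdom M i then chart_inv i y else undefined"
  have m: "?r -` B \<in> sets borel"
    using measurable_sets[OF measurable_chart_inv B] by simp
  have "emeasure (chart_measure i) B =
    (\<integral>\<^sup>+ y. ennreal (sqrt \<bar>det (in_chart M i (g i) y)\<bar>) * indicator (crd M i ` cdom M i) y * indicator (?r -` B) y \<partial>lborel)"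
    unfolding chart_measure_def using B m by (subst emeasure_distr) (auto simp: emeasure_density)
  also have "\<dots> = (\<integral>\<^sup>+ y. ennreal (sqrt \<bar>det (in_chart M i (g i) y)\<bar>) * indicator (crd M i ` (B \<inter> cdom M i)) y \<partial>lborel)"
  proof (rule nn_integral_cong)
    fix y
    have "y \<in> crd M i ` (B \<inter> cdom M i) \<longleftrightarrow> y \<in> crd M i ` cdom M i \<and> ?r y \<in> B"
      by auto
    then show "ennreal (sqrt \<bar>det (in_chart M i (g i) y)\<bar>) * indicator (crd M i ` cdom M i) y * indicator (?r -` B) y
      = ennreal (sqrt \<bar>det (in_chart M i (g i) y)\<bar>) * indicator (crd M i ` (B \<inter> cdom M i)) y"
      by (simp add: indicator_def)
  qed
  finally show ?thesis .
qed

lemma chart_measure_change: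
  assumes B: "B \<in> sets borel" "B \<subseteq> cdom M i" "B \<subseteq> cdom M j"
  shows "emeasure (chart_measure i) B = emeasure (chart_measure j) B"
proof -
  let ?W = "cdom M i \<inter> cdom M j"
  let ?\<phi> = "in_chart M j (crd M i)" and ?\<psi> = "in_chart M i (crd M j)"
  let ?\<phi>' = "\<lambda>y. frechet_derivative ?\<phi> (at y)"
  have im: "?\<phi> ` crd M j ` D = crd M i ` D" if "D \<subseteq> ?W" for D
    using that by (force simp: image_iff subset_iff)
  have oj: "open (crd M j ` ?W)" and oi: "open (crd M i ` ?W)"
    by (rule open_crd_image[OF chart_open_Int(2)], rule open_crd_image[OF chart_open_Int(1)])
  have der: "(?\<phi> has_derivative ?\<phi>' y) (at y)" if "y \<in> crd M j ` ?W" for y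
    using smooth_on_has_derivative[of "crd M j ` ?W" ?\<phi> y] smooth_in_crd[of j i] that
    by (simp add: smooth_in_def Int_commute)
  have det: "det (matrix (?\<phi>' (crd M j x))) = det (Jac j i x)" if "x \<in> ?W" for x
  proof -
    have "jac M j i x a b = ?\<phi>' (crd M j x) (axis a 1) $ b" for a b
      unfolding jac_def
      by (rule pd_eqI'[of "\<lambda>y. crd M i y $ b" j, OF bounded_linear.has_derivative[OF bounded_linear_vec_nth
            der[of "crd M j x", unfolded in_chart_eq], folded in_chart_eq]]) (use that in auto)
    then have "matrix (?\<phi>' (crd M j x)) = transpose (Jac j i x)"
      by (simp add: matrix_def transpose_def Jac_def vec_eq_iff)
    then show ?thesis by simp
  qed
  have cW: "continuous_on (crd M j ` ?W) ?\<phi>" "continuous_on (crd M i ` ?W) ?\<psi>"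
    using smooth_in_crd[of j i] smooth_in_crd[of i j] smooth_on_continuous
    by (auto simp: smooth_in_def Int_commute)
  have hom: "homeomorphism (crd M j ` ?W) (?\<phi> ` crd M j ` ?W) ?\<phi> ?\<psi>"
    unfolding im[OF subset_refl] by (rule homeomorphismI) (use cW in auto)
  have cw: "continuous_on (?\<phi> ` crd M j ` ?W) (in_chart M i (dens i))"
    unfolding im[OF subset_refl] by (rule continuous_on_subset[OF continuous_dens_chart]) auto
  have sd: "smooth_in M j ?W (\<lambda>x. det (Jac j i x))"
    by (intro smooth_in_det chart_open_Int) (simp add: Jac_def smooth_in_jac)
  have "continuous_on (crd M j ` ?W) (in_chart M j (\<lambda>x. det (Jac j i x)))"
    using sd smooth_on_continuous unfolding smooth_in_def by blast
  then have cd: "continuous_on (crd M j ` ?W) (\<lambda>y. det (matrix (?\<phi>' y)))"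
    by (rule continuous_on_eq) (auto simp: det)
  have Bb: "crd M j ` B \<in> sets borel"
    by (rule homeomorphism_image_borel[OF chart_homeomorphism open_crd_cdom B(1,3)])
  have "emeasure (chart_measure j) B =
    (\<integral>\<^sup>+ y. ennreal (in_chart M i (dens i) (?\<phi> y) * \<bar>det (matrix (?\<phi>' y))\<bar>) * indicator (crd M j ` B) y \<partial>lborel)"
    unfolding emeasure_chart_measure[OF B(1)] dens_in_chart
  proof (rule nn_integral_cong)
    fix y
    have "in_chart M j (dens j) y = in_chart M i (dens i) (?\<phi> y) * \<bar>det (matrix (?\<phi>' y))\<bar>" if y: "y \<in> crd M j ` B"
    proof -
      obtain x where x: "x \<in> B" "y = crd M j x" using y by blast
      then have "x \<in> cdom M i" "x \<in> cdom M j" using B by auto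
      then show ?thesis using dens_change[of x i j] det[of x] x by simp
    qed
    then show "ennreal (in_chart M j (dens j) y) * indicator (crd M j ` (B \<inter> cdom M j)) y =
      ennreal (in_chart M i (dens i) (?\<phi> y) * \<bar>det (matrix (?\<phi>' y))\<bar>) * indicator (crd M j ` B) y"
      using B(3) by (simp add: Int_absorb2 indicator_def)
  qed
  also have "\<dots> = (\<integral>\<^sup>+ z. ennreal (in_chart M i (dens i) z) * indicator (?\<phi> ` crd M j ` B) z \<partial>lborel)"
    by (rule change_of_variables_nonneg[OF oj _ der hom _ cw cd Bb])
      (use B oi im[OF subset_refl] in \<open>auto simp: in_chart_eq dens_nonneg\<close>)
  also have "\<dots> = emeasure (chart_measure i) B"
    unfolding emeasure_chart_measure[OF B(1)] dens_in_chart using im[of B] B by (simp add: Int_absorb2)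
  finally show ?thesis by simp
qed

lemma countable_charts: "\<exists>c :: nat \<Rightarrow> 'i. (\<Union>n. cdom M (c n)) = UNIV"
proof -
  obtain F where F: "F \<subseteq> range (cdom M)" "countable F" "\<Union>F = \<Union>(range (cdom M))"
    using Lindelof[of "range (cdom M)"] open_cdom by (metis rangeE)
  have U: "\<Union>F = UNIV" unfolding F(3) using ex_chart by auto
  then have ne: "F \<noteq> {}" by auto
  have "\<exists>i. from_nat_into F n = cdom M i" for n
    using from_nat_into[OF ne, of n] F(1) by blast
  then obtain c where c: "\<And>n. from_nat_into F n = cdom M (c n)" by metis
  have "(\<Union>n. cdom M (c n)) = \<Union>F"
    using range_from_nat_into[OF ne F(2)] unfolding c[symmetric] by simp
  then show ?thesis unfolding U by (intro exI[of _ c])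
qed

definition is_volume :: "'m measure \<Rightarrow> bool" where
  "is_volume \<mu> \<longleftrightarrow> sets \<mu> = sets borel \<and>
     (\<forall>i. \<forall>B\<in>sets borel. B \<subseteq> cdom M i \<longrightarrow> emeasure \<mu> B = emeasure (chart_measure i) B)"

text \<open>Countably many charts cover the manifold; after making them disjoint, a measure is the sum of its restrictions.\<close>

lemma volume_unique:
  assumes "is_volume \<mu>" "is_volume \<mu>'"
  shows "\<mu> = \<mu>'"
proof (rule measure_eqI)
  show s: "sets \<mu> = sets \<mu>'" using assms by (simp add: is_volume_def)
  fix A assume "A \<in> sets \<mu>"
  then have A: "A \<in> sets borel" using assms by (simp add: is_volume_def)
  obtain c :: "nat \<Rightarrow> 'i" where c: "(\<Union>n. cdom M (c n)) = UNIV" using countable_charts by blast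
  define D where "D = disjointed (\<lambda>n. cdom M (c n))"
  have D: "range D \<subseteq> sets borel" unfolding D_def
    by (rule sets.range_disjointed_sets) (use open_cdom in auto)
  have sub: "A \<inter> D n \<subseteq> cdom M (c n)" for n
    unfolding D_def using disjointed_subset[of "\<lambda>n. cdom M (c n)" n] by blast
  have dj: "disjoint_family (\<lambda>n. A \<inter> D n)"
    using disjoint_family_disjointed[of "\<lambda>n. cdom M (c n)"] by (auto simp: disjoint_family_on_def D_def)
  have un: "(\<Union>n. A \<inter> D n) = A"
    using c UN_disjointed_eq[of "\<lambda>n. cdom M (c n)"] by (auto simp: D_def)
  have AD: "range (\<lambda>n. A \<inter> D n) \<subseteq> sets borel" using A D by auto
  have "emeasure \<nu> A = (\<Sum>n. emeasure (chart_measure (c n)) (A \<inter> D n))" if "is_volume \<nu>" for \<nu>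
  proof -
    have "emeasure \<nu> A = (\<Sum>n. emeasure \<nu> (A \<inter> D n))"
      using suminf_emeasure[of "\<lambda>n. A \<inter> D n" \<nu>] AD dj un that by (simp add: is_volume_def)
    moreover have "emeasure \<nu> (A \<inter> D n) = emeasure (chart_measure (c n)) (A \<inter> D n)" for n
      using that sub[of n] AD unfolding is_volume_def by blast
    ultimately show ?thesis by simp
  qed
  then show "emeasure \<mu> A = emeasure \<mu>' A" using assms by simp
qed

text \<open>The chart measures are glued along a disjoint countable refinement of the cover by charts.  On a Borel set inside
  a chart the result agrees with the measure of that chart because chart measures agree on overlaps.\<close>

lemma volume_exists: "\<exists>\<mu>. is_volume \<mu>"
proof -
  obtain c :: "nat \<Rightarrow> 'i" where c: "(\<Union>n. cdom M (c n)) = UNIV" using countable_charts by blast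
  define D where "D = disjointed (\<lambda>n. cdom M (c n))"
  have D: "range D \<subseteq> sets borel" unfolding D_def
    by (rule sets.range_disjointed_sets) (use open_cdom in auto)
  have sub: "D n \<subseteq> cdom M (c n)" for n
    unfolding D_def by (rule disjointed_subset)
  have dj: "disjoint_family D" unfolding D_def by (rule disjoint_family_disjointed)
  have un: "(\<Union>n. D n) = UNIV"
    using c UN_disjointed_eq[of "\<lambda>n. cdom M (c n)"] by (auto simp: D_def)
  define m where "m B = (\<Sum>n. emeasure (chart_measure (c n)) (B \<inter> D n))" for B
  define \<mu> where "\<mu> = measure_of UNIV (sets borel) m"
  have sets: "sets \<mu> = sets borel"
    unfolding \<mu>_def using sets.sigma_sets_eq[of "borel :: 'm measure"] by (simp add: sets_measure_of)
  have em: "emeasure \<mu> B = m B" if "B \<in> sets borel" for B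
  proof (rule emeasure_measure_of[OF \<mu>_def])
    show "positive (sets \<mu>) m" by (simp add: positive_def m_def)
    show "countably_additive (sets \<mu>) m"
    proof (rule countably_additiveI)
      fix A :: "nat \<Rightarrow> 'm set" assume A: "range A \<subseteq> sets \<mu>" "disjoint_family A" "\<Union>(range A) \<in> sets \<mu>"
      have "m (\<Union>(range A)) = (\<Sum>n. \<Sum>k. emeasure (chart_measure (c n)) (A k \<inter> D n))"
        unfolding m_def
      proof (rule suminf_cong)
        fix n
        have "(\<Sum>k. emeasure (chart_measure (c n)) (A k \<inter> D n)) = emeasure (chart_measure (c n)) (\<Union>k. A k \<inter> D n)"
          by (rule suminf_emeasure) (use A D sets in \<open>auto simp: disjoint_family_on_def\<close>)
        then show "emeasure (chart_measure (c n)) (\<Union>(range A) \<inter> D n) = (\<Sum>k. emeasure (chart_measure (c n)) (A k \<inter> D n))"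
          by simp
      qed
      also have "\<dots> = (\<integral>\<^sup>+ n. (\<Sum>k. emeasure (chart_measure (c n)) (A k \<inter> D n)) \<partial>count_space UNIV)"
        by (simp add: nn_integral_count_space_nat)
      also have "\<dots> = (\<Sum>k. \<integral>\<^sup>+ n. emeasure (chart_measure (c n)) (A k \<inter> D n) \<partial>count_space UNIV)"
        by (rule nn_integral_suminf) simp
      also have "\<dots> = (\<Sum>k. m (A k))"
        by (simp add: nn_integral_count_space_nat m_def)
      finally show "(\<Sum>k. m (A k)) = m (\<Union>(range A))" by simp
    qed
  qed (use that sets in auto)
  have "is_volume \<mu>" unfolding is_volume_def
  proof (intro conjI allI ballI impI sets)
    fix i and B :: "'m set" assume B: "B \<in> sets borel" "B \<subseteq> cdom M i"
    have "m B = (\<Sum>n. emeasure (chart_measure i) (B \<inter> D n))"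
      unfolding m_def by (intro suminf_cong chart_measure_change) (use B D sub in auto)
    also have "\<dots> = emeasure (chart_measure i) (\<Union>n. B \<inter> D n)"
    proof (rule suminf_emeasure)
      show "disjoint_family (\<lambda>n. B \<inter> D n)" using dj unfolding disjoint_family_on_def by blast
    qed (use B D in auto)
    also have "(\<Union>n. B \<inter> D n) = B" using un by auto
    finally show "emeasure \<mu> B = emeasure (chart_measure i) B" using em[OF B(1)] by simp
  qed
  then show ?thesis by blast
qed

lemma is_volume_volume: "is_volume (volume M g)"
proof -
  have e: "sets \<mu> = sets borel \<and> (\<forall>i. \<forall>B\<in>sets borel. B \<subseteq> cdom M i \<longrightarrow>
        emeasure \<mu> B = (\<integral>\<^sup>+ y. ennreal (sqrt \<bar>det (in_chart M i (g i) y)\<bar>) * indicator (crd M i ` B) y \<partial>lborel))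
      \<longleftrightarrow> is_volume \<mu>" for \<mu>
    unfolding is_volume_def by (auto simp: emeasure_chart_measure Int_absorb2)
  show ?thesis unfolding volume_def e
    using volume_exists volume_unique by (metis theI)
qed

abbreviation vol :: "'m measure" where "vol \<equiv> volume M g"

lemma sets_vol [simp, measurable_cong]: "sets vol = sets borel"
  and space_vol [simp]: "space vol = UNIV"
  using is_volume_volume sets_eq_imp_space_eq[of vol borel] by (auto simp: is_volume_def)

lemma emeasure_vol: "B \<in> sets borel \<Longrightarrow> B \<subseteq> cdom M i \<Longrightarrow> emeasure vol B = emeasure (chart_measure i) B"
  using is_volume_volume by (auto simp: is_volume_def)

end

section \<open>Integration by parts in a chart\<close>

lemma continuous_zero_extension:
  assumes "open S" "closed K" "K \<subseteq> S" "continuous_on S f" "\<And>x. x \<notin> K \<Longrightarrow> f x = 0"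
  shows "continuous_on UNIV f"
proof -
  have "continuous_on (- K) f"
    by (rule continuous_on_eq[OF continuous_on_const[of _ 0]]) (use assms(5) in auto)
  then have "continuous_on (S \<union> - K) f"
    by (intro continuous_on_open_Un assms) (use assms(2) in auto)
  moreover have "S \<union> - K = UNIV" using assms(3) by auto
  ultimately show ?thesis by simp
qed

lemma integral_translate_lborel:
  fixes f :: "'a::euclidean_space \<Rightarrow> 'b::euclidean_space"
  assumes "f \<in> borel_measurable borel"
  shows "(LINT y|lborel. f (c + y)) = integral\<^sup>L lborel f"
  using integral_distr[of "(+) c" lborel borel f] assms lborel_distr_plus[of c] by simp

text \<open>Difference quotients integrate to 0 by translation invariance, and they converge dominatedly
  to the directional derivative.\<close>

lemma integral_directional_derivative:
  fixes f :: "'a::euclidean_space \<Rightarrow> 'b::euclidean_space"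
  assumes der: "\<And>y. (f has_derivative f' y) (at y)" and cont: "continuous_on UNIV (\<lambda>y. f' y v)"
    and K: "compact K" "\<And>y. y \<notin> K \<Longrightarrow> f y = 0"
  shows "(LINT y|lborel. f' y v) = 0"
proof -
  have cf: "continuous_on UNIV f"
    using der has_derivative_continuous by (blast intro: continuous_at_imp_continuous_on)
  have mf: "f \<in> borel_measurable borel" by (rule borel_measurable_continuous_onI[OF cf])
  have mf': "(\<lambda>y. f' y v) \<in> borel_measurable borel" by (rule borel_measurable_continuous_onI[OF cont])
  have f'0: "f' y v = 0" if "y \<notin> K" for y
  proof -
    have "(f has_derivative (\<lambda>_. 0)) (at y)"
      by (rule has_derivative_transform_within_open[where s="-K" and f="\<lambda>_. 0"])
        (use that K compact_imp_closed in auto)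
    then show ?thesis using has_derivative_unique[OF der] by metis
  qed
  have intf: "integrable lborel f"
  proof -
    have "f = (\<lambda>y. indicator K y *\<^sub>R f y)" using K(2) by (auto simp: indicator_def)
    then show ?thesis using borel_integrable_compact[OF K(1) continuous_on_subset[OF cf]] by simp
  qed
  obtain C where C: "\<And>y. y \<in> K \<Longrightarrow> norm (f' y v) \<le> C"
    using compact_imp_bounded[OF compact_continuous_image[OF continuous_on_subset[OF cont, of K] K(1)]]
    unfolding bounded_iff by auto
  define C' where "C' = max C 0"
  have C': "norm (f' y v) \<le> C'" for y
    using C[of y] f'0[of y] by (cases "y \<in> K") (auto simp: C'_def)
  \<comment> \<open>All difference quotients of step at most 1 vanish off \<open>K'\<close>, the set swept out by \<open>K\<close> in the direction \<open>-v\<close>.\<close>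
  define K' where "K' = {y + z | y z. y \<in> K \<and> z \<in> (\<lambda>t. - (t *\<^sub>R v)) ` {0..1}}"
  have "compact K'" unfolding K'_def
    by (intro compact_sums K(1) compact_continuous_image continuous_intros compact_Icc)
  define t where "t n = inverse (real (Suc n))" for n
  have t: "0 < t n" "t n \<le> 1" for n by (auto simp: t_def field_simps)
  define s where "s n y = (1 / t n) *\<^sub>R (f (t n *\<^sub>R v + y) - f y)" for n y
  have s0: "integral\<^sup>L lborel (s n) = 0" for n
  proof -
    have "integrable lborel (\<lambda>y. f (t n *\<^sub>R v + y))"
      using integrable_distr_eq[of "(+) (t n *\<^sub>R v)" lborel borel f] mf lborel_distr_plus[of "t n *\<^sub>R v"] intf by simp
    then show ?thesis unfolding s_def
      using intf by (simp add: integral_translate_lborel[OF mf])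
  qed
  have line: "((\<lambda>r. f (r *\<^sub>R v + y)) has_derivative (\<lambda>h. f' (r *\<^sub>R v + y) (h *\<^sub>R v))) (at r)" for r y
  proof -
    have "((\<lambda>r. r *\<^sub>R v + y) has_derivative (\<lambda>r. r *\<^sub>R v)) (at r)"
      by (auto intro!: derivative_eq_intros)
    from has_derivative_compose[OF this der] show ?thesis .
  qed
  have lin: "f' y (r *\<^sub>R v) = r *\<^sub>R f' y v" for y r
    using linear_scale[OF has_derivative_linear[OF der]] .
  have bound: "norm (s n y) \<le> C' * indicator K' y" for n y
  proof (cases "y \<in> K'")
    case True
    have "\<exists>x\<in>{0<..<t n}. norm (f (t n *\<^sub>R v + y) - f (0 *\<^sub>R v + y)) \<le> norm (f' (x *\<^sub>R v + y) ((t n - 0) *\<^sub>R v))"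
      by (rule mvt_general[where f="\<lambda>r. f (r *\<^sub>R v + y)"])
        (use t(1) line has_derivative_continuous[OF line] in \<open>auto intro!: continuous_at_imp_continuous_on\<close>)
    then obtain x where "norm (f (t n *\<^sub>R v + y) - f y) \<le> norm (t n *\<^sub>R f' (x *\<^sub>R v + y) v)"
      by (auto simp: lin)
    also have "\<dots> \<le> t n * C'" using C' t(1)[of n] by (simp add: mult_left_mono)
    finally have "norm (f (t n *\<^sub>R v + y) - f y) / t n \<le> C'"
      using t(1)[of n] by (simp add: pos_divide_le_eq mult.commute)
    then show ?thesis using True t(1)[of n] by (simp add: s_def)
  next
    case False
    have "y \<notin> K"
    proof
      assume "y \<in> K"
      moreover have "0 \<in> (\<lambda>t. - (t *\<^sub>R v)) ` {0..1}" by (rule image_eqI[of _ _ 0]) auto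
      ultimately have "y + 0 \<in> K'" unfolding K'_def by blast
      then show False using False by simp
    qed
    moreover have "t n *\<^sub>R v + y \<notin> K"
    proof
      assume "t n *\<^sub>R v + y \<in> K"
      moreover have "- (t n *\<^sub>R v) \<in> (\<lambda>t. - (t *\<^sub>R v)) ` {0..1}"
        using t[of n] by auto
      ultimately have "(t n *\<^sub>R v + y) + - (t n *\<^sub>R v) \<in> K'" unfolding K'_def by blast
      then show False using False by simp
    qed
    ultimately show ?thesis using False K(2) by (simp add: s_def)
  qed
  have lim: "(\<lambda>n. s n y) \<longlonglongrightarrow> f' y v" for y
  proof -
    have l: "((\<lambda>h. norm (f (h *\<^sub>R v + y) - f y - h *\<^sub>R f' y v) / norm h) \<longlongrightarrow> 0) (at 0)"
      using line[where r=0 and y=y] by (simp add: has_derivative_at lin)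
    have e: "norm (f (h *\<^sub>R v + y) - f y - h *\<^sub>R f' y v) / norm h
        = norm ((f (h *\<^sub>R v + y) - f y) /\<^sub>R h - f' y v)" if "h \<noteq> 0" for h
    proof -
      have "(f (h *\<^sub>R v + y) - f y) /\<^sub>R h - f' y v = (f (h *\<^sub>R v + y) - f y - h *\<^sub>R f' y v) /\<^sub>R h"
        using that by (simp add: scaleR_diff_right)
      then show ?thesis by (simp add: divide_inverse mult.commute)
    qed
    have "((\<lambda>h. norm ((f (h *\<^sub>R v + y) - f y) /\<^sub>R h - f' y v)) \<longlongrightarrow> 0) (at 0)"
      by (rule Lim_transform_eventually[OF l], unfold eventually_at_filter, rule eventuallyI) (use e in blast)
    then have "((\<lambda>h. (f (h *\<^sub>R v + y) - f y) /\<^sub>R h) \<longlongrightarrow> f' y v) (at 0)"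
      by (simp add: tendsto_norm_zero_iff LIM_zero_iff)
    moreover have "filterlim t (at 0) sequentially"
      using LIMSEQ_inverse_real_of_nat t(1) unfolding t_def[abs_def]
      by (auto simp: filterlim_at intro!: eventuallyI)
    ultimately have "(\<lambda>n. (f (t n *\<^sub>R v + y) - f y) /\<^sub>R t n) \<longlonglongrightarrow> f' y v"
      by (rule filterlim_compose)
    then show ?thesis by (simp add: s_def divide_inverse)
  qed
  have iK': "integrable lborel (\<lambda>y. C' * indicator K' y)"
    using borel_integrable_compact[OF \<open>compact K'\<close>, of "\<lambda>_. C'"] by (simp add: mult.commute)
  have ms: "s n \<in> borel_measurable lborel" for n
  proof -
    have "continuous_on UNIV (s n)" unfolding s_def
      by (intro continuous_intros continuous_on_compose2[OF cf]) auto
    then show ?thesis using borel_measurable_continuous_onI by simp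
  qed
  have "(\<lambda>n. integral\<^sup>L lborel (s n)) \<longlonglongrightarrow> (LINT y|lborel. f' y v)"
    by (rule integral_dominated_convergence[OF _ ms iK']) (use mf' lim bound in auto)
  then show ?thesis by (simp add: s0 LIMSEQ_const_iff)
qed

context pseudo_riem
begin

lemma emeasure_vol_compact:
  assumes "compact K"
  shows "emeasure vol K < \<infinity>"
proof -
  have "\<exists>U. open U \<and> x \<in> U \<and> emeasure vol U < \<infinity>" for x
  proof -
    obtain i where x: "x \<in> cdom M i" using ex_chart by blast
    obtain \<eta> U L where L: "open U" "x \<in> U" "U \<subseteq> L" "compact L" "L \<subseteq> cdom M i"
      using manifold_bump[OF chart_open_cdom x] by metis
    have "compact (crd M i ` L)"
      by (rule compact_continuous_image[OF continuous_on_subset[OF continuous_crd L(5)] L(4)])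
    moreover have "continuous_on (crd M i ` L) (in_chart M i (dens i))"
      by (rule continuous_on_subset[OF continuous_dens_chart]) (use L(5) in blast)
    ultimately have "integrable lborel (\<lambda>y. indicator (crd M i ` L) y *\<^sub>R in_chart M i (dens i) y)"
      by (rule borel_integrable_compact)
    then have "(\<integral>\<^sup>+ y. ennreal (norm (indicator (crd M i ` L) y *\<^sub>R in_chart M i (dens i) y)) \<partial>lborel) < \<infinity>"
      by (simp add: integrable_iff_bounded)
    also have "(\<integral>\<^sup>+ y. ennreal (norm (indicator (crd M i ` L) y *\<^sub>R in_chart M i (dens i) y)) \<partial>lborel)
        = (\<integral>\<^sup>+ y. ennreal (sqrt \<bar>det (in_chart M i (g i) y)\<bar>) * indicator (crd M i ` (L \<inter> cdom M i)) y \<partial>lborel)"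
      using L(5) by (intro nn_integral_cong)
        (auto simp: indicator_def dens_in_chart Int_absorb2 in_chart_eq dens_def)
    finally have "emeasure vol L < \<infinity>"
      using L(4,5) emeasure_vol[of L i] emeasure_chart_measure[of L i] by (simp add: borel_compact)
    then have "emeasure vol U < \<infinity>"
      using emeasure_mono[of U L vol] L(3,4) by (auto simp: borel_compact)
    then show ?thesis using L by blast
  qed
  then obtain U where U: "\<And>x. open (U x)" "\<And>x. x \<in> U x" "\<And>x. emeasure vol (U x) < \<infinity>" by metis
  have "K \<subseteq> (\<Union>x\<in>K. U x)" using U(2) by blast
  then obtain C where C: "C \<subseteq> K" "finite C" "K \<subseteq> (\<Union>x\<in>C. U x)"
    using compactE_image[OF assms, of K U] U(1) by blast
  have "emeasure vol K \<le> emeasure vol (\<Union>x\<in>C. U x)"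
    by (rule emeasure_mono[OF C(3)]) (use U(1) in \<open>simp add: borel_open open_UN\<close>)
  also have "\<dots> \<le> (\<Sum>x\<in>C. emeasure vol (U x))"
    by (rule emeasure_subadditive_finite[OF C(2)]) (use U(1) in auto)
  also have "\<dots> < \<infinity>" using U(3) by (simp add: C(2) less_top)
  finally show ?thesis .
qed

lemma integrable_vol:
  fixes f :: "'m \<Rightarrow> 'b::euclidean_space"
  assumes "continuous_on UNIV f" "compact K" "\<And>x. x \<notin> K \<Longrightarrow> f x = 0"
  shows "integrable vol f"
proof -
  obtain B where B: "\<And>x. x \<in> K \<Longrightarrow> norm (f x) \<le> B"
    using compact_imp_bounded[OF compact_continuous_image[OF continuous_on_subset[OF assms(1), of K] assms(2)]]
    unfolding bounded_iff by auto
  have m: "f \<in> borel_measurable vol"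
    using borel_measurable_continuous_onI[OF assms(1)] by simp
  show ?thesis
    by (rule integrableI_bounded_set[OF _ m emeasure_vol_compact[OF assms(2)], where B=B])
      (use B assms in \<open>auto simp: borel_compact\<close>)
qed

lemma integral_vol_chart:
  fixes f :: "'m \<Rightarrow> 'b::euclidean_space"
  assumes f: "continuous_on (cdom M i) f" and K: "compact K" "K \<subseteq> cdom M i" "\<And>x. x \<notin> K \<Longrightarrow> f x = 0"
  shows "(LINT x|vol. f x) =
    (LINT y|lborel. (if y \<in> crd M i ` cdom M i then dens i (chart_inv i y) *\<^sub>R f (chart_inv i y) else 0))"
proof -
  let ?U = "crd M i ` cdom M i"
  let ?r = "\<lambda>y. if y \<in> ?U then chart_inv i y else undefined"
  let ?D = "\<lambda>y. sqrt \<bar>det (in_chart M i (g i) y)\<bar> * indicator ?U y"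
  have cU: "continuous_on UNIV f"
    by (rule continuous_zero_extension[OF open_cdom compact_imp_closed[OF K(1)] K(2) f K(3)])
  have m: "f \<in> borel_measurable borel" by (rule borel_measurable_continuous_onI[OF cU])
  have dm: "?D \<in> borel_measurable borel"
    using borel_measurable_continuous_on_indicator[OF _ continuous_dens_chart, of i] open_crd_cdom[of i]
    by (simp add: dens_in_chart mult.commute)
  have em: "density vol (indicator (cdom M i)) = chart_measure i"
  proof (rule measure_eqI)
    fix A assume "A \<in> sets (density vol (indicator (cdom M i)))"
    then have A: "A \<in> sets borel" by simp
    have "emeasure (density vol (indicator (cdom M i))) A = emeasure vol (A \<inter> cdom M i)"
    proof -
      have "emeasure (density vol (indicator (cdom M i))) A = (\<integral>\<^sup>+ x. indicator (cdom M i) x * indicator A x \<partial>vol)"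
        using A open_cdom by (intro emeasure_density borel_measurable_indicator) auto
      also have "\<dots> = (\<integral>\<^sup>+ x. indicator (A \<inter> cdom M i) x \<partial>vol)"
        by (simp add: indicator_inter_arith mult.commute)
      also have "\<dots> = emeasure vol (A \<inter> cdom M i)"
        using A open_cdom by (intro nn_integral_indicator) auto
      finally show ?thesis .
    qed
    also have "\<dots> = emeasure (chart_measure i) (A \<inter> cdom M i)"
      using A open_cdom by (intro emeasure_vol) auto
    also have "\<dots> = emeasure (chart_measure i) A"
      using A open_cdom by (simp add: emeasure_chart_measure)
    finally show "emeasure (density vol (indicator (cdom M i))) A = emeasure (chart_measure i) A" .
  qed simp
  have "(LINT x|vol. f x) = (LINT x|vol. (indicator (cdom M i) x :: real) *\<^sub>R f x)"
    by (rule Bochner_Integration.integral_cong) (use K(2,3) in \<open>auto simp: indicator_def\<close>)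
  also have "\<dots> = (LINT x|density vol (\<lambda>x. ennreal (indicator (cdom M i) x)). f x)"
    by (rule integral_density[symmetric]) (use m open_cdom in \<open>auto intro!: borel_measurable_indicator\<close>)
  also have "\<dots> = (LINT x|chart_measure i. f x)"
    using em by (simp add: ennreal_indicator)
  also have "\<dots> = (LINT y|density lborel (\<lambda>y. ennreal (sqrt \<bar>det (in_chart M i (g i) y)\<bar>) * indicator ?U y). f (?r y))"
    unfolding chart_measure_def by (rule integral_distr) (use m in auto)
  also have "(\<lambda>y. ennreal (sqrt \<bar>det (in_chart M i (g i) y)\<bar>) * indicator ?U y) = (\<lambda>y. ennreal (?D y))"
    by (auto simp: indicator_def)
  also have "(LINT y|density lborel (\<lambda>y. ennreal (?D y)). f (?r y)) = (LINT y|lborel. ?D y *\<^sub>R f (?r y))"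
    by (rule integral_density) (use dm m measurable_compose[OF measurable_chart_inv m] in auto)
  also have "\<dots> = (LINT y|lborel. (if y \<in> ?U then dens i (chart_inv i y) *\<^sub>R f (chart_inv i y) else 0))"
    by (rule Bochner_Integration.integral_cong) (auto simp: dens_def)
  finally show ?thesis .
qed

text \<open>The divergence theorem for a vector field with a single component.\<close>

lemma integral_pd_eq_0:
  fixes h :: "'m \<Rightarrow> 'b::euclidean_space"
  assumes h: "smooth_in M i (cdom M i) h" and K: "compact K" "K \<subseteq> cdom M i" "\<And>x. x \<notin> K \<Longrightarrow> h x = 0"
  shows "(LINT x|vol. (if x \<in> cdom M i then (1 / dens i x) *\<^sub>R pd M i a h x else 0)) = 0"
proof -
  let ?U = "crd M i ` cdom M i"
  let ?D = "\<lambda>y. frechet_derivative (in_chart M i h) (at y)"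
  define f where "f x = (if x \<in> cdom M i then (1 / dens i x) *\<^sub>R pd M i a h x else 0)" for x
  define F where "F y = (if y \<in> ?U then in_chart M i h y else 0)" for y
  define F' where "F' y v = (if y \<in> ?U then ?D y v else 0)" for y v
  let ?L = "crd M i ` K"
  have L: "compact ?L" by (rule compact_continuous_image[OF continuous_on_subset[OF continuous_crd K(2)] K(1)])
  have F0: "F y = 0" if "y \<notin> ?L" for y
  proof (cases "y \<in> ?U")
    case True
    then obtain x where "x \<in> cdom M i" "y = crd M i x" by blast
    then show ?thesis using that K(3)[of x] by (auto simp: F_def)
  qed (simp add: F_def)
  have pd0: "pd M i b h x = 0" if "x \<in> cdom M i" "x \<notin> K" for b x
  proof -
    have "chart_open i (cdom M i - K)"
      using open_cdom compact_imp_closed[OF K(1)] by (auto simp: chart_open_def)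
    then have "pd M i b h x = pd M i b (\<lambda>_. 0) x" by (rule pd_cong) (use that K(3) in auto)
    then show ?thesis by simp
  qed
  have cpd: "continuous_on (cdom M i) (pd M i a h)"
    by (rule smooth_in_continuous[OF chart_open_cdom smooth_in_pd[OF chart_open_cdom h]])
  have cf: "continuous_on (cdom M i) f"
  proof -
    have "continuous_on (cdom M i) (\<lambda>x. (1 / dens i x) *\<^sub>R pd M i a h x)"
      by (intro continuous_intros cpd smooth_in_continuous[OF chart_open_cdom dens_smooth])
        (use dens_pos in force)
    then show ?thesis by (rule continuous_on_eq) (simp add: f_def)
  qed
  have "(LINT x|vol. f x) = (LINT y|lborel. (if y \<in> ?U then dens i (chart_inv i y) *\<^sub>R f (chart_inv i y) else 0))"
    by (rule integral_vol_chart[OF cf K(1,2)]) (use pd0 in \<open>auto simp: f_def\<close>)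
  also have "\<dots> = (LINT y|lborel. F' y (axis a 1))"
  proof (rule Bochner_Integration.integral_cong[OF refl])
    fix y
    show "(if y \<in> ?U then dens i (chart_inv i y) *\<^sub>R f (chart_inv i y) else 0) = F' y (axis a 1)"
    proof (cases "y \<in> ?U")
      case True
      then obtain x where x: "x \<in> cdom M i" "y = crd M i x" by blast
      then show ?thesis using dens_pos[of x i] by (simp add: F'_def f_def pd_def)
    qed (simp add: F'_def)
  qed
  also have "\<dots> = 0"
  proof (rule integral_directional_derivative[OF _ _ L F0])
    have sm: "smooth_on ?U (in_chart M i h)" using h by (simp add: smooth_in_def)
    have out: "F' y v = 0" if "y \<notin> ?L" for y v
    proof (cases "y \<in> ?U")
      case True
      have "(in_chart M i h has_derivative (\<lambda>_. 0)) (at y)"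
      proof (rule has_derivative_transform_within_open[where s="?U - ?L" and f="\<lambda>_. 0"])
        show "open (?U - ?L)" using open_crd_cdom L compact_imp_closed by blast
        show "0 = in_chart M i h z" if "z \<in> ?U - ?L" for z
        proof -
          obtain x where "x \<in> cdom M i" "z = crd M i x" using \<open>z \<in> ?U - ?L\<close> by blast
          then show ?thesis using \<open>z \<in> ?U - ?L\<close> K(3)[of x] by auto
        qed
      qed (use True that in auto)
      then show ?thesis using frechet_derivative_at by (metis F'_def)
    qed (simp add: F'_def)
    show "(F has_derivative F' y) (at y)" for y
    proof (cases "y \<in> ?U")
      case True
      have "(F has_derivative ?D y) (at y)"
        by (rule has_derivative_transform_within_open[OF smooth_on_has_derivative[OF sm True] open_crd_cdom True])
          (simp add: F_def)
      moreover have "F' y = ?D y" using True by (auto simp: F'_def)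
      ultimately show ?thesis by simp
    next
      case False
      then have y: "y \<in> - ?L" using K(2) by blast
      have "F' y = (\<lambda>_. 0)" using out y by auto
      moreover have "(F has_derivative (\<lambda>_. 0)) (at y)"
        by (rule has_derivative_transform_within_open[where s="-?L" and f="\<lambda>_. 0"])
          (use F0 y compact_imp_closed[OF L] in auto)
      ultimately show ?thesis by simp
    qed
    have "continuous_on ?U (\<lambda>y. F' y (axis a 1))"
      by (rule continuous_on_eq[OF smooth_on_continuous[OF smooth_on_frechet_derivative[OF sm]]])
        (simp add: F'_def)
    then show "continuous_on UNIV (\<lambda>y. F' y (axis a 1))"
      by (rule continuous_zero_extension[OF open_crd_cdom compact_imp_closed[OF L], rotated])
        (use K(2) out in auto)
  qed
  finally show ?thesis by (simp add: f_def)
qed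

text \<open>The density is positive and nonempty open subsets of Euclidean space are not negligible.\<close>

lemma open_null_imp_empty:
  assumes "open W" "W \<in> null_sets vol"
  shows "W = {}"
proof (rule ccontr)
  assume "W \<noteq> {}"
  then obtain x i where x: "x \<in> W" "x \<in> cdom M i" using ex_chart by blast
  let ?V = "W \<inter> cdom M i"
  have V: "chart_open i ?V" using assms(1) open_cdom by (auto simp: chart_open_def)
  then have Vb: "?V \<in> sets borel" by (auto simp: chart_open_def)
  have "emeasure vol ?V \<le> emeasure vol W" by (rule emeasure_mono) (use assms in auto)
  then have "emeasure vol ?V = 0" using assms(2) by (simp add: null_setsD1)
  then have "(\<integral>\<^sup>+ y. ennreal (in_chart M i (dens i) y) * indicator (crd M i ` ?V) y \<partial>lborel) = 0"
    using emeasure_vol[OF Vb, of i] emeasure_chart_measure[OF Vb, of i] by (simp add: dens_in_chart Int_absorb2)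
  moreover have "(\<lambda>y. ennreal (in_chart M i (dens i) y) * indicator (crd M i ` ?V) y) \<in> borel_measurable borel"
    by (rule measurable_continuous_on_indicator[OF _ continuous_on_subset[OF continuous_dens_chart]])
      (use open_crd_image[OF V] in auto)
  ultimately have "AE y in lborel. ennreal (in_chart M i (dens i) y) * indicator (crd M i ` ?V) y = 0"
    by (simp add: nn_integral_0_iff_AE)
  then have "AE y in lborel. y \<notin> crd M i ` ?V"
  proof (rule AE_mp, intro AE_I2 impI notI)
    fix y assume *: "ennreal (in_chart M i (dens i) y) * indicator (crd M i ` ?V) y = 0" and "y \<in> crd M i ` ?V"
    then obtain z where z: "z \<in> cdom M i" "y = crd M i z" by blast
    then show False using * \<open>y \<in> crd M i ` ?V\<close> dens_pos[OF z(1)] by (simp add: ennreal_eq_0_iff)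
  qed
  then have "crd M i ` ?V \<in> null_sets lborel"
    using open_crd_image[OF V] by (subst AE_iff_null_sets) auto
  then have "negligible (crd M i ` ?V)"
    unfolding negligible_iff_null_sets by (simp add: null_sets_completionI)
  then show False using open_not_negligible[OF open_crd_image[OF V]] x by blast
qed

lemma integral_vol_nonneg_eq_0:
  fixes f :: "'m \<Rightarrow> real"
  assumes "continuous_on UNIV f" "compact K" "\<And>x. x \<notin> K \<Longrightarrow> f x = 0" "\<And>x. f x \<ge> 0"
    and "(LINT x|vol. f x) = 0"
  shows "f x = 0"
proof -
  have i: "integrable vol f" by (rule integrable_vol[OF assms(1-3)])
  then have AE: "AE x in vol. f x = 0"
    using integral_nonneg_eq_0_iff_AE[OF i] assms(4,5) by simp
  have o: "open {x. f x \<noteq> 0}"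
    by (rule open_Collect_neq[OF assms(1) continuous_on_const])
  have "{x. f x \<noteq> 0} \<in> null_sets vol"
    using AE o by (subst AE_iff_null_sets) auto
  then show ?thesis using open_null_imp_empty[OF o] by blast
qed

end

section \<open>Vector bundles: duals, endomorphisms and covariant derivatives\<close>

lemma bounded_bilinear_matrix_mult:
  "bounded_bilinear ((**) :: 'k::{real_normed_field,euclidean_space}^'a^'b \<Rightarrow> 'k^'c^'a \<Rightarrow> 'k^'c^'b)"
  by (rule bilinear_conv_bounded_bilinear[THEN iffD1])
    (auto simp: bilinear_def matrix_add_ldistrib matrix_matrix_mult_def vec_eq_iff
      scaleR_sum_right algebra_simps sum.distrib intro!: linearI)

lemma bounded_bilinear_matrix_vector:
  "bounded_bilinear ((*v) :: 'k::{real_normed_field,euclidean_space}^'a^'b \<Rightarrow> 'k^'a \<Rightarrow> 'k^'b)"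
  by (rule bilinear_conv_bounded_bilinear[THEN iffD1])
    (auto simp: bilinear_def matrix_vector_mult_def vec_eq_iff
      scaleR_sum_right algebra_simps sum.distrib intro!: linearI)

lemma bounded_linear_transpose:
  "bounded_linear (transpose :: 'k::{real_normed_field,euclidean_space}^'a^'b \<Rightarrow> 'k^'b^'a)"
  by (rule linear_conv_bounded_linear[THEN iffD1]) (auto simp: transpose_def vec_eq_iff intro!: linearI)

interpretation mv: bounded_bilinear "(*v) :: 'k::{real_normed_field,euclidean_space}^'a^'b \<Rightarrow> 'k^'a \<Rightarrow> 'k^'b"
  by (rule bounded_bilinear_matrix_vector)

interpretation mm: bounded_bilinear "(**) :: 'k::{real_normed_field,euclidean_space}^'a^'b \<Rightarrow> 'k^'c^'a \<Rightarrow> 'k^'c^'b"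
  by (rule bounded_bilinear_matrix_mult)

lemma sum_UNIV_pair: "(\<Sum>p\<in>UNIV. f (fst p) (snd p)) = (\<Sum>a\<in>UNIV. \<Sum>b\<in>UNIV. f a b)"
  by (simp add: sum.cartesian_product UNIV_Times_UNIV case_prod_unfold flip: UNIV_Times_UNIV)

context smooth_mfd
begin

lemma transition_self: "vector_bundle M V \<Longrightarrow> x \<in> cdom M i \<Longrightarrow> transition V i i x = mat 1"
  by (simp add: vector_bundle_def)

lemma transition_compose:
  "vector_bundle M V \<Longrightarrow> x \<in> cdom M i \<Longrightarrow> x \<in> cdom M j \<Longrightarrow> x \<in> cdom M k \<Longrightarrow>
   transition V i j x ** transition V j k x = transition V i k x"
  unfolding vector_bundle_def by blast

lemma transition_inverse:
  "vector_bundle M V \<Longrightarrow> x \<in> cdom M i \<Longrightarrow> x \<in> cdom M j \<Longrightarrow>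
   transition V i j x ** transition V j i x = mat 1"
  by (simp add: transition_compose transition_self)

lemma smooth_in_transition:
  fixes V :: "('i, 'm, 'n, 'k::{real_normed_field,euclidean_space}, 'r::finite) vbundle"
  assumes "vector_bundle M V"
  shows "smooth_in M i (cdom M i \<inter> cdom M j) (transition V i j)"
    "smooth_in M j (cdom M i \<inter> cdom M j) (transition V i j)"
proof -
  show 1: "smooth_in M i (cdom M i \<inter> cdom M j) (transition V i j)"
    using assms unfolding vector_bundle_def by blast
  show "smooth_in M j (cdom M i \<inter> cdom M j) (transition V i j)"
    by (rule smooth_in_change[OF chart_open_Int(1) _ 1]) auto
qed

lemma smooth_in_conn_form: "connection M V \<Longrightarrow> smooth_in M i (cdom M i) (\<lambda>x. conn_form V i x a)"
  unfolding connection_def by blast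

lemma connection_change:
  "connection M V \<Longrightarrow> x \<in> cdom M i \<Longrightarrow> x \<in> cdom M j \<Longrightarrow>
   pd M j a (transition V j i) x + conn_form V j x a ** transition V j i x =
     (\<Sum>b\<in>UNIV. jac M j i x a b *\<^sub>R (transition V j i x ** conn_form V i x b))"
  unfolding connection_def by blast

text \<open>This is the transformation law of the connection, solved for the derivative of the inverse transition function by
  differentiating \<open>G G\<^sup>-\<^sup>1 = 1\<close>.\<close>

lemma connection_change_inverse:
  fixes V :: "('i, 'm, 'n, 'k::{real_normed_field,euclidean_space}, 'r::finite) vbundle"
  assumes V: "vector_bundle M V" "connection M V" and x: "x \<in> cdom M i" "x \<in> cdom M j"
  shows "pd M j a (transition V i j) x =
    transition V i j x ** conn_form V j x a - (\<Sum>b\<in>UNIV. jac M j i x a b *\<^sub>R (conn_form V i x b ** transition V i j x))"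
proof -
  let ?W = "cdom M i \<inter> cdom M j"
  let ?G = "transition V j i" and ?H = "transition V i j"
  let ?S = "\<Sum>b\<in>UNIV. jac M j i x a b *\<^sub>R (?G x ** conn_form V i x b)"
  have W: "chart_open j ?W" by (rule chart_open_Int)
  have sG: "smooth_in M j ?W ?G" and sH: "smooth_in M j ?W ?H"
    using smooth_in_transition[OF V(1), where i=j and j=i] smooth_in_transition[OF V(1), where i=i and j=j] by (auto simp: Int_commute)
  have "pd M j a (\<lambda>y. ?G y ** ?H y) x = pd M j a (\<lambda>_. mat 1) x"
    by (rule pd_cong[OF W]) (use x transition_inverse[OF V(1)] in auto)
  then have "?G x ** pd M j a ?H x + pd M j a ?G x ** ?H x = 0"
    using pd_bilinear[OF bounded_bilinear_matrix_mult sG sH, of x a] x by simp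
  moreover have "pd M j a ?G x = ?S - conn_form V j x a ** ?G x"
    using connection_change[OF V(2) x, of a] by (simp add: algebra_simps)
  ultimately have "?G x ** pd M j a ?H x = conn_form V j x a ** (?G x ** ?H x) - ?S ** ?H x"
    by (simp add: mm.diff_left matrix_mul_assoc algebra_simps eq_neg_iff_add_eq_0)
  then have "?H x ** (?G x ** pd M j a ?H x) = ?H x ** (conn_form V j x a - ?S ** ?H x)"
    using transition_inverse[OF V(1) x(2,1)] by simp
  moreover have "?H x ** (?G x ** C) = C" for C :: "'k^'r^'r"
    using transition_inverse[OF V(1) x] by (simp add: matrix_mul_assoc)
  ultimately show ?thesis
    by (simp add: mm.diff_right mm.sum_left mm.sum_right mm.scaleR_left mm.scaleR_right matrix_mul_assoc[symmetric])
qed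

lemma vector_bundle_dual:
  fixes V :: "('i, 'm, 'n, 'k::{real_normed_field,euclidean_space}, 'r::finite) vbundle"
  assumes "vector_bundle M V"
  shows "vector_bundle M (dual_bundle V)"
  unfolding vector_bundle_def
proof (intro conjI allI ballI)
  fix i j k x
  show "transition (dual_bundle V) i i x = mat 1" if "x \<in> cdom M i"
    using that by (simp add: dual_bundle_def transition_self[OF assms] transpose_mat)
  show "transition (dual_bundle V) i j x ** transition (dual_bundle V) j k x = transition (dual_bundle V) i k x"
    if "x \<in> cdom M i \<inter> cdom M j \<inter> cdom M k"
    using that transition_compose[OF assms, of x k j i]
    by (simp add: dual_bundle_def matrix_transpose_mul[symmetric])
  have "smooth_in M i (cdom M i \<inter> cdom M j) (\<lambda>x. transpose (transition V j i x))"
    using smooth_in_transition(2)[OF assms, where i=j and j=i]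
    by (intro smooth_in_linear[OF chart_open_Int(1) bounded_linear_transpose]) (simp add: Int_commute)
  then show "smooth_in M i (cdom M i \<inter> cdom M j) (transition (dual_bundle V) i j)"
    by (simp add: dual_bundle_def)
qed

lemma connection_dual:
  fixes V :: "('i, 'm, 'n, 'k::{real_normed_field,euclidean_space}, 'r::finite) vbundle"
  assumes V: "vector_bundle M V" "connection M V"
  shows "connection M (dual_bundle V)"
  unfolding connection_def
proof (intro conjI allI ballI)
  fix i a
  show "smooth_in M i (cdom M i) (\<lambda>x. conn_form (dual_bundle V) i x a)"
    unfolding dual_bundle_def
    by (simp, intro smooth_in_minus smooth_in_linear[OF chart_open_cdom bounded_linear_transpose]
        chart_open_cdom smooth_in_conn_form V)
next
  fix i j a x assume "x \<in> cdom M i \<inter> cdom M j"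
  then have x: "x \<in> cdom M i" "x \<in> cdom M j" by auto
  have "pd M j a (\<lambda>y. transpose (transition V i j y)) x = transpose (pd M j a (transition V i j) x)"
    using x by (intro pd_linear[OF bounded_linear_transpose smooth_in_transition(2)[OF V(1)]]) auto
  also have "\<dots> = transpose (conn_form V j x a) ** transpose (transition V i j x)
     - (\<Sum>b\<in>UNIV. jac M j i x a b *\<^sub>R (transpose (transition V i j x) ** transpose (conn_form V i x b)))"
  proof -
    interpret t: bounded_linear "transpose :: 'k^'r^'r \<Rightarrow> 'k^'r^'r" by (rule bounded_linear_transpose)
    show ?thesis unfolding connection_change_inverse[OF V x]
      by (simp add: t.diff t.sum t.scaleR matrix_transpose_mul)
  qed
  finally show "pd M j a (transition (dual_bundle V) j i) x + conn_form (dual_bundle V) j x a ** transition (dual_bundle V) j i x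
    = (\<Sum>b\<in>UNIV. jac M j i x a b *\<^sub>R (transition (dual_bundle V) j i x ** conn_form (dual_bundle V) i x b))"
    by (simp add: dual_bundle_def mm.minus_left mm.minus_right sum_negf)
qed

lemma vector_bundle_end:
  fixes V :: "('i, 'm, 'n, 'k::{real_normed_field,euclidean_space}, 'r::finite) vbundle"
  assumes "vector_bundle M V"
  shows "vector_bundle M (end_bundle V)"
  unfolding vector_bundle_def
proof (intro conjI allI ballI)
  fix i j k x
  show "transition (end_bundle V) i i x = mat 1" if "x \<in> cdom M i"
    using that by (auto simp: end_bundle_def transition_self[OF assms] mat_def vec_eq_iff)
  show "transition (end_bundle V) i j x ** transition (end_bundle V) j k x = transition (end_bundle V) i k x"
    if "x \<in> cdom M i \<inter> cdom M j \<inter> cdom M k"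
  proof -
    have "(transition (end_bundle V) i j x ** transition (end_bundle V) j k x) $ cd $ ef =
        (transition V i j x ** transition V j k x) $ fst cd $ fst ef *
        (transition V k j x ** transition V j i x) $ snd ef $ snd cd" for cd ef
      by (simp add: end_bundle_def matrix_matrix_mult_def sum_UNIV_pair[of "\<lambda>a b. _ a b"] sum_product)
        (subst sum_UNIV_pair, simp add: mult_ac)
    then show ?thesis
      using that by (simp add: vec_eq_iff transition_compose[OF assms]) (simp add: end_bundle_def)
  qed
  have "smooth_in M i (cdom M i \<inter> cdom M j) (\<lambda>x. \<chi> cd ef. transition V i j x $ fst cd $ fst ef * transition V j i x $ snd ef $ snd cd)"
    using smooth_in_transition(1)[OF assms, where i=i and j=j] smooth_in_transition(2)[OF assms, where i=j and j=i]
    by (intro smooth_in_vec_lambda smooth_in_mult smooth_in_vec_nth chart_open_Int) (simp_all add: Int_commute)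
  then show "smooth_in M i (cdom M i \<inter> cdom M j) (transition (end_bundle V) i j)"
    by (simp add: end_bundle_def)
qed

text \<open>The transition functions of \<open>End(V)\<close> have the entries \<open>G\<^sub>c\<^sub>e (G\<^sup>-\<^sup>1)\<^sub>f\<^sub>d\<close>; the product rule reduces the claim to the laws
  for \<open>G\<close> and \<open>G\<^sup>-\<^sup>1\<close>.\<close>

lemma connection_end:
  fixes V :: "('i, 'm, 'n, 'k::{real_normed_field,euclidean_space}, 'r::finite) vbundle"
  assumes V: "vector_bundle M V" "connection M V"
  shows "connection M (end_bundle V)"
  unfolding connection_def
proof (intro conjI allI ballI)
  fix i a
  have c: "smooth_in M i (cdom M i) (\<lambda>x. conn_form V i x a $ c $ d)" for c d
    by (intro smooth_in_vec_nth chart_open_cdom smooth_in_conn_form V)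
  have "smooth_in M i (cdom M i) (\<lambda>x. (if P then conn_form V i x a $ c $ d else 0) - (if Q then conn_form V i x a $ e $ f else 0))"
    for P Q c d e f
    by (cases P; cases Q) (auto intro!: smooth_in_diff smooth_in_minus chart_open_cdom c smooth_in_const)
  then show "smooth_in M i (cdom M i) (\<lambda>x. conn_form (end_bundle V) i x a)"
    unfolding end_bundle_def by (simp, intro smooth_in_vec_lambda chart_open_cdom)
next
  fix i j a x assume "x \<in> cdom M i \<inter> cdom M j"
  then have x: "x \<in> cdom M i" "x \<in> cdom M j" by auto
  let ?W = "cdom M i \<inter> cdom M j"
  let ?G = "transition V j i" and ?H = "transition V i j" and ?A = "conn_form V"
  let ?E = "end_bundle V"
  have W: "chart_open j ?W" by (rule chart_open_Int)
  have sG: "smooth_in M j ?W ?G" and sH: "smooth_in M j ?W ?H"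
    using smooth_in_transition[OF V(1), where i=j and j=i] smooth_in_transition[OF V(1), where i=i and j=j] by (auto simp: Int_commute)
  have sE: "smooth_in M j ?W (transition ?E j i)"
    using smooth_in_transition[OF vector_bundle_end[OF V(1)], where i=j and j=i] by (auto simp: Int_commute)
  have xW: "x \<in> ?W" using x by simp
  have nth: "pd M j a T x $ c $ d = pd M j a (\<lambda>y. T y $ c $ d) x"
    if "smooth_in M j ?W T" for T :: "'m \<Rightarrow> 'k^'z^'w" and c d
    using pd_vec_nth[OF smooth_in_vec_nth[OF W that] xW] pd_vec_nth[OF that xW] by metis
  have pG: "pd M j a ?G x = (\<Sum>b\<in>UNIV. jac M j i x a b *\<^sub>R (?G x ** ?A i x b)) - ?A j x a ** ?G x"
    using connection_change[OF V(2) x, of a] by (simp add: algebra_simps)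
  note pH = connection_change_inverse[OF V x, of a]
  have ent: "(\<Sum>b\<in>UNIV. jac M j i x a b *\<^sub>R C b) $ c $ d = (\<Sum>b\<in>UNIV. jac M j i x a b *\<^sub>R C b $ c $ d)" for C :: "'n \<Rightarrow> 'k^'z^'w" and c d
    by simp
  show "pd M j a (transition ?E j i) x + conn_form ?E j x a ** transition ?E j i x =
      (\<Sum>b\<in>UNIV. jac M j i x a b *\<^sub>R (transition ?E j i x ** conn_form ?E i x b))"
  proof (rule vec_eq_iff[THEN iffD2], rule allI, rule vec_eq_iff[THEN iffD2], rule allI)
    fix cd ef :: "'r \<times> 'r"
    obtain c d e f where cd: "cd = (c, d)" "ef = (e, f)" by (metis surj_pair)
    have 1: "pd M j a (transition ?E j i) x $ cd $ ef = ?G x $ c $ e * pd M j a ?H x $ f $ d + pd M j a ?G x $ c $ e * ?H x $ f $ d"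
    proof -
      have "pd M j a (transition ?E j i) x $ cd $ ef = pd M j a (\<lambda>y. ?G y $ c $ e * ?H y $ f $ d) x"
        unfolding nth[OF sE] by (simp add: end_bundle_def cd)
      also have "\<dots> = ?G x $ c $ e * pd M j a (\<lambda>y. ?H y $ f $ d) x + pd M j a (\<lambda>y. ?G y $ c $ e) x * ?H x $ f $ d"
        by (rule pd_bilinear[OF bounded_bilinear_mult _ _ xW x(2)])
          (intro smooth_in_vec_nth W sG sH)+
      finally show ?thesis unfolding nth[OF sG] nth[OF sH] .
    qed
    have 2: "(conn_form ?E j x a ** transition ?E j i x) $ cd $ ef
        = (?A j x a ** ?G x) $ c $ e * ?H x $ f $ d - ?G x $ c $ e * (?H x ** ?A j x a) $ f $ d"
    proof -
      have "(conn_form ?E j x a ** transition ?E j i x) $ cd $ ef = (\<Sum>u\<in>UNIV. \<Sum>v\<in>UNIV.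
          ((if d = v then ?A j x a $ c $ u else 0) - (if c = u then ?A j x a $ v $ d else 0)) * (?G x $ u $ e * ?H x $ f $ v))"
        using sum_UNIV_pair[of "\<lambda>u v. ((if d = v then ?A j x a $ c $ u else 0) -
            (if c = u then ?A j x a $ v $ d else 0)) * (?G x $ u $ e * ?H x $ f $ v)"]
        by (simp add: matrix_matrix_mult_def end_bundle_def cd cong: if_cong)
      also have "\<dots> = (\<Sum>u\<in>UNIV. \<Sum>v\<in>UNIV. if d = v then ?A j x a $ c $ u * (?G x $ u $ e * ?H x $ f $ v) else 0)
          - (\<Sum>u\<in>UNIV. \<Sum>v\<in>UNIV. if c = u then ?A j x a $ v $ d * (?G x $ u $ e * ?H x $ f $ v) else 0)"
        unfolding sum_subtractf[symmetric] by (intro sum.cong refl) (simp add: left_diff_distrib)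
      also have "(\<Sum>u\<in>UNIV. \<Sum>v\<in>UNIV. if c = u then ?A j x a $ v $ d * (?G x $ u $ e * ?H x $ f $ v) else 0)
          = (\<Sum>v\<in>UNIV. ?A j x a $ v $ d * (?G x $ c $ e * ?H x $ f $ v))"
        by (subst sum.swap) simp
      finally show ?thesis
        by (simp add: matrix_matrix_mult_def sum_distrib_left sum_distrib_right mult_ac)
    qed
    have 3: "(transition ?E j i x ** conn_form ?E i x b) $ cd $ ef
        = (?G x ** ?A i x b) $ c $ e * ?H x $ f $ d - ?G x $ c $ e * (?A i x b ** ?H x) $ f $ d" for b
    proof -
      have "(transition ?E j i x ** conn_form ?E i x b) $ cd $ ef = (\<Sum>u\<in>UNIV. \<Sum>v\<in>UNIV.
          ?G x $ c $ u * ?H x $ v $ d * ((if v = f then ?A i x b $ u $ e else 0) - (if u = e then ?A i x b $ f $ v else 0)))"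
        using sum_UNIV_pair[of "\<lambda>u v. ?G x $ c $ u * ?H x $ v $ d *
          ((if v = f then ?A i x b $ u $ e else 0) - (if u = e then ?A i x b $ f $ v else 0))"]
        by (simp add: matrix_matrix_mult_def end_bundle_def cd cong: if_cong)
      also have "\<dots> = (\<Sum>u\<in>UNIV. \<Sum>v\<in>UNIV. if v = f then ?G x $ c $ u * ?H x $ v $ d * ?A i x b $ u $ e else 0)
          - (\<Sum>u\<in>UNIV. \<Sum>v\<in>UNIV. if u = e then ?G x $ c $ u * ?H x $ v $ d * ?A i x b $ f $ v else 0)"
        unfolding sum_subtractf[symmetric] by (intro sum.cong refl) (simp add: right_diff_distrib)
      also have "(\<Sum>u\<in>UNIV. \<Sum>v\<in>UNIV. if u = e then ?G x $ c $ u * ?H x $ v $ d * ?A i x b $ f $ v else 0)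
          = (\<Sum>v\<in>UNIV. ?G x $ c $ e * ?H x $ v $ d * ?A i x b $ f $ v)"
        by (subst sum.swap) simp
      finally show ?thesis
        by (simp add: matrix_matrix_mult_def sum_distrib_left sum_distrib_right mult_ac)
    qed
    show "(pd M j a (transition ?E j i) x + conn_form ?E j x a ** transition ?E j i x) $ cd $ ef =
      (\<Sum>b\<in>UNIV. jac M j i x a b *\<^sub>R (transition ?E j i x ** conn_form ?E i x b)) $ cd $ ef"
      unfolding ent 3 vector_add_component 1 2 pG pH vector_minus_component
      by (simp add: algebra_simps sum_subtractf sum_distrib_left scaleR_diff_right sum_distrib_right)
  qed
qed

end

section \<open>Sums over index lists\<close>

lemma lists_length_Suc: "{I. length I = Suc k} = (\<lambda>(b, J). b # J) ` (UNIV \<times> {J. length J = k})"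
  by (auto simp: length_Suc_conv image_iff)

lemma finite_lists_length [simp]: "finite {I :: 'n::finite list. length I = k}"
  using finite_lists_length_eq[of "UNIV :: 'n set" k] by simp

lemma sum_lists_Suc:
  "(\<Sum>I | length I = Suc k. f I) = (\<Sum>b\<in>UNIV. \<Sum>J | length J = k. f (b # J))"
  for f :: "'n::finite list \<Rightarrow> 'a::comm_monoid_add"
proof -
  have "inj_on (\<lambda>(b, J). b # J) (UNIV \<times> {J :: 'n list. length J = k})" by (auto simp: inj_on_def)
  then show ?thesis
    unfolding lists_length_Suc by (simp add: sum.reindex sum.cartesian_product case_prod_unfold)
qed

lemma sum_lists_0' [simp]: "(\<Sum>I | I = []. f I) = f []"
  by simp

lemma sum_lists_1: "(\<Sum>I | length I = Suc 0. f I) = (\<Sum>b\<in>UNIV. f [b])"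
  for f :: "'n::finite list \<Rightarrow> 'a::comm_monoid_add"
  by (simp add: sum_lists_Suc)

lemma sum_lists_2: "(\<Sum>I | length I = Suc (Suc 0). f I) = (\<Sum>b\<in>UNIV. \<Sum>c\<in>UNIV. f [b, c])"
  for f :: "'n::finite list \<Rightarrow> 'a::comm_monoid_add"
  by (simp add: sum_lists_Suc)

lemma sum_lists_prod:
  fixes f :: "nat \<Rightarrow> 'n::finite \<Rightarrow> 'a::comm_semiring_1"
  shows "(\<Sum>J | length J = k. \<Prod>t<k. f t (J ! t)) = (\<Prod>t<k. \<Sum>b\<in>UNIV. f t b)"
proof (induction k arbitrary: f)
  case (Suc k)
  show ?case
    unfolding sum_lists_Suc prod.lessThan_Suc_shift comp_def
    by (simp add: Suc[of "\<lambda>t. f (Suc t)"] sum_distrib_left[symmetric] sum_distrib_right[symmetric])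
qed simp


section \<open>Bundle-valued forms\<close>

lemma alt_tensors_le_1: "k \<le> 1 \<Longrightarrow> w \<in> alt_tensors k \<longleftrightarrow> (\<forall>I. length I \<noteq> k \<longrightarrow> w I = 0)"
  unfolding alt_tensors_def by auto

context smooth_mfd
begin

definition bundle_conn ::
  "('i, 'm, 'n, 'k::{real_normed_field,euclidean_space}, 'r::finite) vbundle \<Rightarrow> bool" where
  "bundle_conn V \<longleftrightarrow> vector_bundle M V \<and> connection M V"

lemma bundle_conn_dual: "bundle_conn V \<Longrightarrow> bundle_conn (dual_bundle V)"
  and bundle_conn_end: "bundle_conn V \<Longrightarrow> bundle_conn (end_bundle V)"
  by (simp_all add: bundle_conn_def vector_bundle_dual vector_bundle_end connection_dual connection_end)

definition change ::
  "('i, 'm, 'n, 'k::{real_normed_field,euclidean_space}, 'r::finite) vbundle \<Rightarrow> nat \<Rightarrow> 'i \<Rightarrow> 'i \<Rightarrow> 'm \<Rightarrow>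
   ('n list \<Rightarrow> 'k^'r) \<Rightarrow> 'n list \<Rightarrow> 'k^'r" where
  "change V k j i x u I = (\<Sum>J | length J = k. (\<Prod>t<k. jac M j i x (I ! t) (J ! t)) *\<^sub>R (transition V j i x *v u J))"

lemma forms_iff:
  "\<omega> \<in> forms M V k \<longleftrightarrow>
     (\<forall>i x. \<omega> i x \<in> alt_tensors k) \<and>
     (\<forall>i x I. x \<notin> cdom M i \<longrightarrow> \<omega> i x I = 0) \<and>
     (\<forall>i I. smooth_in M i (cdom M i) (\<lambda>x. \<omega> i x I)) \<and>
     (\<forall>i j I. \<forall>x\<in>cdom M i \<inter> cdom M j. length I = k \<longrightarrow> \<omega> j x I = change V k j i x (\<omega> i x) I)"
  unfolding forms_def change_def by blast

lemma forms_alt: "\<omega> \<in> forms M V k \<Longrightarrow> \<omega> i x \<in> alt_tensors k"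
  and forms_outside: "\<omega> \<in> forms M V k \<Longrightarrow> x \<notin> cdom M i \<Longrightarrow> \<omega> i x I = 0"
  and forms_smooth: "\<omega> \<in> forms M V k \<Longrightarrow> smooth_in M i (cdom M i) (\<lambda>x. \<omega> i x I)"
  and forms_change: "\<omega> \<in> forms M V k \<Longrightarrow> x \<in> cdom M i \<Longrightarrow> x \<in> cdom M j \<Longrightarrow> length I = k \<Longrightarrow>
    \<omega> j x I = change V k j i x (\<omega> i x) I"
  by (simp_all add: forms_iff)

lemma forms_length: "\<omega> \<in> forms M V k \<Longrightarrow> length I \<noteq> k \<Longrightarrow> \<omega> i x I = 0"
  using forms_alt[of \<omega> V k i x] by (simp add: alt_tensors_def)

lemma form_eqI:
  assumes "\<omega> \<in> forms M V k" "\<omega>' \<in> forms M V k"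
    and "\<And>i x I. x \<in> cdom M i \<Longrightarrow> length I = k \<Longrightarrow> \<omega> i x I = \<omega>' i x I"
  shows "\<omega> = \<omega>'"
proof (intro ext)
  fix i x I
  show "\<omega> i x I = \<omega>' i x I"
    using assms forms_outside[OF assms(1)] forms_outside[OF assms(2)] forms_length[OF assms(1)] forms_length[OF assms(2)]
    by (cases "x \<in> cdom M i \<and> length I = k") auto
qed

lemma change_0: "change V 0 j i x u [] = transition V j i x *v u []"
  by (simp add: change_def)

lemma change_1: "change V (Suc 0) j i x u [a] = (\<Sum>b\<in>UNIV. jac M j i x a b *\<^sub>R (transition V j i x *v u [b]))"
  by (simp add: change_def sum_lists_1)

lemma change_2: "change V (Suc (Suc 0)) j i x u [a, c] =
   (\<Sum>b\<in>UNIV. \<Sum>d\<in>UNIV. (jac M j i x a b * jac M j i x c d) *\<^sub>R (transition V j i x *v u [b, d]))"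
  by (simp add: change_def sum_lists_2 prod.lessThan_Suc_shift)

text \<open>The cocycle identities of the Jacobian matrices and of the transition functions.\<close>

lemma change_compose:
  assumes V: "vector_bundle M V" and x: "x \<in> cdom M i" "x \<in> cdom M j" "x \<in> cdom M l"
  shows "change V k l j x (change V k j i x u) I = change V k l i x u I"
proof -
  have "change V k l j x (change V k j i x u) I =
    (\<Sum>K | length K = k. \<Sum>J | length J = k.
      ((\<Prod>t<k. jac M l j x (I ! t) (J ! t)) * (\<Prod>t<k. jac M j i x (J ! t) (K ! t))) *\<^sub>R (transition V l i x *v u K))"
    unfolding change_def
    by (simp add: mv.sum_right mv.scaleR_right scaleR_sum_right matrix_vector_mul_assoc transition_compose[OF V x(3,2,1)])
      (rule sum.swap)
  also have "\<dots> = (\<Sum>K | length K = k. (\<Prod>t<k. jac M l i x (I ! t) (K ! t)) *\<^sub>R (transition V l i x *v u K))"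
  proof (rule sum.cong[OF refl])
    fix K :: "'n list"
    have "(\<Sum>J | length J = k. (\<Prod>t<k. jac M l j x (I ! t) (J ! t)) * (\<Prod>t<k. jac M j i x (J ! t) (K ! t)))
        = (\<Prod>t<k. jac M l i x (I ! t) (K ! t))"
      using sum_lists_prod[where k=k and f="\<lambda>t b. jac M l j x (I ! t) b * jac M j i x b (K ! t)"]
      by (simp add: prod.distrib jac_compose[OF x(2,3,1), symmetric])
    then show "(\<Sum>J | length J = k. ((\<Prod>t<k. jac M l j x (I ! t) (J ! t)) * (\<Prod>t<k. jac M j i x (J ! t) (K ! t))) *\<^sub>R
        (transition V l i x *v u K)) = (\<Prod>t<k. jac M l i x (I ! t) (K ! t)) *\<^sub>R (transition V l i x *v u K)"
      by (simp add: scaleR_sum_left[symmetric])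
  qed
  finally show ?thesis by (simp add: change_def)
qed

lemma change_self:
  assumes V: "vector_bundle M V" and x: "x \<in> cdom M i" and I: "length I = k"
  shows "change V k i i x u I = u I"
proof -
  have "(\<Prod>t<k. jac M i i x (I ! t) (J ! t)) = (if J = I then 1 else 0)" if J: "length J = k" for J
  proof (cases "J = I")
    case False
    then obtain t where "t < k" "I ! t \<noteq> J ! t" using J I by (metis nth_equalityI)
    then show ?thesis using False by (auto simp: jac_self[OF x] prod_zero_iff)
  qed (simp add: jac_self[OF x])
  then have "change V k i i x u I = (\<Sum>J | length J = k. (if J = I then u J else 0))"
    unfolding change_def by (intro sum.cong refl) (simp add: transition_self[OF V x])
  also have "\<dots> = u I" using I by (subst sum.delta) auto
  finally show ?thesis .
qed

lemma smooth_in_change_form: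
  assumes V: "vector_bundle M V" and W: "chart_open i W" "W \<subseteq> cdom M j"
    and u: "\<And>J. smooth_in M i W (\<lambda>x. u x J)"
  shows "smooth_in M j W (\<lambda>x. change V k j i x (u x) I)"
proof -
  have Wj: "chart_open j W" and sub: "W \<subseteq> cdom M i \<inter> cdom M j" using W by (auto simp: chart_open_def)
  show ?thesis unfolding change_def
    by (intro smooth_in_sum smooth_in_scaleR smooth_in_prod smooth_in_bilinear[OF Wj bounded_bilinear_matrix_vector] Wj
        smooth_in_change[OF W u] smooth_in_subset[OF smooth_in_jac sub]
        smooth_in_subset[OF _ sub, unfolded Int_commute[of "cdom M i"]] smooth_in_subset[OF _ sub])
      (use smooth_in_transition(1)[OF V, where i=j and j=i] in \<open>simp add: Int_commute\<close>)
qed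

text \<open>Components given in one chart that vanish off a compact subset of it are transported to the other charts and
  extended by 0.\<close>

definition extend_form ::
  "('i, 'm, 'n, 'k::{real_normed_field,euclidean_space}, 'r::finite) vbundle \<Rightarrow> nat \<Rightarrow> 'i \<Rightarrow>
   ('m \<Rightarrow> 'n list \<Rightarrow> 'k^'r) \<Rightarrow> ('i, 'm, 'n, 'k, 'r) form" where
  "extend_form V k i u = (\<lambda>j x I. if x \<in> cdom M i \<inter> cdom M j \<and> length I = k then change V k j i x (u x) I else 0)"

lemma extend_form:
  assumes V: "vector_bundle M V" and k: "k \<le> 1"
    and u: "\<And>J. smooth_in M i (cdom M i) (\<lambda>x. u x J)"
    and K: "compact K" "K \<subseteq> cdom M i" "\<And>x J. x \<notin> K \<Longrightarrow> u x J = 0"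
  shows "extend_form V k i u \<in> forms M V k"
    and "x \<in> cdom M i \<Longrightarrow> length I = k \<Longrightarrow> extend_form V k i u i x I = u x I"
    and "x \<notin> K \<Longrightarrow> extend_form V k i u j x I = 0"
proof -
  show 0: "extend_form V k i u j x I = 0" if "x \<notin> K" for x j I
    using K(3)[OF that] by (simp add: extend_form_def change_def)
  show "x \<in> cdom M i \<Longrightarrow> length I = k \<Longrightarrow> extend_form V k i u i x I = u x I"
    by (simp add: extend_form_def change_self[OF V])
  show "extend_form V k i u \<in> forms M V k"
    unfolding forms_iff
  proof (intro conjI allI ballI impI)
    show "extend_form V k i u j x \<in> alt_tensors k" for j x
      using k by (simp add: alt_tensors_le_1 extend_form_def)
    show "extend_form V k i u j x I = 0" if "x \<notin> cdom M j" for j x I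
      using that by (simp add: extend_form_def)
    show "extend_form V k i u l x I = change V k l j x (extend_form V k i u j x) I"
      if x: "x \<in> cdom M j \<inter> cdom M l" and I: "length I = k" for j l x I
    proof (cases "x \<in> cdom M i")
      case True
      have "change V k l j x (extend_form V k i u j x) I = change V k l j x (change V k j i x (u x)) I"
        using x True unfolding change_def[of V k l] by (intro sum.cong refl) (simp add: extend_form_def)
      also have "\<dots> = change V k l i x (u x) I"
        using x True by (intro change_compose[OF V]) auto
      finally show ?thesis using x True I by (simp add: extend_form_def)
    next
      case False
      then show ?thesis by (simp add: extend_form_def change_def)
    qed
    show "smooth_in M j (cdom M j) (\<lambda>x. extend_form V k i u j x I)" for j I
    proof (rule smooth_in_local)
      fix x assume x: "x \<in> cdom M j"
      show "\<exists>T. chart_open j T \<and> x \<in> T \<and> smooth_in M j T (\<lambda>x. extend_form V k i u j x I)"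
      proof (cases "x \<in> K")
        case True
        have "smooth_in M j (cdom M i \<inter> cdom M j) (\<lambda>x. extend_form V k i u j x I)"
        proof (cases "length I = k")
          case True
          have "smooth_in M j (cdom M i \<inter> cdom M j) (\<lambda>x. change V k j i x (u x) I)"
            by (rule smooth_in_change_form[OF V chart_open_Int(1)]) (auto intro: smooth_in_subset[OF u])
          then show ?thesis
            by (rule smooth_in_cong[OF chart_open_Int(2), rotated]) (simp add: extend_form_def True)
        qed (simp add: extend_form_def smooth_in_const)
        then show ?thesis using True x K(2) chart_open_Int(2) by blast
      next
        case False
        have o: "chart_open j (cdom M j - K)"
          using open_cdom compact_imp_closed[OF K(1)] by (auto simp: chart_open_def)
        moreover have "smooth_in M j (cdom M j - K) (\<lambda>x. extend_form V k i u j x I)"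
          by (rule smooth_in_cong[OF o _ smooth_in_const[of j _ 0]]) (use 0 in auto)
        ultimately show ?thesis using False x by blast
      qed
    qed
  qed
qed

lemma fscale_forms:
  assumes "smooth_fun M f" "\<omega> \<in> forms M V k"
  shows "fscale f \<omega> \<in> forms M V k"
  unfolding forms_iff
proof (intro conjI allI ballI impI)
  show "fscale f \<omega> i x \<in> alt_tensors k" for i x
    using forms_alt[OF assms(2), of i x] by (simp add: alt_tensors_def fscale_def)
  show "fscale f \<omega> i x I = 0" if "x \<notin> cdom M i" for i x I
    using forms_outside[OF assms(2) that] by (simp add: fscale_def)
  show "smooth_in M i (cdom M i) (\<lambda>x. fscale f \<omega> i x I)" for i I
    unfolding fscale_def using assms(1)
    by (intro smooth_in_scaleR chart_open_cdom forms_smooth[OF assms(2)]) (simp add: smooth_fun_def)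
  show "fscale f \<omega> j x I = change V k j i x (fscale f \<omega> i x) I"
    if "x \<in> cdom M i \<inter> cdom M j" "length I = k" for i j x I
    using forms_change[OF assms(2), of x i j I] that
    by (simp add: fscale_def change_def mv.scaleR_right scaleR_sum_right mult.commute)
qed

lemma forms_add:
  assumes "\<omega> \<in> forms M V k" "\<omega>' \<in> forms M V k"
  shows "(\<lambda>i x I. \<omega> i x I + \<omega>' i x I) \<in> forms M V k"
  unfolding forms_iff
proof (intro conjI allI ballI impI)
  show "(\<lambda>I. \<omega> i x I + \<omega>' i x I) \<in> alt_tensors k" for i x
    using forms_alt[OF assms(1), of i x] forms_alt[OF assms(2), of i x] by (simp add: alt_tensors_def)
  show "\<omega> i x I + \<omega>' i x I = 0" if "x \<notin> cdom M i" for i x I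
    using forms_outside[OF assms(1) that] forms_outside[OF assms(2) that] by simp
  show "smooth_in M i (cdom M i) (\<lambda>x. \<omega> i x I + \<omega>' i x I)" for i I
    by (intro smooth_in_add chart_open_cdom forms_smooth[OF assms(1)] forms_smooth[OF assms(2)])
  show "\<omega> j x I + \<omega>' j x I = change V k j i x (\<lambda>I. \<omega> i x I + \<omega>' i x I) I"
    if "x \<in> cdom M i \<inter> cdom M j" "length I = k" for i j x I
    using forms_change[OF assms(1), of x i j I] forms_change[OF assms(2), of x i j I] that
    by (simp add: change_def mv.add_right scaleR_right_distrib sum.distrib)
qed

lemma forms_minus: "\<omega> \<in> forms M V k \<Longrightarrow> (\<lambda>i x I. - \<omega> i x I) \<in> forms M V k"
  using fscale_forms[OF smooth_fun_const[of "-1"]] by (simp add: fscale_def)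

lemma forms_diff:
  assumes "\<omega> \<in> forms M V k" "\<omega>' \<in> forms M V k"
  shows "(\<lambda>i x I. \<omega> i x I - \<omega>' i x I) \<in> forms M V k"
  using forms_add[OF assms(1) forms_minus[OF assms(2)]] by simp

lemma forms_zero: "(\<lambda>_ _ _. 0) \<in> forms M V k"
  by (simp add: forms_iff alt_tensors_def smooth_in_const change_def)

lemma ex_form_with_value:
  assumes V: "vector_bundle M V" and k: "k \<le> 1" and x: "x \<in> cdom M i" and w: "w \<in> alt_tensors k"
  obtains \<omega> where "\<omega> \<in> forms M V k" "\<omega> i x = w"
proof -
  obtain \<eta> U K where b: "smooth_fun M \<eta>" "x \<in> U" "compact K" "K \<subseteq> cdom M i"
    "\<And>y. y \<in> U \<Longrightarrow> \<eta> y = 1" "\<And>y. y \<notin> K \<Longrightarrow> \<eta> y = 0"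
    using manifold_bump[OF chart_open_cdom x] by metis
  let ?u = "\<lambda>y J. \<eta> y *\<^sub>R w J"
  have s: "smooth_in M i (cdom M i) (\<lambda>y. ?u y J)" for J
    using b(1) by (intro smooth_in_scaleR chart_open_cdom smooth_in_const) (simp add: smooth_fun_def)
  have z: "?u y J = 0" if "y \<notin> K" for y J using b(6)[OF that] by simp
  have e1: "extend_form V k i ?u \<in> forms M V k"
    by (rule extend_form(1)[OF V k s b(3,4)]) (rule z)
  have e2: "extend_form V k i ?u i x I = ?u x I" if "length I = k" for I
    by (rule extend_form(2)[OF V k s b(3,4) _ x that]) (rule z)
  have "extend_form V k i ?u i x I = w I" for I
  proof (cases "length I = k")
    case True
    then show ?thesis using e2[OF True] b(2,5) by simp
  next
    case False
    then show ?thesis using w by (simp add: extend_form_def alt_tensors_def)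
  qed
  then show thesis using that[OF e1] by blast
qed


section \<open>The coupled exterior derivative\<close>

lemma smooth_in_cov:
  assumes "connection M V" "chart_open i W" "smooth_in M i W s"
  shows "smooth_in M i W (cov M V i a s)"
proof -
  have "smooth_in M i W (\<lambda>x. conn_form V i x a)"
    by (rule smooth_in_subset[OF smooth_in_conn_form[OF assms(1)]]) (use assms(2) in \<open>simp add: chart_open_def\<close>)
  then have "smooth_in M i W (\<lambda>x. pd M i a s x + conn_form V i x a *v s x)"
    by (intro smooth_in_add[OF assms(2)] smooth_in_pd[OF assms(2,3)]
        smooth_in_bilinear[OF assms(2) bounded_bilinear_matrix_vector _ assms(3)])
  then show ?thesis by (simp add: cov_def[abs_def])
qed

lemma cov_cong:
  assumes "chart_open i W" "x \<in> W" "\<And>y. y \<in> W \<Longrightarrow> s y = t y"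
  shows "cov M V i a s x = cov M V i a t x"
  unfolding cov_def by (simp only: pd_cong[OF assms] assms(3)[OF assms(2)])

lemma cov_add:
  assumes "smooth_in M i W s" "smooth_in M i W t" "x \<in> W"
  shows "cov M V i a (\<lambda>y. s y + t y) x = cov M V i a s x + cov M V i a t x"
  by (simp add: cov_def pd_add[OF assms] mv.add_right)

lemma cov_sum:
  assumes "chart_open i W" "\<And>k. k \<in> A \<Longrightarrow> smooth_in M i W (s k)" "x \<in> W"
  shows "cov M V i a (\<lambda>y. \<Sum>k\<in>A. s k y) x = (\<Sum>k\<in>A. cov M V i a (s k) x)"
proof -
  have "pd M i a (\<lambda>y. \<Sum>k\<in>A. s k y) x = (\<Sum>k\<in>A. pd M i a (s k) x)"
    by (rule pd_sum[OF assms(1) _ assms(3)]) (rule assms(2))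
  then show ?thesis by (simp add: cov_def mv.sum_right sum.distrib)
qed

lemma cov_scaleR:
  assumes "smooth_in M i W f" "smooth_in M i W s" "x \<in> W" "x \<in> cdom M i"
  shows "cov M V i a (\<lambda>y. f y *\<^sub>R s y) x = pd M i a f x *\<^sub>R s x + f x *\<^sub>R cov M V i a s x"
  by (simp add: cov_def pd_scaleR[OF assms] mv.scaleR_right scaleR_right_distrib)

lemma cov_zero [simp]: "cov M V i a (\<lambda>_. 0) x = 0"
  by (simp add: cov_def)

text \<open>The derivative of the transition function cancels against the inhomogeneous term in the law for connection forms.\<close>

lemma cov_change:
  fixes V :: "('i, 'm, 'n, 'k::{real_normed_field,euclidean_space}, 'r::finite) vbundle"
  assumes V: "vector_bundle M V" "connection M V" and s: "smooth_in M i (cdom M i) s"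
    and x: "x \<in> cdom M i" "x \<in> cdom M j"
  shows "cov M V j a (\<lambda>y. transition V j i y *v s y) x =
    (\<Sum>b\<in>UNIV. jac M j i x a b *\<^sub>R (transition V j i x *v cov M V i b s x))"
proof -
  let ?W = "cdom M i \<inter> cdom M j" and ?G = "transition V j i"
  have sG: "smooth_in M j ?W ?G"
    using smooth_in_transition(1)[OF V(1), where i=j and j=i] by (simp add: Int_commute)
  have ss: "smooth_in M i ?W s" by (rule smooth_in_subset[OF s]) auto
  have sj: "smooth_in M j ?W s" by (rule smooth_in_change[OF chart_open_Int(1) _ ss]) auto
  have p: "pd M j a s x = (\<Sum>b\<in>UNIV. jac M j i x a b *\<^sub>R pd M i b s x)"
    by (rule pd_change[OF chart_open_Int(1) _ ss]) (use x in auto)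
  have "cov M V j a (\<lambda>y. ?G y *v s y) x
    = ?G x *v pd M j a s x + (pd M j a ?G x + conn_form V j x a ** ?G x) *v s x"
    using pd_bilinear[OF bounded_bilinear_matrix_vector sG sj, of x a] x
    by (simp add: cov_def matrix_vector_mul_assoc mv.add_left)
  also have "\<dots> = (\<Sum>b\<in>UNIV. jac M j i x a b *\<^sub>R (?G x *v pd M i b s x + (?G x ** conn_form V i x b) *v s x))"
    unfolding p connection_change[OF V(2) x]
    by (simp add: mv.sum_right mv.sum_left mv.scaleR_left mv.scaleR_right scaleR_right_distrib sum.distrib)
  finally show ?thesis
    by (simp add: cov_def mv.add_right matrix_vector_mul_assoc)
qed

lemma ext_d_0: "x \<in> cdom M i \<Longrightarrow> ext_d M V \<omega> i x [a] = cov M V i a (\<lambda>y. \<omega> i y []) x"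
  by (simp add: ext_d_def)

lemma ext_d_1: "x \<in> cdom M i \<Longrightarrow>
   ext_d M V \<omega> i x [a, b] = cov M V i a (\<lambda>y. \<omega> i y [b]) x - cov M V i b (\<lambda>y. \<omega> i y [a]) x"
  by (simp add: ext_d_def)

lemma ext_d_smooth:
  assumes V: "connection M V" and \<omega>: "\<omega> \<in> forms M V k"
  shows "smooth_in M i (cdom M i) (\<lambda>x. ext_d M V \<omega> i x I)"
proof -
  have "smooth_in M i (cdom M i) (\<lambda>x. \<Sum>t<length I. (-1)^t *\<^sub>R cov M V i (I ! t) (\<lambda>y. \<omega> i y (take t I @ drop (Suc t) I)) x)"
    by (intro smooth_in_sum smooth_in_scaleR smooth_in_const smooth_in_cov[OF V] chart_open_cdom forms_smooth[OF \<omega>])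
  then show ?thesis
    by (rule smooth_in_cong[OF chart_open_cdom, rotated]) (simp add: ext_d_def)
qed

lemma ext_d_length:
  assumes \<omega>: "\<omega> \<in> forms M V k" and I: "length I \<noteq> Suc k"
  shows "ext_d M V \<omega> i x I = 0"
proof -
  have "\<omega> i y (take t I @ drop (Suc t) I) = 0" if "t < length I" for t y
    by (rule forms_length[OF \<omega>]) (use I that in auto)
  then have "cov M V i (I ! t) (\<lambda>y. \<omega> i y (take t I @ drop (Suc t) I)) x = 0" if "t < length I" for t
    using that by simp
  then show ?thesis by (simp add: ext_d_def)
qed

lemma ext_d_form_0:
  assumes V: "bundle_conn V" and \<omega>: "\<omega> \<in> forms M V 0"
  shows "ext_d M V \<omega> \<in> forms M V 1"
  unfolding forms_iff
proof (intro conjI allI ballI impI)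
  have V': "vector_bundle M V" "connection M V" using V by (auto simp: bundle_conn_def)
  show "ext_d M V \<omega> i x \<in> alt_tensors 1" for i x
    using ext_d_length[OF \<omega>] by (simp add: alt_tensors_le_1)
  show "ext_d M V \<omega> i x I = 0" if "x \<notin> cdom M i" for i x I
    using that by (simp add: ext_d_def)
  show "smooth_in M i (cdom M i) (\<lambda>x. ext_d M V \<omega> i x I)" for i I
    by (rule ext_d_smooth[OF V'(2) \<omega>])
  show "ext_d M V \<omega> j x I = change V 1 j i x (ext_d M V \<omega> i x) I"
    if xx: "x \<in> cdom M i \<inter> cdom M j" and I: "length I = 1" for i j x I
  proof -
    have x: "x \<in> cdom M i" "x \<in> cdom M j" using xx by auto
    obtain a where a: "I = [a]" using I by (auto simp: length_Suc_conv)
    have "cov M V j a (\<lambda>y. \<omega> j y []) x = cov M V j a (\<lambda>y. transition V j i y *v \<omega> i y []) x"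
      by (rule cov_cong[OF chart_open_Int(2)[where i=i and j=j]]) (use forms_change[OF \<omega>, of _ i j "[]"] x in \<open>auto simp: change_0\<close>)
    also have "\<dots> = (\<Sum>b\<in>UNIV. jac M j i x a b *\<^sub>R (transition V j i x *v cov M V i b (\<lambda>y. \<omega> i y []) x))"
      by (rule cov_change[OF V' forms_smooth[OF \<omega>] x])
    finally show ?thesis unfolding a by (simp add: change_1 ext_d_0 x)
  qed
qed

text \<open>For 1-forms the second derivatives of the coordinate change cancel by their symmetry.\<close>

lemma ext_d_form_1:
  assumes V: "bundle_conn V" and \<omega>: "\<omega> \<in> forms M V 1"
  shows "ext_d M V \<omega> \<in> forms M V 2"
  unfolding forms_iff
proof (intro conjI allI ballI impI)
  have V': "vector_bundle M V" "connection M V" using V by (auto simp: bundle_conn_def)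
  show "ext_d M V \<omega> i x \<in> alt_tensors 2" for i x
    unfolding alt_tensors_def
  proof (intro CollectI conjI allI impI)
    show "ext_d M V \<omega> i x I = 0" if "length I \<noteq> 2" for I
      using ext_d_length[OF \<omega>] that by simp
    fix I :: "'n list" and s t assume st: "s < t \<and> t < length I"
    show "ext_d M V \<omega> i x (I[s := I ! t, t := I ! s]) = - ext_d M V \<omega> i x I"
    proof (cases "length I = 2 \<and> x \<in> cdom M i")
      case True
      then obtain a b where I: "I = [a, b]" by (auto simp: length_Suc_conv numeral_2_eq_2)
      have "s = 0" "t = 1" using st I by auto
      then show ?thesis using True unfolding I by (simp add: ext_d_1)
    next
      case False
      have "ext_d M V \<omega> i x J = 0" if "length J = length I" for J
      proof (cases "x \<in> cdom M i")
        case True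
        then show ?thesis using False that by (intro ext_d_length[OF \<omega>]) auto
      qed (simp add: ext_d_def)
      then show ?thesis by simp
    qed
  qed
  show "ext_d M V \<omega> i x I = 0" if "x \<notin> cdom M i" for i x I
    using that by (simp add: ext_d_def)
  show "smooth_in M i (cdom M i) (\<lambda>x. ext_d M V \<omega> i x I)" for i I
    by (rule ext_d_smooth[OF V'(2) \<omega>])
  show "ext_d M V \<omega> j x I = change V 2 j i x (ext_d M V \<omega> i x) I"
    if xx: "x \<in> cdom M i \<inter> cdom M j" and I: "length I = 2" for i j x I
  proof -
    let ?W = "cdom M i \<inter> cdom M j" and ?G = "transition V j i"
    have x: "x \<in> cdom M i" "x \<in> cdom M j" and W: "chart_open j ?W" using xx by (auto intro: chart_open_Int)
    obtain a b where ab: "I = [a, b]" using I by (auto simp: length_Suc_conv numeral_2_eq_2)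
    have sG: "smooth_in M j ?W ?G"
      using smooth_in_transition(1)[OF V'(1), where i=j and j=i] by (simp add: Int_commute)
    have s\<omega>: "smooth_in M j ?W (\<lambda>y. \<omega> i y J)" for J
      by (rule smooth_in_change[OF chart_open_Int(1) _ smooth_in_subset[OF forms_smooth[OF \<omega>]]]) auto
    have sG\<omega>: "smooth_in M j ?W (\<lambda>y. ?G y *v \<omega> i y J)" for J
      by (rule smooth_in_bilinear[OF W bounded_bilinear_matrix_vector sG s\<omega>])
    have c: "cov M V j a (\<lambda>y. \<omega> j y [b]) x =
        (\<Sum>d\<in>UNIV. pd M j a (\<lambda>y. jac M j i y b d) x *\<^sub>R (?G x *v \<omega> i x [d])) +
        (\<Sum>d\<in>UNIV. \<Sum>c\<in>UNIV. (jac M j i x a c * jac M j i x b d) *\<^sub>R (?G x *v cov M V i c (\<lambda>y. \<omega> i y [d]) x))" for a b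
    proof -
      have "cov M V j a (\<lambda>y. \<omega> j y [b]) x = cov M V j a (\<lambda>y. \<Sum>d\<in>UNIV. jac M j i y b d *\<^sub>R (?G y *v \<omega> i y [d])) x"
        by (rule cov_cong[OF W]) (use forms_change[OF \<omega>, of _ i j "[b]"] x in \<open>auto simp: change_1\<close>)
      also have "\<dots> = (\<Sum>d\<in>UNIV. cov M V j a (\<lambda>y. jac M j i y b d *\<^sub>R (?G y *v \<omega> i y [d])) x)"
        by (rule cov_sum[OF W]) (use xx in \<open>auto intro!: smooth_in_scaleR W smooth_in_jac sG\<omega>\<close>)
      also have "\<dots> = (\<Sum>d\<in>UNIV. pd M j a (\<lambda>y. jac M j i y b d) x *\<^sub>R (?G x *v \<omega> i x [d]) +
          jac M j i x b d *\<^sub>R cov M V j a (\<lambda>y. ?G y *v \<omega> i y [d]) x)"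
        by (intro sum.cong refl cov_scaleR[OF smooth_in_jac sG\<omega> xx x(2)])
      also have "\<dots> = (\<Sum>d\<in>UNIV. pd M j a (\<lambda>y. jac M j i y b d) x *\<^sub>R (?G x *v \<omega> i x [d]) +
          (\<Sum>c\<in>UNIV. (jac M j i x a c * jac M j i x b d) *\<^sub>R (?G x *v cov M V i c (\<lambda>y. \<omega> i y [d]) x)))"
        by (simp add: cov_change[OF V' forms_smooth[OF \<omega>] x] scaleR_sum_right mult.commute)
      finally show ?thesis by (simp add: sum.distrib)
    qed
    have pj: "pd M j a (\<lambda>y. jac M j i y b d) x = pd M j b (\<lambda>y. jac M j i y a d) x" for d
    proof -
      have "smooth_in M j ?W (\<lambda>y. crd M i y $ d)"
        using smooth_in_crd[of j i] by (intro smooth_in_vec_nth W) (simp add: Int_commute)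
      then show ?thesis unfolding jac_def by (intro pd_commute[OF W _ xx])
    qed
    have "ext_d M V \<omega> j x I =
       (\<Sum>d\<in>UNIV. \<Sum>c\<in>UNIV. (jac M j i x a c * jac M j i x b d) *\<^sub>R (?G x *v cov M V i c (\<lambda>y. \<omega> i y [d]) x)) -
       (\<Sum>c\<in>UNIV. \<Sum>d\<in>UNIV. (jac M j i x b d * jac M j i x a c) *\<^sub>R (?G x *v cov M V i d (\<lambda>y. \<omega> i y [c]) x))"
      unfolding ab ext_d_1[OF x(2)] c pj by simp
    also have "\<dots> = (\<Sum>c\<in>UNIV. \<Sum>d\<in>UNIV. (jac M j i x a c * jac M j i x b d) *\<^sub>R
        (?G x *v (cov M V i c (\<lambda>y. \<omega> i y [d]) x - cov M V i d (\<lambda>y. \<omega> i y [c]) x)))"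
      by (subst sum.swap) (simp add: sum_subtractf[symmetric] mv.diff_right scaleR_diff_right mult.commute)
    also have "\<dots> = change V 2 j i x (ext_d M V \<omega> i x) I"
      unfolding ab numeral_2_eq_2 change_2 by (simp add: ext_d_1[OF x(1)])
    finally show ?thesis .
  qed
qed

lemma ext_d_add:
  assumes "\<omega> \<in> forms M V k" "\<omega>' \<in> forms M V k"
  shows "ext_d M V (\<lambda>i x I. \<omega> i x I + \<omega>' i x I) i x I = ext_d M V \<omega> i x I + ext_d M V \<omega>' i x I"
proof (cases "x \<in> cdom M i")
  case True
  have "cov M V i a (\<lambda>y. \<omega> i y J + \<omega>' i y J) x = cov M V i a (\<lambda>y. \<omega> i y J) x + cov M V i a (\<lambda>y. \<omega>' i y J) x" for a J
    by (rule cov_add[OF forms_smooth[OF assms(1)] forms_smooth[OF assms(2)] True])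
  then show ?thesis by (simp add: ext_d_def True scaleR_right_distrib sum.distrib)
qed (simp add: ext_d_def)

lemma ext_d_cong:
  assumes "open U" "x \<in> U" "\<And>y I. y \<in> U \<Longrightarrow> \<omega> i y I = \<omega>' i y I"
  shows "ext_d M V \<omega> i x I = ext_d M V \<omega>' i x I"
proof (cases "x \<in> cdom M i")
  case True
  have U: "chart_open i (U \<inter> cdom M i)" using assms(1) open_cdom by (auto simp: chart_open_def)
  have "cov M V i a (\<lambda>y. \<omega> i y J) x = cov M V i a (\<lambda>y. \<omega>' i y J) x" for a J
    by (rule cov_cong[OF U]) (use assms True in auto)
  then show ?thesis by (simp add: ext_d_def True)
qed (simp add: ext_d_def)

end

section \<open>Pairings of forms\<close>

lemma bounded_bilinear_dual_pairing:
  "bounded_bilinear (dual_pairing i x :: 'k::{real_normed_field,euclidean_space}^'r \<Rightarrow> 'k^'r \<Rightarrow> 'k)"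
  by (rule bilinear_conv_bounded_bilinear[THEN iffD1])
    (auto simp: bilinear_def dual_pairing_def scaleR_sum_right algebra_simps sum.distrib intro!: linearI)

lemma dual_pairing_transpose:
  "dual_pairing i x (transpose A *v u) v = dual_pairing i x u (A *v v)"
proof -
  have "dual_pairing i x (transpose A *v u) v = (\<Sum>c\<in>UNIV. \<Sum>d\<in>UNIV. A $ d $ c * u $ d * v $ c)"
    by (simp add: dual_pairing_def matrix_vector_mult_def transpose_def sum_distrib_right)
  also have "\<dots> = (\<Sum>d\<in>UNIV. \<Sum>c\<in>UNIV. A $ d $ c * u $ d * v $ c)" by (rule sum.swap)
  finally show ?thesis
    by (simp add: dual_pairing_def matrix_vector_mult_def sum_distrib_left mult_ac)
qed

interpretation dp: bounded_bilinear "dual_pairing i x :: 'k::{real_normed_field,euclidean_space}^'r \<Rightarrow> 'k^'r \<Rightarrow> 'k" for i x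
  by (rule bounded_bilinear_dual_pairing)

context pseudo_riem
begin

text \<open>A smooth invariant pairing of the fibres of two bundles, real bilinear only, so that Hermitian
  forms are included.\<close>

definition fibre_pairing ::
  "('i, 'm, 'n, 'k::{real_normed_field,euclidean_space}, 'r::finite) vbundle \<Rightarrow> ('i, 'm, 'n, 'k, 'r) vbundle \<Rightarrow>
   ('i \<Rightarrow> 'm \<Rightarrow> 'k^'r \<Rightarrow> 'k^'r \<Rightarrow> 'k) \<Rightarrow> bool" where
  "fibre_pairing V V' b \<longleftrightarrow> (\<forall>i x. bounded_bilinear (b i x)) \<and>
     (\<forall>i j u v. \<forall>x\<in>cdom M i \<inter> cdom M j. b j x (transition V j i x *v u) (transition V' j i x *v v) = b i x u v) \<and>
     (\<forall>i W s t. chart_open i W \<and> smooth_in M i W s \<and> smooth_in M i W t \<longrightarrow> smooth_in M i W (\<lambda>x. b i x (s x) (t x)))"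

lemma fibre_pairing_dual:
  fixes V :: "('i, 'm, 'n, 'k::{real_normed_field,euclidean_space}, 'r::finite) vbundle"
  assumes V: "vector_bundle M V"
  shows "fibre_pairing (dual_bundle V) V dual_pairing"
  unfolding fibre_pairing_def
proof (intro conjI allI ballI impI)
  show "bounded_bilinear (dual_pairing i x :: 'k^'r \<Rightarrow> _)" for i x
    by (rule bounded_bilinear_dual_pairing)
  show "dual_pairing j x (transition (dual_bundle V) j i x *v u) (transition V j i x *v v) = dual_pairing i x u v"
    if "x \<in> cdom M i \<inter> cdom M j" for i j u v x
  proof -
    have t: "transition (dual_bundle V) j i x = transpose (transition V i j x)" by (simp add: dual_bundle_def)
    have "dual_pairing j x u (transition V i j x *v (transition V j i x *v v)) = dual_pairing j x u v"
      using that transition_inverse[OF V, of x i j] by (simp add: matrix_vector_mul_assoc)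
    then show ?thesis unfolding t dual_pairing_transpose by (simp add: dual_pairing_def)
  qed
  show "smooth_in M i W (\<lambda>x. dual_pairing i x (s x) (t x :: 'k^'r))"
    if "chart_open i W \<and> smooth_in M i W s \<and> smooth_in M i W t" for i W s t
    unfolding dual_pairing_def using that
    by (intro smooth_in_sum smooth_in_mult smooth_in_vec_nth) auto
qed

definition lp ::
  "('i \<Rightarrow> 'm \<Rightarrow> 'k^'r \<Rightarrow> 'k^'r \<Rightarrow> 'k) \<Rightarrow> nat \<Rightarrow> 'i \<Rightarrow> 'm \<Rightarrow> ('n list \<Rightarrow> 'k^'r) \<Rightarrow> ('n list \<Rightarrow> 'k^'r) \<Rightarrow>
   'k::{real_normed_field,euclidean_space}" where
  "lp b k i x u v = (1 / fact k) *\<^sub>R (\<Sum>I | length I = k. \<Sum>J | length J = k.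
     (\<Prod>t<k. gi i x (I ! t) (J ! t)) *\<^sub>R b i x (u I) (v J))"

lemma lp_cong:
  "(\<And>I. length I = k \<Longrightarrow> u I = u' I) \<Longrightarrow> (\<And>I. length I = k \<Longrightarrow> v I = v' I) \<Longrightarrow> lp b k i x u v = lp b k i x u' v'"
  unfolding lp_def by (intro arg_cong2[where f=scaleR] refl sum.cong) auto

lemma lp_add_left:
  assumes "bounded_bilinear (b i x)"
  shows "lp b k i x (\<lambda>I. u I + u' I) v = lp b k i x u v + lp b k i x u' v"
  by (simp add: lp_def bounded_bilinear.add_left[OF assms] scaleR_right_distrib sum.distrib)

lemma lp_diff_right:
  assumes "bounded_bilinear (b i x)"
  shows "lp b k i x u (\<lambda>I. v I - v' I) = lp b k i x u v - lp b k i x u v'"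
  by (simp add: lp_def bounded_bilinear.diff_right[OF assms] scaleR_diff_right sum_subtractf)

lemma lp_zero_left:
  assumes "bounded_bilinear (b i x)" "\<And>I. u I = 0"
  shows "lp b k i x u v = 0"
  by (simp add: lp_def bounded_bilinear.zero_left[OF assms(1)] assms(2))

lemma lp_zero_right:
  assumes "bounded_bilinear (b i x)" "\<And>I. v I = 0"
  shows "lp b k i x u v = 0"
  by (simp add: lp_def bounded_bilinear.zero_right[OF assms(1)] assms(2))

lemma sum_lists_prod2:
  fixes f :: "nat \<Rightarrow> 'n \<Rightarrow> 'n \<Rightarrow> real"
  shows "(\<Sum>I | length I = k. \<Sum>J | length J = k. \<Prod>t<k. f t (I ! t) (J ! t)) = (\<Prod>t<k. \<Sum>a\<in>UNIV. \<Sum>b\<in>UNIV. f t a b)"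
proof -
  have "(\<Sum>J | length J = k. \<Prod>t<k. f t (I ! t) (J ! t)) = (\<Prod>t<k. \<Sum>b\<in>UNIV. f t (I ! t) b)" for I
    by (rule sum_lists_prod)
  then show ?thesis
    using sum_lists_prod[where k=k and f="\<lambda>t a. \<Sum>b\<in>UNIV. f t a b"] by simp
qed

text \<open>The pairing of components is invariant because the inverse metric transforms by the inverse
  Jacobian matrices.\<close>

lemma lp_change:
  fixes b :: "'i \<Rightarrow> 'm \<Rightarrow> 'k^'r::finite \<Rightarrow> 'k^'r \<Rightarrow> 'k::{real_normed_field,euclidean_space}"
  assumes b: "fibre_pairing V V' b" and x: "x \<in> cdom M i" "x \<in> cdom M j"
  shows "lp b k j x (change V k j i x u) (change V' k j i x v) = lp b k i x u v"
proof -
  interpret bb: bounded_bilinear "b j x" using b by (simp add: fibre_pairing_def)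
  have inv: "b j x (transition V j i x *v p) (transition V' j i x *v q) = b i x p q" for p q
    using b x unfolding fibre_pairing_def by blast
  let ?J = "\<lambda>I K. \<Prod>t<k. jac M j i x (I ! t) (K ! t)"
  let ?G = "\<lambda>I J. \<Prod>t<k. gi j x (I ! t) (J ! t)"
  let ?S = "{I :: 'n list. length I = k}"
  have "(\<Sum>I\<in>?S. \<Sum>J\<in>?S. ?G I J *\<^sub>R b j x (change V k j i x u I) (change V' k j i x v J))
    = (\<Sum>I\<in>?S. \<Sum>J\<in>?S. \<Sum>K\<in>?S. \<Sum>L\<in>?S. (?G I J * ?J I K * ?J J L) *\<^sub>R b i x (u K) (v L))"
    by (simp add: change_def bb.sum_left bb.sum_right bb.scaleR_left bb.scaleR_right inv scaleR_sum_right mult_ac)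
      (rule sum.cong[OF refl], rule sum.cong[OF refl], rule sum.swap)
  also have "\<dots> = (\<Sum>I\<in>?S. \<Sum>K\<in>?S. \<Sum>L\<in>?S. \<Sum>J\<in>?S. (?G I J * ?J I K * ?J J L) *\<^sub>R b i x (u K) (v L))"
    by (rule sum.cong[OF refl], subst sum.swap, rule sum.cong[OF refl], rule sum.swap)
  also have "\<dots> = (\<Sum>K\<in>?S. \<Sum>L\<in>?S. \<Sum>I\<in>?S. \<Sum>J\<in>?S. (?G I J * ?J I K * ?J J L) *\<^sub>R b i x (u K) (v L))"
    by (subst sum.swap, rule sum.cong[OF refl], rule sum.swap)
  also have "\<dots> = (\<Sum>K\<in>?S. \<Sum>L\<in>?S. (\<Prod>t<k. gi i x (K ! t) (L ! t)) *\<^sub>R b i x (u K) (v L))"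
  proof (intro sum.cong refl)
    fix K L :: "'n list"
    have "(\<Sum>I\<in>?S. \<Sum>J\<in>?S. ?G I J * ?J I K * ?J J L) = (\<Prod>t<k. gi i x (K ! t) (L ! t))"
      using sum_lists_prod2[where k=k and f="\<lambda>t a b. gi j x a b * jac M j i x a (K ! t) * jac M j i x b (L ! t)"]
      by (simp add: prod.distrib gi_change[OF x] mult_ac)
    then show "(\<Sum>I\<in>?S. \<Sum>J\<in>?S. (?G I J * ?J I K * ?J J L) *\<^sub>R b i x (u K) (v L))
        = (\<Prod>t<k. gi i x (K ! t) (L ! t)) *\<^sub>R b i x (u K) (v L)"
      by (simp add: scaleR_sum_left[symmetric])
  qed
  finally show ?thesis by (simp add: lp_def)
qed

lemma lp_smooth:
  assumes b: "fibre_pairing V V' b" and W: "chart_open i W"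
    and u: "\<And>I. smooth_in M i W (\<lambda>x. u x I)" and v: "\<And>I. smooth_in M i W (\<lambda>x. v x I)"
  shows "smooth_in M i W (\<lambda>x. lp b k i x (u x) (v x))"
proof -
  have s: "smooth_in M i W (\<lambda>x. b i x (u x I) (v x J))" for I J
    using b W u v unfolding fibre_pairing_def by blast
  have gs: "smooth_in M i W (\<lambda>x. gi i x a c)" for a c
    by (rule smooth_in_subset[OF gi_smooth]) (use W in \<open>simp add: chart_open_def\<close>)
  show ?thesis unfolding lp_def
    by (intro smooth_in_linear[OF W bounded_linear_scaleR_right] smooth_in_sum[OF W] smooth_in_scaleR[OF W]
        smooth_in_prod[OF W] s gs)
qed

definition some_chart :: "'m \<Rightarrow> 'i" where
  "some_chart x = (SOME i. x \<in> cdom M i)"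

lemma some_chart: "x \<in> cdom M (some_chart x)"
  unfolding some_chart_def using ex_chart by (rule someI_ex)

definition gpair ::
  "('i \<Rightarrow> 'm \<Rightarrow> 'k^'r \<Rightarrow> 'k^'r \<Rightarrow> 'k) \<Rightarrow> nat \<Rightarrow> ('i, 'm, 'n, 'k, 'r) form \<Rightarrow> ('i, 'm, 'n, 'k, 'r) form \<Rightarrow> 'm \<Rightarrow>
   'k::{real_normed_field,euclidean_space}" where
  "gpair b k \<alpha> \<beta> x = lp b k (some_chart x) x (\<alpha> (some_chart x) x) (\<beta> (some_chart x) x)"

lemma form_pairing_eq: "form_pairing M g b k \<alpha> \<beta> = (LINT x|vol. gpair b k \<alpha> \<beta> x)"
  by (simp add: form_pairing_def gpair_def lp_def some_chart_def gi_def Let_def)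

lemma gpair_chart:
  assumes b: "fibre_pairing V V' b" and "\<alpha> \<in> forms M V k" "\<beta> \<in> forms M V' k" and x: "x \<in> cdom M i"
  shows "gpair b k \<alpha> \<beta> x = lp b k i x (\<alpha> i x) (\<beta> i x)"
proof -
  let ?j = "some_chart x"
  have "lp b k ?j x (\<alpha> ?j x) (\<beta> ?j x) = lp b k ?j x (change V k ?j i x (\<alpha> i x)) (change V' k ?j i x (\<beta> i x))"
    by (rule lp_cong) (use forms_change[OF assms(2) x some_chart] forms_change[OF assms(3) x some_chart] in auto)
  then show ?thesis unfolding gpair_def using lp_change[OF b x some_chart] by simp
qed

lemma gpair_continuous:
  assumes b: "fibre_pairing V V' b" and "\<alpha> \<in> forms M V k" "\<beta> \<in> forms M V' k"
  shows "continuous_on UNIV (gpair b k \<alpha> \<beta>)"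
proof -
  have "isCont (gpair b k \<alpha> \<beta>) x" for x
  proof -
    obtain i where i: "x \<in> cdom M i" using ex_chart by blast
    have "continuous_on (cdom M i) (\<lambda>x. lp b k i x (\<alpha> i x) (\<beta> i x))"
      by (rule smooth_in_continuous[OF chart_open_cdom lp_smooth[OF b chart_open_cdom]])
        (rule forms_smooth[OF assms(2)] forms_smooth[OF assms(3)])+
    then have "continuous_on (cdom M i) (gpair b k \<alpha> \<beta>)"
      by (rule continuous_on_eq) (simp add: gpair_chart[OF assms])
    then show ?thesis using i open_cdom by (simp add: continuous_on_eq_continuous_at)
  qed
  then show ?thesis by (simp add: continuous_at_imp_continuous_on)
qed

lemma gpair_zero:
  assumes b: "fibre_pairing V V' b" and "(\<forall>i I. \<alpha> i x I = 0) \<or> (\<forall>i I. \<beta> i x I = 0)"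
  shows "gpair b k \<alpha> \<beta> x = 0"
  using assms lp_zero_left[of b] lp_zero_right[of b] unfolding gpair_def fibre_pairing_def by metis

lemma gpair_integrable:
  assumes b: "fibre_pairing V V' b" and "\<alpha> \<in> forms M V k" "\<beta> \<in> forms M V' k"
    and c: "compact_support \<alpha> \<or> compact_support \<beta>"
  shows "integrable vol (gpair b k \<alpha> \<beta>)"
proof -
  obtain K where K: "compact K" "\<And>x. x \<notin> K \<Longrightarrow> (\<forall>i I. \<alpha> i x I = 0) \<or> (\<forall>i I. \<beta> i x I = 0)"
    using c unfolding compact_support_def by blast
  show ?thesis
    by (rule integrable_vol[OF gpair_continuous[OF assms(1-3)] K(1)]) (use K(2) gpair_zero[OF b] in blast)
qed

lemma gpair_add_left:
  "fibre_pairing V V' b \<Longrightarrow> gpair b k (\<lambda>i x I. \<alpha> i x I + \<alpha>' i x I) \<beta> x = gpair b k \<alpha> \<beta> x + gpair b k \<alpha>' \<beta> x"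
  unfolding gpair_def fibre_pairing_def by (simp add: lp_add_left)

lemma gpair_diff_right:
  "fibre_pairing V V' b \<Longrightarrow> gpair b k \<alpha> (\<lambda>i x I. \<beta> i x I - \<beta>' i x I) x = gpair b k \<alpha> \<beta> x - gpair b k \<alpha> \<beta>' x"
  unfolding gpair_def fibre_pairing_def by (simp add: lp_diff_right)

lemma form_pairing_add_left:
  assumes "fibre_pairing V V' b" "\<alpha> \<in> forms M V k" "\<alpha>' \<in> forms M V k" "\<beta> \<in> forms M V' k"
    and "compact_support \<alpha> \<or> compact_support \<beta>" "compact_support \<alpha>' \<or> compact_support \<beta>"
  shows "form_pairing M g b k (\<lambda>i x I. \<alpha> i x I + \<alpha>' i x I) \<beta> = form_pairing M g b k \<alpha> \<beta> + form_pairing M g b k \<alpha>' \<beta>"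
  unfolding form_pairing_eq gpair_add_left[OF assms(1)]
  using gpair_integrable[OF assms(1,2,4,5)] gpair_integrable[OF assms(1,3,4,6)] by (rule Bochner_Integration.integral_add)

lemma form_pairing_diff_right:
  assumes "fibre_pairing V V' b" "\<alpha> \<in> forms M V k" "\<beta> \<in> forms M V' k" "\<beta>' \<in> forms M V' k"
    and "compact_support \<alpha> \<or> compact_support \<beta>" "compact_support \<alpha> \<or> compact_support \<beta>'"
  shows "form_pairing M g b k \<alpha> (\<lambda>i x I. \<beta> i x I - \<beta>' i x I) = form_pairing M g b k \<alpha> \<beta> - form_pairing M g b k \<alpha> \<beta>'"
  unfolding form_pairing_eq gpair_diff_right[OF assms(1)]
  using gpair_integrable[OF assms(1,2,3,5)] gpair_integrable[OF assms(1,2,4,6)] by (rule Bochner_Integration.integral_diff)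

lemma prod_gi_g:
  assumes x: "x \<in> cdom M i" and IK: "length I = k" "length K = k"
  shows "(\<Sum>J | length J = k. (\<Prod>t<k. gi i x (I ! t) (J ! t)) * (\<Prod>t<k. g i x $ (J ! t) $ (K ! t))) = (if I = K then 1 else 0)"
proof -
  have "(\<Sum>J | length J = k. (\<Prod>t<k. gi i x (I ! t) (J ! t)) * (\<Prod>t<k. g i x $ (J ! t) $ (K ! t)))
      = (\<Prod>t<k. if I ! t = K ! t then 1 else 0)"
    using sum_lists_prod[where k=k and f="\<lambda>t b. gi i x (I ! t) b * g i x $ b $ (K ! t)"]
    by (simp add: prod.distrib gi_inverse(1)[OF x])
  also have "\<dots> = (if I = K then 1 else 0)"
  proof (cases "I = K")
    case False
    then obtain t where "t < k" "I ! t \<noteq> K ! t" using IK by (metis nth_equalityI)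
    then show ?thesis using False by (auto simp: prod_zero_iff)
  qed simp
  finally show ?thesis .
qed

text \<open>Test forms separate: the component of \<open>u\<close> that is nonzero at a point is detected by a
  bump function times the form obtained by lowering the corresponding index with the metric.\<close>

lemma pairing_nondegenerate:
  fixes V :: "('i, 'm, 'n, 'k::{real_normed_field,euclidean_space}, 'r::finite) vbundle"
  assumes V: "vector_bundle M V" and k: "k \<le> 1" and W: "chart_open i W"
    and u: "\<And>J. continuous_on W (\<lambda>x. u x J)"
    and ortho: "\<And>\<alpha> K. \<alpha> \<in> forms M (dual_bundle V) k \<Longrightarrow> compact K \<Longrightarrow> K \<subseteq> W \<Longrightarrow> (\<And>j x I. x \<notin> K \<Longrightarrow> \<alpha> j x I = 0) \<Longrightarrow>
       (LINT x|vol. lp dual_pairing k i x (\<alpha> i x) (u x)) = 0"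
    and x0: "x0 \<in> W" and J0: "length J0 = k"
  shows "u x0 J0 = 0"
proof (rule ccontr)
  assume "u x0 J0 \<noteq> 0"
  then obtain c where c: "u x0 J0 $ c \<noteq> 0" by (auto simp: vec_eq_iff)
  define \<kappa> where "\<kappa> = inverse (u x0 J0 $ c)"
  define f where "f x = (\<kappa> * (u x J0 $ c)) \<bullet> 1" for x
  have Wi: "W \<subseteq> cdom M i" "open W" using W by (auto simp: chart_open_def)
  have ck: "continuous_on W (\<lambda>x. \<kappa> * (u x J0 $ c))"
    by (intro continuous_intros u)
  have cf: "continuous_on W f" unfolding f_def by (intro continuous_intros ck)
  have fx0: "f x0 > 0" using c by (simp add: f_def \<kappa>_def)
  let ?W = "W \<inter> f -` {0<..}"
  have W': "chart_open i ?W"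
    using Wi continuous_open_preimage[OF cf Wi(2)] by (auto simp: chart_open_def)
  have "x0 \<in> ?W" using x0 fx0 by simp
  then obtain \<eta> U K where b: "smooth_fun M \<eta>" "\<And>y. 0 \<le> \<eta> y" "x0 \<in> U" "compact K" "K \<subseteq> ?W"
    "\<And>y. y \<in> U \<Longrightarrow> \<eta> y = 1" "\<And>y. y \<notin> K \<Longrightarrow> \<eta> y = 0"
    using manifold_bump[OF W'] by metis
  define w where "w x I = (if length I = k then (\<eta> x * (\<Prod>t<k. g i x $ (I ! t) $ (J0 ! t))) *\<^sub>R axis c \<kappa> else 0)" for x I
  have ws: "smooth_in M i (cdom M i) (\<lambda>x. w x I)" for I
    unfolding w_def using b(1) metric_smooth
    by (cases "length I = k") (auto simp: smooth_fun_def intro!: smooth_in_scaleR smooth_in_mult smooth_in_prod chart_open_cdom smooth_in_const)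
  have wz: "w x I = 0" if "x \<notin> K" for x I using b(7)[OF that] by (simp add: w_def)
  have KW: "K \<subseteq> cdom M i" using b(5) Wi by blast
  let ?\<alpha> = "extend_form (dual_bundle V) k i w"
  have Vd: "vector_bundle M (dual_bundle V)" by (rule vector_bundle_dual[OF V])
  have \<alpha>: "?\<alpha> \<in> forms M (dual_bundle V) k"
    by (rule extend_form(1)[OF Vd k ws b(4) KW]) (rule wz)
  have \<alpha>i: "?\<alpha> i x I = w x I" if "x \<in> cdom M i" "length I = k" for x I
    by (rule extend_form(2)[OF Vd k ws b(4) KW _ that]) (rule wz)
  have \<alpha>z: "?\<alpha> j x I = 0" if "x \<notin> K" for j x I
    using wz[OF that] by (simp add: extend_form_def change_def)
  define F where "F x = lp dual_pairing k i x (?\<alpha> i x) (u x)" for x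
  have F0: "F x = 0" if "x \<notin> K" for x
    unfolding F_def by (rule lp_zero_left[OF bounded_bilinear_dual_pairing]) (rule \<alpha>z[OF that])
  have F: "F x = (1 / fact k) *\<^sub>R (\<eta> x *\<^sub>R (\<kappa> * (u x J0 $ c)))" if "x \<in> cdom M i" for x
  proof -
    have d: "dual_pairing i x (axis c \<kappa>) v = \<kappa> * v $ c" for v :: "'k^'r"
      by (simp add: dual_pairing_def axis_def if_distrib[of "\<lambda>t. t * _"] cong: if_cong)
    have "F x = lp dual_pairing k i x (w x) (u x)"
      unfolding F_def by (rule lp_cong) (auto simp: \<alpha>i[OF that])
    also have "\<dots> = (1 / fact k) *\<^sub>R (\<Sum>I | length I = k. \<Sum>J | length J = k.
        ((\<Prod>t<k. gi i x (J ! t) (I ! t)) * (\<Prod>t<k. g i x $ (I ! t) $ (J0 ! t))) *\<^sub>R (\<eta> x *\<^sub>R (\<kappa> * u x J $ c)))"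
    proof -
      have "(\<Prod>t<k. gi i x (I ! t) (J ! t)) *\<^sub>R dual_pairing i x (w x I) (u x J) =
        ((\<Prod>t<k. gi i x (J ! t) (I ! t)) * (\<Prod>t<k. g i x $ (I ! t) $ (J0 ! t))) *\<^sub>R (\<eta> x *\<^sub>R (\<kappa> * u x J $ c))"
        if I: "length I = k" for I J
      proof -
        have "(\<Prod>t<k. gi i x (I ! t) (J ! t)) = (\<Prod>t<k. gi i x (J ! t) (I ! t))"
          by (intro prod.cong refl gi_sym[OF \<open>x \<in> cdom M i\<close>])
        then show ?thesis by (simp add: w_def I dp.scaleR_left d mult_ac)
      qed
      then show ?thesis unfolding lp_def by simp
    qed
    also have "\<dots> = (1 / fact k) *\<^sub>R (\<Sum>J | length J = k. \<Sum>I | length I = k.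
        ((\<Prod>t<k. gi i x (J ! t) (I ! t)) * (\<Prod>t<k. g i x $ (I ! t) $ (J0 ! t))) *\<^sub>R (\<eta> x *\<^sub>R (\<kappa> * u x J $ c)))"
      by (subst sum.swap) simp
    also have "\<dots> = (1 / fact k) *\<^sub>R (\<Sum>J | length J = k. (if J = J0 then 1 else 0) *\<^sub>R (\<eta> x *\<^sub>R (\<kappa> * u x J $ c)))"
      unfolding scaleR_sum_left[symmetric]
      by (intro arg_cong2[where f=scaleR] refl sum.cong) (auto simp: prod_gi_g[OF that _ J0])
    also have "(\<Sum>J | length J = k. (if J = J0 then 1 else 0) *\<^sub>R (\<eta> x *\<^sub>R (\<kappa> * u x J $ c))) = \<eta> x *\<^sub>R (\<kappa> * u x J0 $ c)"
    proof -
      have "(\<Sum>J | length J = k. (if J = J0 then 1 else 0) *\<^sub>R (\<eta> x *\<^sub>R (\<kappa> * u x J $ c)))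
          = (\<Sum>J | length J = k. if J = J0 then \<eta> x *\<^sub>R (\<kappa> * u x J $ c) else 0)"
        by (rule sum.cong) auto
      then show ?thesis using J0 by simp
    qed
    finally show ?thesis .
  qed
  have cW: "continuous_on W F"
  proof (rule continuous_on_eq)
    show "continuous_on W (\<lambda>x. (1 / fact k) *\<^sub>R (\<eta> x *\<^sub>R (\<kappa> * (u x J0 $ c))))"
      by (intro continuous_intros u continuous_on_subset[OF smooth_fun_continuous[OF b(1)]]) auto
  qed (use F Wi in auto)
  have cF: "continuous_on UNIV F"
    by (rule continuous_zero_extension[OF Wi(2) compact_imp_closed[OF b(4)] _ cW F0]) (use b(5) in auto)
  have "(LINT x|vol. F x) = 0"
    unfolding F_def by (rule ortho[OF \<alpha> b(4)]) (use b(5) \<alpha>z in auto)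
  then have "(LINT x|vol. F x \<bullet> 1) = 0"
    using integrable_vol[OF cF b(4) F0] by (simp add: integral_inner_left)
  then have "F x0 \<bullet> 1 = 0"
  proof (rule integral_vol_nonneg_eq_0[rotated -1])
    show "continuous_on UNIV (\<lambda>x. F x \<bullet> 1)" by (intro continuous_intros cF)
    show "compact K" by (rule b(4))
    show "F x \<bullet> 1 = 0" if "x \<notin> K" for x by (simp add: F0[OF that])
    show "0 \<le> F x \<bullet> 1" for x
    proof (cases "x \<in> K")
      case True
      then have "x \<in> cdom M i" "f x > 0" using b(5) KW by auto
      then show ?thesis using b(2)[of x] by (simp add: F f_def)
    qed (simp add: F0)
  qed
  moreover have "F x0 \<bullet> 1 = (1 / fact k) * f x0"
    using F[of x0] x0 Wi b(3,6) by (auto simp: f_def)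
  ultimately show False using fx0 by simp
qed


section \<open>The codifferential and Green's formula\<close>


text \<open>The divergence of \<open>\<psi>\<close> in its first index, in the form \<open>- |g|\<^bsup>-1/2\<^esup> D\<^sub>a (|g|\<^bsup>1/2\<^esup> \<psi>\<^bsup>aI\<^esup>)\<close> in which no
  Christoffel symbols occur since \<open>\<psi>\<close> is alternating.\<close>

definition flux ::
  "nat \<Rightarrow> ('i, 'm, 'n, 'k::{real_normed_field,euclidean_space}, 'r::finite) form \<Rightarrow> 'i \<Rightarrow> 'n \<Rightarrow> 'n list \<Rightarrow> 'm \<Rightarrow> 'k^'r" where
  "flux k \<psi> i a I x = (\<Sum>b\<in>UNIV. \<Sum>J | length J = k.
     (dens i x * gi i x a b * (\<Prod>t<k. gi i x (I ! t) (J ! t))) *\<^sub>R \<psi> i x (b # J))"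

definition divup ::
  "('i, 'm, 'n, 'k::{real_normed_field,euclidean_space}, 'r::finite) vbundle \<Rightarrow> nat \<Rightarrow> ('i, 'm, 'n, 'k, 'r) form \<Rightarrow>
   'i \<Rightarrow> 'n list \<Rightarrow> 'm \<Rightarrow> 'k^'r" where
  "divup V k \<psi> i I x = - ((1 / dens i x) *\<^sub>R (\<Sum>a\<in>UNIV. cov M V i a (flux k \<psi> i a I) x))"

definition cdiv ::
  "('i, 'm, 'n, 'k::{real_normed_field,euclidean_space}, 'r::finite) vbundle \<Rightarrow> nat \<Rightarrow> ('i, 'm, 'n, 'k, 'r) form \<Rightarrow>
   ('i, 'm, 'n, 'k, 'r) form" where
  "cdiv V k \<psi> i x I = (if x \<in> cdom M i \<and> length I = k
     then \<Sum>J | length J = k. (\<Prod>t<k. g i x $ (I ! t) $ (J ! t)) *\<^sub>R divup V k \<psi> i J x else 0)"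

lemma flux_smooth:
  assumes "\<psi> \<in> forms M V l"
  shows "smooth_in M i (cdom M i) (flux k \<psi> i a I)"
  unfolding flux_def[abs_def]
  by (intro smooth_in_sum smooth_in_scaleR smooth_in_mult smooth_in_prod chart_open_cdom dens_smooth gi_smooth
      forms_smooth[OF assms])

lemma divup_smooth:
  assumes "connection M V" "\<psi> \<in> forms M V l"
  shows "smooth_in M i (cdom M i) (divup V k \<psi> i I)"
proof -
  have "smooth_in M i (cdom M i) (\<lambda>x. 1 / dens i x)"
    by (rule smooth_in_divide[OF chart_open_cdom smooth_in_const dens_smooth]) (use dens_pos in force)
  then show ?thesis unfolding divup_def[abs_def]
    by (intro smooth_in_minus[OF chart_open_cdom] smooth_in_scaleR[OF chart_open_cdom] smooth_in_sum[OF chart_open_cdom]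
        smooth_in_cov[OF assms(1) chart_open_cdom flux_smooth[OF assms(2)]])
qed

lemma div_smooth:
  assumes "connection M V" "\<psi> \<in> forms M V l"
  shows "smooth_in M i (cdom M i) (\<lambda>x. cdiv V k \<psi> i x I)"
proof (cases "length I = k")
  case True
  have "smooth_in M i (cdom M i) (\<lambda>x. \<Sum>J | length J = k. (\<Prod>t<k. g i x $ (I ! t) $ (J ! t)) *\<^sub>R divup V k \<psi> i J x)"
    by (intro smooth_in_sum[OF chart_open_cdom] smooth_in_scaleR[OF chart_open_cdom] smooth_in_prod[OF chart_open_cdom]
        metric_smooth divup_smooth[OF assms])
  then show ?thesis
    by (rule smooth_in_cong[OF chart_open_cdom, rotated]) (simp add: cdiv_def True)
qed (simp add: cdiv_def smooth_in_const)

lemma lp_div: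
  assumes x: "x \<in> cdom M i"
  shows "lp dual_pairing k i x u (cdiv V k \<psi> i x) = (1 / fact k) *\<^sub>R (\<Sum>I | length I = k. dual_pairing i x (u I) (divup V k \<psi> i I x))"
proof -
  have "(\<Sum>J | length J = k. (\<Prod>t<k. gi i x (I ! t) (J ! t)) *\<^sub>R cdiv V k \<psi> i x J) = divup V k \<psi> i I x" if I: "length I = k" for I
  proof -
    have "(\<Sum>J | length J = k. (\<Prod>t<k. gi i x (I ! t) (J ! t)) *\<^sub>R cdiv V k \<psi> i x J)
      = (\<Sum>K | length K = k. (\<Sum>J | length J = k. (\<Prod>t<k. gi i x (I ! t) (J ! t)) * (\<Prod>t<k. g i x $ (J ! t) $ (K ! t))) *\<^sub>R divup V k \<psi> i K x)"
      unfolding scaleR_sum_left by (subst sum.swap) (simp add: cdiv_def x scaleR_sum_right)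
    also have "\<dots> = (\<Sum>K | length K = k. if K = I then divup V k \<psi> i K x else 0)"
      by (rule sum.cong) (auto simp: prod_gi_g[OF x I])
    finally show ?thesis using I by simp
  qed
  then have "dual_pairing i x (u I) (divup V k \<psi> i I x) =
      (\<Sum>J | length J = k. (\<Prod>t<k. gi i x (I ! t) (J ! t)) *\<^sub>R dual_pairing i x (u I) (cdiv V k \<psi> i x J))" if "length I = k" for I
    using that by (simp add: dp.sum_right[symmetric] dp.scaleR_right[symmetric])
  then show ?thesis by (simp add: lp_def)
qed

text \<open>Since \<open>\<psi>\<close> is alternating, the antisymmetrisation in \<open>d\<^sup>D \<alpha>\<close> may be dropped, and the factor \<open>1/(k+1)!\<close> of the pairing
  becomes \<open>1/k!\<close>.\<close>

lemma lp_ext_d: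
  fixes \<alpha> :: "('i, 'm, 'n, 'k::{real_normed_field,euclidean_space}, 'r::finite) form"
  assumes k: "k \<le> 1" and x: "x \<in> cdom M i" and \<psi>: "\<psi> \<in> forms M V (Suc k)"
  shows "lp dual_pairing (Suc k) i x (ext_d M V' \<alpha> i x) (\<psi> i x) =
    (1 / fact k) *\<^sub>R (\<Sum>a\<in>UNIV. \<Sum>I | length I = k.
       dual_pairing i x (cov M V' i a (\<lambda>y. \<alpha> i y I) x) ((1 / dens i x) *\<^sub>R flux k \<psi> i a I x))"
proof -
  have dn: "dens i x \<noteq> 0" using dens_pos[OF x] by simp
  have fl: "(1 / dens i x) *\<^sub>R flux k \<psi> i a I x = (\<Sum>b\<in>UNIV. \<Sum>J | length J = k.
     (gi i x a b * (\<Prod>t<k. gi i x (I ! t) (J ! t))) *\<^sub>R \<psi> i x (b # J))" for a I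
    using dn by (simp add: flux_def scaleR_sum_right)
  consider "k = 0" | "k = Suc 0" using k by linarith
  then show ?thesis
  proof cases
    case 1
    then show ?thesis unfolding fl
      by (simp add: lp_def sum_lists_1 ext_d_0[OF x] dp.sum_right dp.scaleR_right)
  next
    case 2
    let ?d = "\<lambda>a c. cov M V' i a (\<lambda>y. \<alpha> i y [c]) x"
    let ?s = "\<lambda>a c. \<Sum>b\<in>UNIV. \<Sum>d\<in>UNIV. (gi i x a b * gi i x c d) *\<^sub>R \<psi> i x [b, d]"
    have skew: "\<psi> i x [d, b] = - \<psi> i x [b, d]" for b d
    proof -
      have "\<psi> i x (I[s := I ! t, t := I ! s]) = - \<psi> i x I" if "s < t \<and> t < length I" for I s t
        using forms_alt[OF \<psi>, of i x] that unfolding alt_tensors_def by blast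
      from this[of 0 1 "[b, d]"] show ?thesis by simp
    qed
    have sk: "?s c a = - ?s a c" for a c
    proof -
      have "?s c a = (\<Sum>d\<in>UNIV. \<Sum>b\<in>UNIV. (gi i x c b * gi i x a d) *\<^sub>R \<psi> i x [b, d])" by (rule sum.swap)
      also have "\<dots> = (\<Sum>d\<in>UNIV. \<Sum>b\<in>UNIV. - ((gi i x a d * gi i x c b) *\<^sub>R \<psi> i x [d, b]))"
        by (intro sum.cong refl, subst skew) (simp add: mult.commute)
      finally show ?thesis by (simp add: sum_negf)
    qed
    have "lp dual_pairing (Suc k) i x (ext_d M V' \<alpha> i x) (\<psi> i x) =
      (1/2) *\<^sub>R (\<Sum>a\<in>UNIV. \<Sum>c\<in>UNIV. dual_pairing i x (?d a c - ?d c a) (?s a c))"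
      by (simp add: lp_def 2 sum_lists_2 ext_d_1[OF x] prod.lessThan_Suc_shift dp.sum_right dp.scaleR_right numeral_2_eq_2)
    also have "(\<Sum>a\<in>UNIV. \<Sum>c\<in>UNIV. dual_pairing i x (?d a c - ?d c a) (?s a c))
      = (\<Sum>a\<in>UNIV. \<Sum>c\<in>UNIV. dual_pairing i x (?d a c) (?s a c)) - (\<Sum>a\<in>UNIV. \<Sum>c\<in>UNIV. dual_pairing i x (?d c a) (?s a c))"
      by (simp only: dp.diff_left sum_subtractf)
    also have "(\<Sum>a\<in>UNIV. \<Sum>c\<in>UNIV. dual_pairing i x (?d c a) (?s a c)) = - (\<Sum>a\<in>UNIV. \<Sum>c\<in>UNIV. dual_pairing i x (?d a c) (?s a c))"
      by (subst sum.swap, subst sk) (simp only: dp.minus_right sum_negf)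
    finally have "lp dual_pairing (Suc k) i x (ext_d M V' \<alpha> i x) (\<psi> i x) =
      (\<Sum>a\<in>UNIV. \<Sum>c\<in>UNIV. dual_pairing i x (?d a c) (?s a c))"
      by (simp add: scaleR_2[symmetric])
    then show ?thesis unfolding fl by (simp add: 2 sum_lists_1)
  qed
qed

lemma pd_dual_pairing:
  fixes V :: "('i, 'm, 'n, 'k::{real_normed_field,euclidean_space}, 'r::finite) vbundle"
  assumes "smooth_in M i (cdom M i) s" "smooth_in M i (cdom M i) t" "x \<in> cdom M i"
  shows "pd M i a (\<lambda>y. dual_pairing i y (s y) (t y)) x =
    dual_pairing i x (cov M (dual_bundle V) i a s x) (t x) + dual_pairing i x (s x) (cov M V i a t x)"
proof -
  have e: "(\<lambda>y. dual_pairing i y (s y) (t y)) = (\<lambda>y. dual_pairing i x (s y) (t y))" by (simp add: dual_pairing_def)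
  have "dual_pairing i x (- transpose (conn_form V i x a) *v s x) (t x) = - dual_pairing i x (s x) (conn_form V i x a *v t x)"
    by (simp only: mv.minus_left dp.minus_left dual_pairing_transpose)
  then show ?thesis
    unfolding e pd_bilinear[OF bounded_bilinear_dual_pairing assms(1,2,3,3)]
    by (simp add: cov_def dual_bundle_def dp.add_left dp.add_right)
qed

text \<open>The difference of the two integrands is the divergence of the vector field \<open>h\<close>, obtained by pairing \<open>\<alpha>\<close> with the
  flux of \<open>\<psi>\<close>, which has compact support in the chart.  The right-hand side is written with components in the
  chart because it is used to prove that \<open>cdiv V k \<psi>\<close> is a form.\<close>

lemma green_chart:
  assumes V: "bundle_conn V" and k: "k \<le> 1" and \<alpha>: "\<alpha> \<in> forms M (dual_bundle V) k" and \<psi>: "\<psi> \<in> forms M V (Suc k)"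
    and K: "compact K" "K \<subseteq> cdom M i" "\<And>j x I. x \<notin> K \<Longrightarrow> \<alpha> j x I = 0"
    and d\<alpha>: "ext_d M (dual_bundle V) \<alpha> \<in> forms M (dual_bundle V) (Suc k)"
  shows "form_pairing M g dual_pairing (Suc k) (ext_d M (dual_bundle V) \<alpha>) \<psi>
       = (LINT x|vol. lp dual_pairing k i x (\<alpha> i x) (cdiv V k \<psi> i x))"
proof -
  have V': "vector_bundle M V" "connection M V" using V by (auto simp: bundle_conn_def)
  note fp = fibre_pairing_dual[OF V'(1)]
  let ?d = "ext_d M (dual_bundle V) \<alpha>"
  define P where "P = gpair dual_pairing (Suc k) ?d \<psi>"
  define Q where "Q x = lp dual_pairing k i x (\<alpha> i x) (cdiv V k \<psi> i x)" for x
  define h where "h a x = (1 / fact k) *\<^sub>R (\<Sum>I | length I = k. dual_pairing i x (\<alpha> i x I) (flux k \<psi> i a I x))" for a x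
  have \<alpha>s: "smooth_in M i (cdom M i) (\<lambda>x. \<alpha> i x I)" for I by (rule forms_smooth[OF \<alpha>])
  have fs: "smooth_in M i (cdom M i) (flux k \<psi> i a I)" for a I by (rule flux_smooth[OF \<psi>])
  have ds: "smooth_in M i (cdom M i) (\<lambda>x. dual_pairing i x (\<alpha> i x I) (flux k \<psi> i a I x))" for a I
    using fp chart_open_cdom \<alpha>s fs unfolding fibre_pairing_def by blast
  have hs: "smooth_in M i (cdom M i) (h a)" for a
    unfolding h_def by (intro smooth_in_linear[OF chart_open_cdom bounded_linear_scaleR_right] smooth_in_sum[OF chart_open_cdom] ds)
  have hz: "h a x = 0" if "x \<notin> K" for a x using K(3)[OF that] by (simp add: h_def dp.zero_left)
  define R where "R a x = (if x \<in> cdom M i then (1 / dens i x) *\<^sub>R pd M i a (h a) x else 0)" for a x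
  have dz: "?d j x I = 0" if x: "x \<notin> K" for j x I
  proof -
    have "?d j x I = ext_d M (dual_bundle V) (\<lambda>_ _ _. 0) j x I"
      by (rule ext_d_cong[of "- K"]) (use K x in \<open>auto intro!: open_Compl compact_imp_closed\<close>)
    then show ?thesis by (simp add: ext_d_def)
  qed
  have Pz: "P x = 0" if "x \<notin> K" for x
    unfolding P_def by (rule gpair_zero[OF fp]) (use dz[OF that] in blast)
  have Qz: "Q x = 0" if "x \<notin> K" for x
    unfolding Q_def by (rule lp_zero_left[OF bounded_bilinear_dual_pairing]) (rule K(3)[OF that])
  have point: "(\<Sum>a\<in>UNIV. R a x) = P x - Q x" for x
  proof (cases "x \<in> cdom M i")
    case True
    have "pd M i a (h a) x = (1 / fact k) *\<^sub>R (\<Sum>I | length I = k.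
        dual_pairing i x (cov M (dual_bundle V) i a (\<lambda>y. \<alpha> i y I) x) (flux k \<psi> i a I x) +
        dual_pairing i x (\<alpha> i x I) (cov M V i a (flux k \<psi> i a I) x))" for a
    proof -
      have "pd M i a (h a) x = (1 / fact k) *\<^sub>R pd M i a (\<lambda>x. \<Sum>I | length I = k. dual_pairing i x (\<alpha> i x I) (flux k \<psi> i a I x)) x"
        unfolding h_def by (rule pd_linear[OF bounded_linear_scaleR_right _ True])
          (intro smooth_in_sum[OF chart_open_cdom] ds)
      also have "pd M i a (\<lambda>x. \<Sum>I | length I = k. dual_pairing i x (\<alpha> i x I) (flux k \<psi> i a I x)) x
        = (\<Sum>I | length I = k. pd M i a (\<lambda>x. dual_pairing i x (\<alpha> i x I) (flux k \<psi> i a I x)) x)"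
        by (rule pd_sum[OF chart_open_cdom ds True])
      finally show ?thesis by (simp add: pd_dual_pairing[OF \<alpha>s fs True, where V=V])
    qed
    then have "(\<Sum>a\<in>UNIV. R a x) = (1 / fact k) *\<^sub>R (\<Sum>a\<in>UNIV. \<Sum>I | length I = k.
        dual_pairing i x (cov M (dual_bundle V) i a (\<lambda>y. \<alpha> i y I) x) ((1 / dens i x) *\<^sub>R flux k \<psi> i a I x)) +
      (1 / fact k) *\<^sub>R (\<Sum>a\<in>UNIV. \<Sum>I | length I = k.
        dual_pairing i x (\<alpha> i x I) ((1 / dens i x) *\<^sub>R cov M V i a (flux k \<psi> i a I) x))"
      by (simp add: R_def True scaleR_sum_right sum.distrib dp.scaleR_right scaleR_right_distrib mult.commute)
    also have "(\<Sum>a\<in>UNIV. \<Sum>I | length I = k. dual_pairing i x (\<alpha> i x I) ((1 / dens i x) *\<^sub>R cov M V i a (flux k \<psi> i a I) x))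
      = - (\<Sum>I | length I = k. dual_pairing i x (\<alpha> i x I) (divup V k \<psi> i I x))"
      by (subst sum.swap) (simp add: divup_def dp.minus_right dp.sum_right dp.scaleR_right scaleR_sum_right sum_negf)
    finally show ?thesis
      by (simp add: P_def Q_def gpair_chart[OF fp d\<alpha> \<psi> True] lp_ext_d[OF k True \<psi>] lp_div[OF True] del: scaleR_sum_right)
  next
    case False
    then have "x \<notin> K" using K(2) by blast
    then show ?thesis using False Pz Qz by (simp add: R_def)
  qed
  have cP: "continuous_on UNIV P" unfolding P_def by (rule gpair_continuous[OF fp d\<alpha> \<psi>])
  have "smooth_in M i (cdom M i) Q" unfolding Q_def
    by (rule lp_smooth[OF fp chart_open_cdom \<alpha>s div_smooth[OF V'(2) \<psi>]])
  from smooth_in_continuous[OF chart_open_cdom this] have cQ: "continuous_on UNIV Q"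
    by (rule continuous_zero_extension[OF open_cdom compact_imp_closed[OF K(1)] K(2)]) (rule Qz)
  have iP: "integrable vol P" by (rule integrable_vol[OF cP K(1) Pz])
  have iQ: "integrable vol Q" by (rule integrable_vol[OF cQ K(1) Qz])
  have cR: "continuous_on UNIV (R a)" for a
  proof (rule continuous_zero_extension[OF open_cdom compact_imp_closed[OF K(1)] K(2)])
    have "continuous_on (cdom M i) (\<lambda>x. (1 / dens i x) *\<^sub>R pd M i a (h a) x)"
      by (intro continuous_intros smooth_in_continuous[OF chart_open_cdom dens_smooth]
          smooth_in_continuous[OF chart_open_cdom smooth_in_pd[OF chart_open_cdom hs]]) (use dens_pos in force)
    then show "continuous_on (cdom M i) (R a)" by (rule continuous_on_eq) (simp add: R_def)
    show "R a x = 0" if "x \<notin> K" for x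
    proof (cases "x \<in> cdom M i")
      case True
      have "chart_open i (cdom M i - K)"
        using open_cdom compact_imp_closed[OF K(1)] by (auto simp: chart_open_def)
      then have "pd M i a (h a) x = pd M i a (\<lambda>_. 0) x" by (rule pd_cong) (use that True hz in auto)
      then show ?thesis by (simp add: R_def)
    qed (simp add: R_def)
  qed
  have Rz: "R a x = 0" if "x \<notin> K" for a x
  proof (cases "x \<in> cdom M i")
    case True
    have "chart_open i (cdom M i - K)"
      using open_cdom compact_imp_closed[OF K(1)] by (auto simp: chart_open_def)
    then have "pd M i a (h a) x = pd M i a (\<lambda>_. 0) x" by (rule pd_cong) (use that True hz in auto)
    then show ?thesis by (simp add: R_def)
  qed (simp add: R_def)
  have "(LINT x|vol. P x - Q x) = (LINT x|vol. (\<Sum>a\<in>UNIV. R a x))" by (simp add: point)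
  also have "\<dots> = (\<Sum>a\<in>UNIV. LINT x|vol. R a x)"
    by (rule Bochner_Integration.integral_sum) (rule integrable_vol[OF cR K(1) Rz])
  also have "\<dots> = 0"
    unfolding R_def using integral_pd_eq_0[OF hs K(1,2) hz] by simp
  finally have "(LINT x|vol. P x) = (LINT x|vol. Q x)"
    using Bochner_Integration.integral_diff[OF iP iQ] by simp
  then show ?thesis by (simp add: form_pairing_eq P_def Q_def)
qed

lemma ext_d_form: "bundle_conn V \<Longrightarrow> k \<le> 1 \<Longrightarrow> \<omega> \<in> forms M V k \<Longrightarrow> ext_d M V \<omega> \<in> forms M V (Suc k)"
  using ext_d_form_0[of V \<omega>] ext_d_form_1[of V \<omega>] by (cases k) (auto simp: numeral_2_eq_2)

text \<open>The local formulas fit together: on the overlap of two charts both are adjoint to the exterior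
  derivative on the same test forms.  This replaces a computation with Christoffel symbols.\<close>

lemma div_form:
  fixes V :: "('i, 'm, 'n, 'k::{real_normed_field,euclidean_space}, 'r::finite) vbundle"
  assumes V: "bundle_conn V" and k: "k \<le> 1" and \<psi>: "\<psi> \<in> forms M V (Suc k)"
  shows "cdiv V k \<psi> \<in> forms M V k"
  unfolding forms_iff
proof (intro conjI allI ballI impI)
  have V': "vector_bundle M V" "connection M V" using V by (auto simp: bundle_conn_def)
  note fp = fibre_pairing_dual[OF V'(1)]
  show "cdiv V k \<psi> i x \<in> alt_tensors k" for i x
    using k by (simp add: alt_tensors_le_1 cdiv_def)
  show "cdiv V k \<psi> i x I = 0" if "x \<notin> cdom M i" for i x I using that by (simp add: cdiv_def)
  show "smooth_in M i (cdom M i) (\<lambda>x. cdiv V k \<psi> i x I)" for i I by (rule div_smooth[OF V'(2) \<psi>])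
  show "cdiv V k \<psi> j x I = change V k j i x (cdiv V k \<psi> i x) I"
    if x: "x \<in> cdom M i \<inter> cdom M j" and I: "length I = k" for i j x I
  proof -
    let ?W = "cdom M i \<inter> cdom M j"
    let ?c = "\<lambda>x. change V k j i x (cdiv V k \<psi> i x)"
    have W: "chart_open j ?W" "open ?W" using chart_open_Int[of j i] by (auto simp: chart_open_def)
    have sd: "smooth_in M j ?W (\<lambda>x. cdiv V k \<psi> j x J)" for J
      by (rule smooth_in_subset[OF div_smooth[OF V'(2) \<psi>]]) auto
    have sc: "smooth_in M j ?W (\<lambda>x. ?c x J)" for J
      by (rule smooth_in_change_form[OF V'(1) chart_open_Int(1)]) (auto intro: smooth_in_subset[OF div_smooth[OF V'(2) \<psi>]])
    have "cdiv V k \<psi> j x I - ?c x I = 0"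
    proof (rule pairing_nondegenerate[OF V'(1) k W(1) _ _ x I, of "\<lambda>x I. cdiv V k \<psi> j x I - ?c x I"])
      show "continuous_on ?W (\<lambda>x. cdiv V k \<psi> j x J - ?c x J)" for J
        by (intro continuous_intros smooth_in_continuous[OF W(1)] sd sc)
      fix \<alpha> :: "('i, 'm, 'n, 'k, 'r) form" and K
      assume \<alpha>: "\<alpha> \<in> forms M (dual_bundle V) k" and K: "compact K" "K \<subseteq> ?W" "\<And>j x I. x \<notin> K \<Longrightarrow> \<alpha> j x I = 0"
      have d: "ext_d M (dual_bundle V) \<alpha> \<in> forms M (dual_bundle V) (Suc k)"
        by (rule ext_d_form[OF bundle_conn_dual[OF V] k \<alpha>])
      let ?P = "\<lambda>x. lp dual_pairing k j x (\<alpha> j x) (cdiv V k \<psi> j x)"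
      let ?Q = "\<lambda>x. lp dual_pairing k j x (\<alpha> j x) (?c x)"
      have z: "lp dual_pairing k l x (\<alpha> l x) v = 0" if "x \<notin> K" for x v l
        by (rule lp_zero_left[OF bounded_bilinear_dual_pairing]) (rule K(3)[OF that])
      have s\<alpha>: "smooth_in M j ?W (\<lambda>x. \<alpha> j x I)" for I
        by (rule smooth_in_subset[OF forms_smooth[OF \<alpha>]]) auto
      have cP: "continuous_on UNIV ?P"
        by (rule continuous_zero_extension[OF W(2) compact_imp_closed[OF K(1)] K(2)
              smooth_in_continuous[OF W(1) lp_smooth[OF fp W(1) s\<alpha> sd]]]) (rule z)
      have cQ: "continuous_on UNIV ?Q"
        by (rule continuous_zero_extension[OF W(2) compact_imp_closed[OF K(1)] K(2)
              smooth_in_continuous[OF W(1) lp_smooth[OF fp W(1) s\<alpha> sc]]]) (rule z)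
      have iP: "integrable vol ?P" by (rule integrable_vol[OF cP K(1) z])
      have iQ: "integrable vol ?Q" by (rule integrable_vol[OF cQ K(1) z])
      have eq: "?Q x = lp dual_pairing k i x (\<alpha> i x) (cdiv V k \<psi> i x)" for x
      proof (cases "x \<in> K")
        case True
        then have xi: "x \<in> cdom M i" "x \<in> cdom M j" using K(2) by auto
        have "?Q x = lp dual_pairing k j x (change (dual_bundle V) k j i x (\<alpha> i x)) (?c x)"
          by (rule lp_cong) (use forms_change[OF \<alpha> xi] in auto)
        then show ?thesis using lp_change[OF fp xi] by simp
      qed (simp add: z)
      have "(LINT x|vol. ?P x) = form_pairing M g dual_pairing (Suc k) (ext_d M (dual_bundle V) \<alpha>) \<psi>"
        by (rule green_chart[OF V k \<alpha> \<psi> K(1) _ K(3) d, symmetric]) (use K(2) in auto)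
      also have "\<dots> = (LINT x|vol. lp dual_pairing k i x (\<alpha> i x) (cdiv V k \<psi> i x))"
        by (rule green_chart[OF V k \<alpha> \<psi> K(1) _ K(3) d]) (use K(2) in auto)
      also have "\<dots> = (LINT x|vol. ?Q x)" unfolding eq ..
      finally have "(LINT x|vol. ?P x - ?Q x) = 0"
        using Bochner_Integration.integral_diff[OF iP iQ] by simp
      then show "(LINT x|vol. lp dual_pairing k j x (\<alpha> j x) (\<lambda>I. cdiv V k \<psi> j x I - ?c x I)) = 0"
        by (simp add: lp_diff_right[OF bounded_bilinear_dual_pairing])
    qed
    then show ?thesis by simp
  qed
qed


lemma ext_d_support:
  assumes "closed K" "\<And>j x I. x \<notin> K \<Longrightarrow> \<alpha> j x I = 0" "x \<notin> K"
  shows "ext_d M V \<alpha> j x I = 0"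
proof -
  have "ext_d M V \<alpha> j x I = ext_d M V (\<lambda>_ _ _. 0) j x I"
    by (rule ext_d_cong[of "- K"]) (use assms in auto)
  then show ?thesis by (simp add: ext_d_def)
qed

lemma cdiv_support:
  fixes V :: "('i, 'm, 'n, 'k::{real_normed_field,euclidean_space}, 'r::finite) vbundle"
  assumes K: "closed K" "\<And>j x I. x \<notin> K \<Longrightarrow> \<psi> j x I = 0" "x \<notin> K"
  shows "cdiv V k \<psi> j x I = 0"
proof (cases "x \<in> cdom M j")
  case True
  have o: "chart_open j (cdom M j - K)" using open_cdom K(1) by (auto simp: chart_open_def)
  have "cov M V j a (flux k \<psi> j a J) x = cov M V j a (\<lambda>_. 0) x" for a J
    by (rule cov_cong[OF o]) (use True K in \<open>auto simp: flux_def\<close>)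
  then show ?thesis by (simp add: cdiv_def divup_def)
qed (simp add: cdiv_def)

lemma green_in_chart:
  assumes V: "bundle_conn V" and k: "k \<le> 1" and \<alpha>: "\<alpha> \<in> forms M (dual_bundle V) k" and \<psi>: "\<psi> \<in> forms M V (Suc k)"
    and K: "compact K" "K \<subseteq> cdom M i" "\<And>j x I. x \<notin> K \<Longrightarrow> \<alpha> j x I = 0"
  shows "form_pairing M g dual_pairing (Suc k) (ext_d M (dual_bundle V) \<alpha>) \<psi> = form_pairing M g dual_pairing k \<alpha> (cdiv V k \<psi>)"
proof -
  have fp: "fibre_pairing (dual_bundle V) V dual_pairing"
    using V fibre_pairing_dual by (auto simp: bundle_conn_def)
  have "lp dual_pairing k i x (\<alpha> i x) (cdiv V k \<psi> i x) = gpair dual_pairing k \<alpha> (cdiv V k \<psi>) x" for x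
  proof (cases "x \<in> K")
    case True
    then show ?thesis using gpair_chart[OF fp \<alpha> div_form[OF V k \<psi>], of x i] K(2) by auto
  next
    case False
    have "gpair dual_pairing k \<alpha> \<beta> x = 0" for \<beta>
      by (rule gpair_zero[OF fp]) (simp add: K(3)[OF False])
    moreover have "lp dual_pairing k i x (\<alpha> i x) v = 0" for v
      by (rule lp_zero_left[OF bounded_bilinear_dual_pairing]) (rule K(3)[OF False])
    ultimately show ?thesis by simp
  qed
  then show ?thesis
    using green_chart[OF V k \<alpha> \<psi> K ext_d_form[OF bundle_conn_dual[OF V] k \<alpha>]] by (simp add: form_pairing_eq)
qed

text \<open>Splitting off bump functions from \<open>\<alpha>\<close> one at a time, by induction on a finite cover of its support, reduces the
  formula to forms supported in a single chart.\<close>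

lemma green_compact_left:
  fixes V :: "('i, 'm, 'n, 'k::{real_normed_field,euclidean_space}, 'r::finite) vbundle"
  assumes V: "bundle_conn V" and k: "k \<le> 1" and \<alpha>: "\<alpha> \<in> forms M (dual_bundle V) k" and \<psi>: "\<psi> \<in> forms M V (Suc k)"
    and c: "compact_support \<alpha>"
  shows "form_pairing M g dual_pairing (Suc k) (ext_d M (dual_bundle V) \<alpha>) \<psi> = form_pairing M g dual_pairing k \<alpha> (cdiv V k \<psi>)"
proof -
  let ?d = "ext_d M (dual_bundle V)"
  have Vd: "bundle_conn (dual_bundle V)" by (rule bundle_conn_dual[OF V])
  have fp: "fibre_pairing (dual_bundle V) V dual_pairing"
    using V fibre_pairing_dual by (auto simp: bundle_conn_def)
  have "\<exists>\<eta> U K i. smooth_fun M \<eta> \<and> open U \<and> x \<in> U \<and> compact K \<and> K \<subseteq> cdom M i \<and>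
      (\<forall>y\<in>U. \<eta> y = 1) \<and> (\<forall>y. y \<notin> K \<longrightarrow> \<eta> y = 0)" for x
    using manifold_bump[OF chart_open_cdom some_chart[of x]] by metis
  then obtain \<eta> U L i where b: "\<And>x. smooth_fun M (\<eta> x)" "\<And>x. open (U x)" "\<And>x. x \<in> U x" "\<And>x. compact (L x)"
    "\<And>x. L x \<subseteq> cdom M (i x)" "\<And>x y. y \<in> U x \<Longrightarrow> \<eta> x y = (1::real)" "\<And>x y. y \<notin> L x \<Longrightarrow> \<eta> x y = 0"
    by metis
  have main: "form_pairing M g dual_pairing (Suc k) (?d \<alpha>) \<psi> = form_pairing M g dual_pairing k \<alpha> (cdiv V k \<psi>)"
    if "finite C" "\<alpha> \<in> forms M (dual_bundle V) k" "compact K" "K \<subseteq> (\<Union>x\<in>C. U x)" "\<And>j x I. x \<notin> K \<Longrightarrow> \<alpha> j x I = 0"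
    for C K and \<alpha> :: "('i, 'm, 'n, 'k, 'r) form"
    using that
  proof (induction C arbitrary: K \<alpha> rule: finite_induct)
    case empty
    show ?case by (rule green_in_chart[OF V k empty.prems(1) \<psi>, of "{}"]) (use empty.prems in auto)
  next
    case (insert x C)
    let ?\<alpha>1 = "fscale (\<eta> x) \<alpha>" and ?\<alpha>2 = "fscale (\<lambda>y. 1 - \<eta> x y) \<alpha>"
    have f: "?\<alpha>1 \<in> forms M (dual_bundle V) k" "?\<alpha>2 \<in> forms M (dual_bundle V) k"
      by (intro fscale_forms smooth_fun_diff smooth_fun_const b(1) insert.prems(1))+
    have z1: "?\<alpha>1 j y I = 0" if "y \<notin> L x" for j y I using b(7)[OF that] by (simp add: fscale_def)
    have z2: "?\<alpha>2 j y I = 0" if "y \<notin> K - U x" for j y I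
      using that b(6)[of y x] insert.prems(4)[of y] by (auto simp: fscale_def)
    have c2: "compact (K - U x)" using insert.prems(2) b(2) by (rule compact_diff)
    have s: "\<alpha> = (\<lambda>i y I. ?\<alpha>1 i y I + ?\<alpha>2 i y I)"
      by (auto simp: fscale_def fun_eq_iff scaleR_left_distrib[symmetric])
    have cs: "compact_support ?\<alpha>1" "compact_support ?\<alpha>2"
      unfolding compact_support_def using z1 z2 b(4)[of x] c2 by (intro exI[of _ "L x"] exI[of _ "K - U x"], blast)+
    have cd: "compact_support (?d ?\<alpha>1)" "compact_support (?d ?\<alpha>2)"
    proof -
      have "?d ?\<alpha>1 j y I = 0" if "y \<notin> L x" for j y I
        by (rule ext_d_support[OF compact_imp_closed[OF b(4)] _ that]) (rule z1)
      then show "compact_support (?d ?\<alpha>1)" unfolding compact_support_def using b(4)[of x] by blast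
      have "?d ?\<alpha>2 j y I = 0" if "y \<notin> K - U x" for j y I
        by (rule ext_d_support[OF compact_imp_closed[OF c2] _ that]) (rule z2)
      then show "compact_support (?d ?\<alpha>2)" unfolding compact_support_def using c2 by blast
    qed
    have "?d \<alpha> = (\<lambda>i y I. ?d ?\<alpha>1 i y I + ?d ?\<alpha>2 i y I)"
      by (subst s) (intro ext ext_d_add[OF f])
    then have "form_pairing M g dual_pairing (Suc k) (?d \<alpha>) \<psi> =
        form_pairing M g dual_pairing (Suc k) (?d ?\<alpha>1) \<psi> + form_pairing M g dual_pairing (Suc k) (?d ?\<alpha>2) \<psi>"
      using form_pairing_add_left[OF fp ext_d_form[OF Vd k f(1)] ext_d_form[OF Vd k f(2)] \<psi>] cd by simp
    also have "form_pairing M g dual_pairing (Suc k) (?d ?\<alpha>1) \<psi> = form_pairing M g dual_pairing k ?\<alpha>1 (cdiv V k \<psi>)"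
      by (rule green_in_chart[OF V k f(1) \<psi> b(4,5)]) (rule z1)
    also have "form_pairing M g dual_pairing (Suc k) (?d ?\<alpha>2) \<psi> = form_pairing M g dual_pairing k ?\<alpha>2 (cdiv V k \<psi>)"
      by (rule insert.IH[OF f(2) c2]) (use insert.prems(3) z2 in auto)
    also have "form_pairing M g dual_pairing k ?\<alpha>1 (cdiv V k \<psi>) + form_pairing M g dual_pairing k ?\<alpha>2 (cdiv V k \<psi>)
        = form_pairing M g dual_pairing k (\<lambda>i y I. ?\<alpha>1 i y I + ?\<alpha>2 i y I) (cdiv V k \<psi>)"
      using form_pairing_add_left[OF fp f div_form[OF V k \<psi>]] cs by simp
    finally show ?case using s by simp
  qed
  obtain K where K: "compact K" "\<And>j x I. x \<notin> K \<Longrightarrow> \<alpha> j x I = 0" using c unfolding compact_support_def by blast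
  have "K \<subseteq> (\<Union>x\<in>K. U x)" using b(3) by blast
  then obtain C where C: "C \<subseteq> K" "finite C" "K \<subseteq> (\<Union>x\<in>C. U x)"
    using compactE_image[OF K(1), of K U] b(2) by blast
  show ?thesis by (rule main[OF C(2) \<alpha> K(1) C(3) K(2)])
qed

text \<open>If only \<open>\<psi>\<close> has compact support, \<open>\<alpha>\<close> may be multiplied by a function that is 1 near the support of \<open>\<psi>\<close>.\<close>

theorem green:
  fixes V :: "('i, 'm, 'n, 'k::{real_normed_field,euclidean_space}, 'r::finite) vbundle"
  assumes V: "bundle_conn V" and k: "k \<le> 1" and \<alpha>: "\<alpha> \<in> forms M (dual_bundle V) k" and \<psi>: "\<psi> \<in> forms M V (Suc k)"
    and c: "compact_support \<alpha> \<or> compact_support \<psi>"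
  shows "form_pairing M g dual_pairing (Suc k) (ext_d M (dual_bundle V) \<alpha>) \<psi> = form_pairing M g dual_pairing k \<alpha> (cdiv V k \<psi>)"
  using c
proof
  assume "compact_support \<alpha>"
  then show ?thesis by (rule green_compact_left[OF V k \<alpha> \<psi>])
next
  let ?d = "ext_d M (dual_bundle V)"
  have fp: "fibre_pairing (dual_bundle V) V dual_pairing"
    using V fibre_pairing_dual by (auto simp: bundle_conn_def)
  assume "compact_support \<psi>"
  then obtain K where K: "compact K" "\<And>j x I. x \<notin> K \<Longrightarrow> \<psi> j x I = 0" unfolding compact_support_def by blast
  obtain \<eta> U L where b: "smooth_fun M \<eta>" "open U" "K \<subseteq> U" "compact L" "\<And>y. y \<in> U \<Longrightarrow> \<eta> y = 1" "\<And>y. y \<notin> L \<Longrightarrow> \<eta> y = 0"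
    using compact_cutoff[OF K(1)] by metis
  let ?\<alpha> = "fscale \<eta> \<alpha>"
  have f: "?\<alpha> \<in> forms M (dual_bundle V) k" by (rule fscale_forms[OF b(1) \<alpha>])
  have cs: "compact_support ?\<alpha>" unfolding compact_support_def fscale_def using b(4,6) by auto
  have e1: "gpair dual_pairing (Suc k) (?d \<alpha>) \<psi> x = gpair dual_pairing (Suc k) (?d ?\<alpha>) \<psi> x" for x
  proof (cases "x \<in> U")
    case True
    have "?d \<alpha> j x = ?d ?\<alpha> j x" for j
      by (rule ext, rule ext_d_cong[OF b(2) True]) (simp add: fscale_def b(5))
    then show ?thesis by (simp add: gpair_def)
  next
    case False
    then have "\<psi> i x I = 0" for i I using K(2) b(3) by blast
    then show ?thesis by (simp add: gpair_zero[OF fp])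
  qed
  have e2: "gpair dual_pairing k \<alpha> (cdiv V k \<psi>) x = gpair dual_pairing k ?\<alpha> (cdiv V k \<psi>) x" for x
  proof (cases "x \<in> U")
    case True
    then show ?thesis by (simp add: gpair_def fscale_def b(5))
  next
    case False
    then have "x \<notin> K" using b(3) by blast
    then have "cdiv V k \<psi> i x I = 0" for i I
      by (rule cdiv_support[OF compact_imp_closed[OF K(1)], rotated]) (rule K(2))
    then show ?thesis by (simp add: gpair_zero[OF fp])
  qed
  have "form_pairing M g dual_pairing (Suc k) (?d ?\<alpha>) \<psi> = form_pairing M g dual_pairing k ?\<alpha> (cdiv V k \<psi>)"
    by (rule green_compact_left[OF V k f \<psi> cs])
  then show ?thesis unfolding form_pairing_eq e1 e2 .
qed

lemma form_nondegenerate: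
  assumes V: "vector_bundle M V" and k: "k \<le> 1" and \<omega>: "\<omega> \<in> forms M V k" "\<omega>' \<in> forms M V k"
    and eq: "\<And>\<alpha>. \<alpha> \<in> forms M (dual_bundle V) k \<Longrightarrow> compact_support \<alpha> \<Longrightarrow>
      form_pairing M g dual_pairing k \<alpha> \<omega> = form_pairing M g dual_pairing k \<alpha> \<omega>'"
  shows "\<omega> = \<omega>'"
proof (rule form_eqI[OF \<omega>])
  note fp = fibre_pairing_dual[OF V]
  fix i x and I :: "'n list" assume x: "x \<in> cdom M i" and I: "length I = k"
  let ?u = "\<lambda>i x I. \<omega> i x I - \<omega>' i x I"
  have "?u i x I = 0"
  proof (rule pairing_nondegenerate[OF V k chart_open_cdom _ _ x I, of "?u i"])
    show "continuous_on (cdom M i) (\<lambda>x. ?u i x J)" for J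
      by (intro continuous_intros smooth_in_continuous[OF chart_open_cdom] forms_smooth[OF \<omega>(1)] forms_smooth[OF \<omega>(2)])
    fix \<alpha> K assume \<alpha>: "\<alpha> \<in> forms M (dual_bundle V) k" and K: "compact K" "K \<subseteq> cdom M i" "\<And>j x I. x \<notin> K \<Longrightarrow> \<alpha> j x I = 0"
    have c: "compact_support \<alpha>" unfolding compact_support_def using K by blast
    have "lp dual_pairing k i x (\<alpha> i x) (?u i x) = gpair dual_pairing k \<alpha> ?u x" for x
    proof (cases "x \<in> K")
      case True
      then show ?thesis using gpair_chart[OF fp \<alpha> forms_diff[OF \<omega>], of x i] K(2) by auto
    next
      case False
      have "gpair dual_pairing k \<alpha> \<beta> x = 0" for \<beta>
        by (rule gpair_zero[OF fp]) (simp add: K(3)[OF False])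
      moreover have "lp dual_pairing k i x (\<alpha> i x) v = 0" for v
        by (rule lp_zero_left[OF bounded_bilinear_dual_pairing]) (rule K(3)[OF False])
      ultimately show ?thesis by simp
    qed
    then have "(LINT x|vol. lp dual_pairing k i x (\<alpha> i x) (?u i x)) = form_pairing M g dual_pairing k \<alpha> ?u"
      by (simp add: form_pairing_eq)
    also have "\<dots> = 0"
      using form_pairing_diff_right[OF fp \<alpha> \<omega>] c eq[OF \<alpha> c] by simp
    finally show "(LINT x|vol. lp dual_pairing k i x (\<alpha> i x) (?u i x)) = 0" .
  qed
  then show "\<omega> i x I = \<omega>' i x I" by simp
qed


section \<open>Weighted forms\<close>

lemma conf_scale_1: "conf_scale M (\<lambda>_. 1)"
  by (simp add: conf_scale_def smooth_fun_const)

lemma rescale_1: "rescale (\<lambda>_. 1) g = g"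
  by (simp add: rescale_def)

lemma rescale_rescale: "rescale \<Omega> (rescale \<Omega>' h) = rescale (\<lambda>x. \<Omega> x * \<Omega>' x) h"
  by (simp add: rescale_def power_mult_distrib)

lemma conf_scale_mult: "conf_scale M \<Omega> \<Longrightarrow> conf_scale M \<Omega>' \<Longrightarrow> conf_scale M (\<lambda>x. \<Omega> x * \<Omega>' x)"
  by (simp add: conf_scale_def smooth_fun_mult)

lemma conf_scale_powr: "conf_scale M \<Omega> \<Longrightarrow> conf_scale M (\<lambda>x. \<Omega> x powr r)"
  unfolding conf_scale_def smooth_fun_def
  by (intro conjI allI smooth_in_powr[OF chart_open_cdom]) (simp_all add: less_imp_neq[symmetric])

lemma g_in_conf_class: "g \<in> conf_class M g"
  unfolding conf_class_def using conf_scale_1 rescale_1 by force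

lemma rescale_in_conf_class: "conf_scale M \<Omega> \<Longrightarrow> h \<in> conf_class M g \<Longrightarrow> rescale \<Omega> h \<in> conf_class M g"
  unfolding conf_class_def using rescale_rescale conf_scale_mult by blast

text \<open>The metric is nowhere zero since it is invertible.\<close>

lemma rescale_inject:
  assumes "conf_scale M \<Omega>" "conf_scale M \<Omega>'" "rescale \<Omega> g = rescale \<Omega>' g"
  shows "\<Omega> = \<Omega>'"
proof
  fix x
  obtain i where x: "x \<in> cdom M i" using ex_chart by blast
  have "g i x \<noteq> 0"
  proof
    assume "g i x = 0"
    then show False using gi_inverse(1)[OF x, of undefined undefined] by simp
  qed
  moreover have "(\<Omega> x)\<^sup>2 *\<^sub>R g i x = (\<Omega>' x)\<^sup>2 *\<^sub>R g i x"
    using assms(3) unfolding rescale_def by (metis (no_types))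
  ultimately have "(\<Omega> x)\<^sup>2 = (\<Omega>' x)\<^sup>2" by simp
  then show "\<Omega> x = \<Omega>' x"
    using assms(1,2) by (simp add: conf_scale_def power2_eq_iff_nonneg less_imp_le)
qed

lemma weighted_forms_eqI:
  assumes "\<psi> \<in> weighted_forms M (conf_class M g) V k" "\<psi>' \<in> weighted_forms M (conf_class M g) V k" "\<psi> g = \<psi>' g"
  shows "\<psi> = \<psi>'"
proof
  fix h
  show "\<psi> h = \<psi>' h"
  proof (cases "h \<in> conf_class M g")
    case True
    then obtain \<Omega> where "conf_scale M \<Omega>" "h = rescale \<Omega> g" unfolding conf_class_def by blast
    then show ?thesis using assms g_in_conf_class unfolding weighted_forms_def by simp
  next
    case False
    then show ?thesis using assms unfolding weighted_forms_def by simp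
  qed
qed

lemma weighted_form_at: "\<psi> \<in> weighted_forms M (conf_class M g) V k \<Longrightarrow> \<psi> g \<in> forms M V k"
  unfolding weighted_forms_def using g_in_conf_class by blast

text \<open>Every metric of the class is \<open>S\<^sup>2 g\<close> for a unique positive \<open>S\<close>, and \<open>S\<^bsup>2k-n\<^esup> \<omega>\<close> is then the only possible value.\<close>

lemma weighted_exists:
  assumes \<omega>: "\<omega> \<in> forms M V k"
  obtains \<psi> where "\<psi> \<in> weighted_forms M (conf_class M g) V k" "\<psi> g = \<omega>"
proof -
  let ?r = "2 * real k - real CARD('n)"
  define S where "S h = (SOME \<Omega>. conf_scale M \<Omega> \<and> h = rescale \<Omega> g)" for h
  define \<psi> where "\<psi> h = (if h \<in> conf_class M g then fscale (\<lambda>x. S h x powr ?r) \<omega> else (\<lambda>_ _ _. 0))" for h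
  have S: "conf_scale M (S h)" "h = rescale (S h) g" if "h \<in> conf_class M g" for h
  proof -
    have "\<exists>\<Omega>. conf_scale M \<Omega> \<and> h = rescale \<Omega> g" using that unfolding conf_class_def by blast
    from someI_ex[OF this] show "conf_scale M (S h)" "h = rescale (S h) g" by (auto simp: S_def)
  qed
  have S1: "S (rescale \<Omega> h) = (\<lambda>x. \<Omega> x * S h x)" if "conf_scale M \<Omega>" "h \<in> conf_class M g" for \<Omega> h
  proof (rule rescale_inject)
    show "conf_scale M (S (rescale \<Omega> h))" by (rule S(1)[OF rescale_in_conf_class[OF that]])
    show "conf_scale M (\<lambda>x. \<Omega> x * S h x)" by (rule conf_scale_mult[OF that(1) S(1)[OF that(2)]])
    show "rescale (S (rescale \<Omega> h)) g = rescale (\<lambda>x. \<Omega> x * S h x) g"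
      using S(2)[OF rescale_in_conf_class[OF that]] S(2)[OF that(2)] rescale_rescale by metis
  qed
  have Sg: "S g = (\<lambda>_. 1)"
    by (rule rescale_inject[OF S(1)[OF g_in_conf_class] conf_scale_1]) (use S(2)[OF g_in_conf_class] rescale_1 in simp)
  have "\<psi> \<in> weighted_forms M (conf_class M g) V k"
    unfolding weighted_forms_def
  proof (intro CollectI conjI allI ballI impI)
    show "\<psi> h = (\<lambda>_ _ _. 0)" if "h \<notin> conf_class M g" for h using that by (simp add: \<psi>_def)
    show "\<psi> h \<in> forms M V k" if "h \<in> conf_class M g" for h
      using that conf_scale_powr[OF S(1)[OF that]] by (simp add: \<psi>_def fscale_forms[OF _ \<omega>] conf_scale_def)
    show "\<psi> (rescale \<Omega> h) = fscale (\<lambda>x. \<Omega> x powr ?r) (\<psi> h)" if h: "h \<in> conf_class M g" and \<Omega>: "conf_scale M \<Omega>" for h \<Omega>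
    proof -
      have "0 \<le> \<Omega> x" "0 \<le> S h x" for x
        using \<Omega> S(1)[OF h] by (auto simp: conf_scale_def less_imp_le)
      then show ?thesis
        using h rescale_in_conf_class[OF \<Omega> h] by (simp add: \<psi>_def S1[OF \<Omega> h] fscale_def powr_mult)
    qed
  qed
  moreover have "\<psi> g = \<omega>" by (simp add: \<psi>_def g_in_conf_class Sg fscale_def)
  ultimately show thesis by (rule that)
qed

lemma weighted:
  assumes "\<omega> \<in> forms M V k"
  shows "weighted M V g k \<omega> \<in> weighted_forms M (conf_class M g) V k" "weighted M V g k \<omega> g = \<omega>"
proof -
  obtain \<psi> where \<psi>: "\<psi> \<in> weighted_forms M (conf_class M g) V k" "\<psi> g = \<omega>" using weighted_exists[OF assms] .
  have "weighted M V g k \<omega> = \<psi>"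
    unfolding weighted_def by (rule the_equality) (use \<psi> weighted_forms_eqI in auto)
  then show "weighted M V g k \<omega> \<in> weighted_forms M (conf_class M g) V k" "weighted M V g k \<omega> g = \<omega>" using \<psi> by auto
qed

text \<open>Green's formula provides an adjoint, and nondegeneracy of the pairing with test forms its uniqueness.\<close>

lemma codiff:
  fixes V :: "('i, 'm, 'n, 'k::{real_normed_field,euclidean_space}, 'r::finite) vbundle"
  assumes V: "bundle_conn V" and k: "k \<le> 1" and \<psi>: "\<psi> \<in> weighted_forms M (conf_class M g) V (Suc k)"
  shows "codiff M V g k \<psi> \<in> weighted_forms M (conf_class M g) V k" "codiff M V g k \<psi> g = cdiv V k (\<psi> g)"
proof -
  have V': "vector_bundle M V" using V by (simp add: bundle_conn_def)
  have \<psi>g: "\<psi> g \<in> forms M V (Suc k)" by (rule weighted_form_at[OF \<psi>])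
  have dg: "cdiv V k (\<psi> g) \<in> forms M V k" by (rule div_form[OF V k \<psi>g])
  let ?\<eta> = "weighted M V g k (cdiv V k (\<psi> g))"
  note \<eta> = weighted[OF dg]
  have "codiff M V g k \<psi> = ?\<eta>"
    unfolding codiff_def
  proof (rule the_equality)
    show "?\<eta> \<in> weighted_forms M (conf_class M g) V k \<and> (\<forall>\<alpha>\<in>forms M (dual_bundle V) k. compact_support \<alpha> \<longrightarrow>
        form_pairing M g dual_pairing (Suc k) (ext_d M (dual_bundle V) \<alpha>) (\<psi> g) = form_pairing M g dual_pairing k \<alpha> (?\<eta> g))"
      using \<eta> green[OF V k _ \<psi>g] by auto
    fix \<eta>' assume e: "\<eta>' \<in> weighted_forms M (conf_class M g) V k \<and> (\<forall>\<alpha>\<in>forms M (dual_bundle V) k. compact_support \<alpha> \<longrightarrow>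
        form_pairing M g dual_pairing (Suc k) (ext_d M (dual_bundle V) \<alpha>) (\<psi> g) = form_pairing M g dual_pairing k \<alpha> (\<eta>' g))"
    have "\<eta>' g = cdiv V k (\<psi> g)"
    proof (rule form_nondegenerate[OF V' k _ dg])
      show "\<eta>' g \<in> forms M V k" using e weighted_form_at by blast
      fix \<alpha> assume a: "\<alpha> \<in> forms M (dual_bundle V) k" "compact_support \<alpha>"
      then show "form_pairing M g dual_pairing k \<alpha> (\<eta>' g) = form_pairing M g dual_pairing k \<alpha> (cdiv V k (\<psi> g))"
        using e green[OF V k a(1) \<psi>g] by simp
    qed
    then show "\<eta>' = ?\<eta>" using e \<eta> weighted_forms_eqI by metis
  qed
  then show "codiff M V g k \<psi> \<in> weighted_forms M (conf_class M g) V k" "codiff M V g k \<psi> g = cdiv V k (\<psi> g)"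
    using \<eta> by auto
qed

lemma zero_weighted: "(\<lambda>_ _ _ _. 0) \<in> weighted_forms M (conf_class M g) V k"
  by (simp add: weighted_forms_def forms_zero fscale_def)

lemma weighted_forms_eq_0_iff:
  "\<psi> \<in> weighted_forms M (conf_class M g) V k \<Longrightarrow> \<psi> = (\<lambda>_ _ _ _. 0) \<longleftrightarrow> \<psi> g = (\<lambda>_ _ _. 0)"
  using weighted_forms_eqI[OF _ zero_weighted] by metis

end

section \<open>Curvature\<close>

context smooth_mfd
begin

lemma curvature_eq:
  fixes V :: "('i, 'm, 'n, 'k::{real_normed_field,euclidean_space}, 'r::finite) vbundle"
  assumes V: "connection M V" and x: "x \<in> cdom M i"
  shows "curvature M V i x a b =
    pd M i a (\<lambda>y. conn_form V i y b) x - pd M i b (\<lambda>y. conn_form V i y a) x +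
    (conn_form V i x a ** conn_form V i x b - conn_form V i x b ** conn_form V i x a)"
proof -
  let ?A = "conn_form V i"
  have c: "cov M V i b (\<lambda>_. v) = (\<lambda>y. ?A y b *v v)" for b v
    by (simp add: cov_def[abs_def])
  have p: "pd M i a (\<lambda>y. ?A y b *v v) x = pd M i a (\<lambda>y. ?A y b) x *v v" for a b v
    by (rule pd_linear[OF mv.bounded_linear_left smooth_in_conn_form[OF V] x])
  have "(\<lambda>v. cov M V i a (cov M V i b (\<lambda>_. v)) x - cov M V i b (cov M V i a (\<lambda>_. v)) x) =
    (*v) (pd M i a (\<lambda>y. ?A y b) x - pd M i b (\<lambda>y. ?A y a) x + (?A x a ** ?A x b - ?A x b ** ?A x a))"
    unfolding c by (simp add: cov_def p mv.diff_left mv.add_left matrix_vector_mul_assoc fun_eq_iff)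
  then show ?thesis unfolding curvature_def by (simp add: matrix_of_matrix_vector_mul)
qed

lemma curvature_skew: "curvature M V i x a b = - curvature M V i x b a"
  by (simp add: curvature_def matrix_def vec_eq_iff)

lemma curvature_smooth:
  assumes V: "connection M V"
  shows "smooth_in M i (cdom M i) (\<lambda>x. curvature M V i x a b)"
proof -
  note A = smooth_in_conn_form[OF V]
  have "smooth_in M i (cdom M i) (\<lambda>x. pd M i a (\<lambda>y. conn_form V i y b) x - pd M i b (\<lambda>y. conn_form V i y a) x +
    (conn_form V i x a ** conn_form V i x b - conn_form V i x b ** conn_form V i x a))"
    by (intro smooth_in_add[OF chart_open_cdom] smooth_in_diff[OF chart_open_cdom] smooth_in_pd[OF chart_open_cdom]
        smooth_in_bilinear[OF chart_open_cdom bounded_bilinear_matrix_mult] A)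
  then show ?thesis by (rule smooth_in_cong[OF chart_open_cdom, rotated]) (simp add: curvature_eq[OF V])
qed

lemma curvature_dual:
  fixes V :: "('i, 'm, 'n, 'k::{real_normed_field,euclidean_space}, 'r::finite) vbundle"
  assumes V: "vector_bundle M V" "connection M V" and x: "x \<in> cdom M i"
  shows "curvature M (dual_bundle V) i x a b = - transpose (curvature M V i x a b)"
proof -
  interpret t: bounded_linear "transpose :: 'k^'r^'r \<Rightarrow> 'k^'r^'r" by (rule bounded_linear_transpose)
  have p: "pd M i a (\<lambda>y. - transpose (conn_form V i y b)) x = - transpose (pd M i a (\<lambda>y. conn_form V i y b) x)" for a b
    using pd_linear[OF bounded_linear_minus[OF bounded_linear_transpose] smooth_in_conn_form[OF V(2)] x] .
  show ?thesis
    unfolding curvature_eq[OF V(2) x] curvature_eq[OF connection_dual[OF V] x]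
    by (simp add: dual_bundle_def p t.diff t.add matrix_transpose_mul mm.minus_left mm.minus_right)
qed

lemma curvature_cov:
  fixes V :: "('i, 'm, 'n, 'k::{real_normed_field,euclidean_space}, 'r::finite) vbundle"
  assumes V: "connection M V" and s: "smooth_in M i (cdom M i) s" and x: "x \<in> cdom M i"
  shows "cov M V i a (cov M V i b s) x - cov M V i b (cov M V i a s) x = curvature M V i x a b *v s x"
proof -
  let ?A = "conn_form V i"
  have A: "smooth_in M i (cdom M i) (\<lambda>y. ?A y b)" for b by (rule smooth_in_conn_form[OF V])
  have "cov M V i a (cov M V i b s) x = pd M i a (pd M i b s) x + ?A x b *v pd M i a s x
      + pd M i a (\<lambda>y. ?A y b) x *v s x + ?A x a *v pd M i b s x + ?A x a *v (?A x b *v s x)" for a b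
  proof -
    have "pd M i a (\<lambda>y. pd M i b s y + ?A y b *v s y) x = pd M i a (pd M i b s) x + pd M i a (\<lambda>y. ?A y b *v s y) x"
      by (rule pd_add[OF smooth_in_pd[OF chart_open_cdom s] smooth_in_bilinear[OF chart_open_cdom bounded_bilinear_matrix_vector A s] x])
    also have "pd M i a (\<lambda>y. ?A y b *v s y) x = ?A x b *v pd M i a s x + pd M i a (\<lambda>y. ?A y b) x *v s x"
      by (rule pd_bilinear[OF bounded_bilinear_matrix_vector A s x x])
    finally show ?thesis by (simp add: cov_def[abs_def] mv.add_right add.assoc)
  qed
  moreover have "pd M i a (pd M i b s) x = pd M i b (pd M i a s) x"
    by (rule pd_commute[OF chart_open_cdom s x])
  ultimately show ?thesis
    by (simp add: curvature_eq[OF V x] mv.add_left mv.diff_left matrix_vector_mul_assoc)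
qed

lemma ext_d_ext_d:
  assumes V: "connection M V" and s: "s \<in> forms M V 0" and x: "x \<in> cdom M i"
  shows "ext_d M V (ext_d M V s) i x [a, b] = curvature M V i x a b *v s i x []"
proof -
  have "cov M V i a (\<lambda>y. ext_d M V s i y [b]) x = cov M V i a (cov M V i b (\<lambda>y. s i y [])) x" for a b
    by (rule cov_cong[OF chart_open_cdom x]) (simp add: ext_d_0)
  then show ?thesis
    using curvature_cov[OF V forms_smooth[OF s] x] by (simp add: ext_d_1[OF x])
qed

text \<open>The curvature is a 2-form because \<open>d\<^sup>D d\<^sup>D s\<close> is one for every section \<open>s\<close>.\<close>

lemma curvature_change:
  fixes V :: "('i, 'm, 'n, 'k::{real_normed_field,euclidean_space}, 'r::finite) vbundle"
  assumes V: "bundle_conn V" and x: "x \<in> cdom M i" "x \<in> cdom M j"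
  shows "curvature M V j x a b *v (transition V j i x *v v) =
    (\<Sum>c\<in>UNIV. \<Sum>d\<in>UNIV. (jac M j i x a c * jac M j i x b d) *\<^sub>R (transition V j i x *v (curvature M V i x c d *v v)))"
proof -
  have V': "vector_bundle M V" "connection M V" using V by (auto simp: bundle_conn_def)
  obtain s where s: "s \<in> forms M V 0" "s i x = (\<lambda>I. if I = [] then v else 0)"
    by (rule ex_form_with_value[OF V'(1) _ x(1), of 0 "\<lambda>I. if I = [] then v else 0"]) (auto simp: alt_tensors_le_1)
  have dd: "ext_d M V (ext_d M V s) \<in> forms M V 2"
    by (rule ext_d_form_1[OF V ext_d_form_0[OF V s(1)]])
  have "s j x [] = transition V j i x *v v"
    using forms_change[OF s(1) x, of "[]"] s(2) by (simp add: change_0)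
  then have "curvature M V j x a b *v (transition V j i x *v v) = ext_d M V (ext_d M V s) j x [a, b]"
    by (simp add: ext_d_ext_d[OF V'(2) s(1) x(2)])
  also have "\<dots> = change V (Suc (Suc 0)) j i x (ext_d M V (ext_d M V s) i x) [a, b]"
    using forms_change[OF dd x, of "[a, b]"] by (simp add: numeral_2_eq_2)
  finally show ?thesis
    unfolding change_2 by (simp add: ext_d_ext_d[OF V'(2) s(1) x(1)] s(2))
qed

lemma end_transition_vec:
  fixes V :: "('i, 'm, 'n, 'k::{real_normed_field,euclidean_space}, 'r::finite) vbundle"
  shows "transition (end_bundle V) j i x *v (\<chi> cd. F $ fst cd $ snd cd) =
    (\<chi> cd. (transition V j i x ** F ** transition V i j x) $ fst cd $ snd cd)"
proof (rule vec_eq_iff[THEN iffD2], rule allI)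
  fix cd :: "'r \<times> 'r"
  let ?G = "transition V j i x" and ?H = "transition V i j x"
  have "(transition (end_bundle V) j i x *v (\<chi> cd. F $ fst cd $ snd cd)) $ cd
      = (\<Sum>u\<in>UNIV. \<Sum>v\<in>UNIV. ?G $ fst cd $ u * ?H $ v $ snd cd * F $ u $ v)"
    using sum_UNIV_pair[of "\<lambda>u v. ?G $ fst cd $ u * ?H $ v $ snd cd * F $ u $ v"]
    by (simp add: matrix_vector_mult_def end_bundle_def)
  also have "\<dots> = (\<Sum>v\<in>UNIV. \<Sum>u\<in>UNIV. ?G $ fst cd $ u * ?H $ v $ snd cd * F $ u $ v)" by (rule sum.swap)
  also have "\<dots> = (?G ** F ** ?H) $ fst cd $ snd cd"
    by (simp add: matrix_matrix_mult_def sum_distrib_left sum_distrib_right mult_ac)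
  finally show "(transition (end_bundle V) j i x *v (\<chi> cd. F $ fst cd $ snd cd)) $ cd
    = (\<chi> cd. (?G ** F ** ?H) $ fst cd $ snd cd) $ cd" by simp
qed

lemma curvature_form_form:
  fixes V :: "('i, 'm, 'n, 'k::{real_normed_field,euclidean_space}, 'r::finite) vbundle"
  assumes V: "bundle_conn V"
  shows "curvature_form M V \<in> forms M (end_bundle V) 2"
  unfolding forms_iff
proof (intro conjI allI ballI impI)
  have V': "vector_bundle M V" "connection M V" using V by (auto simp: bundle_conn_def)
  show "curvature_form M V i x \<in> alt_tensors 2" for i x
    unfolding alt_tensors_def
  proof (intro CollectI conjI allI impI)
    show "curvature_form M V i x I = 0" if "length I \<noteq> 2" for I using that by (simp add: curvature_form_def)
    fix I :: "'n list" and s t assume st: "s < t \<and> t < length I"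
    show "curvature_form M V i x (I[s := I ! t, t := I ! s]) = - curvature_form M V i x I"
    proof (cases "length I = 2")
      case True
      then obtain a b where I: "I = [a, b]" by (auto simp: length_Suc_conv numeral_2_eq_2)
      have "s = 0" "t = 1" using st I by auto
      then show ?thesis unfolding I curvature_form_def using curvature_skew[of V i x b a] by (simp add: vec_eq_iff)
    qed (simp add: curvature_form_def)
  qed
  show "curvature_form M V i x I = 0" if "x \<notin> cdom M i" for i x I using that by (simp add: curvature_form_def)
  show "smooth_in M i (cdom M i) (\<lambda>x. curvature_form M V i x I)" for i I
  proof (cases "length I = 2")
    case True
    have "smooth_in M i (cdom M i) (\<lambda>x. \<chi> cd. curvature M V i x (I ! 0) (I ! 1) $ fst cd $ snd cd)"
      by (intro smooth_in_vec_lambda[OF chart_open_cdom] smooth_in_vec_nth[OF chart_open_cdom] curvature_smooth[OF V'(2)])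
    then show ?thesis
      by (rule smooth_in_cong[OF chart_open_cdom, rotated]) (simp add: curvature_form_def True)
  qed (simp add: curvature_form_def smooth_in_const)
  show "curvature_form M V j x I = change (end_bundle V) 2 j i x (curvature_form M V i x) I"
    if xx: "x \<in> cdom M i \<inter> cdom M j" and I: "length I = 2" for i j x I
  proof -
    have x: "x \<in> cdom M i" "x \<in> cdom M j" using xx by auto
    obtain a b where ab: "I = [a, b]" using I by (auto simp: length_Suc_conv numeral_2_eq_2)
    let ?G = "transition V j i x" and ?H = "transition V i j x"
    have GH: "?G *v (?H *v v) = v" for v
      using transition_inverse[OF V'(1) x(2,1)] by (simp add: matrix_vector_mul_assoc)
    have "curvature M V j x a b *v v = (\<Sum>c\<in>UNIV. \<Sum>d\<in>UNIV. (jac M j i x a c * jac M j i x b d) *\<^sub>R (?G ** curvature M V i x c d ** ?H)) *v v" for v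
      using curvature_change[OF V x, of a b "?H *v v"]
      unfolding GH by (simp add: mv.sum_left mv.scaleR_left matrix_vector_mul_assoc[symmetric] del: matrix_vector_mul_assoc)
    then have c: "curvature M V j x a b = (\<Sum>c\<in>UNIV. \<Sum>d\<in>UNIV. (jac M j i x a c * jac M j i x b d) *\<^sub>R (?G ** curvature M V i x c d ** ?H))"
      by (simp add: matrix_eq)
    show ?thesis
      unfolding ab numeral_2_eq_2 change_2
      by (simp add: curvature_form_def x end_transition_vec c vec_eq_iff)
  qed
qed

end

context pseudo_riem
begin

lemma F_dot_eq: "F_dot M V g \<phi> i x [a] = (\<Sum>b\<in>UNIV. \<Sum>c\<in>UNIV. gi i x c b *\<^sub>R (curvature M V i x a c *v \<phi> i x [b]))"
  by (simp add: F_dot_def gi_def)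

lemma F_dot_form:
  fixes V :: "('i, 'm, 'n, 'k::{real_normed_field,euclidean_space}, 'r::finite) vbundle"
  assumes V: "bundle_conn V" and \<phi>: "\<phi> \<in> forms M V 1"
  shows "F_dot M V g \<phi> \<in> forms M V 1"
  unfolding forms_iff
proof (intro conjI allI ballI impI)
  have V': "vector_bundle M V" "connection M V" using V by (auto simp: bundle_conn_def)
  show "F_dot M V g \<phi> i x \<in> alt_tensors 1" for i x
    by (simp add: alt_tensors_le_1 F_dot_def)
  show "F_dot M V g \<phi> i x I = 0" if "x \<notin> cdom M i" for i x I
    using forms_outside[OF \<phi> that] by (simp add: F_dot_def)
  show "smooth_in M i (cdom M i) (\<lambda>x. F_dot M V g \<phi> i x I)" for i I
  proof (cases "length I = 1")
    case True
    then obtain a where a: "I = [a]" by (auto simp: length_Suc_conv)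
    show ?thesis unfolding a F_dot_eq
      by (intro smooth_in_sum[OF chart_open_cdom] smooth_in_scaleR[OF chart_open_cdom] gi_smooth
          smooth_in_bilinear[OF chart_open_cdom bounded_bilinear_matrix_vector] curvature_smooth[OF V'(2)] forms_smooth[OF \<phi>])
  qed (simp add: F_dot_def smooth_in_const)
  show "F_dot M V g \<phi> j x I = change V 1 j i x (F_dot M V g \<phi> i x) I"
    if xx: "x \<in> cdom M i \<inter> cdom M j" and I: "length I = 1" for i j x I
  proof -
    have x: "x \<in> cdom M i" "x \<in> cdom M j" using xx by auto
    obtain a where a: "I = [a]" using I by (auto simp: length_Suc_conv)
    let ?G = "transition V j i x" and ?j = "jac M j i x"
    let ?z = "\<lambda>d f e. ?G *v (curvature M V i x d f *v \<phi> i x [e])"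
    have \<phi>j: "\<phi> j x [b] = (\<Sum>e\<in>UNIV. ?j b e *\<^sub>R (?G *v \<phi> i x [e]))" for b
      using forms_change[OF \<phi> x, of "[b]"] by (simp add: change_1)
    have "F_dot M V g \<phi> j x [a] = (\<Sum>b\<in>UNIV. \<Sum>c\<in>UNIV. \<Sum>e\<in>UNIV. \<Sum>d\<in>UNIV. \<Sum>f\<in>UNIV.
        (gi j x c b * ?j b e * ?j c f * ?j a d) *\<^sub>R ?z d f e)"
      unfolding F_dot_eq \<phi>j
      by (simp add: mv.sum_right mv.scaleR_right curvature_change[OF V x] scaleR_sum_right mult_ac)
    also have "\<dots> = (\<Sum>p\<in>UNIV. \<Sum>e\<in>UNIV. \<Sum>d\<in>UNIV. \<Sum>f\<in>UNIV.
        (gi j x (snd p) (fst p) * ?j (fst p) e * ?j (snd p) f * ?j a d) *\<^sub>R ?z d f e)"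
      by (rule sum_UNIV_pair[symmetric])
    also have "\<dots> = (\<Sum>p\<in>UNIV. \<Sum>q\<in>UNIV.
        (gi j x (snd p) (fst p) * ?j (fst p) (fst q) * ?j (snd p) (snd (snd q)) * ?j a (fst (snd q))) *\<^sub>R ?z (fst (snd q)) (snd (snd q)) (fst q))"
      by (rule sum.cong[OF refl])
        (simp add: sum_UNIV_pair[where f="\<lambda>e r. (gi j x _ _ * ?j _ e * ?j _ (snd r) * ?j a (fst r)) *\<^sub>R ?z (fst r) (snd r) e"]
          sum_UNIV_pair[where f="\<lambda>d f. (gi j x _ _ * ?j _ _ * ?j _ f * ?j a d) *\<^sub>R ?z d f _"])
    also have "\<dots> = (\<Sum>q\<in>UNIV. \<Sum>p\<in>UNIV.
        (gi j x (snd p) (fst p) * ?j (fst p) (fst q) * ?j (snd p) (snd (snd q)) * ?j a (fst (snd q))) *\<^sub>R ?z (fst (snd q)) (snd (snd q)) (fst q))"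
      by (rule sum.swap)
    also have "\<dots> = (\<Sum>q\<in>UNIV. (gi i x (snd (snd q)) (fst q) * ?j a (fst (snd q))) *\<^sub>R ?z (fst (snd q)) (snd (snd q)) (fst q))"
    proof (rule sum.cong[OF refl])
      fix q :: "'n \<times> 'n \<times> 'n"
      have "(\<Sum>p\<in>UNIV. gi j x (snd p) (fst p) * ?j (fst p) (fst q) * ?j (snd p) (snd (snd q))) = gi i x (snd (snd q)) (fst q)"
        unfolding gi_change[OF x] sum_UNIV_pair[where f="\<lambda>b c. gi j x c b * ?j b (fst q) * ?j c (snd (snd q))"]
        by (subst sum.swap) (simp add: mult_ac)
      then show "(\<Sum>p\<in>UNIV. (gi j x (snd p) (fst p) * ?j (fst p) (fst q) * ?j (snd p) (snd (snd q)) * ?j a (fst (snd q))) *\<^sub>R ?z (fst (snd q)) (snd (snd q)) (fst q))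
        = (gi i x (snd (snd q)) (fst q) * ?j a (fst (snd q))) *\<^sub>R ?z (fst (snd q)) (snd (snd q)) (fst q)"
        by (simp add: scaleR_sum_left[symmetric] sum_distrib_right[symmetric])
    qed
    also have "\<dots> = (\<Sum>e\<in>UNIV. \<Sum>d\<in>UNIV. \<Sum>f\<in>UNIV. (gi i x f e * ?j a d) *\<^sub>R ?z d f e)"
      by (simp add: sum_UNIV_pair[where f="\<lambda>e r. (gi i x (snd r) e * ?j a (fst r)) *\<^sub>R ?z (fst r) (snd r) e"]
          sum_UNIV_pair[where f="\<lambda>d f. (gi i x f _ * ?j a d) *\<^sub>R ?z d f _"])
    also have "\<dots> = (\<Sum>d\<in>UNIV. \<Sum>e\<in>UNIV. \<Sum>f\<in>UNIV. (gi i x f e * ?j a d) *\<^sub>R ?z d f e)" by (rule sum.swap)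
    also have "\<dots> = change V 1 j i x (F_dot M V g \<phi> i x) I"
      unfolding a One_nat_def change_1 F_dot_eq
      by (simp add: mv.sum_right mv.scaleR_right scaleR_sum_right mult_ac)
    finally show ?thesis unfolding a .
  qed
qed

end

section \<open>The complex and the Yang--Mills equation\<close>

definition tens :: "'k::real_normed_field^'r \<Rightarrow> 'k^'r \<Rightarrow> 'k^('r::finite \<times> 'r)" where
  "tens u v = (\<chi> cd. u $ fst cd * v $ snd cd)"

definition endmat :: "'k::real_normed_field^('r::finite \<times> 'r) \<Rightarrow> 'k^'r^'r" where
  "endmat T = (\<chi> c d. T $ (c, d))"

lemma bounded_bilinear_tens:
  "bounded_bilinear (tens :: 'k::{real_normed_field,euclidean_space}^'r \<Rightarrow> 'k^'r \<Rightarrow> 'k^('r::finite \<times> 'r))"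
  by (rule bilinear_conv_bounded_bilinear[THEN iffD1])
    (auto simp: bilinear_def tens_def vec_eq_iff algebra_simps intro!: linearI)

interpretation tn: bounded_bilinear "tens :: 'k::{real_normed_field,euclidean_space}^'r \<Rightarrow> 'k^'r \<Rightarrow> 'k^('r::finite \<times> 'r)"
  by (rule bounded_bilinear_tens)

lemma bounded_linear_endmat:
  "bounded_linear (endmat :: 'k::{real_normed_field,euclidean_space}^('r::finite \<times> 'r) \<Rightarrow> 'k^'r^'r)"
  by (rule linear_conv_bounded_linear[THEN iffD1]) (auto simp: endmat_def vec_eq_iff intro!: linearI)

lemma dual_pairing_tens:
  fixes u v :: "'k::{real_normed_field,euclidean_space}^'r::finite"
  shows "dual_pairing i x (tens u v) T = dual_pairing i x u (endmat T *v v)"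
proof -
  have "dual_pairing i x (tens u v) T = (\<Sum>c\<in>UNIV. \<Sum>d\<in>UNIV. u $ c * v $ d * T $ (c, d))"
    using sum_UNIV_pair[of "\<lambda>c d. u $ c * v $ d * T $ (c, d)"] by (simp add: dual_pairing_def tens_def)
  then show ?thesis
    by (simp add: dual_pairing_def endmat_def matrix_vector_mult_def sum_distrib_left mult_ac)
qed

lemma transition_dual_end_tens:
  fixes V :: "('i, 'm, 'n::finite, 'k::{real_normed_field,euclidean_space}, 'r::finite) vbundle"
  shows "transition (dual_bundle (end_bundle V)) j i x *v tens u v =
    tens (transition (dual_bundle V) j i x *v u) (transition V j i x *v v)"
proof (rule vec_eq_iff[THEN iffD2], rule allI)
  fix cd :: "'r \<times> 'r"
  let ?G = "transition V j i x" and ?H = "transition V i j x"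
  have t: "transition (dual_bundle V) j i x = transpose ?H"
    "transition (dual_bundle (end_bundle V)) j i x = transpose (transition (end_bundle V) i j x)"
    by (simp_all add: dual_bundle_def)
  have "(transition (dual_bundle (end_bundle V)) j i x *v tens u v) $ cd
      = (\<Sum>e\<in>UNIV. \<Sum>f\<in>UNIV. ?H $ e $ fst cd * ?G $ snd cd $ f * (u $ e * v $ f))"
    using sum_UNIV_pair[of "\<lambda>e f. ?H $ e $ fst cd * ?G $ snd cd $ f * (u $ e * v $ f)"]
    unfolding t by (simp add: matrix_vector_mult_def transpose_def end_bundle_def tens_def del: transpose_matrix_vector)
  also have "\<dots> = (transpose ?H *v u) $ fst cd * (?G *v v) $ snd cd"
    by (simp add: matrix_vector_mult_def transpose_def sum_product mult_ac del: transpose_matrix_vector)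
  finally show "(transition (dual_bundle (end_bundle V)) j i x *v tens u v) $ cd
    = tens (transition (dual_bundle V) j i x *v u) (transition V j i x *v v) $ cd"
    unfolding t by (simp add: tens_def del: transpose_matrix_vector)
qed

lemma conn_form_dual_end_tens:
  fixes V :: "('i, 'm, 'n::finite, 'k::{real_normed_field,euclidean_space}, 'r::finite) vbundle"
  shows "conn_form (dual_bundle (end_bundle V)) i x a *v tens u v =
    tens (conn_form (dual_bundle V) i x a *v u) v + tens u (conn_form V i x a *v v)"
proof (rule vec_eq_iff[THEN iffD2], rule allI)
  fix cd :: "'r \<times> 'r"
  obtain c d where cd: "cd = (c, d)" by (metis surj_pair)
  let ?A = "conn_form V i x a"
  have t: "conn_form (dual_bundle V) i x a = - transpose ?A"
    "conn_form (dual_bundle (end_bundle V)) i x a = - transpose (conn_form (end_bundle V) i x a)"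
    by (simp_all add: dual_bundle_def)
  have "(transpose (conn_form (end_bundle V) i x a) *v tens u v) $ cd
      = (\<Sum>e\<in>UNIV. \<Sum>f\<in>UNIV. ((if f = d then ?A $ e $ c else 0) - (if e = c then ?A $ d $ f else 0)) * (u $ e * v $ f))"
    using sum_UNIV_pair[of "\<lambda>e f. ((if f = d then ?A $ e $ c else 0) - (if e = c then ?A $ d $ f else 0)) * (u $ e * v $ f)"]
    by (simp add: matrix_vector_mult_def transpose_def end_bundle_def tens_def cd del: transpose_matrix_vector cong: if_cong)
  also have "\<dots> = (\<Sum>e\<in>UNIV. \<Sum>f\<in>UNIV. if f = d then ?A $ e $ c * (u $ e * v $ f) else 0)
      - (\<Sum>e\<in>UNIV. \<Sum>f\<in>UNIV. if e = c then ?A $ d $ f * (u $ e * v $ f) else 0)"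
    unfolding sum_subtractf[symmetric] by (intro sum.cong refl) (simp add: left_diff_distrib)
  also have "(\<Sum>e\<in>UNIV. \<Sum>f\<in>UNIV. if e = c then ?A $ d $ f * (u $ e * v $ f) else 0) = (\<Sum>f\<in>UNIV. ?A $ d $ f * (u $ c * v $ f))"
    by (subst sum.swap) simp
  also have "(\<Sum>e\<in>UNIV. \<Sum>f\<in>UNIV. if f = d then ?A $ e $ c * (u $ e * v $ f) else 0) - (\<Sum>f\<in>UNIV. ?A $ d $ f * (u $ c * v $ f))
    = (transpose ?A *v u) $ c * v $ d - u $ c * (?A *v v) $ d"
    by (simp add: matrix_vector_mult_def transpose_def sum_distrib_left sum_distrib_right mult_ac del: transpose_matrix_vector)
  finally show "(conn_form (dual_bundle (end_bundle V)) i x a *v tens u v) $ cd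
    = (tens (conn_form (dual_bundle V) i x a *v u) v + tens u (conn_form V i x a *v v)) $ cd"
    unfolding t by (simp add: mv.minus_left tn.minus_left del: transpose_matrix_vector) (simp add: tens_def cd del: transpose_matrix_vector)
qed

context smooth_mfd
begin

lemma cov_tens:
  fixes V :: "('i, 'm, 'n, 'k::{real_normed_field,euclidean_space}, 'r::finite) vbundle"
  assumes "smooth_in M i (cdom M i) s" "smooth_in M i (cdom M i) t" "x \<in> cdom M i"
  shows "cov M (dual_bundle (end_bundle V)) i a (\<lambda>y. tens (s y) (t y)) x =
    tens (cov M (dual_bundle V) i a s x) (t x) + tens (s x) (cov M V i a t x)"
  by (simp add: cov_def pd_bilinear[OF bounded_bilinear_tens assms(1,2,3,3)] conn_form_dual_end_tens tn.add_left tn.add_right)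

text \<open>The product of a \<open>V\<^sup>*\<close>-valued \<open>p\<close>-form and a \<open>V\<close>-valued \<open>q\<close>-form for \<open>p + q = 1\<close>, where no antisymmetrisation
  is needed.  These products serve as test forms with values in the dual of \<open>End(V)\<close>.\<close>

definition tens_form ::
  "nat \<Rightarrow> ('i, 'm, 'n, 'k::{real_normed_field,euclidean_space}, 'r::finite) form \<Rightarrow> ('i, 'm, 'n, 'k, 'r) form \<Rightarrow>
   ('i, 'm, 'n, 'k, 'r \<times> 'r) form" where
  "tens_form p \<alpha> \<phi> = (\<lambda>i x I. tens (\<alpha> i x (take p I)) (\<phi> i x (drop p I)))"

lemma tens_form:
  fixes V :: "('i, 'm, 'n, 'k::{real_normed_field,euclidean_space}, 'r::finite) vbundle"
  assumes p: "p + q = 1" and \<alpha>: "\<alpha> \<in> forms M (dual_bundle V) p" and \<phi>: "\<phi> \<in> forms M V q"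
  shows "tens_form p \<alpha> \<phi> \<in> forms M (dual_bundle (end_bundle V)) 1"
  unfolding forms_iff
proof (intro conjI allI ballI impI)
  show "tens_form p \<alpha> \<phi> i x \<in> alt_tensors 1" for i x
  proof -
    have "tens_form p \<alpha> \<phi> i x I = 0" if "length I \<noteq> 1" for I
    proof (cases "length (take p I) = p")
      case True
      then have "length (drop p I) \<noteq> q" using that p by auto
      then show ?thesis by (simp add: tens_form_def forms_length[OF \<phi>] tn.zero_right)
    next
      case False
      then show ?thesis by (simp add: tens_form_def forms_length[OF \<alpha>] tn.zero_left)
    qed
    then show ?thesis by (simp add: alt_tensors_le_1)
  qed
  show "tens_form p \<alpha> \<phi> i x I = 0" if "x \<notin> cdom M i" for i x I
    by (simp add: tens_form_def forms_outside[OF \<alpha> that] tn.zero_left)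
  show "smooth_in M i (cdom M i) (\<lambda>x. tens_form p \<alpha> \<phi> i x I)" for i I
    unfolding tens_form_def
    by (rule smooth_in_bilinear[OF chart_open_cdom bounded_bilinear_tens forms_smooth[OF \<alpha>] forms_smooth[OF \<phi>]])
  show "tens_form p \<alpha> \<phi> j x I = change (dual_bundle (end_bundle V)) 1 j i x (tens_form p \<alpha> \<phi> i x) I"
    if xx: "x \<in> cdom M i \<inter> cdom M j" and I: "length I = 1" for i j x I
  proof -
    have x: "x \<in> cdom M i" "x \<in> cdom M j" using xx by auto
    obtain a where a: "I = [a]" using I by (auto simp: length_Suc_conv)
    have "p = 0 \<and> q = 1 \<or> p = 1 \<and> q = 0" using p by auto
    then show ?thesis
    proof
      assume pq: "p = 0 \<and> q = 1"
      show ?thesis unfolding a One_nat_def change_1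
        using forms_change[OF \<alpha> x, of "[]"] forms_change[OF \<phi> x, of "[a]"] pq
        by (simp add: tens_form_def change_0 change_1 transition_dual_end_tens tn.sum_right tn.scaleR_right)
    next
      assume pq: "p = 1 \<and> q = 0"
      show ?thesis unfolding a One_nat_def change_1
        using forms_change[OF \<alpha> x, of "[a]"] forms_change[OF \<phi> x, of "[]"] pq
        by (simp add: tens_form_def change_0 change_1 transition_dual_end_tens tn.sum_left tn.scaleR_left)
    qed
  qed
qed

end

context pseudo_riem
begin

lemma lp_1: "lp b (Suc 0) i x u v = (\<Sum>a\<in>UNIV. \<Sum>c\<in>UNIV. gi i x a c *\<^sub>R b i x (u [a]) (v [c]))"
  by (simp add: lp_def sum_lists_1)

lemma lp_2: "lp b (Suc (Suc 0)) i x u v =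
  (1/2) *\<^sub>R (\<Sum>a\<in>UNIV. \<Sum>c\<in>UNIV. \<Sum>b'\<in>UNIV. \<Sum>d\<in>UNIV. (gi i x a b' * gi i x c d) *\<^sub>R b i x (u [a, c]) (v [b', d]))"
  by (simp add: lp_def sum_lists_2 prod.lessThan_Suc_shift numeral_2_eq_2)

text \<open>Against an alternating \<open>v\<close> an antisymmetrised \<open>u\<close> may be replaced by twice one of its terms.\<close>

lemma lp_2_skew:
  fixes b :: "'i \<Rightarrow> 'm \<Rightarrow> 'k::{real_normed_field,euclidean_space}^'r::finite \<Rightarrow> 'k^'r \<Rightarrow> 'k"
  assumes b: "bounded_bilinear (b i x)" and u: "\<And>a c. u [a, c] = w a c - w c a" and v: "\<And>a c. v [a, c] = - v [c, a]"
  shows "lp b (Suc (Suc 0)) i x u v = (\<Sum>a\<in>UNIV. \<Sum>c\<in>UNIV. \<Sum>b'\<in>UNIV. \<Sum>d\<in>UNIV. (gi i x a b' * gi i x c d) *\<^sub>R b i x (w a c) (v [b', d]))"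
    (is "_ = ?S")
proof -
  interpret bb: bounded_bilinear "b i x" by (rule b)
  have "(\<Sum>a\<in>UNIV. \<Sum>c\<in>UNIV. \<Sum>b'\<in>UNIV. \<Sum>d\<in>UNIV. (gi i x a b' * gi i x c d) *\<^sub>R b i x (w c a) (v [b', d]))
    = (\<Sum>c\<in>UNIV. \<Sum>a\<in>UNIV. \<Sum>b'\<in>UNIV. \<Sum>d\<in>UNIV. (gi i x a b' * gi i x c d) *\<^sub>R b i x (w c a) (v [b', d]))"
    by (rule sum.swap)
  also have "\<dots> = (\<Sum>c\<in>UNIV. \<Sum>a\<in>UNIV. \<Sum>d\<in>UNIV. \<Sum>b'\<in>UNIV. - ((gi i x c d * gi i x a b') *\<^sub>R b i x (w c a) (v [d, b'])))"
    by (rule sum.cong[OF refl], rule sum.cong[OF refl], subst sum.swap, rule sum.cong[OF refl], rule sum.cong[OF refl], subst v)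
      (simp add: bb.minus_right mult.commute)
  also have "\<dots> = - ?S" by (simp add: sum_negf)
  finally have "(\<Sum>a\<in>UNIV. \<Sum>c\<in>UNIV. \<Sum>b'\<in>UNIV. \<Sum>d\<in>UNIV. (gi i x a b' * gi i x c d) *\<^sub>R b i x (w c a) (v [b', d])) = - ?S" .
  then have "lp b (Suc (Suc 0)) i x u v = (1/2) *\<^sub>R (?S - (- ?S))"
    unfolding lp_2 u by (simp add: bb.diff_left scaleR_diff_right sum_subtractf)
  then show ?thesis by (simp add: scaleR_2[symmetric])
qed

lemma endmat_curvature_form: "x \<in> cdom M i \<Longrightarrow> endmat (curvature_form M V i x [a, b]) = curvature M V i x a b"
  by (simp add: endmat_def curvature_form_def vec_eq_iff)

lemma curvature_form_skew: "curvature_form M V i x [a, c] = - curvature_form M V i x [c, a]"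
  using curvature_skew[of V i x a c] by (simp add: curvature_form_def vec_eq_iff)

lemma sum_swap4:
  "(\<Sum>a\<in>A. \<Sum>c\<in>C. \<Sum>b\<in>B. \<Sum>d\<in>D. f a c b d) = (\<Sum>b\<in>B. \<Sum>d\<in>D. \<Sum>a\<in>A. \<Sum>c\<in>C. f a c b d)"
proof -
  have "(\<Sum>a\<in>A. \<Sum>c\<in>C. \<Sum>b\<in>B. \<Sum>d\<in>D. f a c b d) = (\<Sum>a\<in>A. \<Sum>b\<in>B. \<Sum>d\<in>D. \<Sum>c\<in>C. f a c b d)"
    by (rule sum.cong[OF refl], subst sum.swap, rule sum.cong[OF refl], rule sum.swap)
  also have "\<dots> = (\<Sum>b\<in>B. \<Sum>d\<in>D. \<Sum>a\<in>A. \<Sum>c\<in>C. f a c b d)"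
    by (subst sum.swap, rule sum.cong[OF refl], rule sum.swap)
  finally show ?thesis .
qed

text \<open>The pointwise Leibniz rule.  The term \<open>d\<^sup>D \<alpha> \<otimes> s\<close> pairs with \<open>F\<close> to \<open>\<langle>d\<^sup>D \<alpha>, F s\<rangle>\<close> where \<open>F s = d\<^sup>D d\<^sup>D s\<close>, and in
  \<open>\<langle>\<alpha> \<and> d\<^sup>D s, F\<rangle>\<close> the contraction of \<open>F\<close> with \<open>d\<^sup>D s\<close> is the action \<open>F \<cdot> d\<^sup>D s\<close>.\<close>

lemma lp_ext_d_tens_1:
  fixes V :: "('i, 'm, 'n, 'k::{real_normed_field,euclidean_space}, 'r::finite) vbundle"
  assumes V: "bundle_conn V" and \<alpha>: "\<alpha> \<in> forms M (dual_bundle V) 1" and s: "s \<in> forms M V 0" and x: "x \<in> cdom M i"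
  shows "lp dual_pairing 2 i x (ext_d M (dual_bundle (end_bundle V)) (tens_form 1 \<alpha> s) i x) (curvature_form M V i x)
    = lp dual_pairing 2 i x (ext_d M (dual_bundle V) \<alpha> i x) (ext_d M V (ext_d M V s) i x)
      - lp dual_pairing 1 i x (\<alpha> i x) (F_dot M V g (ext_d M V s) i x)"
proof -
  have V': "vector_bundle M V" "connection M V" using V by (auto simp: bundle_conn_def)
  let ?d = "ext_d M (dual_bundle V) \<alpha> i x" and ?F = "curvature M V i x" and ?D = "\<lambda>a. cov M V i a (\<lambda>y. s i y []) x"
  have e: "ext_d M (dual_bundle (end_bundle V)) (tens_form 1 \<alpha> s) i x [a, c] =
      tens (?d [a, c]) (s i x []) + (tens (\<alpha> i x [c]) (?D a) - tens (\<alpha> i x [a]) (?D c))" for a c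
    unfolding ext_d_1[OF x]
    by (simp add: tens_form_def cov_tens[OF forms_smooth[OF \<alpha>] forms_smooth[OF s] x, where V=V] tn.diff_left)
  have "lp dual_pairing 2 i x (ext_d M (dual_bundle (end_bundle V)) (tens_form 1 \<alpha> s) i x) (curvature_form M V i x)
    = lp dual_pairing 2 i x (\<lambda>I. tens (?d I) (s i x []) + (tens (\<alpha> i x [I ! 1]) (?D (I ! 0)) - tens (\<alpha> i x [I ! 0]) (?D (I ! 1)))) (curvature_form M V i x)"
    unfolding numeral_2_eq_2 lp_2 e by simp
  also have "\<dots> = lp dual_pairing 2 i x (\<lambda>I. tens (?d I) (s i x [])) (curvature_form M V i x)
    + lp dual_pairing 2 i x (\<lambda>I. tens (\<alpha> i x [I ! 1]) (?D (I ! 0)) - tens (\<alpha> i x [I ! 0]) (?D (I ! 1))) (curvature_form M V i x)"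
    by (rule lp_add_left[OF bounded_bilinear_dual_pairing])
  also have "lp dual_pairing 2 i x (\<lambda>I. tens (?d I) (s i x [])) (curvature_form M V i x)
    = lp dual_pairing 2 i x ?d (ext_d M V (ext_d M V s) i x)"
    unfolding numeral_2_eq_2 lp_2
    by (simp add: dual_pairing_tens endmat_curvature_form[OF x] ext_d_ext_d[OF V'(2) s x])
  also have "lp dual_pairing 2 i x (\<lambda>I. tens (\<alpha> i x [I ! 1]) (?D (I ! 0)) - tens (\<alpha> i x [I ! 0]) (?D (I ! 1))) (curvature_form M V i x)
    = - lp dual_pairing 2 i x (\<lambda>I. tens (\<alpha> i x [I ! 0]) (?D (I ! 1)) - tens (\<alpha> i x [I ! 1]) (?D (I ! 0))) (curvature_form M V i x)"
    unfolding numeral_2_eq_2 lp_2 by (simp add: dp.diff_left scaleR_diff_right sum_subtractf)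
  also have "lp dual_pairing 2 i x (\<lambda>I. tens (\<alpha> i x [I ! 0]) (?D (I ! 1)) - tens (\<alpha> i x [I ! 1]) (?D (I ! 0))) (curvature_form M V i x)
    = (\<Sum>a\<in>UNIV. \<Sum>c\<in>UNIV. \<Sum>b\<in>UNIV. \<Sum>d\<in>UNIV. (gi i x a b * gi i x c d) *\<^sub>R dual_pairing i x (\<alpha> i x [a]) (?F b d *v ?D c))"
    unfolding numeral_2_eq_2 dual_pairing_tens[symmetric] endmat_curvature_form[OF x, symmetric]
    by (rule lp_2_skew[OF bounded_bilinear_dual_pairing]) (simp, rule curvature_form_skew)
  also have "\<dots> = (\<Sum>a\<in>UNIV. \<Sum>b\<in>UNIV. \<Sum>c\<in>UNIV. \<Sum>d\<in>UNIV. (gi i x a b * gi i x c d) *\<^sub>R dual_pairing i x (\<alpha> i x [a]) (?F b d *v ?D c))"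
    by (rule sum.cong[OF refl], rule sum.swap)
  also have "\<dots> = lp dual_pairing 1 i x (\<alpha> i x) (F_dot M V g (ext_d M V s) i x)"
    by (simp add: lp_1 F_dot_eq ext_d_0[OF x] dp.sum_right dp.scaleR_right scaleR_sum_right gi_sym[OF x])
  finally show ?thesis by simp
qed

text \<open>Here \<open>F\<close> moves to the factor \<open>\<alpha>\<close>: the curvature of the dual bundle is \<open>- F\<^sup>T\<close>, hence \<open>F\<close> paired with
  \<open>\<alpha> \<otimes> d\<^sup>D \<phi>\<close> is \<open>- \<langle>d\<^sup>D d\<^sup>D \<alpha>, d\<^sup>D \<phi>\<rangle>\<close>.\<close>

lemma lp_ext_d_tens_0:
  fixes V :: "('i, 'm, 'n, 'k::{real_normed_field,euclidean_space}, 'r::finite) vbundle"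
  assumes V: "bundle_conn V" and \<alpha>: "\<alpha> \<in> forms M (dual_bundle V) 0" and \<phi>: "\<phi> \<in> forms M V 1" and x: "x \<in> cdom M i"
  shows "lp dual_pairing 2 i x (ext_d M (dual_bundle (end_bundle V)) (tens_form 0 \<alpha> \<phi>) i x) (curvature_form M V i x)
    = lp dual_pairing 1 i x (ext_d M (dual_bundle V) \<alpha> i x) (F_dot M V g \<phi> i x)
      - lp dual_pairing 2 i x (ext_d M (dual_bundle V) (ext_d M (dual_bundle V) \<alpha>) i x) (ext_d M V \<phi> i x)"
proof -
  have V': "vector_bundle M V" "connection M V" using V by (auto simp: bundle_conn_def)
  let ?d = "ext_d M V \<phi> i x" and ?F = "curvature M V i x" and ?D = "\<lambda>a. cov M (dual_bundle V) i a (\<lambda>y. \<alpha> i y []) x"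
  have e: "ext_d M (dual_bundle (end_bundle V)) (tens_form 0 \<alpha> \<phi>) i x [a, c] =
      tens (\<alpha> i x []) (?d [a, c]) + (tens (?D a) (\<phi> i x [c]) - tens (?D c) (\<phi> i x [a]))" for a c
    unfolding ext_d_1[OF x]
    by (simp add: tens_form_def cov_tens[OF forms_smooth[OF \<alpha>] forms_smooth[OF \<phi>] x, where V=V] tn.diff_right)
  have sk: "?F b d *v w = - (?F d b *v w)" for b d w
    by (subst curvature_skew) (simp add: mv.minus_left)
  have "lp dual_pairing 2 i x (ext_d M (dual_bundle (end_bundle V)) (tens_form 0 \<alpha> \<phi>) i x) (curvature_form M V i x)
    = lp dual_pairing 2 i x (\<lambda>I. tens (\<alpha> i x []) (?d I) + (tens (?D (I ! 0)) (\<phi> i x [I ! 1]) - tens (?D (I ! 1)) (\<phi> i x [I ! 0]))) (curvature_form M V i x)"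
    unfolding numeral_2_eq_2 lp_2 e by simp
  also have "\<dots> = lp dual_pairing 2 i x (\<lambda>I. tens (\<alpha> i x []) (?d I)) (curvature_form M V i x)
    + lp dual_pairing 2 i x (\<lambda>I. tens (?D (I ! 0)) (\<phi> i x [I ! 1]) - tens (?D (I ! 1)) (\<phi> i x [I ! 0])) (curvature_form M V i x)"
    by (rule lp_add_left[OF bounded_bilinear_dual_pairing])
  also have "lp dual_pairing 2 i x (\<lambda>I. tens (\<alpha> i x []) (?d I)) (curvature_form M V i x)
    = - lp dual_pairing 2 i x (ext_d M (dual_bundle V) (ext_d M (dual_bundle V) \<alpha>) i x) ?d"
  proof -
    have t: "dual_pairing i x (curvature M (dual_bundle V) i x a c *v u) v = - dual_pairing i x u (?F a c *v v)" for a c u v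
      unfolding curvature_dual[OF V' x] by (simp only: mv.minus_left dp.minus_left dual_pairing_transpose)
    have "lp dual_pairing 2 i x (\<lambda>I. tens (\<alpha> i x []) (?d I)) (curvature_form M V i x) =
      (1/2) *\<^sub>R (\<Sum>a\<in>UNIV. \<Sum>c\<in>UNIV. \<Sum>b\<in>UNIV. \<Sum>d\<in>UNIV. (gi i x a b * gi i x c d) *\<^sub>R dual_pairing i x (\<alpha> i x []) (?F b d *v ?d [a, c]))"
      unfolding numeral_2_eq_2 lp_2 dual_pairing_tens endmat_curvature_form[OF x] ..
    also have "\<dots> = (1/2) *\<^sub>R (\<Sum>b\<in>UNIV. \<Sum>d\<in>UNIV. \<Sum>a\<in>UNIV. \<Sum>c\<in>UNIV. (gi i x b a * gi i x d c) *\<^sub>R dual_pairing i x (\<alpha> i x []) (?F b d *v ?d [a, c]))"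
      by (subst sum_swap4) (simp only: gi_sym[OF x])
    also have "\<dots> = - lp dual_pairing 2 i x (ext_d M (dual_bundle V) (ext_d M (dual_bundle V) \<alpha>) i x) ?d"
      unfolding numeral_2_eq_2 lp_2 ext_d_ext_d[OF connection_dual[OF V'] \<alpha> x] t
      by (simp add: sum_negf)
    finally show ?thesis .
  qed
  also have "lp dual_pairing 2 i x (\<lambda>I. tens (?D (I ! 0)) (\<phi> i x [I ! 1]) - tens (?D (I ! 1)) (\<phi> i x [I ! 0])) (curvature_form M V i x)
    = (\<Sum>a\<in>UNIV. \<Sum>c\<in>UNIV. \<Sum>b\<in>UNIV. \<Sum>d\<in>UNIV. (gi i x a b * gi i x c d) *\<^sub>R dual_pairing i x (?D a) (?F b d *v \<phi> i x [c]))"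
    unfolding numeral_2_eq_2 dual_pairing_tens[symmetric] endmat_curvature_form[OF x, symmetric]
    by (rule lp_2_skew[OF bounded_bilinear_dual_pairing]) (simp, rule curvature_form_skew)
  also have "\<dots> = (\<Sum>a\<in>UNIV. \<Sum>b\<in>UNIV. \<Sum>c\<in>UNIV. \<Sum>d\<in>UNIV. (gi i x a b * gi i x c d) *\<^sub>R dual_pairing i x (?D a) (?F b d *v \<phi> i x [c]))"
    by (rule sum.cong[OF refl], rule sum.swap)
  also have "\<dots> = lp dual_pairing 1 i x (ext_d M (dual_bundle V) \<alpha> i x) (F_dot M V g \<phi> i x)"
    by (simp add: lp_1 F_dot_eq ext_d_0[OF x] dp.sum_right dp.scaleR_right scaleR_sum_right gi_sym[OF x])
  finally show ?thesis by simp
qed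


definition Mop ::
  "('i, 'm, 'n, 'k::{real_normed_field,euclidean_space}, 'r::finite) vbundle \<Rightarrow> ('i, 'm, 'n, 'k, 'r) form \<Rightarrow>
   ('i, 'm, 'n, 'k, 'r) form" where
  "Mop V \<phi> = (\<lambda>i x I. cdiv V 1 (ext_d M V \<phi>) i x I - F_dot M V g \<phi> i x I)"

lemma two_Suc: "(2::nat) = Suc 1" by simp

lemma ext_d_form_2: "bundle_conn V \<Longrightarrow> \<phi> \<in> forms M V 1 \<Longrightarrow> ext_d M V \<phi> \<in> forms M V (Suc 1)"
  using ext_d_form_1 by (simp add: numeral_2_eq_2)

lemma cdiv_ext_d_form: "bundle_conn V \<Longrightarrow> \<phi> \<in> forms M V 1 \<Longrightarrow> cdiv V 1 (ext_d M V \<phi>) \<in> forms M V 1"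
  by (rule div_form[OF _ _ ext_d_form_2]) auto

lemma Mop_form:
  assumes "bundle_conn V" "\<phi> \<in> forms M V 1"
  shows "Mop V \<phi> \<in> forms M V 1"
  unfolding Mop_def by (intro forms_diff cdiv_ext_d_form F_dot_form assms)

lemma M_op:
  assumes V: "bundle_conn V" and \<phi>: "\<phi> \<in> forms M V 1"
  shows "M_op M V g \<phi> \<in> weighted_forms M (conf_class M g) V 1" "M_op M V g \<phi> g = Mop V \<phi>"
proof -
  note w = weighted[OF ext_d_form_2[OF V \<phi>], folded two_Suc]
  note c = codiff[OF V _ w(1)[unfolded two_Suc], of, folded two_Suc]
  note f = weighted[OF F_dot_form[OF V \<phi>]]
  show "M_op M V g \<phi> g = Mop V \<phi>"
    using c(2) w(2) f(2) by (simp add: M_op_def Mop_def)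
  have "\<psi> \<in> weighted_forms M (conf_class M g) V 1 \<Longrightarrow> \<psi>' \<in> weighted_forms M (conf_class M g) V 1 \<Longrightarrow>
    (\<lambda>h i x I. \<psi> h i x I - \<psi>' h i x I) \<in> weighted_forms M (conf_class M g) V 1" for \<psi> \<psi>'
    unfolding weighted_forms_def by (auto intro!: forms_diff simp: fscale_def scaleR_diff_right)
  from this[OF c(1) f(1)] show "M_op M V g \<phi> \<in> weighted_forms M (conf_class M g) V 1"
    by (simp add: M_op_def)
qed

lemma well_defined: "bundle_conn V \<Longrightarrow> well_defined_sequence M V g"
  unfolding well_defined_sequence_def
  using ext_d_form_0 M_op(1) codiff(1)[of V 0] by auto

lemma compact_support_ext_d:
  assumes "compact_support \<alpha>"
  shows "compact_support (ext_d M V \<alpha>)"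
proof -
  obtain K where K: "compact K" "\<And>i x I. x \<notin> K \<Longrightarrow> \<alpha> i x I = 0" using assms unfolding compact_support_def by blast
  have "ext_d M V \<alpha> i x I = 0" if "x \<notin> K" for i x I
    by (rule ext_d_support[OF compact_imp_closed[OF K(1)] _ that]) (rule K(2))
  then show ?thesis unfolding compact_support_def using K(1) by blast
qed

lemma compact_support_tens: "compact_support \<alpha> \<Longrightarrow> compact_support (tens_form l \<alpha> \<phi>)"
  unfolding compact_support_def tens_form_def by (metis tn.zero_left)

text \<open>Weak form of \<open>M\<^sup>D d\<^sup>D s = (\<delta>\<^sup>D F) s\<close>, by the Leibniz rule for \<open>d(\<alpha> \<otimes> s)\<close>.\<close>

lemma Mop_ext_d_weak:
  fixes V :: "('i, 'm, 'n, 'k::{real_normed_field,euclidean_space}, 'r::finite) vbundle"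
  assumes V: "bundle_conn V" and \<alpha>: "\<alpha> \<in> forms M (dual_bundle V) 1" "compact_support \<alpha>" and s: "s \<in> forms M V 0"
  shows "form_pairing M g dual_pairing 1 (tens_form 1 \<alpha> s) (cdiv (end_bundle V) 1 (curvature_form M V))
    = form_pairing M g dual_pairing 1 \<alpha> (Mop V (ext_d M V s))"
proof -
  have V': "vector_bundle M V" using V by (simp add: bundle_conn_def)
  note fp = fibre_pairing_dual[OF V']
  let ?F = "curvature_form M V" and ?E = "end_bundle V"
  have E: "bundle_conn ?E" by (rule bundle_conn_end[OF V])
  have F: "?F \<in> forms M ?E (Suc 1)" using curvature_form_form[OF V] unfolding two_Suc .
  have ds: "ext_d M V s \<in> forms M V 1" by (rule ext_d_form_0[OF V s])
  have t: "tens_form 1 \<alpha> s \<in> forms M (dual_bundle ?E) 1" by (rule tens_form[OF _ \<alpha>(1) s]) simp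
  have d\<alpha>: "ext_d M (dual_bundle V) \<alpha> \<in> forms M (dual_bundle V) (Suc 1)"
    by (rule ext_d_form_2[OF bundle_conn_dual[OF V] \<alpha>(1)])
  have "form_pairing M g dual_pairing 1 (tens_form 1 \<alpha> s) (cdiv ?E 1 ?F)
    = form_pairing M g dual_pairing (Suc 1) (ext_d M (dual_bundle ?E) (tens_form 1 \<alpha> s)) ?F"
    by (rule green[OF E le_refl t F, symmetric], rule disjI1, rule compact_support_tens[OF \<alpha>(2)])
  also have "\<dots> = (LINT x|vol. gpair dual_pairing (Suc 1) (ext_d M (dual_bundle V) \<alpha>) (ext_d M V (ext_d M V s)) x
      - gpair dual_pairing 1 \<alpha> (F_dot M V g (ext_d M V s)) x)"
    unfolding form_pairing_eq gpair_def
    using lp_ext_d_tens_1[OF V \<alpha>(1) s some_chart] unfolding two_Suc by simp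
  also have "\<dots> = form_pairing M g dual_pairing (Suc 1) (ext_d M (dual_bundle V) \<alpha>) (ext_d M V (ext_d M V s))
      - form_pairing M g dual_pairing 1 \<alpha> (F_dot M V g (ext_d M V s))"
    unfolding form_pairing_eq
    by (rule Bochner_Integration.integral_diff[OF gpair_integrable[OF fp d\<alpha> ext_d_form_2[OF V ds]]
        gpair_integrable[OF fp \<alpha>(1) F_dot_form[OF V ds]]]) (use \<alpha>(2) compact_support_ext_d in auto)
  also have "form_pairing M g dual_pairing (Suc 1) (ext_d M (dual_bundle V) \<alpha>) (ext_d M V (ext_d M V s))
    = form_pairing M g dual_pairing 1 \<alpha> (cdiv V 1 (ext_d M V (ext_d M V s)))"
    by (rule green[OF V _ \<alpha>(1) ext_d_form_2[OF V ds]]) (use \<alpha>(2) in auto)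
  also have "\<dots> - form_pairing M g dual_pairing 1 \<alpha> (F_dot M V g (ext_d M V s)) = form_pairing M g dual_pairing 1 \<alpha> (Mop V (ext_d M V s))"
    unfolding Mop_def
    by (rule form_pairing_diff_right[OF fp \<alpha>(1) cdiv_ext_d_form[OF V ds] F_dot_form[OF V ds], symmetric]) (use \<alpha>(2) in auto)
  finally show ?thesis .
qed

text \<open>The dual statement: \<open>\<delta>\<^sup>D M\<^sup>D \<phi>\<close> is minus the contraction of \<open>\<phi>\<close> with \<open>\<delta>\<^sup>D F\<close>.\<close>

lemma cdiv_Mop_weak:
  fixes V :: "('i, 'm, 'n, 'k::{real_normed_field,euclidean_space}, 'r::finite) vbundle"
  assumes V: "bundle_conn V" and \<alpha>: "\<alpha> \<in> forms M (dual_bundle V) 0" "compact_support \<alpha>" and \<phi>: "\<phi> \<in> forms M V 1"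
  shows "form_pairing M g dual_pairing 1 (tens_form 0 \<alpha> \<phi>) (cdiv (end_bundle V) 1 (curvature_form M V))
    = - form_pairing M g dual_pairing 0 \<alpha> (cdiv V 0 (Mop V \<phi>))"
proof -
  have V': "vector_bundle M V" using V by (simp add: bundle_conn_def)
  note fp = fibre_pairing_dual[OF V']
  let ?F = "curvature_form M V" and ?E = "end_bundle V" and ?d = "ext_d M (dual_bundle V)"
  have E: "bundle_conn ?E" by (rule bundle_conn_end[OF V])
  have F: "?F \<in> forms M ?E (Suc 1)" using curvature_form_form[OF V] unfolding two_Suc .
  have t: "tens_form 0 \<alpha> \<phi> \<in> forms M (dual_bundle ?E) 1" by (rule tens_form[OF _ \<alpha>(1) \<phi>]) simp
  have d\<alpha>: "?d \<alpha> \<in> forms M (dual_bundle V) 1" by (rule ext_d_form_0[OF bundle_conn_dual[OF V] \<alpha>(1)])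
  have dd\<alpha>: "?d (?d \<alpha>) \<in> forms M (dual_bundle V) (Suc 1)" by (rule ext_d_form_2[OF bundle_conn_dual[OF V] d\<alpha>])
  have c: "compact_support (?d \<alpha>)" "compact_support (?d (?d \<alpha>))" using \<alpha>(2) compact_support_ext_d by auto
  have "form_pairing M g dual_pairing 1 (tens_form 0 \<alpha> \<phi>) (cdiv ?E 1 ?F)
    = form_pairing M g dual_pairing (Suc 1) (ext_d M (dual_bundle ?E) (tens_form 0 \<alpha> \<phi>)) ?F"
    by (rule green[OF E le_refl t F, symmetric], rule disjI1, rule compact_support_tens[OF \<alpha>(2)])
  also have "\<dots> = (LINT x|vol. gpair dual_pairing 1 (?d \<alpha>) (F_dot M V g \<phi>) x
      - gpair dual_pairing (Suc 1) (?d (?d \<alpha>)) (ext_d M V \<phi>) x)"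
    unfolding form_pairing_eq gpair_def
    using lp_ext_d_tens_0[OF V \<alpha>(1) \<phi> some_chart] unfolding two_Suc by simp
  also have "\<dots> = form_pairing M g dual_pairing 1 (?d \<alpha>) (F_dot M V g \<phi>)
      - form_pairing M g dual_pairing (Suc 1) (?d (?d \<alpha>)) (ext_d M V \<phi>)"
    unfolding form_pairing_eq
    by (rule Bochner_Integration.integral_diff[OF gpair_integrable[OF fp d\<alpha> F_dot_form[OF V \<phi>]]
        gpair_integrable[OF fp dd\<alpha> ext_d_form_2[OF V \<phi>]]]) (use c in auto)
  also have "form_pairing M g dual_pairing (Suc 1) (?d (?d \<alpha>)) (ext_d M V \<phi>) = form_pairing M g dual_pairing 1 (?d \<alpha>) (cdiv V 1 (ext_d M V \<phi>))"
    by (rule green[OF V _ d\<alpha> ext_d_form_2[OF V \<phi>]]) (use c in auto)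
  also have "form_pairing M g dual_pairing 1 (?d \<alpha>) (F_dot M V g \<phi>) - form_pairing M g dual_pairing 1 (?d \<alpha>) (cdiv V 1 (ext_d M V \<phi>))
    = - form_pairing M g dual_pairing 1 (?d \<alpha>) (Mop V \<phi>)"
    unfolding Mop_def
    using form_pairing_diff_right[OF fp d\<alpha> cdiv_ext_d_form[OF V \<phi>] F_dot_form[OF V \<phi>]] c by simp
  also have "form_pairing M g dual_pairing 1 (?d \<alpha>) (Mop V \<phi>) = form_pairing M g dual_pairing 0 \<alpha> (cdiv V 0 (Mop V \<phi>))"
    using green[OF V _ \<alpha>(1), of "Mop V \<phi>"] Mop_form[OF V \<phi>] \<alpha>(2) by simp
  finally show ?thesis .
qed

lemma form_pairing_zero_right:
  assumes "\<And>i x. bounded_bilinear (b i x)"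
  shows "form_pairing M g b k \<alpha> (\<lambda>_ _ _. 0) = 0"
  unfolding form_pairing_eq gpair_def by (simp add: lp_zero_right[OF assms])

lemma yang_mills_iff:
  assumes V: "bundle_conn V"
  shows "yang_mills M V g \<longleftrightarrow> cdiv (end_bundle V) 1 (curvature_form M V) = (\<lambda>_ _ _. 0)"
proof -
  have F: "curvature_form M V \<in> forms M (end_bundle V) (Suc 1)" using curvature_form_form[OF V] unfolding two_Suc .
  note w = weighted[OF F, folded two_Suc]
  note c = codiff[OF bundle_conn_end[OF V] _ w(1)[unfolded two_Suc], of, folded two_Suc]
  show ?thesis unfolding yang_mills_def
    using weighted_forms_eq_0_iff[OF c(1)] c(2) w(2) by simp
qed

text \<open>For the forward direction, \<open>s\<close> is chosen with an arbitrary value \<open>v\<close> at a point and \<open>\<alpha>\<close> ranges over all test forms,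
  so that \<open>\<delta>\<^sup>D F v = 0\<close> there.\<close>

theorem is_complex_iff_yang_mills:
  fixes V :: "('i, 'm, 'n, 'k::{real_normed_field,euclidean_space}, 'r::finite) vbundle"
  assumes V: "bundle_conn V"
  shows "is_complex M V g \<longleftrightarrow> yang_mills M V g"
proof
  have V': "vector_bundle M V" using V by (simp add: bundle_conn_def)
  note fp = fibre_pairing_dual[OF V']
  let ?\<delta>F = "cdiv (end_bundle V) 1 (curvature_form M V)"
  have F: "curvature_form M V \<in> forms M (end_bundle V) (Suc 1)" using curvature_form_form[OF V] unfolding two_Suc .
  have \<delta>F: "?\<delta>F \<in> forms M (end_bundle V) 1" by (rule div_form[OF bundle_conn_end[OF V] _ F]) simp
  assume c: "is_complex M V g"
  have M0: "Mop V (ext_d M V s) = (\<lambda>_ _ _. 0)" if "s \<in> forms M V 0" for s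
    using c that M_op(2)[OF V ext_d_form_0[OF V that]] unfolding is_complex_def by simp
  have "?\<delta>F i x [a] = 0" if x: "x \<in> cdom M i" for i x a
  proof -
    have "endmat (?\<delta>F i x [a]) *v v = 0" for v
    proof -
      obtain s where s: "s \<in> forms M V 0" "s i x = (\<lambda>I. if I = [] then v else 0)"
        by (rule ex_form_with_value[OF V' _ x, of 0 "\<lambda>I. if I = [] then v else 0"]) (auto simp: alt_tensors_le_1)
      let ?u = "\<lambda>y I. endmat (?\<delta>F i y I) *v s i y []"
      have us: "smooth_in M i (cdom M i) (\<lambda>y. ?u y J)" for J
        by (rule smooth_in_bilinear[OF chart_open_cdom bounded_bilinear_matrix_vector
              smooth_in_linear[OF chart_open_cdom bounded_linear_endmat forms_smooth[OF \<delta>F]] forms_smooth[OF s(1)]])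
      have "?u x [a] = 0"
      proof (rule pairing_nondegenerate[OF V' _ chart_open_cdom _ _ x, of 1 ?u])
        show "continuous_on (cdom M i) (\<lambda>y. ?u y J)" for J by (rule smooth_in_continuous[OF chart_open_cdom us])
        fix \<alpha> K assume \<alpha>: "\<alpha> \<in> forms M (dual_bundle V) 1" and K: "compact K" "K \<subseteq> cdom M i" "\<And>j x I. x \<notin> K \<Longrightarrow> \<alpha> j x I = 0"
        have c: "compact_support \<alpha>" unfolding compact_support_def using K by blast
        have t: "tens_form 1 \<alpha> s \<in> forms M (dual_bundle (end_bundle V)) 1" by (rule tens_form[OF _ \<alpha> s(1)]) simp
        have "lp dual_pairing 1 i y (\<alpha> i y) (?u y) = gpair dual_pairing 1 (tens_form 1 \<alpha> s) ?\<delta>F y" for y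
        proof (cases "y \<in> K")
          case True
          then have y: "y \<in> cdom M i" using K(2) by blast
          have "lp dual_pairing 1 i y (\<alpha> i y) (?u y) = lp dual_pairing 1 i y (tens_form 1 \<alpha> s i y) (?\<delta>F i y)"
            by (simp add: lp_1 tens_form_def dual_pairing_tens)
          then show ?thesis
            using gpair_chart[OF fibre_pairing_dual[OF vector_bundle_end[OF V']] t \<delta>F y] by simp
        next
          case False
          have "lp dual_pairing 1 i y (\<alpha> i y) (?u y) = 0"
            by (rule lp_zero_left[OF bounded_bilinear_dual_pairing]) (rule K(3)[OF False])
          moreover have "gpair dual_pairing 1 (tens_form 1 \<alpha> s) ?\<delta>F y = 0"
            by (rule gpair_zero[OF fibre_pairing_dual[OF vector_bundle_end[OF V']]]) (simp add: tens_form_def K(3)[OF False] tn.zero_left)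
          ultimately show ?thesis by simp
        qed
        then have "(LINT y|vol. lp dual_pairing 1 i y (\<alpha> i y) (?u y)) = form_pairing M g dual_pairing 1 (tens_form 1 \<alpha> s) ?\<delta>F"
          by (simp add: form_pairing_eq)
        also have "\<dots> = 0"
          unfolding Mop_ext_d_weak[OF V \<alpha> c s(1)] M0[OF s(1)]
          by (rule form_pairing_zero_right[OF bounded_bilinear_dual_pairing])
        finally show "(LINT y|vol. lp dual_pairing 1 i y (\<alpha> i y) (?u y)) = 0" .
      qed simp_all
      then show ?thesis by (simp add: s(2))
    qed
    then have "endmat (?\<delta>F i x [a]) = 0" by (simp add: matrix_eq)
    then show ?thesis by (simp add: endmat_def vec_eq_iff)
  qed
  then have "?\<delta>F = (\<lambda>_ _ _. 0)"
    by (intro form_eqI[OF \<delta>F forms_zero]) (auto simp: length_Suc_conv)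
  then show "yang_mills M V g" by (simp add: yang_mills_iff[OF V])
next
  have V': "vector_bundle M V" using V by (simp add: bundle_conn_def)
  let ?\<delta>F = "cdiv (end_bundle V) 1 (curvature_form M V)"
  assume "yang_mills M V g"
  then have YM: "?\<delta>F = (\<lambda>_ _ _. 0)" by (simp add: yang_mills_iff[OF V])
  have z: "form_pairing M g dual_pairing k \<alpha> (\<lambda>_ _ _. 0) = 0" for k and \<alpha> :: "('i, 'm, 'n, 'k, 's::finite) form"
    by (rule form_pairing_zero_right[OF bounded_bilinear_dual_pairing])
  show "is_complex M V g"
    unfolding is_complex_def
  proof (intro conjI ballI)
    fix s assume s: "s \<in> forms M V 0"
    have ds: "ext_d M V s \<in> forms M V 1" by (rule ext_d_form_0[OF V s])
    have "Mop V (ext_d M V s) = (\<lambda>_ _ _. 0)"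
    proof (rule form_nondegenerate[OF V' _ Mop_form[OF V ds] forms_zero])
      fix \<alpha> assume \<alpha>: "\<alpha> \<in> forms M (dual_bundle V) 1" "compact_support \<alpha>"
      show "form_pairing M g dual_pairing 1 \<alpha> (Mop V (ext_d M V s)) = form_pairing M g dual_pairing 1 \<alpha> (\<lambda>_ _ _. 0)"
        using Mop_ext_d_weak[OF V \<alpha> s] unfolding YM z by simp
    qed simp
    then show "M_op M V g (ext_d M V s) = (\<lambda>_ _ _ _. 0)"
      using weighted_forms_eq_0_iff[OF M_op(1)[OF V ds]] M_op(2)[OF V ds] by simp
  next
    fix \<phi> assume \<phi>: "\<phi> \<in> forms M V 1"
    have Mf: "Mop V \<phi> \<in> forms M V (Suc 0)" using Mop_form[OF V \<phi>] by simp
    have "cdiv V 0 (Mop V \<phi>) = (\<lambda>_ _ _. 0)"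
    proof (rule form_nondegenerate[OF V' _ div_form[OF V _ Mf] forms_zero])
      fix \<alpha> assume \<alpha>: "\<alpha> \<in> forms M (dual_bundle V) 0" "compact_support \<alpha>"
      show "form_pairing M g dual_pairing 0 \<alpha> (cdiv V 0 (Mop V \<phi>)) = form_pairing M g dual_pairing 0 \<alpha> (\<lambda>_ _ _. 0)"
        using cdiv_Mop_weak[OF V \<alpha> \<phi>] unfolding YM z by simp
    qed simp_all
    moreover note c = codiff[OF V _ M_op(1)[OF V \<phi>, unfolded One_nat_def]]
    ultimately show "codiff M V g 0 (M_op M V g \<phi>) = (\<lambda>_ _ _ _. 0)"
      using weighted_forms_eq_0_iff[OF c(1)] c(2) M_op(2)[OF V \<phi>] by simp
  qed
qed


section \<open>Formal self-adjointness\<close>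

lemma hform_bilinear:
  fixes \<sigma> :: "'k::{real_normed_field,euclidean_space} \<Rightarrow> 'k"
  assumes \<sigma>: "scalar_involution \<sigma>"
  shows "bounded_bilinear (hform \<sigma> H i x :: 'k^'r::finite \<Rightarrow> 'k^'r \<Rightarrow> 'k)"
proof -
  interpret s: linear \<sigma> using \<sigma> by (simp add: scalar_involution_def)
  show ?thesis
    by (rule bilinear_conv_bounded_bilinear[THEN iffD1])
      (auto simp: bilinear_def hform_def s.add s.scale scaleR_sum_right algebra_simps sum.distrib intro!: linearI)
qed

text \<open>The covector \<open>u \<mapsto> H(u, v)\<close>; it depends on \<open>v\<close> conjugate linearly when \<open>\<sigma>\<close> is conjugation, hence only real
  linearity is available below.\<close>

definition flatv ::
  "('k::{real_normed_field,euclidean_space} \<Rightarrow> 'k) \<Rightarrow> ('i \<Rightarrow> 'm \<Rightarrow> 'k^'r::finite^'r) \<Rightarrow> 'i \<Rightarrow> 'm \<Rightarrow> 'k^'r \<Rightarrow> 'k^'r" where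
  "flatv \<sigma> H i x v = (\<chi> c. \<Sum>d\<in>UNIV. H i x $ c $ d * \<sigma> (v $ d))"

lemma dual_pairing_flatv: "dual_pairing i x (flatv \<sigma> H i x v) u = hform \<sigma> H i x u v"
  by (simp add: dual_pairing_def flatv_def hform_def sum_distrib_left sum_distrib_right mult_ac)

lemma dual_pairing_eqI: "(\<And>u. dual_pairing i x v u = dual_pairing i x w u) \<Longrightarrow> v = w"
proof -
  assume e: "\<And>u. dual_pairing i x v u = dual_pairing i x w u"
  have "v $ c = w $ c" for c
    using e[of "axis c 1"] by (simp add: dual_pairing_def axis_def if_distrib[of "\<lambda>t. _ * t"] cong: if_cong)
  then show ?thesis by (simp add: vec_eq_iff)
qed

definition flat_form ::
  "('k::{real_normed_field,euclidean_space} \<Rightarrow> 'k) \<Rightarrow> ('i \<Rightarrow> 'm \<Rightarrow> 'k^'r::finite^'r) \<Rightarrow>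
   ('i, 'm, 'n, 'k, 'r) form \<Rightarrow> ('i, 'm, 'n, 'k, 'r) form" where
  "flat_form \<sigma> H \<phi> = (\<lambda>i x I. flatv \<sigma> H i x (\<phi> i x I))"

context
  fixes V :: "('i, 'm, 'n, 'k::{real_normed_field,euclidean_space}, 'r::finite) vbundle"
    and \<sigma> :: "'k \<Rightarrow> 'k" and H :: "'i \<Rightarrow> 'm \<Rightarrow> 'k^'r^'r"
  assumes V: "bundle_conn V" and \<sigma>: "scalar_involution \<sigma>" and H: "bundle_hform M V \<sigma> H"
    and pres: "preserves_hform M V \<sigma> H"
begin

lemma V_facts: "vector_bundle M V" "connection M V"
  using V by (auto simp: bundle_conn_def)

lemma sigma_linear: "bounded_linear \<sigma>"
  using \<sigma> by (simp add: scalar_involution_def linear_conv_bounded_linear)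

lemma hform_swap:
  assumes "x \<in> cdom M i"
  shows "hform \<sigma> H i x v u = \<sigma> (hform \<sigma> H i x u v)"
proof -
  interpret s: bounded_linear \<sigma> by (rule sigma_linear)
  have m: "\<sigma> (a * b) = \<sigma> a * \<sigma> b" "\<sigma> (\<sigma> a) = a" for a b using \<sigma> by (auto simp: scalar_involution_def)
  have h: "\<sigma> (H i x $ c $ d) = H i x $ d $ c" for c d using H assms unfolding bundle_hform_def by metis
  have "\<sigma> (hform \<sigma> H i x u v) = (\<Sum>c\<in>UNIV. \<Sum>d\<in>UNIV. H i x $ d $ c * \<sigma> (u $ c) * v $ d)"
    by (simp add: hform_def s.sum m h)
  also have "\<dots> = (\<Sum>d\<in>UNIV. \<Sum>c\<in>UNIV. H i x $ d $ c * \<sigma> (u $ c) * v $ d)" by (rule sum.swap)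
  finally show ?thesis by (simp add: hform_def mult_ac)
qed

lemma bounded_linear_flatv: "bounded_linear (flatv \<sigma> H i x)"
proof -
  interpret s: bounded_linear \<sigma> by (rule sigma_linear)
  show ?thesis
    by (rule linear_conv_bounded_linear[THEN iffD1])
      (auto simp: flatv_def vec_eq_iff s.add s.scaleR scaleR_sum_right algebra_simps sum.distrib intro!: linearI)
qed

lemma flatv_smooth:
  assumes "chart_open i W" "smooth_in M i W s"
  shows "smooth_in M i W (\<lambda>x. flatv \<sigma> H i x (s x))"
proof -
  have "smooth_in M i W (H i)"
    by (rule smooth_in_subset[of i "cdom M i"]) (use H assms(1) in \<open>auto simp: bundle_hform_def chart_open_def\<close>)
  then show ?thesis unfolding flatv_def
    by (intro smooth_in_vec_lambda[OF assms(1)] smooth_in_sum[OF assms(1)] smooth_in_mult[OF assms(1)]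
        smooth_in_linear[OF assms(1) sigma_linear] smooth_in_vec_nth[OF assms(1)] assms(2))
qed

lemma hform_invariant:
  "x \<in> cdom M i \<Longrightarrow> x \<in> cdom M j \<Longrightarrow> hform \<sigma> H i x (transition V i j x *v u) (transition V i j x *v v) = hform \<sigma> H j x u v"
  using H unfolding bundle_hform_def by blast

lemma fibre_pairing_hform: "fibre_pairing V V (hform \<sigma> H)"
  unfolding fibre_pairing_def
proof (intro conjI allI ballI impI)
  show "bounded_bilinear (hform \<sigma> H i x)" for i x by (rule hform_bilinear[OF \<sigma>])
  show "hform \<sigma> H j x (transition V j i x *v u) (transition V j i x *v v) = hform \<sigma> H i x u v"
    if "x \<in> cdom M i \<inter> cdom M j" for i j u v x using hform_invariant that by auto
  show "smooth_in M i W (\<lambda>x. hform \<sigma> H i x (s x) (t x))"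
    if "chart_open i W \<and> smooth_in M i W s \<and> smooth_in M i W t" for i W s t
  proof -
    have "smooth_in M i W (\<lambda>x. dual_pairing i x (flatv \<sigma> H i x (t x)) (s x))"
      unfolding dual_pairing_def using that flatv_smooth[of i W t]
      by (intro smooth_in_sum smooth_in_mult smooth_in_vec_nth) auto
    then show ?thesis by (simp add: dual_pairing_flatv)
  qed
qed

lemma flatv_change:
  assumes x: "x \<in> cdom M i" "x \<in> cdom M j"
  shows "flatv \<sigma> H j x (transition V j i x *v v) = transition (dual_bundle V) j i x *v flatv \<sigma> H i x v"
proof (rule dual_pairing_eqI[of j x])
  fix u
  have t: "transition (dual_bundle V) j i x = transpose (transition V i j x)" by (simp add: dual_bundle_def)
  have GH: "transition V j i x *v (transition V i j x *v u) = u"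
    using transition_inverse[OF V_facts(1) x(2,1)] by (simp add: matrix_vector_mul_assoc)
  have "dual_pairing j x (flatv \<sigma> H j x (transition V j i x *v v)) u = hform \<sigma> H j x (transition V j i x *v (transition V i j x *v u)) (transition V j i x *v v)"
    unfolding GH by (rule dual_pairing_flatv)
  also have "\<dots> = hform \<sigma> H i x (transition V i j x *v u) v" by (rule hform_invariant[OF x(2,1)])
  also have "\<dots> = dual_pairing j x (transition (dual_bundle V) j i x *v flatv \<sigma> H i x v) u"
    unfolding t dual_pairing_transpose dual_pairing_flatv[symmetric] by (simp add: dual_pairing_def)
  finally show "dual_pairing j x (flatv \<sigma> H j x (transition V j i x *v v)) u
    = dual_pairing j x (transition (dual_bundle V) j i x *v flatv \<sigma> H i x v) u" .
qed

lemma flat_form_form: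
  assumes \<phi>: "\<phi> \<in> forms M V k"
  shows "flat_form \<sigma> H \<phi> \<in> forms M (dual_bundle V) k"
  unfolding forms_iff
proof (intro conjI allI ballI impI)
  interpret f: bounded_linear "flatv \<sigma> H i x" for i x by (rule bounded_linear_flatv)
  show "flat_form \<sigma> H \<phi> i x \<in> alt_tensors k" for i x
    using forms_alt[OF \<phi>, of i x] by (simp add: alt_tensors_def flat_form_def f.zero f.neg)
  show "flat_form \<sigma> H \<phi> i x I = 0" if "x \<notin> cdom M i" for i x I
    using forms_outside[OF \<phi> that] by (simp add: flat_form_def f.zero)
  show "smooth_in M i (cdom M i) (\<lambda>x. flat_form \<sigma> H \<phi> i x I)" for i I
    unfolding flat_form_def by (rule flatv_smooth[OF chart_open_cdom forms_smooth[OF \<phi>]])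
  show "flat_form \<sigma> H \<phi> j x I = change (dual_bundle V) k j i x (flat_form \<sigma> H \<phi> i x) I"
    if "x \<in> cdom M i \<inter> cdom M j" "length I = k" for i j x I
    using that forms_change[OF \<phi>, of x i j I]
    by (simp add: flat_form_def change_def f.sum f.scaleR flatv_change)
qed

text \<open>Preservation of the form, tested against sections with constant components.\<close>

lemma cov_flatv:
  assumes s: "smooth_in M i (cdom M i) s" and x: "x \<in> cdom M i"
  shows "cov M (dual_bundle V) i a (\<lambda>y. flatv \<sigma> H i y (s y)) x = flatv \<sigma> H i x (cov M V i a s x)"
proof (rule dual_pairing_eqI[of i x])
  fix u :: "'k^'r"
  have c: "smooth_in M i (cdom M i) (\<lambda>_. u)" by (rule smooth_in_const)
  have "dual_pairing i x (cov M (dual_bundle V) i a (\<lambda>y. flatv \<sigma> H i y (s y)) x) u + hform \<sigma> H i x (cov M V i a (\<lambda>_. u) x) (s x)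
    = pd M i a (\<lambda>y. hform \<sigma> H i y u (s y)) x"
    using pd_dual_pairing[OF flatv_smooth[OF chart_open_cdom s] c x, where V=V] by (simp add: dual_pairing_flatv)
  also have "\<dots> = hform \<sigma> H i x (cov M V i a (\<lambda>_. u) x) (s x) + hform \<sigma> H i x u (cov M V i a s x)"
    using pres s c x unfolding preserves_hform_def by blast
  finally show "dual_pairing i x (cov M (dual_bundle V) i a (\<lambda>y. flatv \<sigma> H i y (s y)) x) u
    = dual_pairing i x (flatv \<sigma> H i x (cov M V i a s x)) u" by (simp add: dual_pairing_flatv)
qed

lemma ext_d_flat_form:
  assumes \<phi>: "\<phi> \<in> forms M V k"
  shows "ext_d M (dual_bundle V) (flat_form \<sigma> H \<phi>) = flat_form \<sigma> H (ext_d M V \<phi>)"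
proof (intro ext)
  interpret f: bounded_linear "flatv \<sigma> H i x" for i x by (rule bounded_linear_flatv)
  fix i x I
  show "ext_d M (dual_bundle V) (flat_form \<sigma> H \<phi>) i x I = flat_form \<sigma> H (ext_d M V \<phi>) i x I"
    by (cases "x \<in> cdom M i")
      (simp_all add: ext_d_def flat_form_def cov_flatv[OF forms_smooth[OF \<phi>]] f.sum f.scaleR f.zero)
qed

text \<open>Differentiating the compatibility of the form with \<open>D\<close> twice shows that lowering commutes with curvature, and the
  curvature of the dual bundle is \<open>- F\<^sup>T\<close>.\<close>

lemma curvature_hform:
  assumes x: "x \<in> cdom M i"
  shows "hform \<sigma> H i x (curvature M V i x a b *v u) v = - hform \<sigma> H i x u (curvature M V i x a b *v v)"
proof -
  have c: "smooth_in M i (cdom M i) (\<lambda>_. v)" by (rule smooth_in_const)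
  let ?f = "\<lambda>y. flatv \<sigma> H i y v"
  have fs: "smooth_in M i (cdom M i) ?f" by (rule flatv_smooth[OF chart_open_cdom c])
  have "cov M (dual_bundle V) i a (cov M (dual_bundle V) i b ?f) x = flatv \<sigma> H i x (cov M V i a (cov M V i b (\<lambda>_. v)) x)" for a b
  proof -
    have "cov M (dual_bundle V) i a (cov M (dual_bundle V) i b ?f) x
      = cov M (dual_bundle V) i a (\<lambda>y. flatv \<sigma> H i y (cov M V i b (\<lambda>_. v) y)) x"
      by (rule cov_cong[OF chart_open_cdom x]) (rule cov_flatv[OF c])
    then show ?thesis by (simp add: cov_flatv[OF smooth_in_cov[OF V_facts(2) chart_open_cdom c] x])
  qed
  then have "curvature M (dual_bundle V) i x a b *v ?f x = flatv \<sigma> H i x (curvature M V i x a b *v v)"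
    using curvature_cov[OF connection_dual[OF V_facts] fs x, of a b] curvature_cov[OF V_facts(2) c x, of a b]
      linear_diff[OF bounded_linear.linear[OF bounded_linear_flatv]] by metis
  then have "dual_pairing i x (flatv \<sigma> H i x (curvature M V i x a b *v v)) u = - dual_pairing i x (?f x) (curvature M V i x a b *v u)"
    unfolding curvature_dual[OF V_facts x] by (metis mv.minus_left dp.minus_left dual_pairing_transpose)
  then show ?thesis by (simp add: dual_pairing_flatv)
qed

lemma lp_hform_flat:
  assumes x: "x \<in> cdom M i"
  shows "lp (hform \<sigma> H) k i x u v = lp dual_pairing k i x (\<lambda>I. flatv \<sigma> H i x (v I)) u"
  unfolding lp_def dual_pairing_flatv by (subst sum.swap) (simp add: gi_sym[OF x])

lemma form_pairing_hform_flat: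
  "form_pairing M g (hform \<sigma> H) k \<phi> \<psi> = form_pairing M g dual_pairing k (flat_form \<sigma> H \<psi>) \<phi>"
proof -
  have "gpair (hform \<sigma> H) k \<phi> \<psi> = gpair dual_pairing k (flat_form \<sigma> H \<psi>) \<phi>"
    by (rule ext) (simp add: gpair_def lp_hform_flat[OF some_chart] flat_form_def)
  then show ?thesis by (simp only: form_pairing_eq)
qed

lemma form_pairing_hform_swap:
  assumes "\<phi> \<in> forms M V k" "\<psi> \<in> forms M V k" "compact_support \<phi> \<or> compact_support \<psi>"
  shows "form_pairing M g (hform \<sigma> H) k \<psi> \<phi> = \<sigma> (form_pairing M g (hform \<sigma> H) k \<phi> \<psi>)"
proof -
  interpret s: bounded_linear \<sigma> by (rule sigma_linear)
  have e: "gpair (hform \<sigma> H) k \<psi> \<phi> x = \<sigma> (gpair (hform \<sigma> H) k \<phi> \<psi> x)" for x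
    unfolding gpair_def lp_def hform_swap[OF some_chart, of _ _ "\<phi> _ _ _"]
    by (subst sum.swap) (simp add: s.scaleR s.sum gi_sym[OF some_chart])
  have "form_pairing M g (hform \<sigma> H) k \<psi> \<phi> = (LINT x|vol. \<sigma> (gpair (hform \<sigma> H) k \<phi> \<psi> x))"
    unfolding form_pairing_eq by (rule Bochner_Integration.integral_cong[OF refl]) (rule e)
  also have "\<dots> = \<sigma> (form_pairing M g (hform \<sigma> H) k \<phi> \<psi>)"
    unfolding form_pairing_eq
    by (rule integral_bounded_linear[OF sigma_linear gpair_integrable[OF fibre_pairing_hform assms]])
  finally show ?thesis .
qed

text \<open>The two signs from the skewness of \<open>F\<close> in its form indices and with respect to the form cancel.\<close>

lemma F_dot_hform:
  assumes x: "x \<in> cdom M i"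
  shows "lp (hform \<sigma> H) 1 i x (F_dot M V g \<phi> i x) (\<psi> i x) = lp (hform \<sigma> H) 1 i x (\<phi> i x) (F_dot M V g \<psi> i x)"
proof -
  interpret hb: bounded_bilinear "hform \<sigma> H i x" by (rule hform_bilinear[OF \<sigma>])
  let ?F = "curvature M V i x"
  have sk: "hform \<sigma> H i x (?F a c *v u) v = hform \<sigma> H i x u (?F c a *v v)" for a c u v
    unfolding curvature_hform[OF x] by (subst (2) curvature_skew) (simp add: mv.minus_left hb.minus_right)
  have "lp (hform \<sigma> H) 1 i x (F_dot M V g \<phi> i x) (\<psi> i x)
    = (\<Sum>a\<in>UNIV. \<Sum>d\<in>UNIV. \<Sum>b\<in>UNIV. \<Sum>c\<in>UNIV. (gi i x a d * gi i x c b) *\<^sub>R hform \<sigma> H i x (\<phi> i x [b]) (?F c a *v \<psi> i x [d]))"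
    by (simp add: lp_1 F_dot_eq hb.sum_left hb.scaleR_left scaleR_sum_right sk)
  also have "\<dots> = (\<Sum>b\<in>UNIV. \<Sum>c\<in>UNIV. \<Sum>a\<in>UNIV. \<Sum>d\<in>UNIV. (gi i x a d * gi i x c b) *\<^sub>R hform \<sigma> H i x (\<phi> i x [b]) (?F c a *v \<psi> i x [d]))"
    by (rule sum_swap4)
  also have "\<dots> = (\<Sum>b\<in>UNIV. \<Sum>c\<in>UNIV. \<Sum>d\<in>UNIV. \<Sum>a\<in>UNIV. (gi i x b c * gi i x a d) *\<^sub>R hform \<sigma> H i x (\<phi> i x [b]) (?F c a *v \<psi> i x [d]))"
    by (rule sum.cong[OF refl], rule sum.cong[OF refl], subst sum.swap) (simp add: gi_sym[OF x] mult.commute)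
  also have "\<dots> = lp (hform \<sigma> H) 1 i x (\<phi> i x) (F_dot M V g \<psi> i x)"
    by (simp add: lp_1 F_dot_eq hb.sum_right hb.scaleR_right scaleR_sum_right)
  finally show ?thesis .
qed

lemma Mop_hform:
  assumes \<phi>: "\<phi> \<in> forms M V 1" and \<psi>: "\<psi> \<in> forms M V 1" and c: "compact_support \<phi> \<or> compact_support \<psi>"
  shows "form_pairing M g (hform \<sigma> H) 1 (Mop V \<phi>) \<psi> =
    form_pairing M g (hform \<sigma> H) 2 (ext_d M V \<phi>) (ext_d M V \<psi>) - form_pairing M g (hform \<sigma> H) 1 (F_dot M V g \<phi>) \<psi>"
proof -
  interpret f: bounded_linear "flatv \<sigma> H i x" for i x by (rule bounded_linear_flatv)
  note fp = fibre_pairing_dual[OF V_facts(1)]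
  have f: "flat_form \<sigma> H \<psi> \<in> forms M (dual_bundle V) 1" by (rule flat_form_form[OF \<psi>])
  have cs: "compact_support (flat_form \<sigma> H \<psi>)" if "compact_support \<psi>"
    using that unfolding compact_support_def flat_form_def by (metis f.zero)
  have cd: "compact_support (ext_d M V \<phi>)" if "compact_support \<phi>" by (rule compact_support_ext_d[OF that])
  have cc: "compact_support (cdiv V 1 (ext_d M V \<phi>))" "compact_support (F_dot M V g \<phi>)" if \<phi>c: "compact_support \<phi>"
  proof -
    obtain K where K: "compact K" "\<And>i x I. x \<notin> K \<Longrightarrow> ext_d M V \<phi> i x I = 0" using cd[OF \<phi>c] unfolding compact_support_def by blast
    have "cdiv V 1 (ext_d M V \<phi>) i x I = 0" if "x \<notin> K" for i x I
      by (rule cdiv_support[OF compact_imp_closed[OF K(1)] _ that]) (rule K(2))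
    then show "compact_support (cdiv V 1 (ext_d M V \<phi>))" unfolding compact_support_def using K(1) by blast
    obtain L where L: "compact L" "\<And>i x I. x \<notin> L \<Longrightarrow> \<phi> i x I = 0" using \<phi>c unfolding compact_support_def by blast
    show "compact_support (F_dot M V g \<phi>)" unfolding compact_support_def F_dot_def
      using L by (intro exI[of _ L]) (auto simp: mv.zero_right)
  qed
  have "form_pairing M g (hform \<sigma> H) 1 (Mop V \<phi>) \<psi> = form_pairing M g dual_pairing 1 (flat_form \<sigma> H \<psi>) (cdiv V 1 (ext_d M V \<phi>))
      - form_pairing M g dual_pairing 1 (flat_form \<sigma> H \<psi>) (F_dot M V g \<phi>)"
    unfolding form_pairing_hform_flat Mop_def
    by (rule form_pairing_diff_right[OF fp f cdiv_ext_d_form[OF V \<phi>] F_dot_form[OF V \<phi>]]) (use c cs cc in auto)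
  also have "form_pairing M g dual_pairing 1 (flat_form \<sigma> H \<psi>) (cdiv V 1 (ext_d M V \<phi>))
    = form_pairing M g dual_pairing (Suc 1) (ext_d M (dual_bundle V) (flat_form \<sigma> H \<psi>)) (ext_d M V \<phi>)"
    by (rule green[OF V _ f ext_d_form_2[OF V \<phi>], symmetric]) (use c cs cd in auto)
  also have "\<dots> = form_pairing M g (hform \<sigma> H) 2 (ext_d M V \<phi>) (ext_d M V \<psi>)"
    unfolding ext_d_flat_form[OF \<psi>] form_pairing_hform_flat two_Suc ..
  finally show ?thesis by (simp add: form_pairing_hform_flat)
qed

text \<open>The swap rule for the form gives the mirror image of \<open>Mop_hform\<close>, in which both terms are the same.\<close>

theorem self_adjoint: "formally_self_adjoint M V g \<sigma> H"
  unfolding formally_self_adjoint_def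
proof (intro conjI ballI impI)
  interpret s: bounded_linear \<sigma> by (rule sigma_linear)
  fix \<phi> \<psi> assume \<phi>: "\<phi> \<in> forms M V 1" and \<psi>: "\<psi> \<in> forms M V 1" and c: "compact_support \<phi>"
  have Fd: "form_pairing M g (hform \<sigma> H) 1 (F_dot M V g \<phi>) \<psi> = form_pairing M g (hform \<sigma> H) 1 \<phi> (F_dot M V g \<psi>)"
    unfolding form_pairing_eq gpair_def F_dot_hform[OF some_chart] ..
  have "form_pairing M g (hform \<sigma> H) 1 \<phi> (Mop V \<psi>) = \<sigma> (form_pairing M g (hform \<sigma> H) 1 (Mop V \<psi>) \<phi>)"
    by (rule form_pairing_hform_swap[OF Mop_form[OF V \<psi>] \<phi>]) (use c in simp)
  also have "\<dots> = \<sigma> (form_pairing M g (hform \<sigma> H) 2 (ext_d M V \<psi>) (ext_d M V \<phi>)) - \<sigma> (form_pairing M g (hform \<sigma> H) 1 (F_dot M V g \<psi>) \<phi>)"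
    using Mop_hform[OF \<psi> \<phi>] c by (simp add: s.diff)
  also have "\<sigma> (form_pairing M g (hform \<sigma> H) 2 (ext_d M V \<psi>) (ext_d M V \<phi>)) = form_pairing M g (hform \<sigma> H) 2 (ext_d M V \<phi>) (ext_d M V \<psi>)"
    by (rule form_pairing_hform_swap[OF ext_d_form_1[OF V \<psi>] ext_d_form_1[OF V \<phi>], symmetric]) (use compact_support_ext_d[OF c] in simp)
  also have "\<sigma> (form_pairing M g (hform \<sigma> H) 1 (F_dot M V g \<psi>) \<phi>) = form_pairing M g (hform \<sigma> H) 1 \<phi> (F_dot M V g \<psi>)"
    by (rule form_pairing_hform_swap[OF F_dot_form[OF V \<psi>] \<phi>, symmetric]) (use c in simp)
  finally show "form_pairing M g (hform \<sigma> H) 1 (M_op M V g \<phi> g) \<psi> = form_pairing M g (hform \<sigma> H) 1 \<phi> (M_op M V g \<psi> g)"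
    using Mop_hform[OF \<phi> \<psi>] c Fd by (simp add: M_op(2)[OF V \<phi>] M_op(2)[OF V \<psi>])
next
  interpret f: bounded_linear "flatv \<sigma> H i x" for i x by (rule bounded_linear_flatv)
  fix t \<psi> assume t: "t \<in> forms M V 0" and \<psi>: "\<psi> \<in> weighted_forms M (conf_class M g) V 1" and c: "compact_support t"
  have \<psi>g: "\<psi> g \<in> forms M V (Suc 0)" using weighted_form_at[OF \<psi>] by simp
  note cd = codiff[OF V _ \<psi>[unfolded One_nat_def]]
  have cs: "compact_support (flat_form \<sigma> H t)"
    using c unfolding compact_support_def flat_form_def by (metis f.zero)
  have "form_pairing M g (hform \<sigma> H) 1 (ext_d M V t) (\<psi> g) = \<sigma> (form_pairing M g (hform \<sigma> H) 1 (\<psi> g) (ext_d M V t))"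
    by (rule form_pairing_hform_swap[OF weighted_form_at[OF \<psi>] ext_d_form_0[OF V t]]) (use compact_support_ext_d[OF c] in simp)
  also have "form_pairing M g (hform \<sigma> H) 1 (\<psi> g) (ext_d M V t) = form_pairing M g dual_pairing 0 (flat_form \<sigma> H t) (cdiv V 0 (\<psi> g))"
    unfolding form_pairing_hform_flat ext_d_flat_form[OF t, symmetric] One_nat_def
    by (rule green[OF V _ flat_form_form[OF t] \<psi>g]) (use cs in auto)
  also have "\<dots> = form_pairing M g (hform \<sigma> H) 0 (cdiv V 0 (\<psi> g)) t" by (simp add: form_pairing_hform_flat)
  also have "\<sigma> \<dots> = form_pairing M g (hform \<sigma> H) 0 t (cdiv V 0 (\<psi> g))"
    by (rule form_pairing_hform_swap[OF div_form[OF V _ \<psi>g] t, symmetric]) (use c in auto)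
  finally show "form_pairing M g (hform \<sigma> H) 1 (ext_d M V t) (\<psi> g) = form_pairing M g (hform \<sigma> H) 0 t (codiff M V g 0 \<psi> g)"
    using cd(2) by simp
qed

end

end

section \<open>Principal symbols and ellipticity\<close>

lemma sum_delta_lists_1:
  fixes c :: "'n::finite" and v :: "'n \<Rightarrow> 'a::real_vector"
  shows "(\<Sum>e\<in>UNIV. (if c = e then 1 else 0) *\<^sub>R v e) = v c"
  by (simp add: if_distrib[of "\<lambda>r. r *\<^sub>R _"] cong: if_cong)

context pseudo_riem
begin

text \<open>With a vanishing factor \<open>f\<close> split off, only the term in which the derivative hits \<open>f\<close> survives in
  the divergence.\<close>

lemma divup_at_zero:
  assumes x: "x \<in> cdom M i" and f: "smooth_fun M f" "f x = 0"
    and c: "\<And>J. smooth_in M i (cdom M i) (\<lambda>y. \<chi>' i y J)"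
    and eq: "\<And>y J. y \<in> cdom M i \<Longrightarrow> length J = Suc k \<Longrightarrow> \<psi> i y J = f y *\<^sub>R \<chi>' i y J"
  shows "divup V k \<psi> i I x = - (\<Sum>a\<in>UNIV. \<Sum>b\<in>UNIV. \<Sum>J | length J = k.
     (pd M i a f x * gi i x a b * (\<Prod>t<k. gi i x (I ! t) (J ! t))) *\<^sub>R \<chi>' i x (b # J))"
proof -
  have s: "smooth_in M i (cdom M i) (flux k \<chi>' i a I)" for a
    unfolding flux_def[abs_def]
    by (intro smooth_in_sum smooth_in_scaleR smooth_in_mult smooth_in_prod chart_open_cdom dens_smooth gi_smooth c)
  have "cov M V i a (flux k \<psi> i a I) x = pd M i a f x *\<^sub>R flux k \<chi>' i a I x" for a
  proof -
    have "cov M V i a (flux k \<psi> i a I) x = cov M V i a (\<lambda>y. f y *\<^sub>R flux k \<chi>' i a I y) x"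
      by (rule cov_cong[OF chart_open_cdom x]) (simp add: flux_def eq scaleR_sum_right mult_ac)
    also have "\<dots> = pd M i a f x *\<^sub>R flux k \<chi>' i a I x"
      using f by (subst cov_scaleR[OF _ s x x]) (auto simp: smooth_fun_def)
    finally show ?thesis .
  qed
  then show ?thesis
    using dens_pos[OF x] by (simp add: divup_def flux_def scaleR_sum_right mult_ac)
qed

lemma cdiv_at_zero_0:
  assumes x: "x \<in> cdom M i" and f: "smooth_fun M f" "f x = 0"
    and c: "\<And>J. smooth_in M i (cdom M i) (\<lambda>y. \<chi>' i y J)"
    and eq: "\<And>y J. y \<in> cdom M i \<Longrightarrow> length J = Suc 0 \<Longrightarrow> \<psi> i y J = f y *\<^sub>R \<chi>' i y J"
  shows "cdiv V 0 \<psi> i x [] = - (\<Sum>a\<in>UNIV. \<Sum>b\<in>UNIV. (pd M i a f x * gi i x a b) *\<^sub>R \<chi>' i x [b])"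
proof -
  have "divup V 0 \<psi> i [] x = - (\<Sum>a\<in>UNIV. \<Sum>b\<in>UNIV. \<Sum>J | length J = 0.
     (pd M i a f x * gi i x a b * (\<Prod>t<0. gi i x ([] ! t) (J ! t))) *\<^sub>R \<chi>' i x (b # J))"
    by (rule divup_at_zero[where f = f and \<chi>' = \<chi>', OF x f c]) (rule eq)
  then show ?thesis using x by (simp add: cdiv_def)
qed

lemma cdiv_at_zero_1:
  assumes x: "x \<in> cdom M i" and f: "smooth_fun M f" "f x = 0"
    and c: "\<And>J. smooth_in M i (cdom M i) (\<lambda>y. \<chi>' i y J)"
    and eq: "\<And>y J. y \<in> cdom M i \<Longrightarrow> length J = Suc (Suc 0) \<Longrightarrow> \<psi> i y J = f y *\<^sub>R \<chi>' i y J"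
  shows "cdiv V (Suc 0) \<psi> i x [c] = - (\<Sum>a\<in>UNIV. \<Sum>b\<in>UNIV. (pd M i a f x * gi i x a b) *\<^sub>R \<chi>' i x [b, c])"
proof -
  let ?t = "\<lambda>a b. pd M i a f x * gi i x a b"
  have dv: "divup V (Suc 0) \<psi> i I x = - (\<Sum>a\<in>UNIV. \<Sum>b\<in>UNIV. \<Sum>J | length J = Suc 0.
     (pd M i a f x * gi i x a b * (\<Prod>t<Suc 0. gi i x (I ! t) (J ! t))) *\<^sub>R \<chi>' i x (b # J))" for I
    by (rule divup_at_zero[where f = f and \<chi>' = \<chi>', OF x f c]) (rule eq)
  have "cdiv V (Suc 0) \<psi> i x [c] = (\<Sum>d\<in>UNIV. g i x $ c $ d *\<^sub>R divup V (Suc 0) \<psi> i [d] x)"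
    using x by (simp add: cdiv_def sum_lists_1)
  also have "\<dots> = - (\<Sum>d\<in>UNIV. \<Sum>a\<in>UNIV. \<Sum>b\<in>UNIV. \<Sum>e\<in>UNIV. (g i x $ c $ d * gi i x d e) *\<^sub>R ?t a b *\<^sub>R \<chi>' i x [b, e])"
    by (simp add: dv sum_lists_1 scaleR_sum_right sum_negf mult_ac)
  also have "(\<Sum>d\<in>UNIV. \<Sum>a\<in>UNIV. \<Sum>b\<in>UNIV. \<Sum>e\<in>UNIV. (g i x $ c $ d * gi i x d e) *\<^sub>R ?t a b *\<^sub>R \<chi>' i x [b, e])
    = (\<Sum>a\<in>UNIV. \<Sum>b\<in>UNIV. \<Sum>e\<in>UNIV. (\<Sum>d\<in>UNIV. g i x $ c $ d * gi i x d e) *\<^sub>R ?t a b *\<^sub>R \<chi>' i x [b, e])"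
    unfolding scaleR_sum_left
    by (subst sum.swap, rule sum.cong[OF refl], subst sum.swap, rule sum.cong[OF refl], rule sum.swap)
  also have "\<dots> = (\<Sum>a\<in>UNIV. \<Sum>b\<in>UNIV. ?t a b *\<^sub>R \<chi>' i x [b, c])"
    unfolding gi_inverse(2)[OF x] sum_delta_lists_1 ..
  finally show ?thesis .
qed

text \<open>Functions with prescribed differential and forms with prescribed value exist at every point, so a value that does
  not depend on their choice is the symbol.\<close>

lemma symbol_eqI:
  fixes V :: "('i, 'm, 'n, 'k::{real_normed_field,euclidean_space}, 'r::finite) vbundle"
  assumes V: "bundle_conn V" and k: "k \<le> 1" and x: "x \<in> cdom M i" and w: "w \<in> alt_tensors k"
    and z: "\<And>f \<omega> I. smooth_fun M f \<Longrightarrow> f x = 0 \<Longrightarrow> (\<And>a. pd M i a f x = \<xi> $ a) \<Longrightarrow> \<omega> \<in> forms M V k \<Longrightarrow> \<omega> i x = w \<Longrightarrow>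
      (1 / fact m) *\<^sub>R P (fscale (\<lambda>y. f y ^ m) \<omega>) i x I = z I"
  shows "symbol M V k m P i x \<xi> w = z"
  unfolding symbol_def
proof (rule the_equality)
  show "\<forall>f \<omega>. smooth_fun M f \<and> f x = 0 \<and> (\<forall>a. pd M i a f x = \<xi> $ a) \<and> \<omega> \<in> forms M V k \<and> \<omega> i x = w \<longrightarrow>
     z = (\<lambda>I. (1 / fact m) *\<^sub>R P (fscale (\<lambda>y. f y ^ m) \<omega>) i x I)"
    using z by (simp add: fun_eq_iff)
  obtain f where f: "smooth_fun M f" "f x = 0" "\<And>a. pd M i a f x = \<xi> $ a"
    using ex_function_with_differential[OF x] by metis
  obtain \<omega> where \<omega>: "\<omega> \<in> forms M V k" "\<omega> i x = w"
    using ex_form_with_value[OF _ k x w, of V] V unfolding bundle_conn_def by metis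
  fix z' assume "\<forall>f \<omega>. smooth_fun M f \<and> f x = 0 \<and> (\<forall>a. pd M i a f x = \<xi> $ a) \<and> \<omega> \<in> forms M V k \<and> \<omega> i x = w \<longrightarrow>
     z' = (\<lambda>I. (1 / fact m) *\<^sub>R P (fscale (\<lambda>y. f y ^ m) \<omega>) i x I)"
  then have "z' = (\<lambda>I. (1 / fact m) *\<^sub>R P (fscale (\<lambda>y. f y ^ m) \<omega>) i x I)" using f \<omega> by blast
  then show "z' = z" using z[OF f \<omega>] by simp
qed

lemma fscale_ext_d_0:
  assumes x: "x \<in> cdom M i" and f: "smooth_fun M f" and \<omega>: "\<omega> \<in> forms M V 0"
  shows "ext_d M V (fscale f \<omega>) i x [a] = pd M i a f x *\<^sub>R \<omega> i x [] + f x *\<^sub>R ext_d M V \<omega> i x [a]"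
  unfolding ext_d_0[OF x] fscale_def
  by (rule cov_scaleR[OF _ forms_smooth[OF \<omega>] x x]) (use f in \<open>simp add: smooth_fun_def\<close>)

lemma fscale_ext_d_1:
  assumes x: "x \<in> cdom M i" and f: "smooth_fun M f" and \<omega>: "\<omega> \<in> forms M V 1"
  shows "ext_d M V (fscale f \<omega>) i x [a, b] =
    pd M i a f x *\<^sub>R \<omega> i x [b] - pd M i b f x *\<^sub>R \<omega> i x [a] + f x *\<^sub>R ext_d M V \<omega> i x [a, b]"
proof -
  have "cov M V i c (\<lambda>y. f y *\<^sub>R \<omega> i y J) x = pd M i c f x *\<^sub>R \<omega> i x J + f x *\<^sub>R cov M V i c (\<lambda>y. \<omega> i y J) x" for c J
    by (rule cov_scaleR[OF _ forms_smooth[OF \<omega>] x x]) (use f in \<open>simp add: smooth_fun_def\<close>)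
  then show ?thesis unfolding ext_d_1[OF x] fscale_def by (simp add: algebra_simps)
qed

definition raise :: "'i \<Rightarrow> 'm \<Rightarrow> real^'n \<Rightarrow> 'n \<Rightarrow> real" where
  "raise i x \<xi> b = (\<Sum>a\<in>UNIV. \<xi> $ a * gi i x a b)"

lemma symbol_ext_d:
  fixes V :: "('i, 'm, 'n, 'k::{real_normed_field,euclidean_space}, 'r::finite) vbundle"
  assumes V: "bundle_conn V" and x: "x \<in> cdom M i" and w: "w \<in> alt_tensors 0"
  shows "symbol M V 0 1 (ext_d M V) i x \<xi> w = (\<lambda>I. if length I = 1 then \<xi> $ (I ! 0) *\<^sub>R w [] else 0)"
proof (rule symbol_eqI[OF V _ x w])
  fix f I and \<omega> :: "('i, 'm, 'n, 'k, 'r) form"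
  assume f: "smooth_fun M f" "f x = 0" "\<And>a. pd M i a f x = \<xi> $ a" and \<omega>: "\<omega> \<in> forms M V 0" "\<omega> i x = w"
  show "(1 / fact 1) *\<^sub>R ext_d M V (fscale (\<lambda>y. f y ^ 1) \<omega>) i x I = (if length I = 1 then \<xi> $ (I ! 0) *\<^sub>R w [] else 0)"
  proof (cases "length I = 1")
    case True
    then obtain a where "I = [a]" by (auto simp: length_Suc_conv)
    then show ?thesis using fscale_ext_d_0[OF x f(1) \<omega>(1)] f \<omega> by simp
  next
    case False
    then show ?thesis using ext_d_length[OF fscale_forms[OF f(1) \<omega>(1)], of I] by simp
  qed
qed simp

lemma symbol_codiff:
  fixes V :: "('i, 'm, 'n, 'k::{real_normed_field,euclidean_space}, 'r::finite) vbundle"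
  assumes V: "bundle_conn V" and x: "x \<in> cdom M i" and w: "w \<in> alt_tensors 1"
  shows "symbol M V 1 1 (\<lambda>\<phi>. codiff M V g 0 (weighted M V g 1 \<phi>) g) i x \<xi> w =
    (\<lambda>I. if length I = 0 then - (\<Sum>b\<in>UNIV. raise i x \<xi> b *\<^sub>R w [b]) else 0)"
proof (rule symbol_eqI[OF V _ x w])
  fix f I and \<omega> :: "('i, 'm, 'n, 'k, 'r) form"
  assume f: "smooth_fun M f" "f x = 0" "\<And>a. pd M i a f x = \<xi> $ a" and \<omega>: "\<omega> \<in> forms M V 1" "\<omega> i x = w"
  note w = weighted[OF fscale_forms[OF f(1) \<omega>(1)]]
  have "codiff M V g 0 (weighted M V g 1 (fscale f \<omega>)) g = cdiv V 0 (fscale f \<omega>)"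
    using codiff(2)[OF V, of 0] w by simp
  moreover have "cdiv V 0 (fscale f \<omega>) i x I = (if length I = 0 then - (\<Sum>b\<in>UNIV. raise i x \<xi> b *\<^sub>R w [b]) else 0)"
  proof (cases "I = []")
    case True
    have "cdiv V 0 (fscale f \<omega>) i x [] = - (\<Sum>a\<in>UNIV. \<Sum>b\<in>UNIV. (pd M i a f x * gi i x a b) *\<^sub>R \<omega> i x [b])"
      by (rule cdiv_at_zero_0[where f = f and \<chi>' = \<omega>, OF x f(1,2) forms_smooth[OF \<omega>(1)]]) (simp add: fscale_def)
    also have "\<dots> = - (\<Sum>b\<in>UNIV. raise i x \<xi> b *\<^sub>R w [b])"
      unfolding raise_def scaleR_sum_left f(3) \<omega>(2) by (subst sum.swap) simp
    finally show ?thesis using True by simp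
  qed (simp add: cdiv_def)
  ultimately show "(1 / fact 1) *\<^sub>R codiff M V g 0 (weighted M V g 1 (fscale (\<lambda>y. f y ^ 1) \<omega>)) g i x I =
      (if length I = 0 then - (\<Sum>b\<in>UNIV. raise i x \<xi> b *\<^sub>R w [b]) else 0)" by simp
qed simp

text \<open>As \<open>d\<^sup>D (f\<^sup>2 \<omega>) = f (2 df \<and> \<omega> + f d\<^sup>D \<omega>)\<close> and \<open>f x = 0\<close>, only the factor \<open>f\<close> in front is differentiated by \<open>\<delta>\<^sup>D\<close>, and
  the symbol is half of minus the contraction of \<open>2 \<xi> \<and> w\<close> with \<open>\<xi>\<close>.  The term \<open>F \<cdot> f\<^sup>2 \<omega>\<close> vanishes at \<open>x\<close>.\<close>

lemma symbol_M_op: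
  fixes V :: "('i, 'm, 'n, 'k::{real_normed_field,euclidean_space}, 'r::finite) vbundle"
  assumes V: "bundle_conn V" and x: "x \<in> cdom M i" and w: "w \<in> alt_tensors 1"
  shows "symbol M V 1 2 (\<lambda>\<phi>. M_op M V g \<phi> g) i x \<xi> w =
    (\<lambda>I. if length I = 1 then \<xi> $ (I ! 0) *\<^sub>R (\<Sum>b\<in>UNIV. raise i x \<xi> b *\<^sub>R w [b])
       - (\<Sum>b\<in>UNIV. raise i x \<xi> b * \<xi> $ b) *\<^sub>R w I else 0)"
proof (rule symbol_eqI[OF V _ x w])
  fix f I and \<omega> :: "('i, 'm, 'n, 'k, 'r) form"
  assume f: "smooth_fun M f" "f x = 0" "\<And>a. pd M i a f x = \<xi> $ a" and \<omega>: "\<omega> \<in> forms M V 1" "\<omega> i x = w"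
  let ?\<rho> = "fscale f \<omega>"
  have \<rho>: "?\<rho> \<in> forms M V 1" by (rule fscale_forms[OF f(1) \<omega>(1)])
  have e2: "fscale (\<lambda>y. f y ^ 2) \<omega> = fscale f ?\<rho>" by (simp add: fscale_def power2_eq_square)
  have \<rho>2: "fscale f ?\<rho> \<in> forms M V 1" by (rule fscale_forms[OF f(1) \<rho>])
  define c :: "('i, 'm, 'n, 'k, 'r) form" where
    "c i y J = pd M i (J ! 0) f y *\<^sub>R \<omega> i y [J ! 1] - pd M i (J ! 1) f y *\<^sub>R \<omega> i y [J ! 0] + ext_d M V ?\<rho> i y J" for i y J
  have V': "connection M V" using V by (simp add: bundle_conn_def)
  have sf: "smooth_in M i (cdom M i) f" using f(1) by (simp add: smooth_fun_def)
  have sc: "smooth_in M i (cdom M i) (\<lambda>y. c i y J)" for J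
    unfolding c_def
    by (intro smooth_in_add[OF chart_open_cdom] smooth_in_diff[OF chart_open_cdom] smooth_in_scaleR[OF chart_open_cdom]
        smooth_in_pd[OF chart_open_cdom sf] forms_smooth[OF \<omega>(1)] ext_d_smooth[OF V' \<rho>])
  have eq: "ext_d M V (fscale f ?\<rho>) i y J = f y *\<^sub>R c i y J" if y: "y \<in> cdom M i" and J: "length J = Suc (Suc 0)" for y J
  proof -
    obtain a b where "J = [a, b]" using J by (auto simp: length_Suc_conv)
    then show ?thesis
      using fscale_ext_d_1[OF y f(1) \<rho>, of a b] by (simp add: c_def fscale_def scaleR_add_right scaleR_diff_right mult.commute)
  qed
  have cx: "c i x [b, d] = 2 *\<^sub>R (\<xi> $ b *\<^sub>R w [d] - \<xi> $ d *\<^sub>R w [b])" for b d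
    using fscale_ext_d_1[OF x f(1) \<omega>(1), of b d] f \<omega>(2) by (simp add: c_def scaleR_2)
  let ?S = "\<Sum>b\<in>UNIV. raise i x \<xi> b *\<^sub>R w [b]" and ?Q = "\<Sum>b\<in>UNIV. raise i x \<xi> b * \<xi> $ b"
  show "(1 / fact 2) *\<^sub>R M_op M V g (fscale (\<lambda>y. f y ^ 2) \<omega>) g i x I =
      (if length I = 1 then \<xi> $ (I ! 0) *\<^sub>R ?S - ?Q *\<^sub>R w I else 0)"
  proof (cases "length I = 1")
    case True
    then obtain d where d: "I = [d]" by (auto simp: length_Suc_conv)
    have "cdiv V (Suc 0) (ext_d M V (fscale f ?\<rho>)) i x [d] =
        - (\<Sum>a\<in>UNIV. \<Sum>b\<in>UNIV. (pd M i a f x * gi i x a b) *\<^sub>R c i x [b, d])"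
      by (rule cdiv_at_zero_1[where f = f and \<chi>' = c, OF x f(1,2) sc]) (rule eq)
    also have "\<dots> = - (\<Sum>b\<in>UNIV. raise i x \<xi> b *\<^sub>R c i x [b, d])"
      unfolding raise_def scaleR_sum_left f(3) by (subst sum.swap) simp
    also have "(\<Sum>b\<in>UNIV. raise i x \<xi> b *\<^sub>R c i x [b, d])
        = 2 *\<^sub>R ((\<Sum>b\<in>UNIV. (raise i x \<xi> b * \<xi> $ b) *\<^sub>R w [d]) - (\<Sum>b\<in>UNIV. \<xi> $ d *\<^sub>R (raise i x \<xi> b *\<^sub>R w [b])))"
      unfolding cx scaleR_sum_right sum_subtractf[symmetric]
      by (rule sum.cong[OF refl]) (simp add: scaleR_diff_right mult_ac)
    also have "\<dots> = 2 *\<^sub>R (?Q *\<^sub>R w [d] - \<xi> $ d *\<^sub>R ?S)"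
      by (simp add: scaleR_sum_left scaleR_sum_right)
    finally have 1: "cdiv V (Suc 0) (ext_d M V (fscale f ?\<rho>)) i x [d] = - (2 *\<^sub>R (?Q *\<^sub>R w [d] - \<xi> $ d *\<^sub>R ?S))" .
    have 2: "F_dot M V g (fscale f ?\<rho>) i x [d] = 0"
      using f(2) by (simp add: F_dot_def fscale_def)
    show ?thesis
      unfolding e2 M_op(2)[OF V \<rho>2] Mop_def d using 1 2 by simp
  next
    case False
    then show ?thesis
      unfolding e2 M_op(2)[OF V \<rho>2] using forms_length[OF Mop_form[OF V \<rho>2] False] by simp
  qed
qed simp

text \<open>If \<open>P\<^sup>T g P = 1\<close> then \<open>g\<^sup>-\<^sup>1 = P P\<^sup>T\<close>, and \<open>|\<xi>|\<^sup>2\<close> is the sum of the squares of the components of \<open>P\<^sup>T \<xi>\<close>.\<close>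

lemma covector_norm_pos:
  assumes q: "q = 0" and x: "x \<in> cdom M i" and \<xi>: "\<xi> \<noteq> 0"
  shows "(\<Sum>b\<in>UNIV. raise i x \<xi> b * \<xi> $ b) > 0"
proof -
  obtain P :: "real^'n^'n" and \<epsilon> :: "'n \<Rightarrow> real" where P: "invertible P" "range \<epsilon> \<subseteq> {1, -1}" "card {a. \<epsilon> a = -1} = 0"
    "transpose P ** g i x ** P = (\<chi> a b. if a = b then \<epsilon> a else 0)"
    using metric_signature[OF x] q unfolding has_signature_def by blast
  have "\<epsilon> a = 1" for a using P(2,3) by auto
  then have "(\<chi> a b. if a = b then \<epsilon> a else 0) = mat 1" by (simp add: vec_eq_iff mat_def)
  then have 1: "transpose P ** (g i x ** P) = mat 1" using P(4) by (simp add: matrix_mul_assoc)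
  then have "g i x ** (P ** transpose P) = mat 1"
    by (metis matrix_left_right_inverse matrix_mul_assoc)
  then have "(P ** transpose P) ** g i x = mat 1" by (simp add: matrix_left_right_inverse)
  then have "matrix_inv (g i x) = P ** transpose P" by (rule matrix_inv_eqI[OF metric_invertible[OF x]])
  then have gi: "gi i x a b = (\<Sum>c\<in>UNIV. P $ a $ c * P $ b $ c)" for a b
    by (simp add: gi_def matrix_matrix_mult_def transpose_def)
  let ?v = "\<lambda>c. \<Sum>a\<in>UNIV. \<xi> $ a * P $ a $ c"
  have "(\<Sum>b\<in>UNIV. raise i x \<xi> b * \<xi> $ b) = (\<Sum>b\<in>UNIV. \<Sum>a\<in>UNIV. \<Sum>c\<in>UNIV. (\<xi> $ a * P $ a $ c) * (\<xi> $ b * P $ b $ c))"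
    by (simp add: raise_def gi sum_distrib_left sum_distrib_right mult_ac)
  also have "\<dots> = (\<Sum>c\<in>UNIV. ?v c * ?v c)"
    unfolding sum_product by (subst (2) sum.swap, subst sum.swap, rule sum.cong[OF refl], rule sum.swap)
  finally have e: "(\<Sum>b\<in>UNIV. raise i x \<xi> b * \<xi> $ b) = (\<Sum>c\<in>UNIV. ?v c * ?v c)" .
  have "\<exists>c. ?v c \<noteq> 0"
  proof (rule ccontr)
    assume "\<not> (\<exists>c. ?v c \<noteq> 0)"
    then have "\<xi> v* P = 0" by (simp add: vec_eq_iff vector_matrix_mult_def mult.commute)
    then have "(\<xi> v* P) v* matrix_inv P = 0" by simp
    then show False using \<xi> matrix_inv_inverse[OF P(1)] by (simp add: vector_matrix_mul_assoc)
  qed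
  then obtain c where "?v c \<noteq> 0" ..
  then have "0 < ?v c * ?v c" by (metis not_real_square_gt_zero)
  also have "\<dots> \<le> (\<Sum>c\<in>UNIV. ?v c * ?v c)" by (rule member_le_sum) auto
  finally show ?thesis unfolding e .
qed

text \<open>With \<open>S w = \<langle>\<xi>, w\<rangle>\<close> and \<open>Q = |\<xi>|\<^sup>2 > 0\<close>, the preimages needed for exactness are \<open>S w / Q\<close> for the first symbol,
  \<open>- w / Q\<close> for the second and \<open>- v \<xi> / Q\<close> for the third.\<close>

theorem elliptic:
  fixes V :: "('i, 'm, 'n, 'k::{real_normed_field,euclidean_space}, 'r::finite) vbundle"
  assumes V: "bundle_conn V" and q: "q = 0"
  shows "elliptic_sequence M V g"
  unfolding elliptic_sequence_def Let_def
proof (intro allI ballI impI)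
  fix i x and \<xi> :: "real^'n" assume x: "x \<in> cdom M i" and \<xi>: "\<xi> \<noteq> 0"
  let ?s0 = "symbol M V 0 1 (ext_d M V) i x \<xi>"
    and ?s1 = "symbol M V 1 2 (\<lambda>\<phi>. M_op M V g \<phi> g) i x \<xi>"
    and ?s2 = "symbol M V 1 1 (\<lambda>\<phi>. codiff M V g 0 (weighted M V g 1 \<phi>) g) i x \<xi>"
  let ?A0 = "alt_tensors 0 :: ('n list \<Rightarrow> 'k^'r) set" and ?A1 = "alt_tensors 1 :: ('n list \<Rightarrow> 'k^'r) set"
  define \<eta> where "\<eta> = raise i x \<xi>"
  define Q where "Q = (\<Sum>b\<in>UNIV. \<eta> b * \<xi> $ b)"
  define S where "S w = (\<Sum>b\<in>UNIV. \<eta> b *\<^sub>R w [b])" for w :: "'n list \<Rightarrow> 'k^'r"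
  have Q: "Q > 0" using covector_norm_pos[OF q x \<xi>] by (simp add: Q_def \<eta>_def)
  have s0: "?s0 w = (\<lambda>I. if length I = 1 then \<xi> $ (I ! 0) *\<^sub>R w [] else 0)" if "w \<in> ?A0" for w
    by (rule symbol_ext_d[OF V x that])
  have s1: "?s1 w = (\<lambda>I. if length I = 1 then \<xi> $ (I ! 0) *\<^sub>R S w - Q *\<^sub>R w I else 0)" if "w \<in> ?A1" for w
    unfolding S_def Q_def \<eta>_def by (rule symbol_M_op[OF V x that])
  have s2: "?s2 w = (\<lambda>I. if length I = 0 then - S w else 0)" if "w \<in> ?A1" for w
    unfolding S_def \<eta>_def by (rule symbol_codiff[OF V x that])
  note s0' = s0[unfolded One_nat_def] and s1' = s1[unfolded One_nat_def] and s2' = s2[unfolded One_nat_def]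
  have A0: "w \<in> ?A0 \<longleftrightarrow> (\<forall>I. length I \<noteq> 0 \<longrightarrow> w I = 0)" for w by (rule alt_tensors_le_1) simp
  have A1: "w \<in> ?A1 \<longleftrightarrow> (\<forall>I. length I \<noteq> 1 \<longrightarrow> w I = 0)" for w by (rule alt_tensors_le_1) simp
  have S0: "S (\<lambda>I. if length I = 1 then \<xi> $ (I ! 0) *\<^sub>R v else 0) = Q *\<^sub>R v" for v
    by (simp add: S_def Q_def scaleR_sum_left)
  have S1: "S (\<lambda>I. if length I = 1 then \<xi> $ (I ! 0) *\<^sub>R S w - Q *\<^sub>R w I else 0) = 0" for w
  proof -
    have "S (\<lambda>I. if length I = 1 then \<xi> $ (I ! 0) *\<^sub>R S w - Q *\<^sub>R w I else 0)
        = (\<Sum>b\<in>UNIV. (\<eta> b * \<xi> $ b) *\<^sub>R S w - Q *\<^sub>R \<eta> b *\<^sub>R w [b])"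
      unfolding S_def[of "\<lambda>I. if length I = 1 then _ I else 0"] by (simp add: scaleR_diff_right mult.commute)
    also have "\<dots> = Q *\<^sub>R S w - Q *\<^sub>R S w"
      unfolding sum_subtractf scaleR_sum_left[symmetric] scaleR_sum_right[symmetric] Q_def[symmetric] S_def[symmetric] ..
    finally show ?thesis by simp
  qed
  have Sc: "S (\<lambda>I. r *\<^sub>R w I) = r *\<^sub>R S w" for r w by (simp add: S_def scaleR_sum_right mult_ac)
  obtain a where a: "\<xi> $ a \<noteq> 0" using \<xi> by (auto simp: vec_eq_iff)
  have "inj_on ?s0 ?A0"
  proof (rule inj_onI)
    fix w w' assume w: "w \<in> ?A0" "w' \<in> ?A0" "?s0 w = ?s0 w'"
    from fun_cong[OF w(3)[unfolded s0[OF w(1)] s0[OF w(2)]], of "[a]"] have "w [] = w' []" using a by simp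
    then show "w = w'" using w unfolding A0 by (metis (no_types) ext length_0_conv)
  qed
  moreover have "?s0 ` ?A0 = {w \<in> ?A1. ?s1 w = (\<lambda>_. 0)}"
  proof (intro set_eqI iffI)
    fix w assume "w \<in> ?s0 ` ?A0"
    then obtain v where v: "v \<in> ?A0" "w = ?s0 v" by blast
    have w: "w \<in> ?A1" unfolding v(2) s0[OF v(1)] A1 by simp
    have "S w = Q *\<^sub>R v []" unfolding v(2) s0[OF v(1)] by (rule S0)
    then have "?s1 w = (\<lambda>_. 0)" unfolding s1[OF w] by (simp add: v(2) s0'[OF v(1)] fun_eq_iff mult.commute)
    then show "w \<in> {w \<in> ?A1. ?s1 w = (\<lambda>_. 0)}" using w by simp
  next
    fix w assume "w \<in> {w \<in> ?A1. ?s1 w = (\<lambda>_. 0)}"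
    then have w: "w \<in> ?A1" and z: "?s1 w I = 0" for I by auto
    let ?v = "\<lambda>I. if length I = 0 then (1 / Q) *\<^sub>R S w else 0"
    have v: "?v \<in> ?A0" unfolding A0 by simp
    have "w I = ?s0 ?v I" for I
    proof (cases "length I = 1")
      case True
      then have "Q *\<^sub>R w I = \<xi> $ (I ! 0) *\<^sub>R S w" using z[of I] unfolding s1[OF w] by simp
      then have "(1 / Q) *\<^sub>R Q *\<^sub>R w I = (1 / Q) *\<^sub>R \<xi> $ (I ! 0) *\<^sub>R S w" by simp
      then show ?thesis using True Q unfolding s0[OF v] by simp
    next
      case False
      then show ?thesis using w unfolding s0[OF v] A1 by simp
    qed
    then have "w = ?s0 ?v" ..
    then show "w \<in> ?s0 ` ?A0" using v by blast
  qed
  moreover have "?s1 ` ?A1 = {w \<in> ?A1. ?s2 w = (\<lambda>_. 0)}"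
  proof (intro set_eqI iffI)
    fix w assume "w \<in> ?s1 ` ?A1"
    then obtain v where v: "v \<in> ?A1" "w = ?s1 v" by blast
    have w: "w \<in> ?A1" unfolding v(2) s1[OF v(1)] A1 by simp
    have "S w = 0" unfolding v(2) s1[OF v(1)] by (rule S1)
    then have "?s2 w = (\<lambda>_. 0)" unfolding s2[OF w] by (simp add: fun_eq_iff)
    then show "w \<in> {w \<in> ?A1. ?s2 w = (\<lambda>_. 0)}" using w by simp
  next
    fix w assume "w \<in> {w \<in> ?A1. ?s2 w = (\<lambda>_. 0)}"
    then have w: "w \<in> ?A1" and z: "?s2 w [] = 0" by auto
    have S: "S w = 0" using z unfolding s2[OF w] by simp
    let ?v = "\<lambda>I. (- 1 / Q) *\<^sub>R w I"
    have v: "?v \<in> ?A1" using w unfolding A1 by simp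
    have "S ?v = 0" by (simp only: Sc S scaleR_zero_right)
    then have "w I = ?s1 ?v I" for I using w Q unfolding s1[OF v] A1 by simp
    then have "w = ?s1 ?v" ..
    then show "w \<in> ?s1 ` ?A1" using v by blast
  qed
  moreover have "?s2 ` ?A1 = ?A0"
  proof (intro set_eqI iffI)
    fix v assume "v \<in> ?s2 ` ?A1"
    then obtain w where w: "w \<in> ?A1" "v = ?s2 w" by blast
    show "v \<in> ?A0" unfolding w(2) s2[OF w(1)] A0 by simp
  next
    fix v assume v: "v \<in> ?A0"
    let ?w = "\<lambda>I. if length I = 1 then \<xi> $ (I ! 0) *\<^sub>R ((- 1 / Q) *\<^sub>R v []) else 0"
    have w: "?w \<in> ?A1" unfolding A1 by simp
    have "S ?w = Q *\<^sub>R ((- 1 / Q) *\<^sub>R v [])" by (rule S0)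
    then have "v I = ?s2 ?w I" for I using v Q unfolding s2[OF w] A0 by simp
    then have "v = ?s2 ?w" ..
    then show "v \<in> ?s2 ` ?A1" using w by blast
  qed
  ultimately show "inj_on ?s0 ?A0 \<and> ?s0 ` ?A0 = {w \<in> ?A1. ?s1 w = (\<lambda>_. 0)} \<and>
      ?s1 ` ?A1 = {w \<in> ?A1. ?s2 w = (\<lambda>_. 0)} \<and> ?s2 ` ?A1 = ?A0" by blast
qed


section \<open>Conformal invariance\<close>


lemma det_scaleR: "det (r *\<^sub>R (A :: real^'n^'n)) = r ^ CARD('n) * det A"
  using det_rows_mul[of "\<lambda>_. r" "\<lambda>i. A $ i"] by (simp add: scaleR_vec_def vector_scalar_mult_def[abs_def] scalar_mult_eq_scaleR)

lemma transpose_scaleR: "transpose (r *\<^sub>R A) = r *\<^sub>R transpose (A :: real^'n^'n)"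
  by (simp add: transpose_def vec_eq_iff)

lemma has_signature_scaleR:
  assumes "has_signature k l (B :: real^'n^'n)" "r > 0"
  shows "has_signature k l (r\<^sup>2 *\<^sub>R B)"
proof -
  obtain P :: "real^'n^'n" and \<epsilon> :: "'n \<Rightarrow> real" where P: "invertible P" "range \<epsilon> \<subseteq> {1, -1}"
    "card {a. \<epsilon> a = 1} = k" "card {a. \<epsilon> a = -1} = l" "transpose P ** B ** P = (\<chi> a b. if a = b then \<epsilon> a else 0)"
    and t: "transpose B = B"
    using assms(1) unfolding has_signature_def by blast
  let ?P = "(1 / r) *\<^sub>R P"
  have "det ?P \<noteq> 0" using P(1) assms(2) unfolding det_scaleR by (simp add: invertible_det_nz)
  then have "invertible ?P" by (simp add: invertible_det_nz)
  moreover have "transpose ?P ** (r\<^sup>2 *\<^sub>R B) ** ?P = transpose P ** B ** P"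
  proof -
    have "transpose ?P = (1 / r) *\<^sub>R transpose P" by (rule transpose_scaleR)
    then have "transpose ?P ** (r\<^sup>2 *\<^sub>R B) ** ?P = (1 / r * (r\<^sup>2 * (1 / r))) *\<^sub>R (transpose P ** B ** P)"
      by (simp only: mm.scaleR_left mm.scaleR_right scaleR_scaleR mult_ac)
    moreover have "1 / r * (r\<^sup>2 * (1 / r)) = 1" using assms(2) by (simp add: power2_eq_square)
    ultimately show ?thesis by simp
  qed
  moreover have "transpose (r\<^sup>2 *\<^sub>R B) = r\<^sup>2 *\<^sub>R B"
    using arg_cong[OF t, of "\<lambda>A. r\<^sup>2 *\<^sub>R A"] by (simp only: transpose_scaleR)
  ultimately show ?thesis
    unfolding has_signature_def using P(2-5) by (intro conjI exI[of _ ?P] exI[of _ \<epsilon>]) simp_all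
qed

lemma pseudo_riem_rescale:
  assumes \<Omega>: "conf_scale M \<Omega>"
  shows "pseudo_riem M (rescale \<Omega> g) p q"
proof unfold_locales
  have pos: "\<Omega> x > 0" for x using \<Omega> by (simp add: conf_scale_def)
  have s: "smooth_in M i (cdom M i) \<Omega>" for i using \<Omega> by (simp add: conf_scale_def smooth_fun_def)
  show "pseudo_metric M p q (rescale \<Omega> g)"
    unfolding pseudo_metric_def
  proof (intro conjI allI ballI impI)
    show "rescale \<Omega> g i x = 0" if "x \<notin> cdom M i" for i x
      using that metric by (simp add: pseudo_metric_def rescale_def)
    show "smooth_in M i (cdom M i) (rescale \<Omega> g i)" for i
    proof -
      have "smooth_in M i (cdom M i) (g i)" using metric by (simp add: pseudo_metric_def)
      then have "smooth_in M i (cdom M i) (\<lambda>x. (\<Omega> x * \<Omega> x) *\<^sub>R g i x)"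
        by (intro smooth_in_scaleR smooth_in_mult chart_open_cdom s)
      then show ?thesis by (simp add: rescale_def[abs_def] power2_eq_square)
    qed
    show "has_signature p q (rescale \<Omega> g i x)" if "x \<in> cdom M i" for i x
      unfolding rescale_def by (rule has_signature_scaleR[OF metric_signature[OF that] pos])
    show "rescale \<Omega> g j x $ a $ b = (\<Sum>c\<in>UNIV. \<Sum>d\<in>UNIV. jac M j i x a c * jac M j i x b d * rescale \<Omega> g i x $ c $ d)"
      if "x \<in> cdom M i \<inter> cdom M j" for i j a b x
      using metric_change[of x i j] that by (simp add: rescale_def sum_distrib_left mult_ac)
  qed
qed

lemma conf_class_rescale:
  assumes \<Omega>: "conf_scale M \<Omega>"
  shows "conf_class M (rescale \<Omega> g) = conf_class M g"
proof (intro set_eqI iffI)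
  have pos: "\<Omega> x > 0" for x using \<Omega> by (simp add: conf_scale_def)
  fix h assume "h \<in> conf_class M (rescale \<Omega> g)"
  then show "h \<in> conf_class M g"
    using rescale_rescale conf_scale_mult[OF _ \<Omega>] unfolding conf_class_def by blast
next
  have pos: "\<Omega> x > 0" for x using \<Omega> by (simp add: conf_scale_def)
  fix h assume "h \<in> conf_class M g"
  then obtain \<Omega>' where h: "conf_scale M \<Omega>'" "h = rescale \<Omega>' g" unfolding conf_class_def by blast
  let ?\<Omega> = "\<lambda>x. \<Omega>' x * \<Omega> x powr (- 1)"
  have "conf_scale M ?\<Omega>" by (rule conf_scale_mult[OF h(1) conf_scale_powr[OF \<Omega>]])
  moreover have "h = rescale ?\<Omega> (rescale \<Omega> g)"
  proof -
    have "?\<Omega> x * \<Omega> x = \<Omega>' x" for x using pos[of x] by (simp add: powr_minus)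
    then show ?thesis unfolding rescale_rescale h(2) by simp
  qed
  ultimately show "h \<in> conf_class M (rescale \<Omega> g)" unfolding conf_class_def by blast
qed

text \<open>With \<open>h = \<Omega>\<^sup>2 g\<close> and \<open>\<psi>\<close> of weight \<open>2(k+1) - n\<close>, the powers \<open>\<Omega>\<^sup>n\<close> of the volume density, \<open>\<Omega>\<^bsup>-2(k+1)\<^esup>\<close> of
  the inverse metrics and \<open>\<Omega>\<^bsup>2(k+1)-n\<^esup>\<close> of \<open>\<psi>\<close> cancel in the flux, before it is differentiated.\<close>

lemma cdiv_rescale:
  fixes V :: "('i, 'm, 'n, 'k::{real_normed_field,euclidean_space}, 'r::finite) vbundle"
  assumes \<Omega>: "conf_scale M \<Omega>"
  shows "pseudo_riem.cdiv M (rescale \<Omega> g) V k (fscale (\<lambda>x. \<Omega> x powr (2 * real (Suc k) - real CARD('n))) \<psi>)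
    = fscale (\<lambda>x. \<Omega> x powr (2 * real k - real CARD('n))) (cdiv V k \<psi>)"
proof -
  let ?h = "rescale \<Omega> g"
  interpret h: pseudo_riem M ?h p q by (rule pseudo_riem_rescale[OF \<Omega>])
  let ?n = "real CARD('n)" and ?\<psi> = "fscale (\<lambda>x. \<Omega> x powr (2 * real (Suc k) - real CARD('n))) \<psi>"
  have pos: "\<Omega> x > 0" for x using \<Omega> by (simp add: conf_scale_def)
  have d: "h.dens i x = \<Omega> x powr ?n * dens i x" for i x
  proof -
    have "h.dens i x = sqrt (((\<Omega> x) ^ CARD('n))\<^sup>2 * \<bar>det (g i x)\<bar>)"
      unfolding h.dens_def unfolding rescale_def det_scaleR using pos[of x] by (simp add: abs_mult power_mult[symmetric] mult.commute)
    also have "\<dots> = \<Omega> x ^ CARD('n) * dens i x"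
      unfolding dens_def real_sqrt_mult using pos[of x] by simp
    also have "\<Omega> x ^ CARD('n) = \<Omega> x powr ?n" using pos[of x] by (simp add: powr_realpow)
    finally show ?thesis .
  qed
  have gi: "h.gi i x a b = \<Omega> x powr (-2) * gi i x a b" if x: "x \<in> cdom M i" for i x a b
  proof -
    have "matrix_inv (?h i x) = (\<Omega> x powr (-2)) *\<^sub>R matrix_inv (g i x)"
    proof (rule matrix_inv_eqI[OF h.metric_invertible[OF x]])
      have "\<Omega> x powr (-2) * (\<Omega> x)\<^sup>2 = 1" "(\<Omega> x)\<^sup>2 * \<Omega> x powr (-2) = 1" using pos[of x] by (simp_all add: powr_minus powr_numeral)
      then show "((\<Omega> x powr (-2)) *\<^sub>R matrix_inv (g i x)) ** ?h i x = mat 1"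
        by (simp add: rescale_def mm.scaleR_left mm.scaleR_right matrix_inv_inverse[OF metric_invertible[OF x]])
    qed
    then show ?thesis by (simp add: h.gi_def gi_def)
  qed
  have P: "(\<Prod>t<k. \<Omega> x powr r) = \<Omega> x powr (real k * r)" for x r
    using pos[of x] by (simp add: powr_power[symmetric] powr_realpow[symmetric] powr_powr mult.commute)
  have flux: "h.flux k ?\<psi> i a I x = flux k \<psi> i a I x" if x: "x \<in> cdom M i" for i a I x
  proof -
    have "\<Omega> x powr ?n * (\<Omega> x powr (-2) * (\<Omega> x powr (real k * (-2)) * \<Omega> x powr (2 * real (Suc k) - ?n))) = 1"
      using pos[of x] unfolding powr_add[symmetric] by (simp add: algebra_simps)
    then have c: "(\<Omega> x powr ?n * u) * (\<Omega> x powr (-2) * v) * (\<Omega> x powr (real k * (-2)) * w) * \<Omega> x powr (2 * real (Suc k) - ?n)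
        = u * v * w" for u v w
    proof -
      have "(A * u) * (B * v) * (C * w) * D = (A * (B * (C * D))) * (u * v * w)" for A B C D :: real
        by (simp only: mult_ac)
      then show ?thesis using \<open>_ = 1\<close> by simp
    qed
    show ?thesis
      unfolding h.flux_def flux_def fscale_def d gi[OF x] prod.distrib P scaleR_scaleR c ..
  qed
  have du: "h.divup V k ?\<psi> i I x = \<Omega> x powr (- ?n) *\<^sub>R divup V k \<psi> i I x" if x: "x \<in> cdom M i" for i I x
  proof -
    have "cov M V i a (h.flux k ?\<psi> i a I) x = cov M V i a (flux k \<psi> i a I) x" for a
      by (rule cov_cong[OF chart_open_cdom x flux])
    then show ?thesis unfolding h.divup_def divup_def d by (simp add: powr_minus divide_inverse)
  qed
  show ?thesis
  proof (intro ext)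
    fix i x I
    show "h.cdiv V k ?\<psi> i x I = fscale (\<lambda>x. \<Omega> x powr (2 * real k - ?n)) (cdiv V k \<psi>) i x I"
    proof (cases "x \<in> cdom M i")
      case True
      have "(\<Omega> x)\<^sup>2 = \<Omega> x powr 2" using pos[of x] by (simp add: powr_numeral)
      moreover have "\<Omega> x powr (real k * 2) * \<Omega> x powr (- ?n) = \<Omega> x powr (2 * real k - ?n)"
        unfolding powr_add[symmetric] by (simp add: mult.commute)
      ultimately have c: "(\<Prod>t<k. ?h i x $ (I ! t) $ (J ! t)) * \<Omega> x powr (- ?n)
          = \<Omega> x powr (2 * real k - ?n) * (\<Prod>t<k. g i x $ (I ! t) $ (J ! t))" for J
        unfolding rescale_def by (simp add: prod.distrib P del: prod_constant)
      show ?thesis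
        unfolding h.cdiv_def du[OF True] scaleR_scaleR c by (simp add: fscale_def cdiv_def scaleR_sum_right)
    qed (simp add: h.cdiv_def cdiv_def fscale_def)
  qed
qed

text \<open>Both sides are weighted forms for the same conformal class, so it suffices to compare their values at one metric.\<close>

theorem codiff_conformal:
  fixes V :: "('i, 'm, 'n, 'k::{real_normed_field,euclidean_space}, 'r::finite) vbundle"
  assumes V: "bundle_conn V" and k: "k \<le> 1" and \<psi>: "\<psi> \<in> weighted_forms M (conf_class M g) V (Suc k)" and \<Omega>: "conf_scale M \<Omega>"
  shows "codiff M V (rescale \<Omega> g) k \<psi> = codiff M V g k \<psi>"
proof -
  let ?h = "rescale \<Omega> g"
  interpret h: pseudo_riem M ?h p q by (rule pseudo_riem_rescale[OF \<Omega>])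
  note C = conf_class_rescale[OF \<Omega>]
  note c = codiff[OF V k \<psi>] and ch = h.codiff[OF V k, unfolded C, OF \<psi>]
  have w: "\<psi>' ?h = fscale (\<lambda>x. \<Omega> x powr (2 * real l - real CARD('n))) (\<psi>' g)"
    if "\<psi>' \<in> weighted_forms M (conf_class M g) V l" for \<psi>' l
    using that g_in_conf_class \<Omega> unfolding weighted_forms_def by blast
  show ?thesis
  proof (rule h.weighted_forms_eqI)
    show "codiff M V ?h k \<psi> ?h = codiff M V g k \<psi> ?h"
      unfolding ch(2) w[OF \<psi>] w[OF c(1)] c(2) by (rule cdiv_rescale[OF \<Omega>])
  qed (use c(1) ch(1) C in simp_all)
qed

text \<open>In dimension 4 the weight of 2-forms is 0, and the factor \<open>\<Omega>\<^bsup>-2\<^esup>\<close> of \<open>F\<cdot>\<close> from its raised index is the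
  weight of 1-forms.\<close>

theorem conformal_invariance:
  fixes V :: "('i, 'm, 'n, 'k::{real_normed_field,euclidean_space}, 'r::finite) vbundle"
  assumes V: "bundle_conn V" and n: "CARD('n) = 4"
  shows "conformally_invariant M V g"
  unfolding conformally_invariant_def
proof (intro ballI conjI allI)
  fix h assume "h \<in> conf_class M g"
  then obtain \<Omega> where \<Omega>: "conf_scale M \<Omega>" and h: "h = rescale \<Omega> g" unfolding conf_class_def by blast
  interpret h: pseudo_riem M h p q unfolding h by (rule pseudo_riem_rescale[OF \<Omega>])
  have C: "conf_class M h = conf_class M g" unfolding h by (rule conf_class_rescale[OF \<Omega>])
  have pos: "\<Omega> x > 0" for x using \<Omega> by (simp add: conf_scale_def)
  have w: "\<psi> h = fscale (\<lambda>x. \<Omega> x powr (2 * real l - 4)) (\<psi> g)"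
    if "\<psi> \<in> weighted_forms M (conf_class M g) V l" for \<psi> l
    using that g_in_conf_class \<Omega> n unfolding weighted_forms_def h by simp
  show "weighted_forms M (conf_class M h) V k = weighted_forms M (conf_class M g) V k" for k by (simp add: C)
  show "codiff M V h 0 \<psi> = codiff M V g 0 \<psi>" if "\<psi> \<in> weighted_forms M (conf_class M g) V 1" for \<psi>
    unfolding h by (rule codiff_conformal[OF V _ _ \<Omega>]) (use that in simp_all)
  fix \<phi> assume \<phi>: "\<phi> \<in> forms M V 1"
  have d\<phi>: "ext_d M V \<phi> \<in> forms M V 2" by (rule ext_d_form_1[OF V \<phi>])
  note wd = weighted[OF d\<phi>] and wdh = h.weighted[OF d\<phi>, unfolded C]
  have 2: "weighted M V h 2 (ext_d M V \<phi>) = weighted M V g 2 (ext_d M V \<phi>)"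
  proof (rule h.weighted_forms_eqI[unfolded C, OF wdh(1) wd(1)])
    show "weighted M V h 2 (ext_d M V \<phi>) h = weighted M V g 2 (ext_d M V \<phi>) h"
      unfolding wdh(2) w[OF wd(1)] wd(2) using pos by (simp add: fscale_def less_imp_neq[symmetric])
  qed
  have c: "codiff M V h 1 (weighted M V g 2 (ext_d M V \<phi>)) = codiff M V g 1 (weighted M V g 2 (ext_d M V \<phi>))"
    unfolding h by (rule codiff_conformal[OF V _ _ \<Omega>]) (use wd(1) in \<open>simp_all add: numeral_2_eq_2\<close>)
  have F: "F_dot M V h \<phi> = fscale (\<lambda>x. \<Omega> x powr (2 * real 1 - 4)) (F_dot M V g \<phi>)"
  proof (intro ext)
    fix i x I
    show "F_dot M V h \<phi> i x I = fscale (\<lambda>x. \<Omega> x powr (2 * real 1 - 4)) (F_dot M V g \<phi>) i x I"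
    proof (cases "x \<in> cdom M i")
      case True
      have "matrix_inv (h i x) = (\<Omega> x powr (-2)) *\<^sub>R matrix_inv (g i x)"
      proof (rule matrix_inv_eqI[OF h.metric_invertible[OF True]])
        have "\<Omega> x powr (-2) * (\<Omega> x)\<^sup>2 = 1" "(\<Omega> x)\<^sup>2 * \<Omega> x powr (-2) = 1" using pos[of x] by (simp_all add: powr_minus powr_numeral)
        then show "((\<Omega> x powr (-2)) *\<^sub>R matrix_inv (g i x)) ** h i x = mat 1"
          by (simp add: h rescale_def mm.scaleR_left mm.scaleR_right matrix_inv_inverse[OF metric_invertible[OF True]])
      qed
      then show ?thesis by (simp add: F_dot_def fscale_def scaleR_sum_right)
    next
      case False
      then show ?thesis by (simp add: F_dot_def fscale_def forms_outside[OF \<phi>])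
    qed
  qed
  note wf = weighted[OF F_dot_form[OF V \<phi>]] and wfh = h.weighted[OF h.F_dot_form[OF V \<phi>], unfolded C]
  have 1: "weighted M V h 1 (F_dot M V h \<phi>) = weighted M V g 1 (F_dot M V g \<phi>)"
    by (rule h.weighted_forms_eqI[unfolded C, OF wfh(1) wf(1)]) (unfold wfh(2) w[OF wf(1)] wf(2), rule F)
  show "M_op M V h \<phi> = M_op M V g \<phi>"
    unfolding M_op_def 1 2 c ..
qed

end

section \<open>Properties of the Yang--Mills sequence\<close>

theorem theorem3p2:
  fixes M :: "('i, 'm::{t2_space,second_countable_topology}, 'n::finite) atlas"
    and V :: "('i, 'm, 'n, 'k::{real_normed_field,euclidean_space}, 'r::finite) vbundle"
    and g :: "('i, 'm, 'n) metric"
    and p q :: nat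
  assumes "smooth_manifold M"
    and "CARD('n) \<ge> 2"
    and "pseudo_metric M p q g"
    and "vector_bundle M V"
    and "connection M V"
  shows "well_defined_sequence M V g \<and>
    (is_complex M V g \<longleftrightarrow> yang_mills M V g) \<and>
    (\<forall>\<sigma> H. scalar_involution \<sigma> \<and> bundle_hform M V \<sigma> H \<and> preserves_hform M V \<sigma> H \<longrightarrow>
       formally_self_adjoint M V g \<sigma> H) \<and>
    (q = 0 \<longrightarrow> elliptic_sequence M V g) \<and>
    (CARD('n) = 4 \<longrightarrow> conformally_invariant M V g)"
proof -
  interpret pseudo_riem M g p q
    using assms(1,3) by unfold_locales
  have V: "bundle_conn V" using assms(4,5) by (simp add: bundle_conn_def)
  show ?thesis
  proof (intro conjI allI impI)
    show "well_defined_sequence M V g" by (rule well_defined[OF V])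
    show "is_complex M V g \<longleftrightarrow> yang_mills M V g" by (rule is_complex_iff_yang_mills[OF V])
    show "formally_self_adjoint M V g \<sigma> H"
      if "scalar_involution \<sigma> \<and> bundle_hform M V \<sigma> H \<and> preserves_hform M V \<sigma> H" for \<sigma> H
      using self_adjoint[OF V] that by simp
    show "elliptic_sequence M V g" if "q = 0" by (rule elliptic[OF V that])
    show "conformally_invariant M V g" if "CARD('n) = 4" by (rule conformal_invariance[OF V that])
  qed
qed

end
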